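(* Let $\mathcal{A}$ be a plus-one generated arrangement of lines in $\mathbb{P}^2=\mathbb{P}^2(\mathbb{C})$ of exponents $(a,b)$ and level $d$, let $l_0^{\mathcal{A}}$ and $Z$ be the line and the finite scheme associated with its resolution (defined in the context), and let $l\subset\mathbb{P}^2$ be an arbitrary line. (1) If $l\cap Z=\emptyset$, then $\mathcal{T}_{\mathcal{A}}\otimes\mathcal{O}_l=\mathcal{O}_l(-a)\oplus\mathcal{O}_l(1-b)$. (2) If $|l\cap Z|=1$, then $\mathcal{T}_{\mathcal{A}}\otimes\mathcal{O}_l=\mathcal{O}_l(1-a)\oplus\mathcal{O}_l(-b)$. (3) If $l=l_0^{\mathcal{A}}$ (in which case $|l\cap Z|=d+1-b$), then $\mathcal{T}_{\mathcal{A}}\otimes\mathcal{O}_l=\mathcal{O}_l(-d)\oplus\mathcal{O}_l(d+1-a-b)$.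
   Context: An arrangement $\mathcal{A}$ is a finite set of $n=|\mathcal{A}|$ distinct lines in $\mathbb{P}^2=\mathbb{P}^2(\mathbb{C})$, with defining polynomial $f_{\mathcal{A}}=\prod_{H\in\mathcal{A}}\alpha_H$, where $\alpha_H\in\mathbb{C}[x,y,z]$ is a linear form defining $H$. The vector bundle associated to $\mathcal{A}$ is the rank $2$ vector bundle $\mathcal{T}_{\mathcal{A}}=\ker\big(\nabla f_{\mathcal{A}}:\mathcal{O}_{\mathbb{P}^2}^3\to\mathcal{O}_{\mathbb{P}^2}(n-1)\big)$, where $\nabla f_{\mathcal{A}}=[\partial_x f_{\mathcal{A}}\ \partial_y f_{\mathcal{A}}\ \partial_z f_{\mathcal{A}}]$. $\mathcal{A}$ is plus-one generated of exponents $(a,b)$ and level $d$, where $a\le b\le d$, if there is an exact sequence $$0\to\mathcal{O}_{\mathbb{P}^2}(-1-d)\to\mathcal{O}_{\mathbb{P}^2}(-d)\oplus\mathcal{O}_{\mathbb{P}^2}(-b)\oplus\mathcal{O}_{\mathbb{P}^2}(-a)\to\mathcal{T}_{\mathcal{A}}\to0.$$ Fix such a resolution. The component $\mathcal{O}_{\mathbb{P}^2}(-a)\to\mathcal{T}_{\mathcal{A}}$ is a nonzero section fitting in an exact sequence $$0\to\mathcal{O}_{\mathbb{P}^2}(-a)\to\mathcal{T}_{\mathcal{A}}\to I_Z(1-b)\to0,$$ where $Z$ is a finite scheme of length $d+1-b$ with ideal sheaf $I_Z$. It is the complete intersection of a line $l_0^{\mathcal{A}}$ and a curve of degree $d+1-b$,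 whose equations are the components $\mathcal{O}_{\mathbb{P}^2}(-1-d)\to\mathcal{O}_{\mathbb{P}^2}(-d)$ and $\mathcal{O}_{\mathbb{P}^2}(-1-d)\to\mathcal{O}_{\mathbb{P}^2}(-b)$ of the first map of the resolution; that is, $0\to\mathcal{O}_{\mathbb{P}^2}(-1-d)\to\mathcal{O}_{\mathbb{P}^2}(-d)\oplus\mathcal{O}_{\mathbb{P}^2}(-b)\to I_Z(1-b)\to0$ is exact. $|l\cap Z|$ denotes the length of the scheme-theoretic intersection $l\cap Z$. Equalities of bundles mean isomorphisms. *)

theory Defs
  imports
    "HOL-Analysis.Cartesian_Space"
    "HOL-Algebra.Ideal"
    "HOL-Algebra.Module"
    "HOL-Algebra.Free_Abelian_Groups"
    "HOL-Library.Poly_Mapping"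
    "HOL-Library.Extended_Nat"
begin

section \<open>Ternary forms\<close>

text \<open>Polynomials in \<open>x, y, z\<close>: finitely supported maps from exponent vectors to coefficients.\<close>

type_synonym poly3 = "(3 \<Rightarrow>\<^sub>0 nat) \<Rightarrow>\<^sub>0 complex"

definition meval :: "(3 \<Rightarrow>\<^sub>0 nat) \<Rightarrow> complex^3 \<Rightarrow> complex"
  where "meval m v = (\<Prod>i\<in>UNIV. (v $ i) ^ Poly_Mapping.lookup m i)"

definition peval :: "poly3 \<Rightarrow> complex^3 \<Rightarrow> complex"
  where "peval p v = (\<Sum>m\<in>Poly_Mapping.keys p. Poly_Mapping.lookup p m * meval m v)"

definition mdeg :: "(3 \<Rightarrow>\<^sub>0 nat) \<Rightarrow> nat"
  where "mdeg m = (\<Sum>i\<in>UNIV. Poly_Mapping.lookup m i)"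

text \<open>Degrees are integers, so that twists can be added freely. The zero polynomial is
  homogeneous of every degree.\<close>

definition homog :: "int \<Rightarrow> poly3 \<Rightarrow> bool"
  where "homog k p \<longleftrightarrow> (\<forall>m\<in>Poly_Mapping.keys p. int (mdeg m) = k)"

definition partial :: "3 \<Rightarrow> poly3 \<Rightarrow> poly3"
  where "partial i p = (\<Sum>m\<in>Poly_Mapping.keys p.
    Poly_Mapping.single (m - Poly_Mapping.single i 1)
      (of_nat (Poly_Mapping.lookup m i) * Poly_Mapping.lookup p m))"

lemma peval_superset:
  assumes "finite S" "Poly_Mapping.keys p \<subseteq> S"
  shows "peval p v = (\<Sum>m\<in>S. Poly_Mapping.lookup p m * meval m v)"
  unfolding peval_def using assms
  by (intro sum.mono_neutral_left) (auto simp: in_keys_iff)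

lemma peval_zero [simp]: "peval 0 v = 0"
  by (simp add: peval_def)

lemma peval_single: "peval (Poly_Mapping.single m c) v = c * meval m v"
  by (cases "c = 0") (simp_all add: peval_def)

lemma peval_one [simp]: "peval 1 v = 1"
proof -
  have "peval (Poly_Mapping.single 0 1) v = 1"
    by (subst peval_single) (simp add: meval_def)
  then show ?thesis by simp
qed

lemma peval_add: "peval (p + q) v = peval p v + peval q v"
proof -
  let ?S = "Poly_Mapping.keys p \<union> Poly_Mapping.keys q"
  have "peval (p + q) v = (\<Sum>m\<in>?S. Poly_Mapping.lookup (p + q) m * meval m v)"
    by (rule peval_superset) (use Poly_Mapping.keys_add[of p q] in auto)
  also have "\<dots> = peval p v + peval q v"
    by (simp add: lookup_add algebra_simps sum.distrib
        peval_superset[of ?S p] peval_superset[of ?S q])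
  finally show ?thesis .
qed

lemma peval_sum: "peval (sum f A) v = (\<Sum>i\<in>A. peval (f i) v)"
  by (induction A rule: infinite_finite_induct) (simp_all add: peval_add)

lemma poly3_expand:
  "(p :: poly3) = (\<Sum>m\<in>Poly_Mapping.keys p. Poly_Mapping.single m (Poly_Mapping.lookup p m))"
  by (rule poly_mapping_eqI)
    (simp add: lookup_sum lookup_single when_def in_keys_iff)

lemma meval_add: "meval (m + n) v = meval m v * meval n v"
  by (simp add: meval_def lookup_add power_add prod.distrib)

lemma mdeg_add: "mdeg (m + n) = mdeg m + mdeg n"
  by (simp add: mdeg_def lookup_add sum.distrib)

lemma peval_mult: "peval (p * q) v = peval p v * peval q v"
proof -
  have "p * q = (\<Sum>m\<in>Poly_Mapping.keys p. \<Sum>n\<in>Poly_Mapping.keys q.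
      Poly_Mapping.single (m + n) (Poly_Mapping.lookup p m * Poly_Mapping.lookup q n))"
    by (subst (1) poly3_expand[of p], subst (1) poly3_expand[of q])
      (simp add: sum_product mult_single)
  then have "peval (p * q) v = (\<Sum>m\<in>Poly_Mapping.keys p. \<Sum>n\<in>Poly_Mapping.keys q.
      Poly_Mapping.lookup p m * Poly_Mapping.lookup q n * meval (m + n) v)"
    by (simp add: peval_sum peval_single)
  then show ?thesis
    by (simp add: meval_add peval_def sum_product algebra_simps)
qed

lemma homog_one: "homog 0 1"
  by (simp add: homog_def mdeg_def)

lemma homog_mult:
  assumes "homog k p" "homog n q"
  shows "homog (k + n) (p * q)"
  using assms Poly_Mapping.keys_mult[of p q]
  by (fastforce simp: homog_def mdeg_add)


section \<open>The projective plane\<close>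

typedef proj_plane = "{{c *s v | c. True} | v :: complex^3. v \<noteq> 0}"
  morphisms line_of Abs_proj_plane
proof -
  have "(1 :: complex^3) \<noteq> 0" by simp
  then show ?thesis by blast
qed

definition zero_locus :: "poly3 \<Rightarrow> proj_plane set"
  where "zero_locus p = {x. \<forall>v\<in>line_of x. peval p v = 0}"

definition affine_cone :: "proj_plane set \<Rightarrow> (complex^3) set"
  where "affine_cone X = {v. v \<noteq> 0 \<and> (\<exists>x\<in>X. v \<in> line_of x)}"

lemma meval_scale: "meval m (c *s v) = c ^ mdeg m * meval m v"
  by (simp add: meval_def mdeg_def power_mult_distrib prod.distrib power_sum)

lemma peval_scale:
  assumes "homog k p"
  shows "peval p (c *s v) = c ^ nat k * peval p v"
proof -
  have "mdeg m = nat k" if "m \<in> Poly_Mapping.keys p" for m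
    using assms that by (auto simp: homog_def)
  then show ?thesis
    by (simp add: peval_def meval_scale sum_distrib_left algebra_simps)
qed

lemma line_of_basis: obtains v where "v \<noteq> 0" "line_of x = {c *s v | c. True}" "v \<in> line_of x"
proof -
  obtain v where v: "v \<noteq> 0" "line_of x = {c *s v | c. True}"
    using line_of[of x] by blast
  moreover have "v = 1 *s v" by simp
  ultimately show thesis
    using that by blast
qed

lemma zero_locus_one: "zero_locus 1 = {}"
  unfolding zero_locus_def by (auto intro: line_of_basis)

lemma zero_locus_mult:
  assumes "homog k p" "homog n q"
  shows "zero_locus (p * q) = zero_locus p \<union> zero_locus q"
proof -
  have "x \<in> zero_locus p \<or> x \<in> zero_locus q" if x: "x \<in> zero_locus (p * q)" for x
  proof -
    obtain v where v: "line_of x = {c *s v | c. True}" "v \<in> line_of x"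
      by (rule line_of_basis)
    then have "peval p v = 0 \<or> peval q v = 0"
      using x v(2) by (auto simp: zero_locus_def peval_mult)
    then show ?thesis
      using assms by (auto simp: zero_locus_def v(1) peval_scale)
  qed
  then show ?thesis
    by (auto simp: zero_locus_def peval_mult)
qed

text \<open>The Zariski topology.\<close>

instantiation proj_plane :: topological_space
begin

definition open_proj_plane :: "proj_plane set \<Rightarrow> bool"
  where "open U \<longleftrightarrow> (\<exists>P. (\<forall>p\<in>P. \<exists>k. homog k p) \<and> - U = (\<Inter>p\<in>P. zero_locus p))"

instance
proof
  show "open (UNIV :: proj_plane set)"
    unfolding open_proj_plane_def using homog_one zero_locus_one
    by (intro exI[of _ "{1}"]) auto
next
  fix S T :: "proj_plane set"
  assume "open S" "open T"
  then obtain P Q where P: "\<forall>p\<in>P. \<exists>k. homog k p" "- S = (\<Inter>p\<in>P. zero_locus p)"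
    and Q: "\<forall>p\<in>Q. \<exists>k. homog k p" "- T = (\<Inter>p\<in>Q. zero_locus p)"
    unfolding open_proj_plane_def by blast
  let ?R = "{p * q | p q. p \<in> P \<and> q \<in> Q}"
  have "\<forall>r\<in>?R. \<exists>k. homog k r"
    using P(1) Q(1) homog_mult by blast
  moreover have locus: "zero_locus (p * q) = zero_locus p \<union> zero_locus q" if "p \<in> P" "q \<in> Q" for p q
    using P(1) Q(1) zero_locus_mult that by blast
  have "(\<Inter>r\<in>?R. zero_locus r) = - S \<union> - T"
  proof (intro equalityI subsetI)
    fix x assume x: "x \<in> (\<Inter>r\<in>?R. zero_locus r)"
    show "x \<in> - S \<union> - T"
    proof (rule ccontr)
      assume "x \<notin> - S \<union> - T"
      then obtain p q where "p \<in> P" "x \<notin> zero_locus p" "q \<in> Q" "x \<notin> zero_locus q"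
        unfolding P(2) Q(2) by blast
      moreover from this have "x \<in> zero_locus (p * q)"
        using x by blast
      ultimately show False
        using locus by blast
    qed
  next
    fix x assume "x \<in> - S \<union> - T"
    then show "x \<in> (\<Inter>r\<in>?R. zero_locus r)"
      unfolding P(2) Q(2) using locus by blast
  qed
  ultimately show "open (S \<inter> T)"
    unfolding open_proj_plane_def by (intro exI[of _ ?R]) auto
next
  fix K :: "proj_plane set set"
  assume K: "\<forall>S\<in>K. open S"
  let ?R = "{p. (\<exists>k. homog k p) \<and> (\<exists>S\<in>K. - S \<subseteq> zero_locus p)}"
  have "(\<Inter>r\<in>?R. zero_locus r) \<subseteq> - S" if "S \<in> K" for S
  proof -
    obtain P where P: "\<forall>p\<in>P. \<exists>k. homog k p" "- S = (\<Inter>p\<in>P. zero_locus p)"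
      using K \<open>S \<in> K\<close> unfolding open_proj_plane_def by blast
    then have "P \<subseteq> ?R"
      using \<open>S \<in> K\<close> by blast
    then show ?thesis
      unfolding P(2) by blast
  qed
  then have "- \<Union>K = (\<Inter>r\<in>?R. zero_locus r)"
    by blast
  moreover have "\<forall>r\<in>?R. \<exists>k. homog k r"
    by blast
  ultimately show "open (\<Union>K)"
    unfolding open_proj_plane_def by (intro exI conjI)
qed

end

definition defines_line :: "poly3 \<Rightarrow> proj_plane set \<Rightarrow> bool"
  where "defines_line p l \<longleftrightarrow> homog 1 p \<and> p \<noteq> 0 \<and> l = zero_locus p"

definition is_line :: "proj_plane set \<Rightarrow> bool"
  where "is_line l \<longleftrightarrow> (\<exists>p. defines_line p l)"


section \<open>Sheaves of modules\<close>

text \<open>The structure sheaf \<open>\<O>\<close> of a ringed space is itself given as a presheaf of modules whose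
  module of sections over \<open>U\<close> is the ring \<open>\<O>(U)\<close>, acting on itself by multiplication. For any other
  presheaf of modules the fields \<open>mult\<close> and \<open>one\<close>, which the record type inherits, play no
  role.\<close>

record ('x, 'r, 'm) module_presheaf =
  sections :: "'x set \<Rightarrow> ('r, 'm) module"
  restr :: "'x set \<Rightarrow> 'x set \<Rightarrow> 'm \<Rightarrow> 'm"  \<comment> \<open>\<open>restr F U V\<close> maps \<open>F(U)\<close> to \<open>F(V)\<close> for \<open>V \<subseteq> U\<close>\<close>

type_synonym ('x, 'm, 'n) presheaf_map = "'x set \<Rightarrow> 'm \<Rightarrow> 'n"

subsection \<open>Morphisms and exactness\<close>

definition sheaf_hom ::
  "('x::topological_space, 'r, 'r) module_presheaf \<Rightarrow> ('x, 'r, 'm) module_presheaf \<Rightarrow>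
   ('x, 'r, 'n) module_presheaf \<Rightarrow> ('x, 'm, 'n) presheaf_map \<Rightarrow> bool"
  where "sheaf_hom Ox F G \<phi> \<longleftrightarrow>
    (\<forall>U. open U \<longrightarrow>
      \<phi> U \<in> carrier (sections F U) \<rightarrow> carrier (sections G U) \<and>
      (\<forall>s\<in>carrier (sections F U). \<forall>t\<in>carrier (sections F U).
        \<phi> U (s \<oplus>\<^bsub>sections F U\<^esub> t) = \<phi> U s \<oplus>\<^bsub>sections G U\<^esub> \<phi> U t) \<and>
      (\<forall>r\<in>carrier (sections Ox U). \<forall>s\<in>carrier (sections F U).
        \<phi> U (r \<odot>\<^bsub>sections F U\<^esub> s) = r \<odot>\<^bsub>sections G U\<^esub> \<phi> U s) \<and>
      (\<forall>V. open V \<longrightarrow> V \<subseteq> U \<longrightarrow>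
        (\<forall>s\<in>carrier (sections F U). \<phi> V (restr F U V s) = restr G U V (\<phi> U s))))"

definition sheaf_isomorphic ::
  "('x::topological_space, 'r, 'r) module_presheaf \<Rightarrow> ('x, 'r, 'm) module_presheaf \<Rightarrow>
   ('x, 'r, 'n) module_presheaf \<Rightarrow> bool"
  where "sheaf_isomorphic Ox F G \<longleftrightarrow>
    (\<exists>\<phi>. sheaf_hom Ox F G \<phi> \<and>
      (\<forall>U. open U \<longrightarrow> bij_betw (\<phi> U) (carrier (sections F U)) (carrier (sections G U))))"

text \<open>\<open>t\<close> is a section over \<open>U\<close> of the image sheaf of \<open>\<phi>\<close>.\<close>

definition locally_in_image ::
  "('x::topological_space, 'r, 'm) module_presheaf \<Rightarrow> ('x, 'r, 'n) module_presheaf \<Rightarrow>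
   ('x, 'm, 'n) presheaf_map \<Rightarrow> 'x set \<Rightarrow> 'n \<Rightarrow> bool"
  where "locally_in_image F G \<phi> U t \<longleftrightarrow>
    (\<forall>x\<in>U. \<exists>V. open V \<and> x \<in> V \<and> V \<subseteq> U \<and>
      (\<exists>s\<in>carrier (sections F V). \<phi> V s = restr G U V t))"

definition short_exact ::
  "('x::topological_space, 'r, 'r) module_presheaf \<Rightarrow> ('x, 'r, 'm) module_presheaf \<Rightarrow>
   ('x, 'r, 'n) module_presheaf \<Rightarrow> ('x, 'r, 'q) module_presheaf \<Rightarrow>
   ('x, 'm, 'n) presheaf_map \<Rightarrow> ('x, 'n, 'q) presheaf_map \<Rightarrow> bool"
  where "short_exact Ox F G H \<phi> \<psi> \<longleftrightarrow>
    sheaf_hom Ox F G \<phi> \<and> sheaf_hom Ox G H \<psi> \<and>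
    (\<forall>U. open U \<longrightarrow>
      inj_on (\<phi> U) (carrier (sections F U)) \<and>
      (\<forall>t\<in>carrier (sections G U).
        \<psi> U t = \<zero>\<^bsub>sections H U\<^esub> \<longleftrightarrow> locally_in_image F G \<phi> U t) \<and>
      (\<forall>u\<in>carrier (sections H U). locally_in_image G H \<psi> U u))"

subsection \<open>Direct sums and kernels\<close>

definition direct_sum ::
  "('x, 'r, 'm) module_presheaf \<Rightarrow> ('x, 'r, 'n) module_presheaf \<Rightarrow>
   ('x, 'r, 'm \<times> 'n) module_presheaf"
  where "direct_sum F G =
    \<lparr> sections = (\<lambda>U.
        \<lparr> carrier = carrier (sections F U) \<times> carrier (sections G U),
          monoid.mult = (\<lambda>(s, t) (s', t'). (s \<otimes>\<^bsub>sections F U\<^esub> s', t \<otimes>\<^bsub>sections G U\<^esub> t')),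
          monoid.one = (\<one>\<^bsub>sections F U\<^esub>, \<one>\<^bsub>sections G U\<^esub>),
          ring.zero = (\<zero>\<^bsub>sections F U\<^esub>, \<zero>\<^bsub>sections G U\<^esub>),
          ring.add = (\<lambda>(s, t) (s', t'). (s \<oplus>\<^bsub>sections F U\<^esub> s', t \<oplus>\<^bsub>sections G U\<^esub> t')),
          module.smult = (\<lambda>r (s, t). (r \<odot>\<^bsub>sections F U\<^esub> s, r \<odot>\<^bsub>sections G U\<^esub> t)) \<rparr>),
      restr = (\<lambda>U V (s, t). (restr F U V s, restr G U V t)) \<rparr>"

definition kernel_sheaf ::
  "('x, 'r, 'm) module_presheaf \<Rightarrow> ('x, 'r, 'n) module_presheaf \<Rightarrow>
   ('x, 'm, 'n) presheaf_map \<Rightarrow> ('x, 'r, 'm) module_presheaf"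
  where "kernel_sheaf F G \<phi> =
    \<lparr> sections = (\<lambda>U. (sections F U)
        \<lparr> carrier := {s \<in> carrier (sections F U). \<phi> U s = \<zero>\<^bsub>sections G U\<^esub>} \<rparr>),
      restr = restr F \<rparr>"

subsection \<open>Stalks and sheafification\<close>

definition germ ::
  "('x::topological_space, 'r, 'm) module_presheaf \<Rightarrow> 'x \<Rightarrow> 'x set \<Rightarrow> 'm \<Rightarrow> ('x set \<times> 'm) set"
  where "germ F x U s =
    {(V, t). open V \<and> x \<in> V \<and> t \<in> carrier (sections F V) \<and>
      (\<exists>W. open W \<and> x \<in> W \<and> W \<subseteq> U \<inter> V \<and> restr F U W s = restr F V W t)}"

definition stalk ::
  "('x::topological_space, 'r, 'r) module_presheaf \<Rightarrow> ('x, 'r, 'm) module_presheaf \<Rightarrow> 'x \<Rightarrow>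
   (('x set \<times> 'r) set, ('x set \<times> 'm) set) module"
  where "stalk Ox F x =
    \<lparr> carrier = {germ F x U s | U s. open U \<and> x \<in> U \<and> s \<in> carrier (sections F U)},
      monoid.mult = (\<lambda>A B. THE C. \<exists>U. open U \<and> x \<in> U \<and>
        (\<exists>s\<in>carrier (sections F U). \<exists>t\<in>carrier (sections F U).
          A = germ F x U s \<and> B = germ F x U t \<and> C = germ F x U (s \<otimes>\<^bsub>sections F U\<^esub> t))),
      monoid.one = germ F x UNIV \<one>\<^bsub>sections F UNIV\<^esub>,
      ring.zero = germ F x UNIV \<zero>\<^bsub>sections F UNIV\<^esub>,
      ring.add = (\<lambda>A B. THE C. \<exists>U. open U \<and> x \<in> U \<and>
        (\<exists>s\<in>carrier (sections F U). \<exists>t\<in>carrier (sections F U).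
          A = germ F x U s \<and> B = germ F x U t \<and> C = germ F x U (s \<oplus>\<^bsub>sections F U\<^esub> t))),
      module.smult = (\<lambda>A B. THE C. \<exists>U. open U \<and> x \<in> U \<and>
        (\<exists>r\<in>carrier (sections Ox U). \<exists>s\<in>carrier (sections F U).
          A = germ Ox x U r \<and> B = germ F x U s \<and> C = germ F x U (r \<odot>\<^bsub>sections F U\<^esub> s))) \<rparr>"

definition sheafify ::
  "('x::topological_space, 'r, 'r) module_presheaf \<Rightarrow> ('x, 'r, 'm) module_presheaf \<Rightarrow>
   ('x, 'r, 'x \<Rightarrow> ('x set \<times> 'm) set) module_presheaf"
  where "sheafify Ox F =
    \<lparr> sections = (\<lambda>U.
        \<lparr> carrier = {\<sigma> \<in> extensional U. \<forall>x\<in>U. \<exists>V. open V \<and> x \<in> V \<and> V \<subseteq> U \<and>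
            (\<exists>s\<in>carrier (sections F V). \<forall>y\<in>V. \<sigma> y = germ F y V s)},
          monoid.mult = (\<lambda>\<sigma> \<tau>. \<lambda>x\<in>U. \<sigma> x \<otimes>\<^bsub>stalk Ox F x\<^esub> \<tau> x),
          monoid.one = (\<lambda>x\<in>U. \<one>\<^bsub>stalk Ox F x\<^esub>),
          ring.zero = (\<lambda>x\<in>U. \<zero>\<^bsub>stalk Ox F x\<^esub>),
          ring.add = (\<lambda>\<sigma> \<tau>. \<lambda>x\<in>U. \<sigma> x \<oplus>\<^bsub>stalk Ox F x\<^esub> \<tau> x),
          module.smult = (\<lambda>r \<sigma>. \<lambda>x\<in>U. germ Ox x U r \<odot>\<^bsub>stalk Ox F x\<^esub> \<sigma> x) \<rparr>),
      restr = (\<lambda>U V \<sigma>. restrict \<sigma> V) \<rparr>"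

subsection \<open>Tensor products\<close>

text \<open>The tensor product of modules as a quotient of the free abelian group on pairs. The relations
  are those of a balanced biadditive map.\<close>

definition tensor_relations ::
  "('r, 'k) ring_scheme \<Rightarrow> ('r, 'm) module \<Rightarrow> ('r, 'n) module \<Rightarrow> ('m \<times> 'n \<Rightarrow>\<^sub>0 int) set"
  where "tensor_relations R M N =
    {frag_of (m \<oplus>\<^bsub>M\<^esub> m', n) - frag_of (m, n) - frag_of (m', n) | m m' n.
      m \<in> carrier M \<and> m' \<in> carrier M \<and> n \<in> carrier N} \<union>
    {frag_of (m, n \<oplus>\<^bsub>N\<^esub> n') - frag_of (m, n) - frag_of (m, n') | m n n'.
      m \<in> carrier M \<and> n \<in> carrier N \<and> n' \<in> carrier N} \<union>
    {frag_of (r \<odot>\<^bsub>M\<^esub> m, n) - frag_of (m, r \<odot>\<^bsub>N\<^esub> n) | r m n.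
      r \<in> carrier R \<and> m \<in> carrier M \<and> n \<in> carrier N}"

definition tensor_free :: "('r, 'm) module \<Rightarrow> ('r, 'n) module \<Rightarrow> ('m \<times> 'n \<Rightarrow>\<^sub>0 int) monoid"
  where "tensor_free M N = free_Abelian_group (carrier M \<times> carrier N)"

definition tensor_coset ::
  "('r, 'k) ring_scheme \<Rightarrow> ('r, 'm) module \<Rightarrow> ('r, 'n) module \<Rightarrow>
   ('m \<times> 'n \<Rightarrow>\<^sub>0 int) \<Rightarrow> ('m \<times> 'n \<Rightarrow>\<^sub>0 int) set"
  where "tensor_coset R M N u =
    generate (tensor_free M N) (tensor_relations R M N) #>\<^bsub>tensor_free M N\<^esub> u"

definition tensor_module ::
  "('r, 'k) ring_scheme \<Rightarrow> ('r, 'm) module \<Rightarrow> ('r, 'n) module \<Rightarrow>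
   ('r, ('m \<times> 'n \<Rightarrow>\<^sub>0 int) set) module"
  where "tensor_module R M N =
    \<lparr> carrier = tensor_coset R M N ` carrier (tensor_free M N),
      monoid.mult = undefined,
      monoid.one = undefined,
      ring.zero = tensor_coset R M N 0,
      ring.add = (\<lambda>A B. A <#>\<^bsub>tensor_free M N\<^esub> B),
      module.smult = (\<lambda>r A. \<Union>u\<in>A. tensor_coset R M N
        (frag_extend (\<lambda>(m, n). frag_of (r \<odot>\<^bsub>M\<^esub> m, n)) u)) \<rparr>"

definition tensor_presheaf ::
  "('x, 'r, 'r) module_presheaf \<Rightarrow> ('x, 'r, 'm) module_presheaf \<Rightarrow>
   ('x, 'r, 'n) module_presheaf \<Rightarrow> ('x, 'r, ('m \<times> 'n \<Rightarrow>\<^sub>0 int) set) module_presheaf"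
  where "tensor_presheaf Ox F G =
    \<lparr> sections = (\<lambda>U. tensor_module (sections Ox U) (sections F U) (sections G U)),
      restr = (\<lambda>U V A. \<Union>u\<in>A. tensor_coset (sections Ox V) (sections F V) (sections G V)
        (frag_extend (\<lambda>(m, n). frag_of (restr F U V m, restr G U V n)) u)) \<rparr>"

definition tensor_sheaf ::
  "('x::topological_space, 'r, 'r) module_presheaf \<Rightarrow> ('x, 'r, 'm) module_presheaf \<Rightarrow>
   ('x, 'r, 'n) module_presheaf \<Rightarrow>
   ('x, 'r, 'x \<Rightarrow> ('x set \<times> ('m \<times> 'n \<Rightarrow>\<^sub>0 int) set) set) module_presheaf"
  where "tensor_sheaf Ox F G = sheafify Ox (tensor_presheaf Ox F G)"

subsection \<open>Closed subschemes\<close>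

text \<open>A closed subscheme is given by its sheaf of ideals \<open>I\<close>, with \<open>I U \<subseteq> \<O>(U)\<close>.\<close>

definition ideal_stalk ::
  "('x::topological_space, 'r, 'r) module_presheaf \<Rightarrow> ('x set \<Rightarrow> 'r set) \<Rightarrow> 'x \<Rightarrow>
   ('x set \<times> 'r) set set"
  where "ideal_stalk Ox I x = {germ Ox x U s | U s. open U \<and> x \<in> U \<and> s \<in> I U}"

definition ideal_sum ::
  "('x::topological_space, 'r, 'r) module_presheaf \<Rightarrow> ('x set \<Rightarrow> 'r set) \<Rightarrow>
   ('x set \<Rightarrow> 'r set) \<Rightarrow> 'x set \<Rightarrow> 'r set"
  where "ideal_sum Ox I J U =
    {s \<in> carrier (sections Ox U). \<forall>x\<in>U. \<exists>V. open V \<and> x \<in> V \<and> V \<subseteq> U \<and>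
      restr Ox U V s \<in> I V <+>\<^bsub>sections Ox V\<^esub> J V}"

definition subscheme_points ::
  "('x::topological_space, 'r, 'r) module_presheaf \<Rightarrow> ('x set \<Rightarrow> 'r set) \<Rightarrow> 'x set"
  where "subscheme_points Ox I = {x. ideal_stalk Ox I x \<noteq> carrier (stalk Ox Ox x)}"

text \<open>The length of the module \<open>R / I\<close>: the supremum of the lengths of chains of ideals
  between \<open>I\<close> and \<open>R\<close>.\<close>

definition quotient_length :: "('r, 'k) ring_scheme \<Rightarrow> 'r set \<Rightarrow> enat"
  where "quotient_length R I = Sup {enat n | n. \<exists>J.
    J 0 = I \<and> J n = carrier R \<and> (\<forall>i\<le>n. ideal (J i) R) \<and> (\<forall>i<n. J i \<subset> J (Suc i))}"

definition subscheme_length ::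
  "('x::topological_space, 'r, 'r) module_presheaf \<Rightarrow> ('x set \<Rightarrow> 'r set) \<Rightarrow> enat"
  where "subscheme_length Ox I =
    (if finite (subscheme_points Ox I)
     then \<Sum>x\<in>subscheme_points Ox I. quotient_length (stalk Ox Ox x) (ideal_stalk Ox I x)
     else \<infinity>)"


section \<open>Line bundles on the plane and on its closed subsets\<close>

text \<open>Points are the closed points and all closed subsets \<open>X\<close> are taken with their reduced structure.
  A section of \<open>\<O>\<^sub>X(k)\<close> over \<open>U\<close> is a function on the affine cone over \<open>U \<inter> X\<close> that is
  locally a quotient of two forms whose degrees differ by \<open>k\<close>; it is extended by \<open>0\<close> off that cone.
  As \<open>U\<close> ranges over the open subsets of the plane, this is the direct image on the
  plane of the sheaf on \<open>X\<close>.\<close>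

definition twist_sections ::
  "proj_plane set \<Rightarrow> int \<Rightarrow> proj_plane set \<Rightarrow> (complex^3 \<Rightarrow> complex) set"
  where "twist_sections X k U =
    {s. (\<forall>v. v \<notin> affine_cone (U \<inter> X) \<longrightarrow> s v = 0) \<and>
      (\<forall>x\<in>U \<inter> X. \<exists>V p q m n. open V \<and> x \<in> V \<and> V \<subseteq> U \<and>
        homog m p \<and> homog n q \<and> m - n = k \<and>
        (\<forall>v\<in>affine_cone (V \<inter> X). peval q v \<noteq> 0 \<and> s v = peval p v / peval q v))}"

definition twist ::
  "proj_plane set \<Rightarrow> int \<Rightarrow>
   (proj_plane, complex^3 \<Rightarrow> complex, complex^3 \<Rightarrow> complex) module_presheaf"
  where "twist X k =
    \<lparr> sections = (\<lambda>U.
        \<lparr> carrier = twist_sections X k U,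
          monoid.mult = (\<lambda>s t v. s v * t v),
          monoid.one = (\<lambda>v. if v \<in> affine_cone (U \<inter> X) then 1 else 0),
          ring.zero = (\<lambda>v. 0),
          ring.add = (\<lambda>s t v. s v + t v),
          module.smult = (\<lambda>r s v. r v * s v) \<rparr>),
      restr = (\<lambda>U V s v. if v \<in> affine_cone V then s v else 0) \<rparr>"

abbreviation O_plane ::
  "(proj_plane, complex^3 \<Rightarrow> complex, complex^3 \<Rightarrow> complex) module_presheaf"
  where "O_plane \<equiv> twist UNIV 0"

text \<open>The ideal sheaf of a reduced closed subset.\<close>

definition vanishing_ideal ::
  "proj_plane set \<Rightarrow> proj_plane set \<Rightarrow> (complex^3 \<Rightarrow> complex) set"
  where "vanishing_ideal X U =
    {s \<in> carrier (sections O_plane U). \<forall>v\<in>affine_cone (U \<inter> X). s v = 0}"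

text \<open>The ideal sheaf of the (possibly non-reduced) closed subscheme with equations \<open>p = 0\<close>
  for \<open>p \<in> S\<close>: locally it is generated by the regular functions \<open>p / q\<close> with \<open>q\<close> a nowhere
  vanishing form of the same degree as \<open>p\<close>.\<close>

definition forms_ideal :: "poly3 set \<Rightarrow> proj_plane set \<Rightarrow> (complex^3 \<Rightarrow> complex) set"
  where "forms_ideal S U =
    {s \<in> carrier (sections O_plane U). \<forall>x\<in>U. \<exists>V. open V \<and> x \<in> V \<and> V \<subseteq> U \<and>
      restr O_plane U V s \<in> Idl\<^bsub>sections O_plane V\<^esub>
        {t \<in> carrier (sections O_plane V). \<exists>p\<in>S. \<exists>q k. homog k p \<and> homog k q \<and>
          (\<forall>v\<in>affine_cone V. peval q v \<noteq> 0 \<and> t v = peval p v / peval q v)}}"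


section \<open>Line arrangements\<close>

definition line_arrangement :: "proj_plane set set \<Rightarrow> bool"
  where "line_arrangement \<A> \<longleftrightarrow> finite \<A> \<and> (\<forall>H\<in>\<A>. is_line H)"

text \<open>The linear forms \<open>\<alpha> H\<close> are a choice, unique up to nonzero scalars.\<close>

definition defining_poly ::
  "(proj_plane set \<Rightarrow> poly3) \<Rightarrow> proj_plane set set \<Rightarrow> poly3"
  where "defining_poly \<alpha> \<A> = (\<Prod>H\<in>\<A>. \<alpha> H)"

definition gradient_map ::
  "poly3 \<Rightarrow> (proj_plane, (complex^3 \<Rightarrow> complex) \<times> (complex^3 \<Rightarrow> complex) \<times> (complex^3 \<Rightarrow> complex),
     complex^3 \<Rightarrow> complex) presheaf_map"
  where "gradient_map f U = (\<lambda>(s1, s2, s3) v.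
    peval (partial 1 f) v * s1 v + peval (partial 2 f) v * s2 v + peval (partial 3 f) v * s3 v)"

definition arrangement_bundle ::
  "(proj_plane set \<Rightarrow> poly3) \<Rightarrow> proj_plane set set \<Rightarrow>
   (proj_plane, complex^3 \<Rightarrow> complex,
     (complex^3 \<Rightarrow> complex) \<times> (complex^3 \<Rightarrow> complex) \<times> (complex^3 \<Rightarrow> complex)) module_presheaf"
  where "arrangement_bundle \<alpha> \<A> =
    kernel_sheaf (direct_sum O_plane (direct_sum O_plane O_plane))
      (twist UNIV (int (card \<A>) - 1)) (gradient_map (defining_poly \<alpha> \<A>))"

text \<open>An arrangement with bundle \<open>T\<close> is plus-one generated of exponents \<open>(a, b)\<close> and level \<open>d\<close> if
  some pair \<open>(\<phi>, \<psi>)\<close> satisfies the following.\<close>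

definition plus_one_resolution ::
  "(proj_plane, complex^3 \<Rightarrow> complex, 't) module_presheaf \<Rightarrow> int \<Rightarrow> int \<Rightarrow> int \<Rightarrow>
   (proj_plane, complex^3 \<Rightarrow> complex,
     (complex^3 \<Rightarrow> complex) \<times> (complex^3 \<Rightarrow> complex) \<times> (complex^3 \<Rightarrow> complex)) presheaf_map \<Rightarrow>
   (proj_plane, (complex^3 \<Rightarrow> complex) \<times> (complex^3 \<Rightarrow> complex) \<times> (complex^3 \<Rightarrow> complex),
     't) presheaf_map \<Rightarrow> bool"
  where "plus_one_resolution T a b d \<phi> \<psi> \<longleftrightarrow> a \<le> b \<and> b \<le> d \<and>
    short_exact O_plane
      (twist UNIV (- 1 - d))
      (direct_sum (twist UNIV (- d)) (direct_sum (twist UNIV (- b)) (twist UNIV (- a))))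
      T \<phi> \<psi>"

text \<open>The forms \<open>e\<close> and \<open>g\<close> are the first two components of \<open>\<phi>\<close>, that is, equations of the line
  \<open>l\<^sub>0\<close> and of a curve of degree \<open>d + 1 - b\<close>.\<close>

definition resolution_equations ::
  "int \<Rightarrow> int \<Rightarrow>
   (proj_plane, complex^3 \<Rightarrow> complex,
     (complex^3 \<Rightarrow> complex) \<times> (complex^3 \<Rightarrow> complex) \<times> (complex^3 \<Rightarrow> complex)) presheaf_map \<Rightarrow>
   poly3 \<Rightarrow> poly3 \<Rightarrow> bool"
  where "resolution_equations b d \<phi> e g \<longleftrightarrow>
    homog 1 e \<and> homog (d + 1 - b) g \<and>
    (\<forall>U. open U \<longrightarrow> (\<forall>s\<in>carrier (sections (twist UNIV (- 1 - d)) U).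
      fst (\<phi> U s) = (\<lambda>v. peval e v * s v) \<and> fst (snd (\<phi> U s)) = (\<lambda>v. peval g v * s v)))"

definition intersection_ideal ::
  "proj_plane set \<Rightarrow> poly3 \<Rightarrow> poly3 \<Rightarrow> proj_plane set \<Rightarrow> (complex^3 \<Rightarrow> complex) set"
  where "intersection_ideal l e g = ideal_sum O_plane (vanishing_ideal l) (forms_ideal {e, g})"

end

theory Submission
  imports Defs "HOL-Computational_Algebra.Fundamental_Theorem_Algebra"
begin

text \<open>
  On a line \<open>l\<close> everything is read off from the presentation
  \<open>\<O>(-1-d) \<rightarrow> \<O>(-d) \<oplus> \<O>(-b) \<oplus> \<O>(-a) \<rightarrow> T\<close>, whose first map is multiplication by a triple \<open>(e, g, h)\<close> of sections,
  \<open>h\<close> of degree \<open>d + 1 - a\<close>. Tensoring is right exact, so \<open>T \<otimes> \<O>\<^sub>l\<close> is the cokernel of \<open>(e, g, h)\<close> on \<open>l\<close>.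
  Let \<open>a\<^sub>1, a\<^sub>2\<close> be two of the three entries, \<open>a\<^sub>3\<close> the third one, \<open>\<O>(n\<^sub>i)\<close> the target of \<open>a\<^sub>i\<close> and \<open>n\<^sub>0 = -1-d\<close>.
  If \<open>a\<^sub>1, a\<^sub>2\<close> have no common zero on \<open>l\<close> and \<open>a\<^sub>3 = A a\<^sub>1 + B a\<^sub>2\<close> there for sections \<open>A, B\<close> of twists on \<open>l\<close>, then
  \<open>(y\<^sub>1, y\<^sub>2, y\<^sub>3) \<mapsto> (y\<^sub>3 - A y\<^sub>1 - B y\<^sub>2, a\<^sub>2 y\<^sub>1 - a\<^sub>1 y\<^sub>2)\<close> identifies the cokernel with
  \<open>\<O>\<^sub>l(n\<^sub>3) \<oplus> \<O>\<^sub>l(n\<^sub>1 + n\<^sub>2 - n\<^sub>0)\<close>. This is \<open>restriction_splits\<close>; each case of the theorem is an instance of it.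

  \<^item> If \<open>l\<close> misses \<open>Z\<close>, the pair is \<open>(e, g)\<close>. The form \<open>e\<close> has exactly one zero on \<open>l\<close>; since \<open>g\<close> does not vanish
    there, some multiple of \<open>g\<close> agrees with \<open>h\<close> at that point, and the difference is divisible by \<open>e\<close>
    (\<open>splitting_disjoint\<close>).

  \<^item> If \<open>e\<close> does not vanish identically on \<open>l\<close> but \<open>l\<close> meets \<open>Z\<close>, then \<open>g\<close> vanishes at the zero of \<open>e\<close>, hence is a multiple
    of \<open>e\<close> on \<open>l\<close>, and the pair is \<open>(e, h)\<close> (\<open>splitting_transversal\<close>).

  \<^item> If \<open>e\<close> vanishes on \<open>l\<close>, the pair is \<open>(g, h)\<close> and the third entry is \<open>0\<close> (\<open>splitting_on_e\<close>). This is the case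
    \<open>l = l\<^sub>0\<close>; when \<open>|l \<inter> Z| = 1\<close> it occurs with \<open>d = b\<close>, and both descriptions of the bundle agree.

  The last two cases need that \<open>e, g, h\<close> have no common zero, that is, that \<open>T\<close> is locally free (\<open>no_common_zero\<close>).
  This is where it matters that \<open>T\<close> is the kernel of a map between free sheaves. Suppose that \<open>\<phi> = (e, g, h)\<close> vanishes at
  a point with local parameters \<open>p, q\<close>, and write \<open>\<phi> = p \<beta> + q \<gamma>\<close>. Then \<open>p \<psi>(\<beta>) = - q \<psi>(\<gamma>)\<close>, so \<open>\<psi>(\<beta>) = q s\<close> and
  \<open>\<psi>(\<gamma>) = - p s\<close> for a triple of functions \<open>s\<close>. As \<open>q s\<close> is annihilated by the gradient, so is \<open>s\<close>; hence
  \<open>s = \<psi>(\<sigma>)\<close>, and exactness gives \<open>\<beta> - q \<sigma> = c \<phi>\<close> and \<open>\<gamma> + p \<sigma> = c' \<phi>\<close>. Altogether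
  \<open>\<phi> = (p c + q c') \<phi>\<close>, which is absurd because \<open>p c + q c'\<close> vanishes at the point and \<open>\<phi>\<close> is injective.

  For the length, let \<open>e = 0\<close> on \<open>l\<close>. Then \<open>g\<close> is not identically \<open>0\<close> on \<open>l\<close>, since otherwise \<open>h\<close> would be a nowhere
  vanishing section of the twist \<open>\<O>\<^sub>l(d + 1 - a)\<close> of positive degree. The local ring of \<open>l\<close> at a point is a discrete
  valuation ring, so the length of \<open>l \<inter> Z\<close> there is the order of vanishing of \<open>g\<close>, and the orders add up to the degree
  of \<open>g\<close> by the fundamental theorem of algebra.

  That the cokernel really is the sheafified tensor product rests on one remark: a section of \<open>\<O>\<^sub>l\<close> lifts locally to the
  plane, so locally every tensor is of the form \<open>t \<otimes> 1\<close>, and \<open>t \<otimes> 1 = 0\<close> as soon as \<open>t\<close> is a multiple of the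
  equation of \<open>l\<close>.
\<close>

section \<open>Forms\<close>

lemma peval_uminus: "peval (- p) v = - peval p v"
  using peval_add[of p "- p" v] by (simp add: eq_neg_iff_add_eq_0 add.commute)

lemma peval_diff: "peval (p - q) v = peval p v - peval q v"
  using peval_add[of p "- q" v] by (simp add: peval_uminus)

lemma peval_power: "peval (p ^ n) v = peval p v ^ n"
  by (induction n) (simp_all add: peval_mult)

lemma peval_const: "peval (Poly_Mapping.single 0 c) v = c"
  by (simp add: peval_single meval_def)

lemmas peval_simps = peval_add peval_mult peval_uminus peval_diff peval_power peval_const peval_sum

lemma homog_zero [simp]: "homog k 0"
  by (simp add: homog_def)

lemma homog_add: "homog k p \<Longrightarrow> homog k q \<Longrightarrow> homog k (p + q)"
  using Poly_Mapping.keys_add[of p q] by (auto simp: homog_def)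

lemma homog_uminus: "homog k p \<Longrightarrow> homog k (- p)"
  by (simp add: homog_def)

lemma homog_diff: "homog k p \<Longrightarrow> homog k q \<Longrightarrow> homog k (p - q)"
  using homog_add[of k p "- q"] by (simp add: homog_uminus)

lemma homog_sum: "(\<And>i. i \<in> I \<Longrightarrow> homog k (f i)) \<Longrightarrow> homog k (sum f I)"
  by (induction I rule: infinite_finite_induct) (auto intro: homog_add)

lemma homog_const: "homog 0 (Poly_Mapping.single 0 c)"
  by (cases "c = 0") (simp_all add: homog_def mdeg_def)

lemma homog_power: "homog k p \<Longrightarrow> homog (int n * k) (p ^ n)"
proof (induction n)
  case (Suc n)
  then show ?case using homog_mult[of k p "int n * k" "p ^ n"] by (simp add: algebra_simps)
qed (simp add: homog_one)

lemma homog_neg: "homog k p \<Longrightarrow> k < 0 \<Longrightarrow> p = 0"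
proof -
  assume "homog k p" "k < 0"
  then have "Poly_Mapping.keys p = {}" by (fastforce simp: homog_def)
  then show "p = 0" by simp
qed

text \<open>A polynomial restricted to an affine line is a univariate polynomial. Identities between forms are reduced to
  this everywhere below, instead of to algebra in three variables.\<close>

lemma peval_restrict_line: "\<exists>P. \<forall>t. poly P t = peval p (u + t *s w)"
proof (intro exI allI)
  fix t
  show "poly (\<Sum>m\<in>Poly_Mapping.keys p. smult (Poly_Mapping.lookup p m)
      (\<Prod>i\<in>UNIV. [:u $ i, w $ i:] ^ Poly_Mapping.lookup m i)) t = peval p (u + t *s w)"
    by (simp add: peval_def poly_sum meval_def poly_prod algebra_simps)
qed

text \<open>Polynomial functions on a set swept out by lines through \<open>v0\<close> behave like an integral domain. The
  set is the whole space or the cone over a line.\<close>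

lemma peval_mult_eq_0_on_lines:
  assumes S: "\<And>t. v0 + t *s (v - v0) \<in> S"
    and "\<And>u. u \<in> S \<Longrightarrow> peval p u * peval q u = 0"
    and "peval p v0 \<noteq> 0"
  shows "peval q v = 0"
proof -
  obtain P where P: "\<And>t. poly P t = peval p (v0 + t *s (v - v0))"
    using peval_restrict_line by metis
  obtain Q where Q: "\<And>t. poly Q t = peval q (v0 + t *s (v - v0))"
    using peval_restrict_line by metis
  have "poly (P * Q) t = 0" for t
    using assms(2)[OF S] by (simp add: P Q)
  then have "P * Q = 0"
    using poly_all_0_iff_0 by blast
  moreover have "P \<noteq> 0"
    using P[of 0] assms(3) by auto
  ultimately have "Q = 0" by simp
  then show ?thesis
    using Q[of 1] by simp
qed

subsection \<open>Points\<close>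

text \<open>The point spanned by a vector; meaningful for nonzero vectors only.\<close>

definition pt :: "complex^3 \<Rightarrow> proj_plane"
  where "pt v = Abs_proj_plane {c *s v | c. True}"

lemma line_of_pt: "v \<noteq> 0 \<Longrightarrow> line_of (pt v) = {c *s v | c. True}"
  unfolding pt_def by (rule Abs_proj_plane_inverse) blast

lemma mem_line_of: "v \<noteq> 0 \<Longrightarrow> v \<in> line_of x \<longleftrightarrow> x = pt v"
proof
  assume v: "v \<noteq> 0" "v \<in> line_of x"
  obtain w where w: "w \<noteq> 0" "line_of x = {c *s w | c. True}" by (rule line_of_basis)
  then obtain c where c: "v = c *s w" using v(2) by auto
  then have "c \<noteq> 0" using v(1) by auto
  have "{c *s v | c. True} = {c *s w | c. True}"
  proof (intro equalityI subsetI)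
    fix u assume "u \<in> {c *s v | c. True}" then show "u \<in> {c *s w | c. True}"
      by (auto simp: c)
  next
    fix u assume "u \<in> {c *s w | c. True}"
    then obtain k where "u = k *s w" by auto
    then have "u = (k / c) *s v" using \<open>c \<noteq> 0\<close> by (simp add: c)
    then show "u \<in> {c *s v | c. True}" by blast
  qed
  then have "line_of x = line_of (pt v)" using v(1) w(2) by (simp add: line_of_pt)
  then show "x = pt v" by (simp add: line_of_inject)
next
  assume v: "v \<noteq> 0" "x = pt v"
  have "v = 1 *s v" by simp
  then show "v \<in> line_of x" using line_of_pt[OF v(1)] v(2) by blast
qed

lemma pt_cases: obtains v where "v \<noteq> 0" "x = pt v"
  using line_of_basis[of x] mem_line_of by metis

lemma pt_scale: "c \<noteq> 0 \<Longrightarrow> v \<noteq> 0 \<Longrightarrow> pt (c *s v) = pt v"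
  using mem_line_of[of "c *s v" "pt v"] line_of_pt[of v] by auto

lemma pt_eqD: "v \<noteq> 0 \<Longrightarrow> w \<noteq> 0 \<Longrightarrow> pt v = pt w \<Longrightarrow> \<exists>c. c \<noteq> 0 \<and> v = c *s w"
proof -
  assume a: "v \<noteq> 0" "w \<noteq> 0" "pt v = pt w"
  then have "v \<in> line_of (pt w)" using mem_line_of by metis
  then obtain c where c: "v = c *s w" using line_of_pt[OF a(2)] by auto
  then show ?thesis using a(1) by (intro exI[of _ c]) auto
qed

lemma mem_affine_cone: "v \<in> affine_cone X \<longleftrightarrow> v \<noteq> 0 \<and> pt v \<in> X"
  by (auto simp: affine_cone_def mem_line_of)

lemma pt_zero_locus: "homog k p \<Longrightarrow> v \<noteq> 0 \<Longrightarrow> pt v \<in> zero_locus p \<longleftrightarrow> peval p v = 0"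
  unfolding zero_locus_def using mem_line_of[of v "pt v"]
  by (auto simp: line_of_pt peval_scale)

definition nonzero_locus :: "poly3 \<Rightarrow> proj_plane set"
  where "nonzero_locus p = - zero_locus p"

lemma open_nonzero_locus: "homog k p \<Longrightarrow> open (nonzero_locus p)"
  unfolding open_proj_plane_def nonzero_locus_def by (intro exI[of _ "{p}"]) auto

lemma pt_nonzero_locus: "homog k p \<Longrightarrow> v \<noteq> 0 \<Longrightarrow> pt v \<in> nonzero_locus p \<longleftrightarrow> peval p v \<noteq> 0"
  by (simp add: nonzero_locus_def pt_zero_locus)

lemma open_basis:
  assumes "open U" "v \<noteq> 0" "pt v \<in> U"
  obtains k p where "homog k p" "peval p v \<noteq> 0"
    "\<And>w. w \<noteq> 0 \<Longrightarrow> peval p w \<noteq> 0 \<Longrightarrow> pt w \<in> U"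
proof -
  obtain P where P: "\<forall>p\<in>P. \<exists>k. homog k p" "- U = (\<Inter>p\<in>P. zero_locus p)"
    using assms(1) unfolding open_proj_plane_def by blast
  then obtain p where p: "p \<in> P" "pt v \<notin> zero_locus p" using assms(3) by blast
  then obtain k where k: "homog k p" using P by blast
  show thesis
  proof (rule that[OF k])
    show "peval p v \<noteq> 0" using p(2) pt_zero_locus[OF k assms(2)] by simp
    show "pt w \<in> U" if "w \<noteq> 0" "peval p w \<noteq> 0" for w
      using P(2) p(1) that pt_zero_locus[OF k that(1)] by blast
  qed
qed

text \<open>Nonempty open sets are dense: one contains the complement of the zero locus of a form \<open>p\<close>, and
  \<open>p * q\<close> vanishes everywhere. The origin has to be treated separately, as it lies over no point.\<close>

lemma peval_eq_0_dense:
  assumes lines: "\<And>v v0 t. v \<in> S \<Longrightarrow> v0 \<in> S \<Longrightarrow> v0 + t *s (v - v0) \<in> S"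
    and "open U" "v0 \<noteq> 0" "v0 \<in> S" "pt v0 \<in> U"
    and zero: "\<And>v. v \<in> S \<Longrightarrow> v \<noteq> 0 \<Longrightarrow> pt v \<in> U \<Longrightarrow> peval q v = 0"
    and "v \<in> S"
  shows "peval q v = 0"
proof -
  obtain k p where p: "homog k p" "peval p v0 \<noteq> 0"
    "\<And>w. w \<noteq> 0 \<Longrightarrow> peval p w \<noteq> 0 \<Longrightarrow> pt w \<in> U"
    using open_basis[OF assms(2,3,5)] by metis
  have a: "peval p u * peval q u = 0" if "u \<in> S" "u \<noteq> 0" for u
    using zero[OF that] p(3)[OF that(2)] by (cases "peval p u = 0") auto
  show ?thesis
  proof (cases "0 \<in> S")
    case True
    obtain Q where Q: "\<And>t. poly Q t = peval (p * q) (0 + t *s v0)"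
      using peval_restrict_line by metis
    have "poly Q t = 0" if "t \<noteq> 0" for t
    proof -
      have "0 + t *s (v0 - 0) \<in> S" using lines[OF assms(4) True] .
      then show ?thesis using a[of "t *s v0"] that assms(3) by (simp add: Q peval_mult)
    qed
    then have "poly ([:0, 1:] * Q) t = 0" for t
      by (cases "t = 0") simp_all
    then have "[:0, 1:] * Q = 0" using poly_all_0_iff_0 by blast
    then have "Q = 0" by simp
    then have "peval p 0 * peval q 0 = 0" using Q[of 0] by (simp add: peval_mult)
    then have b: "peval p u * peval q u = 0" if "u \<in> S" for u
      using a[OF that] by blast
    show ?thesis
      by (rule peval_mult_eq_0_on_lines[where S = S, OF lines[OF assms(7,4)] b p(2)])
  next
    case False
    show ?thesis
      by (rule peval_mult_eq_0_on_lines[where S = S, OF lines[OF assms(7,4)] a p(2)]) (use False in auto)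
  qed
qed

lemma peval_eq_0_dense_UNIV:
  assumes "open U" "x \<in> U" "\<And>v. v \<in> affine_cone U \<Longrightarrow> peval q v = 0"
  shows "peval q v = 0"
proof -
  obtain v0 where "v0 \<noteq> 0" "x = pt v0" by (rule pt_cases)
  then show ?thesis
    using peval_eq_0_dense[of UNIV U v0 q v, OF _ assms(1)] assms(2,3) unfolding mem_affine_cone by blast
qed


subsection \<open>Linear forms and frames\<close>

text \<open>A monomial of degree one is a variable.\<close>

lemma homog_1_key:
  assumes "homog 1 p" "m \<in> Poly_Mapping.keys p"
  obtains i where "m = Poly_Mapping.single i 1"
proof -
  have "int (mdeg m) = 1" using assms by (auto simp: homog_def)
  then have "(\<Sum>i\<in>UNIV. Poly_Mapping.lookup m i) = 1" by (simp add: mdeg_def del: of_nat_sum)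
  then obtain i where i: "Poly_Mapping.lookup m i = 1" "\<And>j. j \<noteq> i \<Longrightarrow> Poly_Mapping.lookup m j = 0"
    using sum_eq_1_iff[of UNIV "Poly_Mapping.lookup m"] by auto
  have "m = Poly_Mapping.single i 1"
    by (rule poly_mapping_eqI) (use i in \<open>auto simp: lookup_single when_def\<close>)
  then show thesis by (rule that)
qed

lemma meval_single: "meval (Poly_Mapping.single i (Suc 0)) v = v $ i"
proof -
  have "meval (Poly_Mapping.single i (Suc 0)) v = (\<Prod>j\<in>UNIV. if j = i then v $ i else 1)"
    unfolding meval_def by (rule prod.cong) (auto simp: lookup_single when_def)
  then show ?thesis by simp
qed

lemma homog_1_linear:
  assumes "homog 1 p"
  obtains w where "\<And>v. peval p v = (\<Sum>i\<in>UNIV. w $ i * v $ i)"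
proof -
  have *: "\<exists>i. m = Poly_Mapping.single i 1" if "m \<in> Poly_Mapping.keys p" for m
    using homog_1_key[OF assms that] by blast
  have "peval p v = (\<Sum>i\<in>UNIV. (\<chi> i. Poly_Mapping.lookup p (Poly_Mapping.single i 1)) $ i * v $ i)" for v
  proof -
    have inj: "inj_on (\<lambda>i. Poly_Mapping.single i (1::nat)) (UNIV :: 3 set)"
      by (rule inj_onI) (metis lookup_single_eq lookup_single_not_eq zero_neq_one)
    have "peval p v = (\<Sum>m\<in>(\<lambda>i. Poly_Mapping.single i 1) ` UNIV. Poly_Mapping.lookup p m * meval m v)"
      by (rule peval_superset) (use * in auto)
    also have "\<dots> = (\<Sum>i\<in>UNIV. Poly_Mapping.lookup p (Poly_Mapping.single i 1) * v $ i)"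
      by (subst sum.reindex[OF inj]) (simp add: meval_single)
    finally show ?thesis by simp
  qed
  then show thesis by (rule that)
qed

definition linear_form :: "complex^3 \<Rightarrow> poly3"
  where "linear_form w = (\<Sum>i\<in>UNIV. Poly_Mapping.single (Poly_Mapping.single i 1) (w $ i))"

lemma homog_linear_form: "homog 1 (linear_form w)"
  unfolding linear_form_def
proof (rule homog_sum)
  fix i :: 3
  have "mdeg (Poly_Mapping.single i 1) = 1"
    by (simp add: mdeg_def lookup_single when_def)
  then show "homog 1 (Poly_Mapping.single (Poly_Mapping.single i 1) (w $ i))"
    by (simp add: homog_def)
qed

lemma peval_linear_form: "peval (linear_form w) v = (\<Sum>i\<in>UNIV. w $ i * v $ i)"
  by (simp add: linear_form_def peval_sum peval_single meval_single)

lemma peval_linear: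
  assumes "homog 1 p"
  shows "peval p (u + v) = peval p u + peval p v" "peval p (c *s v) = c * peval p v"
    "peval p 0 = 0" "peval p (u - v) = peval p u - peval p v"
proof -
  obtain w where w: "\<And>v. peval p v = (\<Sum>i\<in>UNIV. w $ i * v $ i)"
    by (rule homog_1_linear[OF assms]) metis
  show "peval p (u + v) = peval p u + peval p v" "peval p (c *s v) = c * peval p v"
    "peval p 0 = 0" "peval p (u - v) = peval p u - peval p v"
    by (simp_all add: w algebra_simps sum.distrib sum_distrib_left sum_subtractf)
qed

lemma defines_line_nonzero:
  assumes "homog 1 p" "p \<noteq> 0"
  obtains v where "peval p v = 1"
proof -
  obtain m where m: "m \<in> Poly_Mapping.keys p" using assms(2) by (metis all_not_in_conv keys_eq_empty)
  have "\<exists>v. peval p v \<noteq> 0"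
  proof (rule ccontr)
    assume "\<not> ?thesis"
    then have z: "peval p v = 0" for v by simp
    obtain i where i: "m = Poly_Mapping.single i 1" by (rule homog_1_key[OF assms(1) m])
    define v :: "complex^3" where "v = (\<chi> j. if j = i then 1 else 0)"
    have "meval n v = (if n = m then 1 else 0)" if nk: "n \<in> Poly_Mapping.keys p" for n
    proof -
      obtain k where k: "n = Poly_Mapping.single k 1" by (rule homog_1_key[OF assms(1) nk])
      then have "n = m \<longleftrightarrow> k = i" using i by (metis lookup_single_eq lookup_single_not_eq zero_neq_one)
      then show ?thesis by (simp add: k meval_single v_def)
    qed
    then have "peval p v = (\<Sum>n\<in>Poly_Mapping.keys p. Poly_Mapping.lookup p n * (if n = m then 1 else 0))"
      by (simp add: peval_def)
    also have "\<dots> = Poly_Mapping.lookup p m" using m by (simp add: if_distrib cong: if_cong)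
    finally show False using z m by (simp add: in_keys_iff)
  qed
  then obtain v where "peval p v \<noteq> 0" by blast
  then have "peval p ((1 / peval p v) *s v) = 1" using peval_linear[OF assms(1)] by simp
  then show thesis by (rule that)
qed

definition det3 :: "complex^3 \<Rightarrow> complex^3 \<Rightarrow> complex^3 \<Rightarrow> complex"
  where "det3 a b c = a$1 * (b$2 * c$3 - b$3 * c$2) - a$2 * (b$1 * c$3 - b$3 * c$1)
    + a$3 * (b$1 * c$2 - b$2 * c$1)"

text \<open>A basis \<open>A, B, C\<close> of the space together with its dual basis of linear forms \<open>p, q,
  r\<close>. The line \<open>p = 0\<close> is then parametrised by \<open>s \<mapsto> s B + C\<close>, with
  \<open>B\<close> as its point at infinity, and \<open>p, q\<close> are local parameters at the point
  \<open>C\<close>.\<close>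

definition frame where
  "frame p q r A B C \<longleftrightarrow> homog 1 p \<and> homog 1 q \<and> homog 1 r \<and>
    (\<forall>v. v = peval p v *s A + peval q v *s B + peval r v *s C) \<and>
    (\<forall>a b c. peval p (a *s A + b *s B + c *s C) = a \<and> peval q (a *s A + b *s B + c *s C) = b \<and>
      peval r (a *s A + b *s B + c *s C) = c)"

text \<open>Cramer's rule.\<close>

lemma frame_det3:
  assumes "det3 A B C \<noteq> 0"
  obtains p q r where "frame p q r A B C"
proof -
  have ex: "\<exists>p. homog 1 p \<and> (\<forall>v. peval p v = f v)"
    if "\<And>v. f v = a * v$1 + b * v$2 + c * v$3" for f a b c
    by (rule exI[of _ "linear_form (vector [a, b, c])"])
      (simp add: homog_linear_form peval_linear_form sum_3 that)
  let ?D = "det3 A B C"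
  have "\<exists>p. homog 1 p \<and> (\<forall>v. peval p v = det3 v B C / ?D)"
    by (rule ex[of _ "(B$2 * C$3 - B$3 * C$2) / ?D" "- (B$1 * C$3 - B$3 * C$1) / ?D" "(B$1 * C$2 - B$2 * C$1) / ?D"])
      (unfold det3_def, simp add: diff_divide_distrib add_divide_distrib algebra_simps)
  then obtain p where p: "homog 1 p" "\<And>v. peval p v = det3 v B C / ?D" by blast
  have "\<exists>p. homog 1 p \<and> (\<forall>v. peval p v = det3 A v C / ?D)"
    by (rule ex[of _ "(A$3 * C$2 - A$2 * C$3) / ?D" "(A$1 * C$3 - A$3 * C$1) / ?D" "(A$2 * C$1 - A$1 * C$2) / ?D"])
      (unfold det3_def, simp add: diff_divide_distrib add_divide_distrib algebra_simps)
  then obtain q where q: "homog 1 q" "\<And>v. peval q v = det3 A v C / ?D" by blast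
  have "\<exists>p. homog 1 p \<and> (\<forall>v. peval p v = det3 A B v / ?D)"
    by (rule ex[of _ "(A$2 * B$3 - A$3 * B$2) / ?D" "(A$3 * B$1 - A$1 * B$3) / ?D" "(A$1 * B$2 - A$2 * B$1) / ?D"])
      (unfold det3_def, simp add: diff_divide_distrib add_divide_distrib algebra_simps)
  then obtain r where r: "homog 1 r" "\<And>v. peval r v = det3 A B v / ?D" by blast
  have "frame p q r A B C"
    unfolding frame_def
  proof (intro conjI allI p(1) q(1) r(1))
    fix v :: "complex^3"
    have "?D *s v = det3 v B C *s A + det3 A v C *s B + det3 A B v *s C"
      by (simp add: vec_eq_iff forall_3 det3_def algebra_simps)
    then have "inverse ?D *s (?D *s v) = inverse ?D *s (det3 v B C *s A + det3 A v C *s B + det3 A B v *s C)"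
      by (rule arg_cong)
    then show "v = peval p v *s A + peval q v *s B + peval r v *s C"
      using assms by (simp add: p q r divide_inverse vector_add_ldistrib mult.commute)
  next
    fix a b c
    have "det3 (a *s A + b *s B + c *s C) B C = a * ?D" by (simp add: det3_def algebra_simps)
    then show "peval p (a *s A + b *s B + c *s C) = a" using assms by (simp add: p)
    have "det3 A (a *s A + b *s B + c *s C) C = b * ?D" by (simp add: det3_def algebra_simps)
    then show "peval q (a *s A + b *s B + c *s C) = b" using assms by (simp add: q)
    have "det3 A B (a *s A + b *s B + c *s C) = c * ?D" by (simp add: det3_def algebra_simps)
    then show "peval r (a *s A + b *s B + c *s C) = c" using assms by (simp add: r)
  qed
  then show thesis by (rule that)
qed

lemma frame_basis:
  assumes "frame p q r A B C"
  shows "peval p A = 1" "peval p B = 0" "peval p C = 0" "peval q A = 0" "peval q B = 1" "peval q C = 0"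
    "peval r A = 0" "peval r B = 0" "peval r C = 1"
proof -
  have *: "peval p (a *s A + b *s B + c *s C) = a" "peval q (a *s A + b *s B + c *s C) = b"
      "peval r (a *s A + b *s B + c *s C) = c" for a b c
    using assms unfolding frame_def by blast+
  show "peval p A = 1" "peval p B = 0" "peval p C = 0" "peval q A = 0" "peval q B = 1" "peval q C = 0"
    "peval r A = 0" "peval r B = 0" "peval r C = 1"
    using *[of 1 0 0] *[of 0 1 0] *[of 0 0 1] by simp_all
qed

lemma frame_expand: "frame p q r A B C \<Longrightarrow> v = peval p v *s A + peval q v *s B + peval r v *s C"
  unfolding frame_def by blast

lemma frame_homog: "frame p q r A B C \<Longrightarrow> homog 1 p" "frame p q r A B C \<Longrightarrow> homog 1 q"
   "frame p q r A B C \<Longrightarrow> homog 1 r"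
  unfolding frame_def by blast+

text \<open>Let \<open>w\<close> be the coefficient vector of \<open>p\<close>. The missing vector is the cross product
  \<open>B = cnj C \<times> w\<close>: it is killed by \<open>p\<close>, and \<open>B \<times> C = |C|\<^sup>2
  w\<close>, so that \<open>det (A, B, C) = |C|\<^sup>2\<close> whenever \<open>p\<close> takes the value
  \<open>1\<close> at \<open>A\<close>. Conjugating \<open>C\<close> is what excludes isotropic vectors.\<close>

lemma frame_exists:
  assumes p: "homog 1 p" "p \<noteq> 0" and C: "peval p C = 0" "C \<noteq> 0"
  obtains q r A B where "frame p q r A B C"
proof -
  obtain w where w: "\<And>v. peval p v = (\<Sum>i\<in>UNIV. w $ i * v $ i)"
    by (rule homog_1_linear[OF p(1)]) metis
  obtain A where A: "peval p A = 1" by (rule defines_line_nonzero[OF p])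
  define B :: "complex^3" where "B = vector [cnj (C$2) * w$3 - cnj (C$3) * w$2, cnj (C$3) * w$1 - cnj (C$1) * w$3,
      cnj (C$1) * w$2 - cnj (C$2) * w$1]"
  have B: "peval p B = 0" by (simp add: w sum_3 B_def algebra_simps)
  have "det3 A B C = (cnj (C$1) * C$1 + cnj (C$2) * C$2 + cnj (C$3) * C$3) * peval p A
     - (cnj (C$1) * A$1 + cnj (C$2) * A$2 + cnj (C$3) * A$3) * peval p C"
    by (simp add: det3_def B_def w sum_3 algebra_simps)
  also have "\<dots> = of_real ((cmod (C$1))\<^sup>2 + (cmod (C$2))\<^sup>2 + (cmod (C$3))\<^sup>2)"
    by (simp add: A C complex_norm_square mult.commute del: of_real_power)
  finally have D: "det3 A B C = of_real ((cmod (C$1))\<^sup>2 + (cmod (C$2))\<^sup>2 + (cmod (C$3))\<^sup>2)" .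
  have "(cmod (C$1))\<^sup>2 + (cmod (C$2))\<^sup>2 + (cmod (C$3))\<^sup>2 \<noteq> 0"
  proof
    assume "(cmod (C$1))\<^sup>2 + (cmod (C$2))\<^sup>2 + (cmod (C$3))\<^sup>2 = 0"
    then have "cmod (C$1) = 0" "cmod (C$2) = 0" "cmod (C$3) = 0"
      by (metis add_nonneg_eq_0_iff add_nonneg_nonneg zero_le_power2 power_eq_0_iff)+
    then show False using C(2) by (simp add: vec_eq_iff forall_3)
  qed
  then have "det3 A B C \<noteq> 0" unfolding D by (simp del: of_real_add of_real_power)
  then obtain p' q r where f: "frame p' q r A B C" by (rule frame_det3)
  have "peval p v = peval p' v" for v
    by (subst frame_expand[OF f, of v]) (simp add: peval_linear[OF p(1)] A B C)
  then have "frame p q r A B C" using f p(1) unfolding frame_def by simp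
  then show thesis by (rule that)
qed

lemma frame_swap: "frame p q r A B C \<Longrightarrow> frame p r q A C B"
proof -
  have [simp]: "a *s A + c *s C + b *s B = a *s A + b *s B + c *s C" for a b c
    by (simp add: add_ac)
  show "frame p q r A B C \<Longrightarrow> frame p r q A C B"
    unfolding frame_def by simp
qed

lemma ex_orthogonal: "\<exists>w::complex^3. w \<noteq> 0 \<and> (\<Sum>i\<in>UNIV. w $ i * C $ i) = 0"
proof (cases "C $ 1 = 0 \<and> C $ 2 = 0")
  case True
  have "vector [1, 0, 0] \<noteq> (0 :: complex^3)" by (simp add: vec_eq_iff forall_3)
  then show ?thesis using True by (intro exI[of _ "vector [1, 0, 0]"]) (simp add: sum_3)
next
  case False
  have "vector [C$2, - C$1, 0] \<noteq> (0 :: complex^3)"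
    using False by (auto simp: vec_eq_iff forall_3)
  then show ?thesis by (intro exI[of _ "vector [C$2, - C$1, 0]"]) (simp add: sum_3)
qed

lemma ex_frame_at:
  assumes "C \<noteq> 0"
  obtains p q r A B where "frame p q r A B C"
proof -
  obtain w where w: "w \<noteq> 0" "peval (linear_form w) C = 0"
    using ex_orthogonal[of C] by (auto simp: peval_linear_form)
  then obtain i where "w $ i \<noteq> 0" by (auto simp: vec_eq_iff)
  then have "peval (linear_form w) (\<chi> j. if j = i then 1 else 0) \<noteq> 0"
    by (simp add: peval_linear_form if_distrib cong: if_cong)
  then have "linear_form w \<noteq> 0" by auto
  then show thesis using frame_exists[OF homog_linear_form _ w(2) assms] that by metis
qed

subsection \<open>Forms in a frame\<close>

text \<open>The homogenisation of \<open>c\<close> to degree \<open>n\<close>; coefficients of \<open>c\<close> beyond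
  \<open>n\<close> are dropped.\<close>

definition bin :: "nat \<Rightarrow> complex poly \<Rightarrow> poly3 \<Rightarrow> poly3 \<Rightarrow> poly3"
  where "bin n c q r = (\<Sum>i\<le>n. Poly_Mapping.single 0 (coeff c i) * q ^ i * r ^ (n - i))"

lemma homog_bin: "homog 1 q \<Longrightarrow> homog 1 r \<Longrightarrow> homog (int n) (bin n c q r)"
  unfolding bin_def
proof (rule homog_sum)
  fix i assume "homog 1 q" "homog 1 r" "i \<in> {..n}"
  then have "homog (0 + int i * 1 + int (n - i) * 1) (Poly_Mapping.single 0 (coeff c i) * q ^ i * r ^ (n - i))"
    by (intro homog_mult homog_const homog_power)
  then show "homog (int n) (Poly_Mapping.single 0 (coeff c i) * q ^ i * r ^ (n - i))"
    using \<open>i \<in> {..n}\<close> by (simp add: of_nat_diff)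
qed

lemma peval_bin: "peval (bin n c q r) v = (\<Sum>i\<le>n. coeff c i * peval q v ^ i * peval r v ^ (n - i))"
  by (simp add: bin_def peval_simps)

lemma peval_bin_pCons: "peval (bin (Suc n) (pCons 0 c) q r) v = peval q v * peval (bin n c q r) v"
  by (simp add: peval_bin sum.atMost_Suc_shift sum_distrib_left mult_ac del: sum.atMost_Suc)

lemma peval_bin_Suc: "degree c \<le> n \<Longrightarrow> peval (bin (Suc n) c q r) v = peval r v * peval (bin n c q r) v"
  by (simp add: peval_bin sum_distrib_left coeff_eq_0 Suc_diff_le mult_ac)

lemma peval_bin_add: "peval (bin n (c + d) q r) v = peval (bin n c q r) v + peval (bin n d q r) v"
  by (simp add: peval_bin algebra_simps sum.distrib)

lemma peval_bin_smult: "peval (bin n (smult a c) q r) v = a * peval (bin n c q r) v"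
  by (simp add: peval_bin algebra_simps sum_distrib_left)

lemma poly_bin:
  assumes "degree c \<le> n" "peval r v = 1"
  shows "peval (bin n c q r) v = poly c (peval q v)"
  using assms by (simp add: peval_bin poly_altdef)
    (rule sum.mono_neutral_right, auto simp: coeff_eq_0)

text \<open>At the point at infinity only the top coefficient survives, which may be zero: a drop of the degree of
  \<open>c\<close> is a zero at infinity.\<close>

lemma peval_bin_infinity: "peval r v = 0 \<Longrightarrow> peval (bin n c q r) v = coeff c n * peval q v ^ n"
proof -
  assume "peval r v = 0"
  then have "peval (bin n c q r) v = (\<Sum>i\<le>n. if i = n then coeff c n * peval q v ^ n else 0)"
    unfolding peval_bin by (intro sum.cong) auto
  then show ?thesis by simp
qed

text \<open>In the coordinates of the frame, collect the monomials divisible by \<open>p\<close>. Induction on the degree,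
  one variable at a time, avoids a change of coordinates in the polynomial ring.\<close>

lemma frame_decomp_nat:
  assumes f: "frame p q r A B C" and "homog (int n) N"
  shows "\<exists>N' c. homog (int n - 1) N' \<and> degree c \<le> n \<and>
    (\<forall>v. peval N v = peval p v * peval N' v + peval (bin n c q r) v)"
proof -
  let ?P = "\<lambda>n N. \<exists>N' c. homog (int n - 1) N' \<and> degree c \<le> n \<and>
    (\<forall>v. peval N v = peval p v * peval N' v + peval (bin n c q r) v)"
  note h = frame_homog[OF f]
  have add: "?P n (N + M)" if P: "?P n N" "?P n M" for n N M
  proof -
    obtain N' c where 1: "homog (int n - 1) N'" "degree c \<le> n"
      "\<And>v. peval N v = peval p v * peval N' v + peval (bin n c q r) v" using P(1) by blast
    obtain M' d where 2: "homog (int n - 1) M'" "degree d \<le> n"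
      "\<And>v. peval M v = peval p v * peval M' v + peval (bin n d q r) v" using P(2) by blast
    show ?thesis
      by (intro exI[of _ "N' + M'"] exI[of _ "c + d"] conjI homog_add degree_add_le 1 2)
        (simp add: peval_simps peval_bin_add 1 2 algebra_simps)
  qed
  have zero: "?P n 0" for n
    by (intro exI[of _ 0] exI[of _ "0 :: complex poly"]) (simp add: peval_bin)
  have sum: "?P n (sum g I)" if "\<And>i. i \<in> I \<Longrightarrow> ?P n (g i)" for n g and I :: "(3 \<Rightarrow>\<^sub>0 nat) set"
    using that
  proof (induction I rule: infinite_finite_induct)
    case (infinite I)
    then show ?case using zero[of n] by (simp only: sum.infinite[OF infinite.hyps])
  next
    case empty
    then show ?case using zero[of n] by (simp only: sum.empty)
  next
    case (insert i I)
    have "?P n (g i)" "?P n (sum g I)" using insert by blast+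
    from add[OF this] show ?case by (simp only: sum.insert[OF insert.hyps])
  qed
  have mono: "?P n (Poly_Mapping.single m a)" if "mdeg m = n" for m n a
    using that
  proof (induction n arbitrary: m a)
    case 0
    then have "m = 0" by (intro poly_mapping_eqI) (simp add: mdeg_def)
    then show ?case
      by (intro exI[of _ 0] exI[of _ "[:a:]"]) (simp add: peval_bin peval_const)
  next
    case (Suc n)
    then have "mdeg m \<noteq> 0" by simp
    then obtain i where i: "Poly_Mapping.lookup m i \<noteq> 0" by (auto simp: mdeg_def)
    define m' where "m' = m - Poly_Mapping.single i 1"
    have m: "m = m' + Poly_Mapping.single i 1"
      by (rule poly_mapping_eqI) (use i in \<open>auto simp: m'_def lookup_add lookup_minus lookup_single when_def\<close>)
    have "mdeg (Poly_Mapping.single i 1) = 1"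
      by (simp add: mdeg_def lookup_single when_def)
    then have "mdeg m' = n" using Suc.prems by (simp add: m mdeg_add)
    then obtain N' c where 1: "homog (int n - 1) N'" "degree c \<le> n"
      "\<And>v. peval (Poly_Mapping.single m' a) v = peval p v * peval N' v + peval (bin n c q r) v"
      using Suc.IH by blast
    have xi: "v $ i = peval p v * A $ i + peval q v * B $ i + peval r v * C $ i" for v
      by (subst (1) frame_expand[OF f, of v]) simp
    have ev: "peval (Poly_Mapping.single m a) v =
       (peval p v * A $ i + peval q v * B $ i + peval r v * C $ i) * (peval p v * peval N' v + peval (bin n c q r) v)" for v
      using 1(3)[of v] by (simp add: m peval_single meval_add meval_single xi[of v] mult_ac)
    let ?l = "Poly_Mapping.single 0 (A $ i) * p + Poly_Mapping.single 0 (B $ i) * q + Poly_Mapping.single 0 (C $ i) * r"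
    have hl: "homog 1 ?l"
      using homog_mult[OF homog_const h(1)] homog_mult[OF homog_const h(2)] homog_mult[OF homog_const h(3)]
      by (intro homog_add) simp_all
    have "homog (int n) (?l * N')"
      using homog_mult[OF hl 1(1)] by simp
    moreover have "homog (int n) (Poly_Mapping.single 0 (A $ i) * bin n c q r)"
      using homog_mult[OF homog_const homog_bin[OF h(2,3)]] by simp
    ultimately have "homog (int n) (?l * N' + Poly_Mapping.single 0 (A $ i) * bin n c q r)" by (rule homog_add)
    moreover have "degree (smult (B $ i) (pCons 0 c) + smult (C $ i) c) \<le> Suc n"
      using 1(2) by (intro degree_add_le) (auto intro!: order.trans[OF degree_smult_le] simp: degree_pCons_eq_if)
    ultimately show ?case
      by (intro exI[of _ "?l * N' + Poly_Mapping.single 0 (A $ i) * bin n c q r"]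
            exI[of _ "smult (B $ i) (pCons 0 c) + smult (C $ i) c"] conjI)
        (simp_all add: ev peval_simps peval_bin_add peval_bin_smult peval_bin_pCons peval_bin_Suc[OF 1(2)] algebra_simps)
  qed
  have "?P n (\<Sum>m\<in>Poly_Mapping.keys N. Poly_Mapping.single m (Poly_Mapping.lookup N m))"
    by (rule sum, rule mono) (use assms(2) in \<open>auto simp: homog_def\<close>)
  then show ?thesis using poly3_expand[of N] by simp
qed

lemma vanish_on_affine_line_imp_dvd:
  assumes f: "frame p q r A B C" and N: "homog k N" and z: "\<And>s. peval N (s *s B + C) = 0"
  obtains N' where "homog (k - 1) N'" "\<And>v. peval N v = peval p v * peval N' v"
proof (cases "k < 0")
  case True
  then show thesis using homog_neg[OF N] that[of 0] by simp
next
  case False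
  then obtain n where k: "k = int n" by (metis nat_0_le not_less)
  obtain N' c where c: "homog (int n - 1) N'" "degree c \<le> n"
    "\<And>v. peval N v = peval p v * peval N' v + peval (bin n c q r) v"
    using frame_decomp_nat[OF f] N unfolding k by blast
  have "poly c s = 0" for s
  proof -
    have a: "peval p (s *s B + C) = 0" "peval q (s *s B + C) = s" "peval r (s *s B + C) = 1"
      using frame_basis[OF f] peval_linear[OF frame_homog(1)[OF f]] peval_linear[OF frame_homog(2)[OF f]]
        peval_linear[OF frame_homog(3)[OF f]] by simp_all
    then show ?thesis using z[of s] poly_bin[OF c(2) a(3)] c(3) by simp
  qed
  then have "c = 0" using poly_all_0_iff_0 by blast
  then have "peval N v = peval p v * peval N' v" for v using c(3) by (simp add: peval_bin)
  then show thesis using that c(1) k by blast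
qed

lemma vanish_on_line_imp_dvd:
  assumes f: "frame p q r A B C" and N: "homog k N" and z: "\<And>v. peval p v = 0 \<Longrightarrow> peval N v = 0"
  obtains N' where "homog (k - 1) N'" "\<And>v. peval N v = peval p v * peval N' v"
proof -
  have "peval N (s *s B + C) = 0" for s
    using frame_basis[OF f] by (intro z) (simp add: peval_linear[OF frame_homog(1)[OF f]])
  then show thesis using vanish_on_affine_line_imp_dvd[OF f N] that by metis
qed

text \<open>The forms \<open>p, q\<close> generate the ideal of the point \<open>C\<close>.\<close>

lemma vanish_at_point_imp_ideal:
  assumes f: "frame p q r A B C" and N: "homog k N" and z: "peval N C = 0"
  obtains N1 N2 where "homog (k - 1) N1" "homog (k - 1) N2"
    "\<And>v. peval N v = peval p v * peval N1 v + peval q v * peval N2 v"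
proof (cases "k < 0")
  case True
  then show thesis using homog_neg[OF N] that[of 0 0] by simp
next
  case False
  then obtain n where k: "k = int n" by (metis nat_0_le not_less)
  obtain N' c where c: "homog (int n - 1) N'" "degree c \<le> n"
    "\<And>v. peval N v = peval p v * peval N' v + peval (bin n c q r) v"
    using frame_decomp_nat[OF f] N unfolding k by blast
  have "poly c 0 = 0" using c(3)[of C] poly_bin[OF c(2), of r C q] z frame_basis[OF f] by simp
  then obtain c' where c': "c = pCons 0 c'" by (metis pCons_cases poly_0_coeff_0 coeff_pCons_0)
  show thesis
  proof (cases n)
    case 0
    then have "c = 0" using c(2) c' by (simp add: degree_pCons_eq_if split: if_splits)
    then show thesis using that[of N' 0] c by (simp add: peval_bin k)
  next
    case (Suc m)
    show thesis
      using that[of N' "bin m c' q r"] c homog_bin[OF frame_homog(2)[OF f] frame_homog(3)[OF f], of m c']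
      by (simp add: k Suc c' peval_bin_pCons)
  qed
qed

section \<open>Sections of twists\<close>

lemma affine_cone_mono: "X \<subseteq> Y \<Longrightarrow> v \<in> affine_cone X \<Longrightarrow> v \<in> affine_cone Y"
  by (auto simp: mem_affine_cone)

lemma affine_cone_Int: "v \<in> affine_cone (X \<inter> Y) \<longleftrightarrow> v \<in> affine_cone X \<and> v \<in> affine_cone Y"
  by (auto simp: mem_affine_cone)

lemma affine_cone_UNIV: "v \<in> affine_cone UNIV \<longleftrightarrow> v \<noteq> 0"
  by (auto simp: mem_affine_cone)

text \<open>The pointwise condition in the definition of sections of a twist, on the part \<open>Y\<close> of the plane.\<close>

definition is_fraction :: "proj_plane set \<Rightarrow> int \<Rightarrow> (complex^3 \<Rightarrow> complex) \<Rightarrow> bool"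
  where "is_fraction Y k s \<longleftrightarrow> (\<exists>p q m n. homog m p \<and> homog n q \<and> m - n = k \<and>
    (\<forall>v\<in>affine_cone Y. peval q v \<noteq> 0 \<and> s v = peval p v / peval q v))"

lemma mem_twist_sections: "s \<in> twist_sections X k U \<longleftrightarrow> (\<forall>v. v \<notin> affine_cone (U \<inter> X) \<longrightarrow> s v = 0) \<and>
    (\<forall>x\<in>U \<inter> X. \<exists>V. open V \<and> x \<in> V \<and> V \<subseteq> U \<and> is_fraction (V \<inter> X) k s)"
  unfolding twist_sections_def is_fraction_def mem_Collect_eq by (intro conj_cong refl ball_cong) blast

lemma is_fractionE:
  assumes "is_fraction Y k s"
  obtains p q m n where "homog m p" "homog n q" "m - n = k"
    "\<And>v. v \<in> affine_cone Y \<Longrightarrow> peval q v \<noteq> 0" "\<And>v. v \<in> affine_cone Y \<Longrightarrow> s v = peval p v / peval q v"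
  using assms unfolding is_fraction_def by blast

lemma is_fraction_subset: "is_fraction Y k s \<Longrightarrow> Y' \<subseteq> Y \<Longrightarrow> is_fraction Y' k s"
  unfolding is_fraction_def by (metis (no_types, lifting) affine_cone_mono)

lemma is_fraction_cong: "(\<And>v. v \<in> affine_cone Y \<Longrightarrow> s v = t v) \<Longrightarrow> is_fraction Y k s \<longleftrightarrow> is_fraction Y k t"
  unfolding is_fraction_def by (intro arg_cong[where f = Ex] ext) (metis (no_types, lifting))

lemma is_fractionI:
  "homog m p \<Longrightarrow> homog n q \<Longrightarrow> m - n = k \<Longrightarrow> (\<And>v. v \<in> affine_cone Y \<Longrightarrow> peval q v \<noteq> 0) \<Longrightarrow>
   (\<And>v. v \<in> affine_cone Y \<Longrightarrow> s v = peval p v / peval q v) \<Longrightarrow> is_fraction Y k s"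
  unfolding is_fraction_def by blast

lemma is_fraction_form: "homog k p \<Longrightarrow> is_fraction Y k (peval p)"
  by (rule is_fractionI[of k p 0 1]) (simp_all add: homog_one)

lemma is_fraction_zero: "is_fraction Y k (\<lambda>v. 0)"
  using is_fraction_form[of k 0 Y] is_fraction_cong[of Y "peval 0" "\<lambda>v. 0" k] by simp

lemma is_fraction_add:
  assumes "is_fraction Y k s" "is_fraction Y k t"
  shows "is_fraction Y k (\<lambda>v. s v + t v)"
proof -
  obtain p q m n where 1: "homog m p" "homog n q" "m - n = k"
    "\<And>v. v \<in> affine_cone Y \<Longrightarrow> peval q v \<noteq> 0" "\<And>v. v \<in> affine_cone Y \<Longrightarrow> s v = peval p v / peval q v"
    using is_fractionE[OF assms(1)] by metis
  obtain p' q' m' n' where 2: "homog m' p'" "homog n' q'" "m' - n' = k"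
    "\<And>v. v \<in> affine_cone Y \<Longrightarrow> peval q' v \<noteq> 0" "\<And>v. v \<in> affine_cone Y \<Longrightarrow> t v = peval p' v / peval q' v"
    using is_fractionE[OF assms(2)] by metis
  have "homog (m + n') (p * q')" "homog (m' + n) (p' * q)"
    using homog_mult[OF 1(1) 2(2)] homog_mult[OF 2(1) 1(2)] by simp_all
  moreover have "m' + n = m + n'" using 1(3) 2(3) by simp
  ultimately have "homog (m + n') (p * q' + p' * q)" by (auto intro: homog_add)
  then show ?thesis
    by (rule is_fractionI[OF _ homog_mult[OF 1(2) 2(2)]])
      (use 1(3-) 2(3-) in \<open>simp_all add: peval_simps field_simps\<close>)
qed

lemma is_fraction_mult:
  assumes "is_fraction Y k s" "is_fraction Y k' t"
  shows "is_fraction Y (k + k') (\<lambda>v. s v * t v)"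
proof -
  obtain p q m n where 1: "homog m p" "homog n q" "m - n = k"
    "\<And>v. v \<in> affine_cone Y \<Longrightarrow> peval q v \<noteq> 0" "\<And>v. v \<in> affine_cone Y \<Longrightarrow> s v = peval p v / peval q v"
    using is_fractionE[OF assms(1)] by metis
  obtain p' q' m' n' where 2: "homog m' p'" "homog n' q'" "m' - n' = k'"
    "\<And>v. v \<in> affine_cone Y \<Longrightarrow> peval q' v \<noteq> 0" "\<And>v. v \<in> affine_cone Y \<Longrightarrow> t v = peval p' v / peval q' v"
    using is_fractionE[OF assms(2)] by metis
  show ?thesis
    by (rule is_fractionI[OF homog_mult[OF 1(1) 2(1)] homog_mult[OF 1(2) 2(2)]])
      (use 1(3-) 2(3-) in \<open>simp_all add: peval_simps\<close>)
qed

lemma is_fraction_inverse: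
  assumes "is_fraction Y k s" "\<And>v. v \<in> affine_cone Y \<Longrightarrow> s v \<noteq> 0"
  shows "is_fraction Y (- k) (\<lambda>v. inverse (s v))"
proof -
  obtain p q m n where 1: "homog m p" "homog n q" "m - n = k"
    "\<And>v. v \<in> affine_cone Y \<Longrightarrow> peval q v \<noteq> 0" "\<And>v. v \<in> affine_cone Y \<Longrightarrow> s v = peval p v / peval q v"
    using is_fractionE[OF assms(1)] by metis
  show ?thesis
    by (rule is_fractionI[OF 1(2,1)]) (use 1(3-) assms(2) in auto)
qed

lemma tw_outside: "s \<in> twist_sections X k U \<Longrightarrow> v \<notin> affine_cone (U \<inter> X) \<Longrightarrow> s v = 0"
  by (simp add: mem_twist_sections)

lemma tw_local:
  assumes "s \<in> twist_sections X k U" "x \<in> U" "x \<in> X"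
  obtains V where "open V" "x \<in> V" "V \<subseteq> U" "is_fraction (V \<inter> X) k s"
  using assms unfolding mem_twist_sections by blast

lemma twI:
  assumes "\<And>v. v \<notin> affine_cone (U \<inter> X) \<Longrightarrow> s v = 0"
    "\<And>x. x \<in> U \<Longrightarrow> x \<in> X \<Longrightarrow> \<exists>V. open V \<and> x \<in> V \<and> V \<subseteq> U \<and> is_fraction (V \<inter> X) k s"
  shows "s \<in> twist_sections X k U"
  using assms unfolding mem_twist_sections by blast

lemma tw_fraction:
  assumes "open U" "is_fraction (U \<inter> X) k s"
  shows "(\<lambda>v. if v \<in> affine_cone (U \<inter> X) then s v else 0) \<in> twist_sections X k U"
proof (rule twI)
  fix x assume "x \<in> U"
  have "is_fraction (U \<inter> X) k (\<lambda>v. if v \<in> affine_cone (U \<inter> X) then s v else 0)"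
    using assms(2) by (subst is_fraction_cong[of _ _ s]) auto
  then show "\<exists>V. open V \<and> x \<in> V \<and> V \<subseteq> U \<and>
      is_fraction (V \<inter> X) k (\<lambda>v. if v \<in> affine_cone (U \<inter> X) then s v else 0)"
    using assms(1) \<open>x \<in> U\<close> by blast
qed simp

lemma tw_zero: "open U \<Longrightarrow> (\<lambda>v. 0) \<in> twist_sections X k U"
  using tw_fraction[OF _ is_fraction_zero] by (simp cong: if_cong)

lemma tw_add:
  assumes "s \<in> twist_sections X k U" "t \<in> twist_sections X k U"
  shows "(\<lambda>v. s v + t v) \<in> twist_sections X k U"
proof (rule twI)
  fix v assume "v \<notin> affine_cone (U \<inter> X)"
  then show "s v + t v = 0" using tw_outside[OF assms(1)] tw_outside[OF assms(2)] by simp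
next
  fix x assume x: "x \<in> U" "x \<in> X"
  obtain V where V: "open V" "x \<in> V" "V \<subseteq> U" "is_fraction (V \<inter> X) k s" by (rule tw_local[OF assms(1) x])
  obtain W where W: "open W" "x \<in> W" "W \<subseteq> U" "is_fraction (W \<inter> X) k t" by (rule tw_local[OF assms(2) x])
  have "is_fraction ((V \<inter> W) \<inter> X) k (\<lambda>v. s v + t v)"
    using V(4) W(4) by (intro is_fraction_add) (auto elim: is_fraction_subset)
  then show "\<exists>V. open V \<and> x \<in> V \<and> V \<subseteq> U \<and> is_fraction (V \<inter> X) k (\<lambda>v. s v + t v)"
    using V W by (intro exI[of _ "V \<inter> W"]) auto
qed

lemma tw_mult:
  assumes "s \<in> twist_sections X k U" "t \<in> twist_sections X' k' U'" "U \<subseteq> U'" "X \<subseteq> X'" "open U"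
  shows "(\<lambda>v. s v * t v) \<in> twist_sections X (k + k') U"
proof (rule twI)
  fix v assume "v \<notin> affine_cone (U \<inter> X)"
  then show "s v * t v = 0" using tw_outside[OF assms(1)] by simp
next
  fix x assume x: "x \<in> U" "x \<in> X"
  obtain V where V: "open V" "x \<in> V" "V \<subseteq> U" "is_fraction (V \<inter> X) k s" by (rule tw_local[OF assms(1) x])
  obtain W where W: "open W" "x \<in> W" "W \<subseteq> U'" "is_fraction (W \<inter> X') k' t"
    using tw_local[OF assms(2)] x assms(3,4) by blast
  have "is_fraction ((V \<inter> W \<inter> U) \<inter> X) (k + k') (\<lambda>v. s v * t v)"
    using V(4) W(4) assms(4) by (intro is_fraction_mult) (auto elim: is_fraction_subset)
  then show "\<exists>V. open V \<and> x \<in> V \<and> V \<subseteq> U \<and> is_fraction (V \<inter> X) (k + k') (\<lambda>v. s v * t v)"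
    using V W x assms(5) by (intro exI[of _ "V \<inter> W \<inter> U"]) auto
qed

lemma tw_mult': 
  assumes "s \<in> twist_sections X k U" "t \<in> twist_sections X' k' U'" "U \<subseteq> U'" "X \<subseteq> X'" "open U" "k + k' = m"
  shows "(\<lambda>v. t v * s v) \<in> twist_sections X m U"
  using tw_mult[OF assms(1-5)] assms(6) by (simp add: mult.commute)

lemma tw_inverse:
  assumes "s \<in> twist_sections X k U" "\<And>v. v \<in> affine_cone (U \<inter> X) \<Longrightarrow> s v \<noteq> 0"
  shows "(\<lambda>v. inverse (s v)) \<in> twist_sections X (- k) U"
proof (rule twI)
  fix v assume "v \<notin> affine_cone (U \<inter> X)"
  then show "inverse (s v) = 0" using tw_outside[OF assms(1)] by simp
next
  fix x assume x: "x \<in> U" "x \<in> X"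
  obtain V where V: "open V" "x \<in> V" "V \<subseteq> U" "is_fraction (V \<inter> X) k s" by (rule tw_local[OF assms(1) x])
  have "is_fraction (V \<inter> X) (- k) (\<lambda>v. inverse (s v))"
    using V(4) by (rule is_fraction_inverse) (use V(3) assms(2) in \<open>auto simp: affine_cone_Int mem_affine_cone\<close>)
  then show "\<exists>V. open V \<and> x \<in> V \<and> V \<subseteq> U \<and> is_fraction (V \<inter> X) (- k) (\<lambda>v. inverse (s v))"
    using V by blast
qed

lemma tw_restrict:
  assumes "s \<in> twist_sections X k U" "V \<subseteq> U" "Y \<subseteq> X" "open V"
  shows "(\<lambda>v. if v \<in> affine_cone (V \<inter> Y) then s v else 0) \<in> twist_sections Y k V"
proof (rule twI)
  fix x assume x: "x \<in> V" "x \<in> Y"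
  obtain W where W: "open W" "x \<in> W" "W \<subseteq> U" "is_fraction (W \<inter> X) k s"
    using tw_local[OF assms(1)] x assms(2,3) by blast
  have "is_fraction ((V \<inter> W) \<inter> Y) k s"
    using W(4) assms(3) by (elim is_fraction_subset) auto
  then have "is_fraction ((V \<inter> W) \<inter> Y) k (\<lambda>v. if v \<in> affine_cone (V \<inter> Y) then s v else 0)"
    by (subst is_fraction_cong[of _ _ s]) (auto simp: mem_affine_cone)
  then show "\<exists>W. open W \<and> x \<in> W \<and> W \<subseteq> V \<and> is_fraction (W \<inter> Y) k (\<lambda>v. if v \<in> affine_cone (V \<inter> Y) then s v else 0)"
    using W x assms(4) by (intro exI[of _ "V \<inter> W"]) auto
qed simp

lemma tw_form:
  assumes "homog k p" "open U"
  shows "(\<lambda>v. if v \<in> affine_cone (U \<inter> X) then peval p v else 0) \<in> twist_sections X k U"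
  using tw_fraction[OF assms(2) is_fraction_form[OF assms(1)]] .

lemma tw_form_mult:
  assumes "homog k p" "s \<in> twist_sections X m U" "open U"
  shows "(\<lambda>v. peval p v * s v) \<in> twist_sections X (k + m) U"
proof -
  have "(\<lambda>v. (if v \<in> affine_cone (U \<inter> X) then peval p v else 0) * s v) \<in> twist_sections X (k + m) U"
    by (rule tw_mult[OF tw_form[OF assms(1,3)] assms(2) _ _ assms(3)]) auto
  also have "(\<lambda>v. (if v \<in> affine_cone (U \<inter> X) then peval p v else 0) * s v) = (\<lambda>v. peval p v * s v)"
    using tw_outside[OF assms(2)] by auto
  finally show ?thesis .
qed

lemma tw_cmult:
  assumes "s \<in> twist_sections X m U" "open U"
  shows "(\<lambda>v. c * s v) \<in> twist_sections X m U"
  using tw_form_mult[OF homog_const[of c] assms] by (simp add: peval_const)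

lemma tw_diff:
  assumes "s \<in> twist_sections X k U" "t \<in> twist_sections X k U" "open U"
  shows "(\<lambda>v. s v - t v) \<in> twist_sections X k U"
  using tw_add[OF assms(1) tw_cmult[OF assms(2,3), of "-1"]] by simp

text \<open>Twists are locally trivial: powers of a linear form that does not vanish at the point.\<close>

lemma tw_local_generator:
  assumes "v0 \<noteq> 0"
  obtains U \<rho> where "open U" "pt v0 \<in> U" "\<rho> \<in> twist_sections UNIV k U" "\<And>v. v \<in> affine_cone U \<Longrightarrow> \<rho> v \<noteq> 0"
proof -
  obtain p q r A B where f: "frame p q r A B v0" using ex_frame_at[OF assms] by metis
  note r = frame_homog(3)[OF f] and r1 = frame_basis(9)[OF f]
  let ?U = "nonzero_locus r"
  have U: "open ?U" "pt v0 \<in> ?U" using open_nonzero_locus[OF r] pt_nonzero_locus[OF r assms] r1 by auto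
  have nz: "peval r v \<noteq> 0" if "v \<in> affine_cone ?U" for v
    using that pt_nonzero_locus[OF r] by (auto simp: mem_affine_cone)
  show thesis
  proof (cases "k \<ge> 0")
    case True
    have "homog k (r ^ nat k)" using homog_power[OF r, of "nat k"] True by simp
    from tw_form[OF this U(1), of UNIV] show thesis
      by (rule that[OF U]) (simp add: peval_power nz)
  next
    case False
    have h: "homog (- k) (r ^ nat (- k))" using homog_power[OF r, of "nat (- k)"] False by simp
    have "is_fraction ?U (- (- k)) (\<lambda>v. inverse (peval (r ^ nat (- k)) v))"
      by (rule is_fraction_inverse[OF is_fraction_form[OF h]]) (simp add: peval_power nz)
    then have "(\<lambda>v. if v \<in> affine_cone (?U \<inter> UNIV) then inverse (peval (r ^ nat (- k)) v) else 0) \<in> twist_sections UNIV k ?U"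
      by (intro tw_fraction[OF U(1)]) simp
    then show thesis by (rule that[OF U]) (simp add: peval_power nz)
  qed
qed

lemma open_nonvanishing:
  assumes "open V" "is_fraction (V \<inter> X) k s" "v0 \<noteq> 0" "pt v0 \<in> V" "pt v0 \<in> X" "s v0 \<noteq> 0"
  obtains W where "open W" "pt v0 \<in> W" "W \<subseteq> V" "\<And>v. v \<in> affine_cone (W \<inter> X) \<Longrightarrow> s v \<noteq> 0"
proof -
  obtain p q m n where 1: "homog m p" "homog n q" "m - n = k"
    "\<And>v. v \<in> affine_cone (V \<inter> X) \<Longrightarrow> peval q v \<noteq> 0" "\<And>v. v \<in> affine_cone (V \<inter> X) \<Longrightarrow> s v = peval p v / peval q v"
    using is_fractionE[OF assms(2)] by metis
  have "peval p v0 \<noteq> 0" using 1(5)[of v0] assms by (auto simp: mem_affine_cone)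
  then show thesis
    using that[of "V \<inter> nonzero_locus p"] assms open_nonzero_locus[OF 1(1)] 1(4,5)
      pt_nonzero_locus[OF 1(1)] by (auto simp: mem_affine_cone)
qed

lemma tw_open_nonvanishing:
  assumes "s \<in> twist_sections X k U" "v0 \<noteq> 0" "pt v0 \<in> U" "pt v0 \<in> X" "s v0 \<noteq> 0"
  obtains W where "open W" "pt v0 \<in> W" "W \<subseteq> U" "\<And>v. v \<in> affine_cone (W \<inter> X) \<Longrightarrow> s v \<noteq> 0"
proof -
  obtain V where V: "open V" "pt v0 \<in> V" "V \<subseteq> U" "is_fraction (V \<inter> X) k s" by (rule tw_local[OF assms(1,3,4)])
  show thesis by (rule open_nonvanishing[OF V(1,4) assms(2) V(2) assms(4,5)]) (use that V(3) in blast)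
qed

text \<open>The fraction that defines a section on \<open>X\<close> near a point makes sense on an open subset of the
  plane.\<close>

lemma tw_lift:
  assumes "s \<in> twist_sections X k U" "x \<in> U" "x \<in> X"
  obtains V t where "open V" "x \<in> V" "V \<subseteq> U" "t \<in> twist_sections UNIV k V"
    "\<And>v. v \<in> affine_cone (V \<inter> X) \<Longrightarrow> t v = s v"
proof -
  obtain V where V: "open V" "x \<in> V" "V \<subseteq> U" "is_fraction (V \<inter> X) k s" by (rule tw_local[OF assms])
  obtain p q m n where 1: "homog m p" "homog n q" "m - n = k"
    "\<And>v. v \<in> affine_cone (V \<inter> X) \<Longrightarrow> peval q v \<noteq> 0" "\<And>v. v \<in> affine_cone (V \<inter> X) \<Longrightarrow> s v = peval p v / peval q v"
    using is_fractionE[OF V(4)] by metis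
  obtain v0 where v0: "v0 \<noteq> 0" "x = pt v0" by (rule pt_cases)
  let ?W = "V \<inter> nonzero_locus q"
  have W: "open ?W" using V(1) open_nonzero_locus[OF 1(2)] by auto
  have "is_fraction (?W \<inter> UNIV) k (\<lambda>v. peval p v / peval q v)"
    by (rule is_fractionI[OF 1(1-3)]) (auto simp: mem_affine_cone pt_nonzero_locus[OF 1(2)])
  note a = tw_fraction[OF W this]
  show thesis
    by (rule that[OF W _ _ a])
      (use V v0 1(4,5) assms(3) in \<open>auto simp: mem_affine_cone pt_nonzero_locus[OF 1(2)]\<close>)
qed

lemma lines_in_kernel:
  assumes "homog 1 p" "v \<in> {v. peval p v = 0}" "v0 \<in> {v. peval p v = 0}"
  shows "v0 + t *s (v - v0) \<in> {v. peval p v = 0}"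
  using assms(2,3) by (simp add: peval_linear[OF assms(1)])

lemma peval_eq_0_dense_line:
  assumes "homog 1 p" "open U" "v0 \<noteq> 0" "peval p v0 = 0" "pt v0 \<in> U"
    and "\<And>v. v \<noteq> 0 \<Longrightarrow> peval p v = 0 \<Longrightarrow> pt v \<in> U \<Longrightarrow> peval q v = 0" "peval p v = 0"
  shows "peval q v = 0"
  by (rule peval_eq_0_dense[where S = "{v. peval p v = 0}", OF lines_in_kernel[OF assms(1)] assms(2,3) _ assms(5)])
    (use assms(4,6,7) in auto)

text \<open>The equation of a line generates its ideal sheaf, also with twists.\<close>

lemma tw_vanish_divide:
  assumes l: "homog 1 p" "p \<noteq> 0" "l = zero_locus p" and s: "s \<in> twist_sections UNIV k U"
    and x: "x \<in> U" "x \<in> l" and z: "\<And>v. v \<in> affine_cone (U \<inter> l) \<Longrightarrow> s v = 0"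
  obtains V t where "open V" "x \<in> V" "V \<subseteq> U" "t \<in> twist_sections UNIV (k - 1) V"
    "\<And>v. v \<in> affine_cone V \<Longrightarrow> s v = peval p v * t v"
proof -
  obtain v0 where v0: "v0 \<noteq> 0" "x = pt v0" by (rule pt_cases)
  have p0: "peval p v0 = 0" using x(2) v0 l(3) pt_zero_locus[OF l(1) v0(1)] by simp
  obtain V where V: "open V" "x \<in> V" "V \<subseteq> U" "is_fraction (V \<inter> UNIV) k s" by (rule tw_local[OF s x(1) UNIV_I])
  obtain N Q m n where 1: "homog m N" "homog n Q" "m - n = k"
    "\<And>v. v \<in> affine_cone (V \<inter> UNIV) \<Longrightarrow> peval Q v \<noteq> 0" "\<And>v. v \<in> affine_cone (V \<inter> UNIV) \<Longrightarrow> s v = peval N v / peval Q v"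
    using is_fractionE[OF V(4)] by metis
  have N0: "peval N v = 0" if "peval p v = 0" for v
  proof (rule peval_eq_0_dense_line[OF l(1) V(1) v0(1) p0 _ _ that])
    show "pt v0 \<in> V" using V(2) v0 by simp
    fix v assume v: "v \<noteq> 0" "peval p v = 0" "pt v \<in> V"
    then have "s v = 0" using z[of v] V(3) l(3) pt_zero_locus[OF l(1)] by (auto simp: mem_affine_cone)
    then show "peval N v = 0" using 1(4,5)[of v] v by (simp add: mem_affine_cone)
  qed
  obtain q r A B where f: "frame p q r A B v0" by (rule frame_exists[OF l(1,2) p0 v0(1)])
  obtain N' where N': "homog (m - 1) N'" "\<And>v. peval N v = peval p v * peval N' v"
    using vanish_on_line_imp_dvd[OF f 1(1) N0] by metis
  have "is_fraction (V \<inter> UNIV) (k - 1) (\<lambda>v. peval N' v / peval Q v)"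
    by (rule is_fractionI[OF N'(1) 1(2)]) (use 1 in auto)
  from tw_fraction[OF V(1) this] show thesis
    by (rule that[OF V(1-3)]) (use 1(5) N'(2) in simp)
qed

text \<open>The local parameters \<open>p, q\<close> generate the maximal ideal of the point \<open>C\<close>.\<close>

lemma tw_point_divide:
  assumes f: "frame p q r A B C" "C \<noteq> 0" and s: "s \<in> twist_sections UNIV k U"
    and x: "pt C \<in> U" and z: "s C = 0"
  obtains V s1 s2 where "open V" "pt C \<in> V" "V \<subseteq> U" "s1 \<in> twist_sections UNIV (k - 1) V"
    "s2 \<in> twist_sections UNIV (k - 1) V"
    "\<And>v. v \<in> affine_cone V \<Longrightarrow> s v = peval p v * s1 v + peval q v * s2 v"
proof -
  obtain V where V: "open V" "pt C \<in> V" "V \<subseteq> U" "is_fraction (V \<inter> UNIV) k s" by (rule tw_local[OF s x UNIV_I])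
  obtain N Q m n where 1: "homog m N" "homog n Q" "m - n = k"
    "\<And>v. v \<in> affine_cone (V \<inter> UNIV) \<Longrightarrow> peval Q v \<noteq> 0" "\<And>v. v \<in> affine_cone (V \<inter> UNIV) \<Longrightarrow> s v = peval N v / peval Q v"
    using is_fractionE[OF V(4)] by metis
  have "peval N C = 0" using 1(4,5)[of C] V(2) f(2) z by (auto simp: mem_affine_cone)
  then obtain N1 N2 where N: "homog (m - 1) N1" "homog (m - 1) N2"
    "\<And>v. peval N v = peval p v * peval N1 v + peval q v * peval N2 v"
    using vanish_at_point_imp_ideal[OF f(1) 1(1)] by metis
  have "is_fraction (V \<inter> UNIV) (k - 1) (\<lambda>v. peval N1 v / peval Q v)"
    by (rule is_fractionI[OF N(1) 1(2)]) (use 1 in auto)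
  note a = tw_fraction[OF V(1) this]
  have "is_fraction (V \<inter> UNIV) (k - 1) (\<lambda>v. peval N2 v / peval Q v)"
    by (rule is_fractionI[OF N(2) 1(2)]) (use 1 in auto)
  note b = tw_fraction[OF V(1) this]
  show thesis
    by (rule that[OF V(1-3) a b]) (use 1(5) N(3) in \<open>simp add: add_divide_distrib\<close>)
qed

text \<open>The local parameters \<open>p, q\<close> form a regular sequence: from \<open>p a = - q b\<close> it follows
  that \<open>q\<close> divides \<open>a\<close>. In numerators this is the primality of the linear form
  \<open>q\<close>, checked on the line \<open>q = 0\<close>, where \<open>p\<close> and the denominators are
  not identically zero.\<close>

lemma tw_coprime:
  assumes f: "frame p q r A B C" "C \<noteq> 0" and a: "a \<in> twist_sections UNIV k U" and b: "b \<in> twist_sections UNIV k U"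
    and x: "pt C \<in> U" and rel: "\<And>v. v \<in> affine_cone U \<Longrightarrow> peval p v * a v = - peval q v * b v"
  obtains V s where "open V" "pt C \<in> V" "V \<subseteq> U" "s \<in> twist_sections UNIV (k - 1) V"
    "\<And>v. v \<in> affine_cone V \<Longrightarrow> a v = peval q v * s v" "\<And>v. v \<in> affine_cone V \<Longrightarrow> b v = - peval p v * s v"
proof -
  note hp = frame_homog(1)[OF f(1)] and hq = frame_homog(2)[OF f(1)]
  obtain V where V: "open V" "pt C \<in> V" "V \<subseteq> U" "is_fraction (V \<inter> UNIV) k a" by (rule tw_local[OF a x UNIV_I])
  obtain W where W: "open W" "pt C \<in> W" "W \<subseteq> U" "is_fraction (W \<inter> UNIV) k b" by (rule tw_local[OF b x UNIV_I])
  obtain M Q m n where 1: "homog m M" "homog n Q" "m - n = k"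
    "\<And>v. v \<in> affine_cone (V \<inter> UNIV) \<Longrightarrow> peval Q v \<noteq> 0" "\<And>v. v \<in> affine_cone (V \<inter> UNIV) \<Longrightarrow> a v = peval M v / peval Q v"
    using is_fractionE[OF V(4)] by metis
  obtain N R m' n' where 2: "homog m' N" "homog n' R" "m' - n' = k"
    "\<And>v. v \<in> affine_cone (W \<inter> UNIV) \<Longrightarrow> peval R v \<noteq> 0" "\<And>v. v \<in> affine_cone (W \<inter> UNIV) \<Longrightarrow> b v = peval N v / peval R v"
    using is_fractionE[OF W(4)] by metis
  have O: "open (V \<inter> W)" "pt C \<in> V \<inter> W" using V W by auto
  have rel': "peval (p * M * R + q * N * Q) v = 0" for v
  proof (rule peval_eq_0_dense_UNIV[OF O])
    fix v assume v: "v \<in> affine_cone (V \<inter> W)"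
    have v': "v \<in> affine_cone V" "v \<in> affine_cone W" "v \<in> affine_cone U"
      using v V(3) by (auto simp: mem_affine_cone)
    show "peval (p * M * R + q * N * Q) v = 0"
      using rel[OF v'(3)] 1(4,5)[of v] 2(4,5)[of v] v' by (simp add: peval_simps field_simps)
  qed
  have qC: "peval q C = 0" "peval p C = 0" "peval p A = 1" "peval q A = 0" using frame_basis[OF f(1)] by auto
  have M0: "peval M v = 0" if "peval q v = 0" for v
  proof -
    have *: "peval (p * R) u * peval M u = 0" if "u \<in> {v. peval q v = 0}" for u
      using rel'[of u] that by (simp add: peval_simps mult_ac)
    have R: "peval R u * peval (p * M) u = 0" if "u \<in> {v. peval q v = 0}" for u
      using *[OF that] by (simp add: peval_simps mult_ac)
    have "peval R C \<noteq> 0" using 2(4)[of C] W(2) f(2) by (simp add: mem_affine_cone)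
    then have pM: "peval (p * M) u = 0" if "peval q u = 0" for u
      using that qC
      by (intro peval_mult_eq_0_on_lines[where S = "{v. peval q v = 0}", OF lines_in_kernel[OF hq] R]) auto
    show ?thesis
    proof (rule peval_mult_eq_0_on_lines[where S = "{v. peval q v = 0}" and p = p and ?v0.0 = A])
      show "A + t *s (v - A) \<in> {v. peval q v = 0}" for t
        by (rule lines_in_kernel[OF hq]) (use that qC in auto)
    qed (use pM qC in \<open>auto simp: peval_mult\<close>)
  qed
  have f': "frame q p r B A C"
    using f(1) unfolding frame_def by (metis add.commute)
  obtain M' where M': "homog (m - 1) M'" "\<And>v. peval M v = peval q v * peval M' v"
    using vanish_on_line_imp_dvd[OF f' 1(1) M0] by metis
  have "is_fraction (V \<inter> W \<inter> UNIV) (k - 1) (\<lambda>v. peval M' v / peval Q v)"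
    by (rule is_fractionI[OF M'(1) 1(2)]) (use 1 in \<open>auto simp: affine_cone_Int\<close>)
  note s = tw_fraction[OF O(1) this]
  show thesis
  proof (rule that[OF O _ s])
    show "V \<inter> W \<subseteq> U" using V(3) by blast
    fix v assume v: "v \<in> affine_cone (V \<inter> W)"
    have v': "v \<in> affine_cone V" "v \<in> affine_cone W" "v \<in> affine_cone U"
      using v V(3) by (auto simp: mem_affine_cone)
    show "a v = peval q v * (if v \<in> affine_cone (V \<inter> W \<inter> UNIV) then peval M' v / peval Q v else 0)"
      using 1(5)[of v] M'(2) v v' by simp
    have "peval q u * peval (p * M' * R + N * Q) u = 0" for u
      using rel'[of u] by (simp add: peval_simps M'(2) algebra_simps)
    then have "peval (p * M' * R + N * Q) v = 0"
      by (intro peval_mult_eq_0_on_lines[where S = UNIV and p = q and ?v0.0 = B]) (use frame_basis[OF f(1)] in auto)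
    then have "peval N v / peval R v = - peval p v * (peval M' v / peval Q v)"
      using 1(4)[of v] 2(4)[of v] v' by (simp add: peval_simps field_simps eq_neg_iff_add_eq_0)
    then show "b v = - peval p v * (if v \<in> affine_cone (V \<inter> W \<inter> UNIV) then peval M' v / peval Q v else 0)"
      using 2(5)[of v] v v' by simp
  qed
qed

section \<open>Forms and sections on a line\<close>

lemma defines_lineD:
  assumes "defines_line p l"
  shows "homog 1 p" "p \<noteq> 0" "l = zero_locus p"
  using assms by (auto simp: defines_line_def)

lemma mem_cone_line: "defines_line p l \<Longrightarrow> v \<in> affine_cone l \<longleftrightarrow> v \<noteq> 0 \<and> peval p v = 0"
  using pt_zero_locus[of 1 p v] by (auto simp: defines_line_def mem_affine_cone)

lemma pt_mem_line: "defines_line p l \<Longrightarrow> v \<noteq> 0 \<Longrightarrow> pt v \<in> l \<longleftrightarrow> peval p v = 0"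
  using pt_zero_locus[of 1 p v] by (auto simp: defines_line_def)

lemma ex_point_on_line:
  assumes "homog 1 p"
  obtains v where "v \<noteq> 0" "peval p v = 0"
proof -
  obtain w where w: "\<And>v. peval p v = (\<Sum>i\<in>UNIV. w $ i * v $ i)"
    by (rule homog_1_linear[OF assms]) metis
  obtain v where "v \<noteq> 0" "(\<Sum>i\<in>UNIV. v $ i * w $ i) = 0" using ex_orthogonal by blast
  then show thesis using that[of v] by (simp add: w mult.commute)
qed

lemma two_lines_meet:
  assumes "homog 1 p" "p \<noteq> 0" "homog 1 e"
  obtains v where "v \<noteq> 0" "peval p v = 0" "peval e v = 0"
proof -
  obtain C where C: "C \<noteq> 0" "peval p C = 0" by (rule ex_point_on_line[OF assms(1)])
  obtain q r A B where f: "frame p q r A B C" by (rule frame_exists[OF assms(1,2) C(2,1)])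
  note b = frame_basis[OF f] and lin = peval_linear[OF assms(1)] peval_linear[OF assms(3)]
    peval_linear[OF frame_homog(2)[OF f]] peval_linear[OF frame_homog(3)[OF f]]
  define v where "v = peval e C *s B - peval e B *s C"
  show thesis
  proof (cases "v = 0")
    case True
    then have "peval q v = 0" using lin by simp
    then have "peval e C = 0" using lin b by (simp add: v_def)
    then show thesis using that C by blast
  next
    case False
    then show thesis using that[of v] lin b by (simp add: v_def)
  qed
qed

text \<open>A line is irreducible: two nonempty open subsets of it meet.\<close>

lemma peval_eq_0_dense_line2:
  assumes "homog 1 p" "open U" "open U'" "v0 \<noteq> 0" "peval p v0 = 0" "pt v0 \<in> U"
    "v1 \<noteq> 0" "peval p v1 = 0" "pt v1 \<in> U'"
    and z: "\<And>v. v \<noteq> 0 \<Longrightarrow> peval p v = 0 \<Longrightarrow> pt v \<in> U \<Longrightarrow> pt v \<in> U' \<Longrightarrow> peval q v = 0"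
    and v: "peval p v = 0"
  shows "peval q v = 0"
proof -
  obtain k h where h: "homog k h" "peval h v0 \<noteq> 0"
    "\<And>w. w \<noteq> 0 \<Longrightarrow> peval h w \<noteq> 0 \<Longrightarrow> pt w \<in> U"
    using open_basis[OF assms(2,4,6)] by metis
  have "peval (h * q) u = 0" if "peval p u = 0" for u
    by (rule peval_eq_0_dense_line[OF assms(1,3,7,8,9) _ that]) (use h z in \<open>auto simp: peval_mult\<close>)
  then show ?thesis
    by (intro peval_mult_eq_0_on_lines[where S = "{v. peval p v = 0}" and p = h and ?v0.0 = v0])
      (use h(2) v lines_in_kernel[OF assms(1), of v v0] assms(5) in \<open>auto simp: peval_mult\<close>)
qed

text \<open>On a line the form \<open>e\<close> has a single zero \<open>C\<close>. Away from it the quotient is a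
  fraction anyway; near it the numerator of \<open>t\<close> lies in the ideal of the point, which
  \<open>e\<close> generates modulo the equation of the line.\<close>

lemma tw_line_divide:
  assumes l: "defines_line p l" and e: "homog 1 e" and ne: "v1 \<in> affine_cone l" "peval e v1 \<noteq> 0"
    and t: "t \<in> twist_sections l k UNIV" and z: "\<And>v. v \<in> affine_cone l \<Longrightarrow> peval e v = 0 \<Longrightarrow> t v = 0"
  obtains a where "a \<in> twist_sections l (k - 1) UNIV" "\<And>v. v \<in> affine_cone l \<Longrightarrow> t v = peval e v * a v"
proof -
  note p = defines_lineD[OF l]
  obtain C where C: "C \<noteq> 0" "peval p C = 0" "peval e C = 0" by (rule two_lines_meet[OF p(1,2) e])
  obtain q r A B where f: "frame p q r A B C" by (rule frame_exists[OF p(1,2) C(2,1)])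
  have ev: "peval e v = peval q v * peval e B" if "peval p v = 0" for v
    by (subst (1) frame_expand[OF f, of v]) (simp add: peval_linear[OF e] C that)
  have eB: "peval e B \<noteq> 0" using ne ev[of v1] by (auto simp: mem_cone_line[OF l])
  have Cl: "pt C \<in> l" using pt_mem_line[OF l] C by simp
  obtain V where V: "open V" "pt C \<in> V" "is_fraction (V \<inter> l) k t"
    using tw_local[OF t UNIV_I Cl] by metis
  obtain N Q m n where 1: "homog m N" "homog n Q" "m - n = k"
    "\<And>v. v \<in> affine_cone (V \<inter> l) \<Longrightarrow> peval Q v \<noteq> 0" "\<And>v. v \<in> affine_cone (V \<inter> l) \<Longrightarrow> t v = peval N v / peval Q v"
    using is_fractionE[OF V(3)] by metis
  have CV: "C \<in> affine_cone (V \<inter> l)" using C V(2) Cl by (simp add: mem_affine_cone)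
  have "t C = 0" using z[of C] C by (simp add: mem_cone_line[OF l])
  then have "peval N C = 0" using 1(4,5)[OF CV] by simp
  then obtain N1 N2 where N: "homog (m - 1) N1" "homog (m - 1) N2"
    "\<And>v. peval N v = peval p v * peval N1 v + peval q v * peval N2 v"
    using vanish_at_point_imp_ideal[OF f 1(1)] by metis
  define a where "a = (\<lambda>v. if v \<in> affine_cone l then if peval e v \<noteq> 0 then t v / peval e v
    else peval N2 v / peval (Q * Poly_Mapping.single 0 (peval e B)) v else 0)"
  have "a \<in> twist_sections l (k - 1) UNIV"
  proof (rule twI)
    fix v assume "v \<notin> affine_cone (UNIV \<inter> l)"
    then show "a v = 0" by (simp add: a_def)
  next
    fix x assume x: "x \<in> UNIV" "x \<in> l"
    obtain v0 where v0: "v0 \<noteq> 0" "x = pt v0" by (rule pt_cases)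
    have pv0: "peval p v0 = 0" using x v0 pt_mem_line[OF l] by simp
    show "\<exists>V. open V \<and> x \<in> V \<and> V \<subseteq> UNIV \<and> is_fraction (V \<inter> l) (k - 1) a"
    proof (cases "peval e v0 = 0")
      case False
      obtain W where W: "open W" "x \<in> W" "is_fraction (W \<inter> l) k t"
        using tw_local[OF t x] by metis
      let ?W = "W \<inter> nonzero_locus e"
      have nz: "v \<in> affine_cone (?W \<inter> l) \<Longrightarrow> peval e v \<noteq> 0" for v
        using pt_nonzero_locus[OF e] by (auto simp: mem_affine_cone)
      have "is_fraction (?W \<inter> l) (k + - 1) (\<lambda>v. t v * inverse (peval e v))"
        by (intro is_fraction_mult is_fraction_inverse is_fraction_form e nz)
          (use W(3) in \<open>auto elim: is_fraction_subset\<close>)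
      then have "is_fraction (?W \<inter> l) (k - 1) a"
        by (subst is_fraction_cong[of _ _ "\<lambda>v. t v * inverse (peval e v)"])
          (use nz in \<open>auto simp: a_def divide_inverse affine_cone_Int\<close>)
      moreover have "open ?W" "x \<in> ?W"
        using W open_nonzero_locus[OF e] False v0 pt_nonzero_locus[OF e v0(1)] by auto
      ultimately show ?thesis by blast
    next
      case True
      then have q0: "peval q v0 = 0" using ev[OF pv0] eB by simp
      have v0C: "v0 = peval r v0 *s C" by (subst (1) frame_expand[OF f, of v0]) (simp add: pv0 q0)
      then have "peval r v0 \<noteq> 0" using v0(1) by (metis vector_smult_lzero)
      then have "x = pt C" using pt_scale[OF _ C(1)] v0(2) v0C by metis
      have hQ: "homog n (Q * Poly_Mapping.single 0 (peval e B))"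
        using homog_mult[OF 1(2) homog_const] by simp
      have "is_fraction (V \<inter> l) (k - 1) a"
      proof (rule is_fractionI[OF N(2) hQ])
        fix v assume v: "v \<in> affine_cone (V \<inter> l)"
        then have vl: "v \<in> affine_cone l" "peval p v = 0" "v \<noteq> 0"
          using mem_cone_line[OF l] by (auto simp: affine_cone_Int)
        show "peval (Q * Poly_Mapping.single 0 (peval e B)) v \<noteq> 0"
          using 1(4)[OF v] eB by (simp add: peval_simps)
        show "a v = peval N2 v / peval (Q * Poly_Mapping.single 0 (peval e B)) v"
          using 1(4,5)[OF v] vl ev[OF vl(2)] eB N(3)[of v] by (simp add: a_def peval_simps)
      qed (use 1 in simp)
      then show ?thesis using V \<open>x = pt C\<close> by blast
    qed
  qed
  moreover have "t v = peval e v * a v" if "v \<in> affine_cone l" for v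
    using z[OF that] that by (simp add: a_def)
  ultimately show thesis by (rule that)
qed

lemma line_poly:
  assumes f: "frame p q r A B C" and N: "homog (int n) N"
  obtains c where "degree c \<le> n" "\<And>s. poly c s = peval N (s *s B + C)" "coeff c n = peval N B"
    "\<And>v. peval p v = 0 \<Longrightarrow> peval N v = peval (bin n c q r) v"
proof -
  obtain N' c where c: "homog (int n - 1) N'" "degree c \<le> n"
    "\<And>v. peval N v = peval p v * peval N' v + peval (bin n c q r) v"
    using frame_decomp_nat[OF f N] by blast
  note b = frame_basis[OF f] and lin = peval_linear[OF frame_homog(1)[OF f]]
    peval_linear[OF frame_homog(2)[OF f]] peval_linear[OF frame_homog(3)[OF f]]
  show thesis
  proof (rule that[OF c(2)])
    show "poly c s = peval N (s *s B + C)" for s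
      using poly_bin[OF c(2), of r "s *s B + C" q] by (simp add: c(3) lin b)
    show "coeff c n = peval N B" by (simp add: c(3) b peval_bin_infinity)
  qed (simp add: c(3))
qed

lemma frame_vector_nonzero:
  assumes "frame p q r A B C"
  shows "s *s B + C \<noteq> 0" "peval p (s *s B + C) = 0" "B \<noteq> 0" "C \<noteq> 0"
    "peval q (s *s B + C) = s" "peval r (s *s B + C) = 1"
proof -
  note b = frame_basis[OF assms] and lin = peval_linear[OF frame_homog(1)[OF assms]]
    peval_linear[OF frame_homog(2)[OF assms]] peval_linear[OF frame_homog(3)[OF assms]]
  show a: "peval p (s *s B + C) = 0" "peval q (s *s B + C) = s" "peval r (s *s B + C) = 1"
    by (simp_all add: b lin)
  show "s *s B + C \<noteq> 0" using a(3) lin(11) by auto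
  show "B \<noteq> 0" "C \<noteq> 0" using b lin by auto
qed

lemma form_has_zero_on_line:
  assumes l: "defines_line p l" and g: "homog k g" "k \<ge> 1"
  obtains v where "v \<in> affine_cone l" "peval g v = 0"
proof -
  note p = defines_lineD[OF l]
  obtain C where C: "C \<noteq> 0" "peval p C = 0" by (rule ex_point_on_line[OF p(1)])
  obtain q r A B where f: "frame p q r A B C" by (rule frame_exists[OF p(1,2) C(2,1)])
  obtain n where n: "k = int n" "n \<ge> 1" using g(2) by (metis nat_0_le of_nat_1 of_nat_le_iff order_trans zero_le_one)
  obtain c where c: "degree c \<le> n" "\<And>s. poly c s = peval g (s *s B + C)" "coeff c n = peval g B"
    using line_poly[OF f] g(1) n(1) by metis
  show thesis
  proof (cases "peval g B = 0")
    case True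
    then show thesis using that[of B] frame_vector_nonzero[OF f] frame_basis[OF f] mem_cone_line[OF l] by simp
  next
    case False
    then have "degree c = n" using c(1,3) le_degree[of c n] by simp
    then obtain s where "poly c s = 0"
      using n(2) fundamental_theorem_of_algebra_alt[of c] by (metis constant_degree fundamental_theorem_of_algebra not_one_le_zero)
    then show thesis using that[of "s *s B + C"] frame_vector_nonzero[OF f] mem_cone_line[OF l] c(2) by simp
  qed
qed

text \<open>Let \<open>H\<close> be nowhere zero and equal to \<open>N / Q\<close> near a point \<open>B\<close>. Placed
  at infinity, \<open>B\<close> is neither a zero of \<open>N\<close> nor of \<open>Q\<close>, so the degrees of
  the restricted polynomials are those of the forms. Comparing with the representation of \<open>H\<close> near
  any other point, \<open>N\<close> and \<open>Q\<close> vanish to the same order everywhere; hence they have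
  the same degree, and \<open>k = 0\<close>.\<close>

lemma section_has_zero_on_line:
  assumes l: "defines_line p l" and H: "H \<in> twist_sections l k UNIV" and k: "k \<ge> 1"
  obtains v where "v \<in> affine_cone l" "H v = 0"
proof -
  have False if nz: "\<And>v. v \<in> affine_cone l \<Longrightarrow> H v \<noteq> 0"
  proof -
    note p = defines_lineD[OF l]
    obtain B where B: "B \<noteq> 0" "peval p B = 0" by (rule ex_point_on_line[OF p(1)])
    obtain q r A C where f': "frame p q r A C B" by (rule frame_exists[OF p(1,2) B(2,1)])
    have f: "frame p r q A B C" by (rule frame_swap[OF f'])
    have Bl: "pt B \<in> l" "B \<in> affine_cone l" using pt_mem_line[OF l] mem_cone_line[OF l] B by auto
    obtain V where V: "open V" "pt B \<in> V" "is_fraction (V \<inter> l) k H"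
      using tw_local[OF H UNIV_I Bl(1)] by metis
    obtain N Q m n where 1: "homog m N" "homog n Q" "m - n = k"
      "\<And>v. v \<in> affine_cone (V \<inter> l) \<Longrightarrow> peval Q v \<noteq> 0" "\<And>v. v \<in> affine_cone (V \<inter> l) \<Longrightarrow> H v = peval N v / peval Q v"
      using is_fractionE[OF V(3)] by metis
    have BV: "B \<in> affine_cone (V \<inter> l)" using V(2) B(1) Bl by (simp add: mem_affine_cone)
    have NB: "peval N B \<noteq> 0" "peval Q B \<noteq> 0" using 1(4,5)[OF BV] nz[OF Bl(2)] by auto
    then have "\<not> m < 0" "\<not> n < 0" using homog_neg 1(1,2) by fastforce+
    then obtain m' n' where mn: "m = int m'" "n = int n'" by (metis nat_0_le not_less)
    obtain c where c: "degree c \<le> m'" "\<And>s. poly c s = peval N (s *s B + C)" "coeff c m' = peval N B"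
      using line_poly[OF f] 1(1) mn(1) by metis
    obtain d where d: "degree d \<le> n'" "\<And>s. poly d s = peval Q (s *s B + C)" "coeff d n' = peval Q B"
      using line_poly[OF f] 1(2) mn(2) by metis
    have deg: "degree c = m'" "degree d = n'" "c \<noteq> 0" "d \<noteq> 0"
      using c(1,3) d(1,3) NB le_degree[of c m'] le_degree[of d n'] by auto
    have "order s c = order s d" for s
    proof -
      let ?u = "s *s B + C"
      have u: "?u \<noteq> 0" "peval p ?u = 0" using frame_vector_nonzero[OF f] by simp_all
      then have ul: "pt ?u \<in> l" "?u \<in> affine_cone l" using pt_mem_line[OF l] mem_cone_line[OF l] by auto
      obtain W where W: "open W" "pt ?u \<in> W" "is_fraction (W \<inter> l) k H"
        using tw_local[OF H UNIV_I ul(1)] by metis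
      obtain M R i j where 2: "homog i M" "homog j R" "i - j = k"
        "\<And>v. v \<in> affine_cone (W \<inter> l) \<Longrightarrow> peval R v \<noteq> 0" "\<And>v. v \<in> affine_cone (W \<inter> l) \<Longrightarrow> H v = peval M v / peval R v"
        using is_fractionE[OF W(3)] by metis
      have uW: "?u \<in> affine_cone (W \<inter> l)" using W(2) u(1) ul by (simp add: mem_affine_cone)
      have nzu: "peval M ?u \<noteq> 0" "peval R ?u \<noteq> 0" using 2(4,5)[OF uW] nz[OF ul(2)] by auto
      have eq: "peval (N * R - M * Q) v = 0" if "peval p v = 0" for v
      proof (rule peval_eq_0_dense_line2[OF p(1) V(1) W(1) B V(2) u W(2) _ that])
        fix v assume v: "v \<noteq> 0" "peval p v = 0" "pt v \<in> V" "pt v \<in> W"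
        then have "v \<in> affine_cone (V \<inter> l)" "v \<in> affine_cone (W \<inter> l)"
          using pt_mem_line[OF l] by (auto simp: mem_affine_cone)
        from 1(4,5)[OF this(1)] 2(4,5)[OF this(2)]
        show "peval (N * R - M * Q) v = 0" by (simp add: peval_simps field_simps)
      qed
      have "\<not> i < 0" "\<not> j < 0" using homog_neg 2(1,2) nzu by fastforce+
      then obtain i' j' where ij: "i = int i'" "j = int j'" by (metis nat_0_le not_less)
      obtain a where a: "\<And>s. poly a s = peval M (s *s B + C)"
        using line_poly[OF f] 2(1) ij(1) by metis
      obtain b where b: "\<And>s. poly b s = peval R (s *s B + C)"
        using line_poly[OF f] 2(2) ij(2) by metis
      have "poly (c * b - a * d) t = 0" for t
        using eq[of "t *s B + C"] frame_vector_nonzero(2)[OF f, of t] by (simp add: peval_simps a b c(2) d(2))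
      then have "c * b - a * d = 0" using poly_all_0_iff_0 by blast
      then have cb: "c * b = a * d" by simp
      have ab: "poly a s \<noteq> 0" "poly b s \<noteq> 0" using a b nzu by auto
      then have "a \<noteq> 0" "b \<noteq> 0" by auto
      then have "order s c + order s b = order s a + order s d"
        using arg_cong[OF cb, of "order s"] deg(3,4) by (simp add: order_mult)
      then show ?thesis using ab by (simp add: order_0I)
    qed
    then have "proots c = proots d" using deg(3,4) by (intro multiset_eqI) simp
    then have "m' = n'" using size_proots_complex[of c] size_proots_complex[of d] deg by simp
    then show False using mn 1(3) k by simp
  qed
  then show thesis using that by blast
qed

section \<open>Presheaves of modules and sheafification\<close>

locale presheaf =
  fixes F :: "('x::topological_space, 'r, 'm) module_presheaf"
  assumes restr_closed: "\<lbrakk>open U; open V; V \<subseteq> U; s \<in> carrier (sections F U)\<rbrakk> \<Longrightarrow> restr F U V s \<in> carrier (sections F V)"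
    and restr_restr: "\<lbrakk>open U; open V; open W; W \<subseteq> V; V \<subseteq> U; s \<in> carrier (sections F U)\<rbrakk> \<Longrightarrow>
      restr F V W (restr F U V s) = restr F U W s"
begin

lemma germ_eq_iff:
  assumes U: "open U" "x \<in> U" "s \<in> carrier (sections F U)" and V: "open V" "x \<in> V" "t \<in> carrier (sections F V)"
  shows "germ F x U s = germ F x V t \<longleftrightarrow> (\<exists>W. open W \<and> x \<in> W \<and> W \<subseteq> U \<inter> V \<and> restr F U W s = restr F V W t)"
proof
  assume "germ F x U s = germ F x V t"
  moreover have "(U, s) \<in> germ F x U s" unfolding germ_def using U by auto
  ultimately have "(U, s) \<in> germ F x V t" by simp
  then obtain W where "open W" "x \<in> W" "W \<subseteq> V \<inter> U" "restr F V W t = restr F U W s"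
    unfolding germ_def by auto
  then show "\<exists>W. open W \<and> x \<in> W \<and> W \<subseteq> U \<inter> V \<and> restr F U W s = restr F V W t"
    by (intro exI[of _ W]) auto
next
  assume "\<exists>W. open W \<and> x \<in> W \<and> W \<subseteq> U \<inter> V \<and> restr F U W s = restr F V W t"
  then obtain W where W: "open W" "x \<in> W" "W \<subseteq> U" "W \<subseteq> V" "restr F U W s = restr F V W t" by auto
  have sub: "germ F x U s \<subseteq> germ F x V t" if U: "open U" "x \<in> U" "s \<in> carrier (sections F U)" and
     V: "open V" "x \<in> V" "t \<in> carrier (sections F V)" and W: "W \<subseteq> U" "W \<subseteq> V" "restr F U W s = restr F V W t" for U V s t
  proof
    fix z assume "z \<in> germ F x U s"
    then obtain V' t' W' where z: "z = (V', t')" "open V'" "x \<in> V'" "t' \<in> carrier (sections F V')"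
      "open W'" "x \<in> W'" "W' \<subseteq> U" "W' \<subseteq> V'" "restr F U W' s = restr F V' W' t'"
      unfolding germ_def by auto
    let ?Y = "W \<inter> W'"
    have Y: "open ?Y" using \<open>open W\<close> z by auto
    have "restr F V ?Y t = restr F W ?Y (restr F V W t)"
      using restr_restr[of V W ?Y t] V W \<open>open W\<close> Y by simp
    also have "\<dots> = restr F W ?Y (restr F U W s)" using W by simp
    also have "\<dots> = restr F U ?Y s" using restr_restr[of U W ?Y s] U W \<open>open W\<close> Y by simp
    also have "\<dots> = restr F W' ?Y (restr F U W' s)" using restr_restr[of U W' ?Y s] U z Y by simp
    also have "\<dots> = restr F V' ?Y t'" using restr_restr[of V' W' ?Y t'] z Y by simp
    finally show "z \<in> germ F x V t"
      unfolding germ_def using z \<open>x \<in> W\<close> Y W by (auto intro!: exI[of _ ?Y])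
  qed
  show "germ F x U s = germ F x V t"
    using sub[OF U V W(3-5)] sub[OF V U W(4,3) W(5)[symmetric]] by blast
qed

lemma germ_restr:
  assumes "open U" "open V" "V \<subseteq> U" "x \<in> V" "s \<in> carrier (sections F U)"
  shows "germ F x V (restr F U V s) = germ F x U s"
proof (subst germ_eq_iff)
  show "\<exists>W. open W \<and> x \<in> W \<and> W \<subseteq> V \<inter> U \<and> restr F V W (restr F U V s) = restr F U W s"
    using assms by (intro exI[of _ V]) (auto simp: restr_restr)
qed (use assms restr_closed in auto)

lemma germ_eqI:
  assumes "open U" "x \<in> U" "s \<in> carrier (sections F U)" "open V" "x \<in> V" "t \<in> carrier (sections F V)"
    "open W" "x \<in> W" "W \<subseteq> U" "W \<subseteq> V" "restr F U W s = restr F V W t"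
  shows "germ F x U s = germ F x V t"
  using germ_eq_iff[OF assms(1-6)] assms(7-) by blast

lemma germ_eqE:
  assumes "germ F x U s = germ F x V t"
    "open U" "x \<in> U" "s \<in> carrier (sections F U)" "open V" "x \<in> V" "t \<in> carrier (sections F V)"
  obtains W where "open W" "x \<in> W" "W \<subseteq> U" "W \<subseteq> V" "restr F U W s = restr F V W t"
  using germ_eq_iff[OF assms(2-)] assms(1) by blast

end

locale presheaf_module = presheaf F + Ox: presheaf Ox
  for Ox :: "('x::topological_space, 'r, 'r) module_presheaf" and F :: "('x, 'r, 'm) module_presheaf" +
  assumes add_closed: "\<lbrakk>open U; s \<in> carrier (sections F U); t \<in> carrier (sections F U)\<rbrakk> \<Longrightarrow>
      s \<oplus>\<^bsub>sections F U\<^esub> t \<in> carrier (sections F U)"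
    and smult_closed: "\<lbrakk>open U; r \<in> carrier (sections Ox U); s \<in> carrier (sections F U)\<rbrakk> \<Longrightarrow>
      r \<odot>\<^bsub>sections F U\<^esub> s \<in> carrier (sections F U)"
    and restr_add: "\<lbrakk>open U; open V; V \<subseteq> U; s \<in> carrier (sections F U); t \<in> carrier (sections F U)\<rbrakk> \<Longrightarrow>
      restr F U V (s \<oplus>\<^bsub>sections F U\<^esub> t) = restr F U V s \<oplus>\<^bsub>sections F V\<^esub> restr F U V t"
    and restr_smult: "\<lbrakk>open U; open V; V \<subseteq> U; r \<in> carrier (sections Ox U); s \<in> carrier (sections F U)\<rbrakk> \<Longrightarrow>
      restr F U V (r \<odot>\<^bsub>sections F U\<^esub> s) = restr Ox U V r \<odot>\<^bsub>sections F V\<^esub> restr F U V s"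
begin

lemma stalk_add:
  assumes U: "open U" "x \<in> U" "s \<in> carrier (sections F U)" "t \<in> carrier (sections F U)"
  shows "germ F x U s \<oplus>\<^bsub>stalk Ox F x\<^esub> germ F x U t = germ F x U (s \<oplus>\<^bsub>sections F U\<^esub> t)"
  unfolding stalk_def ring_record_simps
proof (rule the_equality)
  show "\<exists>V. open V \<and> x \<in> V \<and> (\<exists>s'\<in>carrier (sections F V). \<exists>t'\<in>carrier (sections F V).
      germ F x U s = germ F x V s' \<and> germ F x U t = germ F x V t' \<and>
      germ F x U (s \<oplus>\<^bsub>sections F U\<^esub> t) = germ F x V (s' \<oplus>\<^bsub>sections F V\<^esub> t'))"
    using U by blast
next
  fix C assume "\<exists>V. open V \<and> x \<in> V \<and> (\<exists>s'\<in>carrier (sections F V). \<exists>t'\<in>carrier (sections F V).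
      germ F x U s = germ F x V s' \<and> germ F x U t = germ F x V t' \<and> C = germ F x V (s' \<oplus>\<^bsub>sections F V\<^esub> t'))"
  then obtain V s' t' where V: "open V" "x \<in> V" "s' \<in> carrier (sections F V)" "t' \<in> carrier (sections F V)"
    and eq: "germ F x U s = germ F x V s'" "germ F x U t = germ F x V t'"
    and C: "C = germ F x V (s' \<oplus>\<^bsub>sections F V\<^esub> t')" by blast
  obtain W where W: "open W" "x \<in> W" "W \<subseteq> U" "W \<subseteq> V" "restr F U W s = restr F V W s'"
    by (rule germ_eqE[OF eq(1) U(1-3) V(1-3)])
  obtain W' where W': "open W'" "x \<in> W'" "W' \<subseteq> U" "W' \<subseteq> V" "restr F U W' t = restr F V W' t'"
    by (rule germ_eqE[OF eq(2) U(1,2,4) V(1,2,4)])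
  let ?Y = "W \<inter> W'"
  have Y: "open ?Y" "x \<in> ?Y" "?Y \<subseteq> U" "?Y \<subseteq> V" using W W' by auto
  have "restr F U ?Y s = restr F V ?Y s'"
    using restr_restr[of U W ?Y s] restr_restr[of V W ?Y s'] U V W Y by simp
  moreover have "restr F U ?Y t = restr F V ?Y t'"
    using restr_restr[of U W' ?Y t] restr_restr[of V W' ?Y t'] U V W' Y by simp
  ultimately show "C = germ F x U (s \<oplus>\<^bsub>sections F U\<^esub> t)"
    unfolding C by (intro germ_eqI[of V x _ U _ ?Y]) (use U V Y in \<open>simp_all add: restr_add add_closed\<close>)
qed

lemma stalk_smult:
  assumes U: "open U" "x \<in> U" "r \<in> carrier (sections Ox U)" "s \<in> carrier (sections F U)"
  shows "germ Ox x U r \<odot>\<^bsub>stalk Ox F x\<^esub> germ F x U s = germ F x U (r \<odot>\<^bsub>sections F U\<^esub> s)"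
  unfolding stalk_def module.simps
proof (rule the_equality)
  show "\<exists>V. open V \<and> x \<in> V \<and> (\<exists>r'\<in>carrier (sections Ox V). \<exists>s'\<in>carrier (sections F V).
      germ Ox x U r = germ Ox x V r' \<and> germ F x U s = germ F x V s' \<and>
      germ F x U (r \<odot>\<^bsub>sections F U\<^esub> s) = germ F x V (r' \<odot>\<^bsub>sections F V\<^esub> s'))"
    using U by blast
next
  fix C assume "\<exists>V. open V \<and> x \<in> V \<and> (\<exists>r'\<in>carrier (sections Ox V). \<exists>s'\<in>carrier (sections F V).
      germ Ox x U r = germ Ox x V r' \<and> germ F x U s = germ F x V s' \<and> C = germ F x V (r' \<odot>\<^bsub>sections F V\<^esub> s'))"
  then obtain V r' s' where V: "open V" "x \<in> V" "r' \<in> carrier (sections Ox V)" "s' \<in> carrier (sections F V)"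
    and eq: "germ Ox x U r = germ Ox x V r'" "germ F x U s = germ F x V s'"
    and C: "C = germ F x V (r' \<odot>\<^bsub>sections F V\<^esub> s')" by blast
  obtain W where W: "open W" "x \<in> W" "W \<subseteq> U" "W \<subseteq> V" "restr Ox U W r = restr Ox V W r'"
    by (rule Ox.germ_eqE[OF eq(1) U(1-3) V(1-3)])
  obtain W' where W': "open W'" "x \<in> W'" "W' \<subseteq> U" "W' \<subseteq> V" "restr F U W' s = restr F V W' s'"
    by (rule germ_eqE[OF eq(2) U(1,2,4) V(1,2,4)])
  let ?Y = "W \<inter> W'"
  have Y: "open ?Y" "x \<in> ?Y" "?Y \<subseteq> U" "?Y \<subseteq> V" using W W' by auto
  have "restr Ox U ?Y r = restr Ox V ?Y r'"
    using Ox.restr_restr[of U W ?Y r] Ox.restr_restr[of V W ?Y r'] U V W Y by simp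
  moreover have "restr F U ?Y s = restr F V ?Y s'"
    using restr_restr[of U W' ?Y s] restr_restr[of V W' ?Y s'] U V W' Y by simp
  ultimately show "C = germ F x U (r \<odot>\<^bsub>sections F U\<^esub> s)"
    unfolding C by (intro germ_eqI[of V x _ U _ ?Y]) (use U V Y in \<open>simp_all add: restr_smult smult_closed\<close>)
qed

end

text \<open>Gluing is stated for a choice of one neighbourhood for each point; this is the form in which locally defined
  data arise below.\<close>

locale sheaf_of_modules = presheaf_module Ox G for Ox and G :: "('x::topological_space, 'r, 'm) module_presheaf" +
  assumes separated: "\<lbrakk>open U; s \<in> carrier (sections G U); t \<in> carrier (sections G U);
      \<And>x. x \<in> U \<Longrightarrow> \<exists>V. open V \<and> x \<in> V \<and> V \<subseteq> U \<and> restr G U V s = restr G U V t\<rbrakk> \<Longrightarrow> s = t"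
    and glue: "\<lbrakk>open U; \<And>x. x \<in> U \<Longrightarrow> open (V x) \<and> x \<in> V x \<and> V x \<subseteq> U \<and> g x \<in> carrier (sections G (V x));
      \<And>x y z. \<lbrakk>x \<in> U; y \<in> U; z \<in> V x; z \<in> V y\<rbrakk> \<Longrightarrow>
        \<exists>W. open W \<and> z \<in> W \<and> W \<subseteq> V x \<and> W \<subseteq> V y \<and> restr G (V x) W (g x) = restr G (V y) W (g y)\<rbrakk> \<Longrightarrow>
      \<exists>t\<in>carrier (sections G U). \<forall>x\<in>U. restr G U (V x) t = g x"

lemma sheaf_homD:
  assumes "sheaf_hom Ox F G \<phi>" "open U"
  shows "s \<in> carrier (sections F U) \<Longrightarrow> \<phi> U s \<in> carrier (sections G U)"
    "s \<in> carrier (sections F U) \<Longrightarrow> t \<in> carrier (sections F U) \<Longrightarrow>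
       \<phi> U (s \<oplus>\<^bsub>sections F U\<^esub> t) = \<phi> U s \<oplus>\<^bsub>sections G U\<^esub> \<phi> U t"
    "r \<in> carrier (sections Ox U) \<Longrightarrow> s \<in> carrier (sections F U) \<Longrightarrow>
       \<phi> U (r \<odot>\<^bsub>sections F U\<^esub> s) = r \<odot>\<^bsub>sections G U\<^esub> \<phi> U s"
    "open V \<Longrightarrow> V \<subseteq> U \<Longrightarrow> s \<in> carrier (sections F U) \<Longrightarrow> \<phi> V (restr F U V s) = restr G U V (\<phi> U s)"
  using assms by (simp_all add: sheaf_hom_def Pi_iff)

lemma bchoice2E:
  assumes "\<forall>x\<in>U. \<exists>y z. Q x y z"
  obtains f g where "\<And>x. x \<in> U \<Longrightarrow> Q x (f x) (g x)"
  using assms by metis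

text \<open>A sheaf \<open>G\<close> is the sheafification of \<open>P\<close> if there is a morphism \<open>P
  \<rightarrow> G\<close> that is locally injective and locally surjective. The relation \<open>R\<close> in the
  proof says that the germs of \<open>\<sigma>\<close> are represented by sections of \<open>P\<close> with
  images \<open>g\<close>; it is the graph of the isomorphism.\<close>

theorem sheafify_isomorphic:
  fixes P :: "('x::topological_space, 'r, 'm) module_presheaf" and G :: "('x, 'r, 'n) module_presheaf"
  assumes "presheaf_module Ox P" and "sheaf_of_modules Ox G" and hom: "sheaf_hom Ox P G \<theta>"
    and inj: "\<And>U s t x. \<lbrakk>open U; x \<in> U; s \<in> carrier (sections P U); t \<in> carrier (sections P U); \<theta> U s = \<theta> U t\<rbrakk> \<Longrightarrow>
      \<exists>V. open V \<and> x \<in> V \<and> V \<subseteq> U \<and> restr P U V s = restr P U V t"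
    and surj: "\<And>U g. \<lbrakk>open U; g \<in> carrier (sections G U)\<rbrakk> \<Longrightarrow> locally_in_image P G \<theta> U g"
  shows "sheaf_isomorphic Ox (sheafify Ox P) G"
proof -
  interpret P: presheaf_module Ox P by fact
  interpret G: sheaf_of_modules Ox G by fact
  note \<theta> = sheaf_homD[OF hom]
  define R where "R U \<sigma> g \<longleftrightarrow> (\<forall>x\<in>U. \<exists>V s. open V \<and> x \<in> V \<and> V \<subseteq> U \<and> s \<in> carrier (sections P V) \<and>
     \<sigma> x = germ P x V s \<and> \<theta> V s = restr G U V g)" for U \<sigma> g
  have RE: "\<exists>V s. open V \<and> x \<in> V \<and> V \<subseteq> U \<and> s \<in> carrier (sections P V) \<and>
     \<sigma> x = germ P x V s \<and> \<theta> V s = restr G U V g" if "R U \<sigma> g" "x \<in> U" for U \<sigma> g x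
    using that unfolding R_def by blast
  \<comment> \<open>shrinking the witness of \<open>R\<close>\<close>
  have shrink: "restr P V W s \<in> carrier (sections P W) \<and> \<sigma>x = germ P x W (restr P V W s) \<and>
      \<theta> W (restr P V W s) = restr G U W g"
    if "open U" "open V" "open W" "x \<in> W" "W \<subseteq> V" "V \<subseteq> U" "s \<in> carrier (sections P V)"
      "\<sigma>x = germ P x V s" "\<theta> V s = restr G U V g" "g \<in> carrier (sections G U)" for U V W s \<sigma>x x g
    using that P.restr_closed[of V W s] P.germ_restr[of V W x s] \<theta>(4)[of V W s] G.restr_restr[of U V W g] by simp
  have exR: "\<exists>g\<in>carrier (sections G U). R U \<sigma> g"
    if U: "open U" and \<sigma>: "\<sigma> \<in> carrier (sections (sheafify Ox P) U)" for U \<sigma>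
  proof -
    have "\<forall>x\<in>U. \<exists>V s. open V \<and> x \<in> V \<and> V \<subseteq> U \<and> s \<in> carrier (sections P V) \<and> (\<forall>y\<in>V. \<sigma> y = germ P y V s)"
      using \<sigma> by (auto simp: sheafify_def Bex_def)
    then obtain V s where V: "\<And>x. x \<in> U \<Longrightarrow> open (V x) \<and> x \<in> V x \<and> V x \<subseteq> U \<and> s x \<in> carrier (sections P (V x)) \<and>
        (\<forall>y\<in>V x. \<sigma> y = germ P y (V x) (s x))"
      by (rule bchoice2E) (rule that)
    have "\<exists>t\<in>carrier (sections G U). \<forall>x\<in>U. restr G U (V x) t = \<theta> (V x) (s x)"
    proof (rule G.glue[OF U])
      show "open (V x) \<and> x \<in> V x \<and> V x \<subseteq> U \<and> \<theta> (V x) (s x) \<in> carrier (sections G (V x))" if "x \<in> U" for x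
        using V[OF that] \<theta>(1)[of "V x" "s x"] by simp
      fix x y z assume xyz: "x \<in> U" "y \<in> U" "z \<in> V x" "z \<in> V y"
      have a: "open (V x)" "s x \<in> carrier (sections P (V x))" "\<sigma> z = germ P z (V x) (s x)"
        using V[OF xyz(1)] xyz(3) by auto
      have b: "open (V y)" "s y \<in> carrier (sections P (V y))" "\<sigma> z = germ P z (V y) (s y)"
        using V[OF xyz(2)] xyz(4) by auto
      obtain W where W: "open W" "z \<in> W" "W \<subseteq> V x" "W \<subseteq> V y" "restr P (V x) W (s x) = restr P (V y) W (s y)"
        by (rule P.germ_eqE[OF trans[OF a(3)[symmetric] b(3)] a(1) xyz(3) a(2) b(1) xyz(4) b(2)])
      have "restr G (V x) W (\<theta> (V x) (s x)) = restr G (V y) W (\<theta> (V y) (s y))"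
        using \<theta>(4)[OF a(1) W(1,3) a(2)] \<theta>(4)[OF b(1) W(1,4) b(2)] W(5) by simp
      with W(1-4) show "\<exists>W. open W \<and> z \<in> W \<and> W \<subseteq> V x \<and> W \<subseteq> V y \<and>
          restr G (V x) W (\<theta> (V x) (s x)) = restr G (V y) W (\<theta> (V y) (s y))" by (intro exI[of _ W] conjI)
    qed
    then obtain t where t: "t \<in> carrier (sections G U)" "\<And>x. x \<in> U \<Longrightarrow> restr G U (V x) t = \<theta> (V x) (s x)" by blast
    have "R U \<sigma> t" unfolding R_def
    proof
      fix x assume "x \<in> U"
      then show "\<exists>V s. open V \<and> x \<in> V \<and> V \<subseteq> U \<and> s \<in> carrier (sections P V) \<and> \<sigma> x = germ P x V s \<and> \<theta> V s = restr G U V t"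
        using V[of x] t(2)[of x] by (intro exI[of _ "V x"] exI[of _ "s x"]) simp
    qed
    then show ?thesis using t(1) by blast
  qed
  have uniq: "g = h" if U: "open U" and g: "g \<in> carrier (sections G U)" "h \<in> carrier (sections G U)"
    and R: "R U \<sigma> g" "R U \<sigma> h" for U \<sigma> g h
  proof (rule G.separated[OF U g])
    fix x assume x: "x \<in> U"
    obtain V s where V: "open V" "x \<in> V" "V \<subseteq> U" "s \<in> carrier (sections P V)" "\<sigma> x = germ P x V s" "\<theta> V s = restr G U V g"
      using RE[OF R(1) x] by blast
    obtain V' s' where V': "open V'" "x \<in> V'" "V' \<subseteq> U" "s' \<in> carrier (sections P V')" "\<sigma> x = germ P x V' s'" "\<theta> V' s' = restr G U V' h"
      using RE[OF R(2) x] by blast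
    obtain W where W: "open W" "x \<in> W" "W \<subseteq> V" "W \<subseteq> V'" "restr P V W s = restr P V' W s'"
      by (rule P.germ_eqE[OF trans[OF V(5)[symmetric] V'(5)] V(1,2,4) V'(1,2,4)])
    have "restr G U W g = restr G U W h"
      using shrink[OF U V(1) W(1,2,3) V(3-6) g(1)] shrink[OF U V'(1) W(1,2,4) V'(3-6) g(2)] W(5) by simp
    then show "\<exists>V. open V \<and> x \<in> V \<and> V \<subseteq> U \<and> restr G U V g = restr G U V h"
      using W V(3) by blast
  qed
  define \<phi> where "\<phi> U \<sigma> = (THE g. g \<in> carrier (sections G U) \<and> R U \<sigma> g)" for U \<sigma>
  have \<phi>_eq: "\<phi> U \<sigma> = g" if "open U" "g \<in> carrier (sections G U)" "R U \<sigma> g" for U \<sigma> g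
    unfolding \<phi>_def using that(2,3) uniq[OF that(1) _ that(2) _ that(3)] by (intro the_equality conjI) blast+
  have \<phi>: "\<phi> U \<sigma> \<in> carrier (sections G U)" "R U \<sigma> (\<phi> U \<sigma>)"
    if U\<sigma>: "open U" "\<sigma> \<in> carrier (sections (sheafify Ox P) U)" for U \<sigma>
  proof -
    obtain g where "g \<in> carrier (sections G U)" "R U \<sigma> g" using exR[OF U\<sigma>] by blast
    then show "\<phi> U \<sigma> \<in> carrier (sections G U)" "R U \<sigma> (\<phi> U \<sigma>)"
      using \<phi>_eq[OF U\<sigma>(1)] by simp_all
  qed
  have R_add: "R U (\<sigma> \<oplus>\<^bsub>sections (sheafify Ox P) U\<^esub> \<tau>) (g \<oplus>\<^bsub>sections G U\<^esub> h)"
    if U: "open U" and g: "g \<in> carrier (sections G U)" "h \<in> carrier (sections G U)" and R: "R U \<sigma> g" "R U \<tau> h" for U \<sigma> \<tau> g h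
    unfolding R_def
  proof
    fix x assume x: "x \<in> U"
    obtain V s where V: "open V" "x \<in> V" "V \<subseteq> U" "s \<in> carrier (sections P V)" "\<sigma> x = germ P x V s" "\<theta> V s = restr G U V g"
      using RE[OF R(1) x] by blast
    obtain V' s' where V': "open V'" "x \<in> V'" "V' \<subseteq> U" "s' \<in> carrier (sections P V')" "\<tau> x = germ P x V' s'" "\<theta> V' s' = restr G U V' h"
      using RE[OF R(2) x] by blast
    let ?W = "V \<inter> V'"
    have W: "open ?W" "x \<in> ?W" "?W \<subseteq> V" "?W \<subseteq> V'" "?W \<subseteq> U" using V V' by auto
    note 1 = shrink[OF U V(1) W(1,2,3) V(3-6) g(1)] and 2 = shrink[OF U V'(1) W(1,2,4) V'(3-6) g(2)]
    let ?s = "restr P V ?W s" and ?s' = "restr P V' ?W s'"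
    have "(\<sigma> \<oplus>\<^bsub>sections (sheafify Ox P) U\<^esub> \<tau>) x = germ P x ?W (?s \<oplus>\<^bsub>sections P ?W\<^esub> ?s')"
      using 1 2 P.stalk_add[OF W(1,2)] x by (simp add: sheafify_def)
    moreover have "\<theta> ?W (?s \<oplus>\<^bsub>sections P ?W\<^esub> ?s') = restr G U ?W (g \<oplus>\<^bsub>sections G U\<^esub> h)"
      using 1 2 \<theta>(2)[OF W(1)] G.restr_add[OF U W(1,5) g] by simp
    ultimately show "\<exists>V s. open V \<and> x \<in> V \<and> V \<subseteq> U \<and> s \<in> carrier (sections P V) \<and>
        (\<sigma> \<oplus>\<^bsub>sections (sheafify Ox P) U\<^esub> \<tau>) x = germ P x V s \<and> \<theta> V s = restr G U V (g \<oplus>\<^bsub>sections G U\<^esub> h)"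
      using W 1 2 P.add_closed[OF W(1), of ?s ?s'] by (intro exI[of _ ?W] exI[of _ "?s \<oplus>\<^bsub>sections P ?W\<^esub> ?s'"]) simp
  qed
  have R_smult: "R U (r \<odot>\<^bsub>sections (sheafify Ox P) U\<^esub> \<sigma>) (r \<odot>\<^bsub>sections G U\<^esub> g)"
    if U: "open U" and r: "r \<in> carrier (sections Ox U)" and g: "g \<in> carrier (sections G U)" and R: "R U \<sigma> g" for U \<sigma> r g
    unfolding R_def
  proof
    fix x assume x: "x \<in> U"
    obtain V s where V: "open V" "x \<in> V" "V \<subseteq> U" "s \<in> carrier (sections P V)" "\<sigma> x = germ P x V s" "\<theta> V s = restr G U V g"
      using RE[OF R x] by blast
    let ?r = "restr Ox U V r"
    have rV: "?r \<in> carrier (sections Ox V)" using P.Ox.restr_closed[OF U V(1,3) r] .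
    have "(r \<odot>\<^bsub>sections (sheafify Ox P) U\<^esub> \<sigma>) x = germ P x V (?r \<odot>\<^bsub>sections P V\<^esub> s)"
      using P.stalk_smult[OF V(1,2) rV V(4)] P.Ox.germ_restr[OF U V(1,3,2) r] x V(5) by (simp add: sheafify_def)
    moreover have "\<theta> V (?r \<odot>\<^bsub>sections P V\<^esub> s) = restr G U V (r \<odot>\<^bsub>sections G U\<^esub> g)"
      using \<theta>(3)[OF V(1) rV V(4)] V(6) G.restr_smult[OF U V(1,3) r g] by simp
    ultimately show "\<exists>V s. open V \<and> x \<in> V \<and> V \<subseteq> U \<and> s \<in> carrier (sections P V) \<and>
        (r \<odot>\<^bsub>sections (sheafify Ox P) U\<^esub> \<sigma>) x = germ P x V s \<and> \<theta> V s = restr G U V (r \<odot>\<^bsub>sections G U\<^esub> g)"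
      using V(1-3) P.smult_closed[OF V(1) rV V(4)] by (intro exI[of _ V] exI[of _ "?r \<odot>\<^bsub>sections P V\<^esub> s"]) simp
  qed
  have R_restr: "R V (restr (sheafify Ox P) U V \<sigma>) (restr G U V g)"
    if U: "open U" and V: "open V" "V \<subseteq> U" and g: "g \<in> carrier (sections G U)" and R: "R U \<sigma> g" for U V \<sigma> g
    unfolding R_def
  proof
    fix x assume x: "x \<in> V"
    have xU: "x \<in> U" using x V(2) by blast
    obtain V' s where V': "open V'" "x \<in> V'" "V' \<subseteq> U" "s \<in> carrier (sections P V')" "\<sigma> x = germ P x V' s" "\<theta> V' s = restr G U V' g"
      using RE[OF R xU] by blast
    let ?W = "V \<inter> V'"
    have W: "open ?W" "x \<in> ?W" "?W \<subseteq> V" "?W \<subseteq> V'" using V V' x by auto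
    note 1 = shrink[OF U V'(1) W(1,2,4) V'(3-6) g]
    have "restr G V ?W (restr G U V g) = restr G U ?W g" using G.restr_restr[OF U V(1) W(1,3) V(2) g] .
    then show "\<exists>V' s. open V' \<and> x \<in> V' \<and> V' \<subseteq> V \<and> s \<in> carrier (sections P V') \<and>
        restr (sheafify Ox P) U V \<sigma> x = germ P x V' s \<and> \<theta> V' s = restr G V V' (restr G U V g)"
      using 1 W x V' by (intro exI[of _ ?W] exI[of _ "restr P V' ?W s"]) (simp add: sheafify_def)
  qed
  have "sheaf_hom Ox (sheafify Ox P) G \<phi>"
    unfolding sheaf_hom_def
  proof (intro allI impI conjI ballI funcsetI)
    fix U :: "'x set" assume U: "open U"
    fix \<sigma> assume \<sigma>: "\<sigma> \<in> carrier (sections (sheafify Ox P) U)"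
    show "\<phi> U \<sigma> \<in> carrier (sections G U)" using \<phi>[OF U \<sigma>] by blast
    {
      fix \<tau> assume \<tau>: "\<tau> \<in> carrier (sections (sheafify Ox P) U)"
      show "\<phi> U (\<sigma> \<oplus>\<^bsub>sections (sheafify Ox P) U\<^esub> \<tau>) = \<phi> U \<sigma> \<oplus>\<^bsub>sections G U\<^esub> \<phi> U \<tau>"
        by (rule \<phi>_eq[OF U G.add_closed[OF U] R_add[OF U]]) (rule \<phi>[OF U \<sigma>] \<phi>[OF U \<tau>])+
    next
      fix V assume V: "open V" "V \<subseteq> U"
      show "\<phi> V (restr (sheafify Ox P) U V \<sigma>) = restr G U V (\<phi> U \<sigma>)"
        by (rule \<phi>_eq[OF V(1) G.restr_closed[OF U V] R_restr[OF U V]]) (rule \<phi>[OF U \<sigma>])+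
    }
    fix r assume r: "r \<in> carrier (sections Ox U)"
    show "\<phi> U (r \<odot>\<^bsub>sections (sheafify Ox P) U\<^esub> \<sigma>) = r \<odot>\<^bsub>sections G U\<^esub> \<phi> U \<sigma>"
      by (rule \<phi>_eq[OF U G.smult_closed[OF U r] R_smult[OF U r]]) (rule \<phi>[OF U \<sigma>])+
  qed
  moreover have "bij_betw (\<phi> U) (carrier (sections (sheafify Ox P) U)) (carrier (sections G U))" if U: "open U" for U
    unfolding bij_betw_def
  proof
    show "inj_on (\<phi> U) (carrier (sections (sheafify Ox P) U))"
    proof (rule inj_onI)
      fix \<sigma> \<tau> assume \<sigma>: "\<sigma> \<in> carrier (sections (sheafify Ox P) U)" and \<tau>: "\<tau> \<in> carrier (sections (sheafify Ox P) U)"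
        and eq: "\<phi> U \<sigma> = \<phi> U \<tau>"
      have ext: "\<sigma> \<in> extensional U" "\<tau> \<in> extensional U" using \<sigma> \<tau> by (auto simp: sheafify_def)
      show "\<sigma> = \<tau>"
      proof (rule extensionalityI[OF ext])
        fix x assume x: "x \<in> U"
        let ?g = "\<phi> U \<sigma>"
        note g = \<phi>(1)[OF U \<sigma>]
        have R: "R U \<sigma> ?g" "R U \<tau> ?g" using \<phi>(2)[OF U \<sigma>] \<phi>(2)[OF U \<tau>] eq by auto
        obtain V s where V: "open V" "x \<in> V" "V \<subseteq> U" "s \<in> carrier (sections P V)" "\<sigma> x = germ P x V s" "\<theta> V s = restr G U V ?g"
          using RE[OF R(1) x] by blast
        obtain V' s' where V': "open V'" "x \<in> V'" "V' \<subseteq> U" "s' \<in> carrier (sections P V')" "\<tau> x = germ P x V' s'" "\<theta> V' s' = restr G U V' ?g"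
          using RE[OF R(2) x] by blast
        let ?W = "V \<inter> V'"
        have W: "open ?W" "x \<in> ?W" "?W \<subseteq> V" "?W \<subseteq> V'" using V V' by auto
        note 1 = shrink[OF U V(1) W(1,2,3) V(3-6) g] and 2 = shrink[OF U V'(1) W(1,2,4) V'(3-6) g]
        let ?s = "restr P V ?W s" and ?s' = "restr P V' ?W s'"
        obtain Y where Y: "open Y" "x \<in> Y" "Y \<subseteq> ?W" "restr P ?W Y ?s = restr P ?W Y ?s'"
          using inj[OF W(1,2) conjunct1[OF 1] conjunct1[OF 2] trans[OF 1[THEN conjunct2, THEN conjunct2] 2[THEN conjunct2, THEN conjunct2, symmetric]]] by blast
        have "germ P x ?W ?s = germ P x ?W ?s'"
          by (rule P.germ_eqI[OF W(1,2) conjunct1[OF 1] W(1,2) conjunct1[OF 2] Y(1,2,3,3,4)])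
        then show "\<sigma> x = \<tau> x" using 1 2 by simp
      qed
    qed
    show "\<phi> U ` carrier (sections (sheafify Ox P) U) = carrier (sections G U)"
    proof (intro equalityI subsetI)
      fix g assume "g \<in> \<phi> U ` carrier (sections (sheafify Ox P) U)"
      then show "g \<in> carrier (sections G U)" using \<phi>(1)[OF U] by blast
    next
      fix g assume g: "g \<in> carrier (sections G U)"
      have "\<forall>x\<in>U. \<exists>V s. open V \<and> x \<in> V \<and> V \<subseteq> U \<and> s \<in> carrier (sections P V) \<and> \<theta> V s = restr G U V g"
        using surj[OF U g] unfolding locally_in_image_def by blast
      then obtain V s where V: "\<And>x. x \<in> U \<Longrightarrow> open (V x) \<and> x \<in> V x \<and> V x \<subseteq> U \<and> s x \<in> carrier (sections P (V x)) \<and>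
          \<theta> (V x) (s x) = restr G U (V x) g"
        by (rule bchoice2E) (rule that)
      define \<sigma> where "\<sigma> = (\<lambda>x\<in>U. germ P x (V x) (s x))"
      have \<sigma>: "\<sigma> y = germ P y (V x) (s x)" if x: "x \<in> U" and y: "y \<in> V x" for x y
      proof -
        note Vx = V[OF x]
        have yU: "y \<in> U" using Vx y by blast
        note Vy = V[OF yU]
        let ?W = "V x \<inter> V y"
        have W: "open ?W" "y \<in> ?W" "?W \<subseteq> V x" "?W \<subseteq> V y" using Vx Vy y by auto
        have 1: "restr P (V x) ?W (s x) \<in> carrier (sections P ?W)" "\<theta> ?W (restr P (V x) ?W (s x)) = restr G U ?W g"
          "germ P y ?W (restr P (V x) ?W (s x)) = germ P y (V x) (s x)"
          using P.restr_closed[of "V x" ?W "s x"] P.germ_restr[of "V x" ?W y "s x"] \<theta>(4)[of "V x" ?W "s x"]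
            G.restr_restr[of U "V x" ?W g] Vx W U g by auto
        have 2: "restr P (V y) ?W (s y) \<in> carrier (sections P ?W)" "\<theta> ?W (restr P (V y) ?W (s y)) = restr G U ?W g"
          "germ P y ?W (restr P (V y) ?W (s y)) = germ P y (V y) (s y)"
          using P.restr_closed[of "V y" ?W "s y"] P.germ_restr[of "V y" ?W y "s y"] \<theta>(4)[of "V y" ?W "s y"]
            G.restr_restr[of U "V y" ?W g] Vy W U g by auto
        obtain Y where Y: "open Y" "y \<in> Y" "Y \<subseteq> ?W"
          "restr P ?W Y (restr P (V x) ?W (s x)) = restr P ?W Y (restr P (V y) ?W (s y))"
          using inj[OF W(1,2) 1(1) 2(1) trans[OF 1(2) 2(2)[symmetric]]] by blast
        have "germ P y ?W (restr P (V x) ?W (s x)) = germ P y ?W (restr P (V y) ?W (s y))"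
          by (rule P.germ_eqI[OF W(1,2) 1(1) W(1,2) 2(1) Y(1,2,3,3,4)])
        then show ?thesis using 1(3) 2(3) yU by (simp add: \<sigma>_def)
      qed
      have "\<sigma> \<in> carrier (sections (sheafify Ox P) U)"
      proof -
        have "\<exists>W. open W \<and> x \<in> W \<and> W \<subseteq> U \<and> (\<exists>s\<in>carrier (sections P W). \<forall>y\<in>W. \<sigma> y = germ P y W s)"
          if x: "x \<in> U" for x
          using V[OF x] \<sigma>[OF x] by (intro exI[of _ "V x"] conjI bexI[of _ "s x"] ballI) simp_all
        moreover have "\<sigma> \<in> extensional U" by (simp add: \<sigma>_def)
        ultimately show ?thesis by (simp add: sheafify_def)
      qed
      moreover have "R U \<sigma> g" unfolding R_def
      proof
        fix x assume x: "x \<in> U"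
        show "\<exists>V s. open V \<and> x \<in> V \<and> V \<subseteq> U \<and> s \<in> carrier (sections P V) \<and>
          \<sigma> x = germ P x V s \<and> \<theta> V s = restr G U V g"
          by (rule exI[of _ "V x"], rule exI[of _ "s x"]) (use V[OF x] x in \<open>simp add: \<sigma>_def\<close>)
      qed
      ultimately show "g \<in> \<phi> U ` carrier (sections (sheafify Ox P) U)"
        using \<phi>_eq[OF U g] by (intro image_eqI[of g "\<phi> U" \<sigma>]) simp_all
    qed
  qed
  ultimately show ?thesis unfolding sheaf_isomorphic_def by blast
qed

section \<open>Twists, direct sums and the bundle of an arrangement\<close>

lemma twist_simps [simp]:
  "carrier (sections (twist X k) U) = twist_sections X k U"
  "s \<oplus>\<^bsub>sections (twist X k) U\<^esub> t = (\<lambda>v. s v + t v)"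
  "s \<otimes>\<^bsub>sections (twist X k) U\<^esub> t = (\<lambda>v. s v * t v)"
  "r \<odot>\<^bsub>sections (twist X k) U\<^esub> s = (\<lambda>v. r v * s v)"
  "\<zero>\<^bsub>sections (twist X k) U\<^esub> = (\<lambda>v. 0)"
  "\<one>\<^bsub>sections (twist X k) U\<^esub> = (\<lambda>v. if v \<in> affine_cone (U \<inter> X) then 1 else 0)"
  "restr (twist X k) U V s = (\<lambda>v. if v \<in> affine_cone V then s v else 0)"
  by (simp_all add: twist_def)

lemma direct_sum_simps [simp]:
  "carrier (sections (direct_sum F G) U) = carrier (sections F U) \<times> carrier (sections G U)"
  "s \<oplus>\<^bsub>sections (direct_sum F G) U\<^esub> t = (fst s \<oplus>\<^bsub>sections F U\<^esub> fst t, snd s \<oplus>\<^bsub>sections G U\<^esub> snd t)"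
  "r \<odot>\<^bsub>sections (direct_sum F G) U\<^esub> s = (r \<odot>\<^bsub>sections F U\<^esub> fst s, r \<odot>\<^bsub>sections G U\<^esub> snd s)"
  "\<zero>\<^bsub>sections (direct_sum F G) U\<^esub> = (\<zero>\<^bsub>sections F U\<^esub>, \<zero>\<^bsub>sections G U\<^esub>)"
  "restr (direct_sum F G) U V s = (restr F U V (fst s), restr G U V (snd s))"
  by (simp_all add: direct_sum_def split: prod.split)

lemma kernel_sheaf_simps [simp]:
  "carrier (sections (kernel_sheaf F G \<phi>) U) = {s \<in> carrier (sections F U). \<phi> U s = \<zero>\<^bsub>sections G U\<^esub>}"
  "s \<oplus>\<^bsub>sections (kernel_sheaf F G \<phi>) U\<^esub> t = s \<oplus>\<^bsub>sections F U\<^esub> t"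
  "r \<odot>\<^bsub>sections (kernel_sheaf F G \<phi>) U\<^esub> s = r \<odot>\<^bsub>sections F U\<^esub> s"
  "\<zero>\<^bsub>sections (kernel_sheaf F G \<phi>) U\<^esub> = \<zero>\<^bsub>sections F U\<^esub>"
  "restr (kernel_sheaf F G \<phi>) U V s = restr F U V s"
  by (simp_all add: kernel_sheaf_def)

lemma tw_restr:
  assumes "s \<in> twist_sections X k U" "open V" "V \<subseteq> U"
  shows "(\<lambda>v. if v \<in> affine_cone V then s v else 0) \<in> twist_sections X k V"
proof -
  have "(\<lambda>v. if v \<in> affine_cone V then s v else 0) = (\<lambda>v. if v \<in> affine_cone (V \<inter> X) then s v else 0)"
    using tw_outside[OF assms(1)] assms(3) by (fastforce simp: mem_affine_cone)
  then show ?thesis using tw_restrict[OF assms(1,3) subset_refl assms(2)] by simp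
qed

lemma restr_twice:
  "W \<subseteq> V \<Longrightarrow> (\<lambda>v. if v \<in> affine_cone W then if v \<in> affine_cone V then s v else 0 else 0) =
     (\<lambda>v. if v \<in> affine_cone W then s v else 0)"
  using affine_cone_mono by fastforce

lemma presheaf_twist: "presheaf (twist X k)"
  by unfold_locales (simp_all add: tw_restr restr_twice)

lemma tw_O_mult: "r \<in> twist_sections UNIV 0 U \<Longrightarrow> s \<in> twist_sections X k U \<Longrightarrow> open U \<Longrightarrow>
    (\<lambda>v. r v * s v) \<in> twist_sections X k U"
  by (rule tw_mult'[of s X k U r UNIV 0 U]) auto

lemma presheaf_module_twist: "presheaf_module O_plane (twist X k)"
proof -
  interpret presheaf "twist X k" by (rule presheaf_twist)
  interpret O: presheaf O_plane by (rule presheaf_twist)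
  show ?thesis by unfold_locales (auto simp: tw_add tw_O_mult)
qed

text \<open>Sections are functions, and being a section is a local condition.\<close>

lemma sheaf_twist: "sheaf_of_modules O_plane (twist X k)"
proof -
  interpret presheaf_module O_plane "twist X k" by (rule presheaf_module_twist)
  show ?thesis
  proof
    fix U s t
    assume U: "open U" "s \<in> carrier (sections (twist X k) U)" "t \<in> carrier (sections (twist X k) U)"
      and loc: "\<And>x. x \<in> U \<Longrightarrow> \<exists>V. open V \<and> x \<in> V \<and> V \<subseteq> U \<and> restr (twist X k) U V s = restr (twist X k) U V t"
    show "s = t"
    proof
      fix v
      show "s v = t v"
      proof (cases "v \<in> affine_cone U")
        case True
        then have v: "v \<noteq> 0" "pt v \<in> U" by (auto simp: mem_affine_cone)
        obtain V where "pt v \<in> V" "restr (twist X k) U V s = restr (twist X k) U V t" using loc[OF v(2)] by blast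
        then show ?thesis using v by (auto simp: mem_affine_cone dest: fun_cong[of _ _ v])
      next
        case False
        then have "v \<notin> affine_cone (U \<inter> X)" by (auto simp: mem_affine_cone)
        then show ?thesis using U tw_outside[of s X k U v] tw_outside[of t X k U v] by simp
      qed
    qed
  next
    fix U and V :: "proj_plane \<Rightarrow> proj_plane set" and g
    assume U: "open U" and V: "\<And>x. x \<in> U \<Longrightarrow> open (V x) \<and> x \<in> V x \<and> V x \<subseteq> U \<and> g x \<in> carrier (sections (twist X k) (V x))"
      and agree: "\<And>x y z. \<lbrakk>x \<in> U; y \<in> U; z \<in> V x; z \<in> V y\<rbrakk> \<Longrightarrow>
        \<exists>W. open W \<and> z \<in> W \<and> W \<subseteq> V x \<and> W \<subseteq> V y \<and> restr (twist X k) (V x) W (g x) = restr (twist X k) (V y) W (g y)"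
    define t where "t = (\<lambda>v. if v \<in> affine_cone U then g (pt v) v else 0)"
    have t: "t v = g x v" if x: "x \<in> U" and v: "v \<in> affine_cone (V x)" for x v
    proof -
      have v': "v \<noteq> 0" "pt v \<in> V x" "pt v \<in> U" using v V[OF x] by (auto simp: mem_affine_cone)
      obtain W where "pt v \<in> W" "restr (twist X k) (V x) W (g x) = restr (twist X k) (V (pt v)) W (g (pt v))"
        using agree[OF x v'(3,2)] V[OF v'(3)] by blast
      then have "g x v = g (pt v) v" using v' by (auto simp: mem_affine_cone dest: fun_cong[of _ _ v])
      then show ?thesis using v' by (simp add: t_def mem_affine_cone)
    qed
    have "t \<in> twist_sections X k U"
    proof (rule twI)
      fix v assume v: "v \<notin> affine_cone (U \<inter> X)"
      show "t v = 0"
      proof (cases "v \<in> affine_cone U")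
        case True
        then have v': "v \<noteq> 0" "pt v \<in> U" "pt v \<notin> X" using v by (auto simp: mem_affine_cone)
        then have "g (pt v) v = 0" using V[OF v'(2)] tw_outside[of "g (pt v)" X k "V (pt v)" v] by (simp add: mem_affine_cone)
        then show ?thesis by (simp add: t_def)
      qed (simp add: t_def)
    next
      fix x assume x: "x \<in> U" "x \<in> X"
      obtain W where W: "open W" "x \<in> W" "W \<subseteq> V x" "is_fraction (W \<inter> X) k (g x)"
        using tw_local[of "g x" X k "V x" x] V[OF x(1)] x(2) by auto
      have "is_fraction (W \<inter> X) k t"
        using W(4) by (subst is_fraction_cong[of _ _ "g x"]) (use t[OF x(1)] W(3) in \<open>auto simp: mem_affine_cone\<close>)
      then show "\<exists>V. open V \<and> x \<in> V \<and> V \<subseteq> U \<and> is_fraction (V \<inter> X) k t"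
        using W V[OF x(1)] by blast
    qed
    moreover have "restr (twist X k) U (V x) t = g x" if x: "x \<in> U" for x
    proof
      fix v show "restr (twist X k) U (V x) t v = g x v"
        using t[OF x, of v] V[OF x] tw_outside[of "g x" X k "V x" v] by (auto simp: mem_affine_cone)
    qed
    ultimately show "\<exists>t\<in>carrier (sections (twist X k) U). \<forall>x\<in>U. restr (twist X k) U (V x) t = g x"
      by auto
  qed
qed

lemma presheaf_module_direct_sum:
  assumes "presheaf_module Ox F" "presheaf_module Ox G"
  shows "presheaf_module Ox (direct_sum F G)"
proof -
  interpret F: presheaf_module Ox F by fact
  interpret G: presheaf_module Ox G by fact
  show ?thesis
    by unfold_locales
      (auto simp: F.restr_closed G.restr_closed F.restr_restr G.restr_restr F.Ox.restr_closed
        F.Ox.restr_restr F.add_closed G.add_closed F.smult_closed G.smult_closed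
        F.restr_add G.restr_add F.restr_smult G.restr_smult)
qed

lemma sheaf_direct_sum:
  assumes "sheaf_of_modules Ox F" "sheaf_of_modules Ox G"
  shows "sheaf_of_modules Ox (direct_sum F G)"
proof -
  interpret F: sheaf_of_modules Ox F by fact
  interpret G: sheaf_of_modules Ox G by fact
  interpret presheaf_module Ox "direct_sum F G"
    by (rule presheaf_module_direct_sum) unfold_locales
  show ?thesis
  proof
    fix U s t
    assume U: "open U" "s \<in> carrier (sections (direct_sum F G) U)" "t \<in> carrier (sections (direct_sum F G) U)"
      and loc: "\<And>x. x \<in> U \<Longrightarrow> \<exists>V. open V \<and> x \<in> V \<and> V \<subseteq> U \<and> restr (direct_sum F G) U V s = restr (direct_sum F G) U V t"
    have "fst s = fst t"
    proof (rule F.separated[OF U(1)])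
      fix x assume "x \<in> U"
      from loc[OF this] show "\<exists>V. open V \<and> x \<in> V \<and> V \<subseteq> U \<and> restr F U V (fst s) = restr F U V (fst t)" by auto
    qed (use U in auto)
    moreover have "snd s = snd t"
    proof (rule G.separated[OF U(1)])
      fix x assume "x \<in> U"
      from loc[OF this] show "\<exists>V. open V \<and> x \<in> V \<and> V \<subseteq> U \<and> restr G U V (snd s) = restr G U V (snd t)" by auto
    qed (use U in auto)
    ultimately show "s = t" by (rule prod_eqI)
  next
    fix U and V :: "'a \<Rightarrow> 'a set" and g
    assume U: "open U" and V: "\<And>x. x \<in> U \<Longrightarrow> open (V x) \<and> x \<in> V x \<and> V x \<subseteq> U \<and> g x \<in> carrier (sections (direct_sum F G) (V x))"
      and agree: "\<And>x y z. \<lbrakk>x \<in> U; y \<in> U; z \<in> V x; z \<in> V y\<rbrakk> \<Longrightarrow>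
        \<exists>W. open W \<and> z \<in> W \<and> W \<subseteq> V x \<and> W \<subseteq> V y \<and> restr (direct_sum F G) (V x) W (g x) = restr (direct_sum F G) (V y) W (g y)"
    have "\<exists>t\<in>carrier (sections F U). \<forall>x\<in>U. restr F U (V x) t = fst (g x)"
    proof (rule F.glue[OF U])
      show "open (V x) \<and> x \<in> V x \<and> V x \<subseteq> U \<and> fst (g x) \<in> carrier (sections F (V x))" if "x \<in> U" for x
        using V[OF that] by auto
      fix x y z assume "x \<in> U" "y \<in> U" "z \<in> V x" "z \<in> V y"
      from agree[OF this] show "\<exists>W. open W \<and> z \<in> W \<and> W \<subseteq> V x \<and> W \<subseteq> V y \<and> restr F (V x) W (fst (g x)) = restr F (V y) W (fst (g y))"
        by auto
    qed
    then obtain t1 where t1: "t1 \<in> carrier (sections F U)" "\<And>x. x \<in> U \<Longrightarrow> restr F U (V x) t1 = fst (g x)" by blast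
    have "\<exists>t\<in>carrier (sections G U). \<forall>x\<in>U. restr G U (V x) t = snd (g x)"
    proof (rule G.glue[OF U])
      show "open (V x) \<and> x \<in> V x \<and> V x \<subseteq> U \<and> snd (g x) \<in> carrier (sections G (V x))" if "x \<in> U" for x
        using V[OF that] by auto
      fix x y z assume "x \<in> U" "y \<in> U" "z \<in> V x" "z \<in> V y"
      from agree[OF this] show "\<exists>W. open W \<and> z \<in> W \<and> W \<subseteq> V x \<and> W \<subseteq> V y \<and> restr G (V x) W (snd (g x)) = restr G (V y) W (snd (g y))"
        by auto
    qed
    then obtain t2 where t2: "t2 \<in> carrier (sections G U)" "\<And>x. x \<in> U \<Longrightarrow> restr G U (V x) t2 = snd (g x)" by blast
    show "\<exists>t\<in>carrier (sections (direct_sum F G) U). \<forall>x\<in>U. restr (direct_sum F G) U (V x) t = g x"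
      by (rule bexI[of _ "(t1, t2)"]) (use t1 t2 in auto)
  qed
qed

lemma sheaf_isomorphic_swap:
  assumes "sheaf_isomorphic Ox F (direct_sum G H)"
  shows "sheaf_isomorphic Ox F (direct_sum H G)"
proof -
  obtain \<phi> where hom: "sheaf_hom Ox F (direct_sum G H) \<phi>"
    and bij: "\<And>U. open U \<Longrightarrow> bij_betw (\<phi> U) (carrier (sections F U)) (carrier (sections (direct_sum G H) U))"
    using assms unfolding sheaf_isomorphic_def by blast
  note \<phi> = sheaf_homD[OF hom]
  have "sheaf_hom Ox F (direct_sum H G) (\<lambda>U s. prod.swap (\<phi> U s))"
    unfolding sheaf_hom_def using \<phi> by (auto simp: mem_Times_iff)
  moreover have "bij_betw (\<lambda>s. prod.swap (\<phi> U s)) (carrier (sections F U)) (carrier (sections (direct_sum H G) U))"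
    if "open U" for U
  proof -
    have "bij_betw prod.swap (carrier (sections (direct_sum G H) U)) (carrier (sections (direct_sum H G) U))"
      by (simp add: bij_betw_def product_swap)
    from bij_betw_trans[OF bij[OF that] this] show ?thesis by (simp add: comp_def)
  qed
  ultimately show ?thesis unfolding sheaf_isomorphic_def by (intro exI[of _ "\<lambda>U s. prod.swap (\<phi> U s)"]) blast
qed

lemma arrangement_bundle_simps:
  "s \<in> carrier (sections (arrangement_bundle \<alpha> \<A>) U) \<longleftrightarrow>
    fst s \<in> twist_sections UNIV 0 U \<and> fst (snd s) \<in> twist_sections UNIV 0 U \<and> snd (snd s) \<in> twist_sections UNIV 0 U \<and>
    (\<forall>v. peval (partial 1 (defining_poly \<alpha> \<A>)) v * fst s v + peval (partial 2 (defining_poly \<alpha> \<A>)) v * fst (snd s) v +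
      peval (partial 3 (defining_poly \<alpha> \<A>)) v * snd (snd s) v = 0)"
  by (cases s) (auto simp: arrangement_bundle_def gradient_map_def fun_eq_iff)

lemma arrangement_bundle_ops [simp]:
  "s \<oplus>\<^bsub>sections (arrangement_bundle \<alpha> \<A>) U\<^esub> t =
    (\<lambda>v. fst s v + fst t v, \<lambda>v. fst (snd s) v + fst (snd t) v, \<lambda>v. snd (snd s) v + snd (snd t) v)"
  "r \<odot>\<^bsub>sections (arrangement_bundle \<alpha> \<A>) U\<^esub> s = (\<lambda>v. r v * fst s v, \<lambda>v. r v * fst (snd s) v, \<lambda>v. r v * snd (snd s) v)"
  "\<zero>\<^bsub>sections (arrangement_bundle \<alpha> \<A>) U\<^esub> = (\<lambda>v. 0, \<lambda>v. 0, \<lambda>v. 0)"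
  "restr (arrangement_bundle \<alpha> \<A>) U V s = (\<lambda>v. if v \<in> affine_cone V then fst s v else 0,
     \<lambda>v. if v \<in> affine_cone V then fst (snd s) v else 0, \<lambda>v. if v \<in> affine_cone V then snd (snd s) v else 0)"
  by (simp_all add: arrangement_bundle_def)

lemma presheaf_module_arrangement_bundle: "presheaf_module O_plane (arrangement_bundle \<alpha> \<A>)"
proof -
  interpret O: presheaf O_plane by (rule presheaf_twist)
  have 1: "a * (r * x) + b * (r * y) + c * (r * z) = r * (a * x + b * y + c * z)" for a b c r x y z :: complex
    by (simp add: algebra_simps)
  have 2: "a * (x + x') + b * (y + y') + c * (z + z') = (a * x + b * y + c * z) + (a * x' + b * y' + c * z')"
    for a b c x y z x' y' z' :: complex
    by (simp add: algebra_simps)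
  show ?thesis
    by unfold_locales (auto simp: arrangement_bundle_simps tw_restr restr_twice tw_add tw_O_mult 1 2 cong: if_cong)
qed

section \<open>Tensor products\<close>

text \<open>Only closure under the operations is required of the factors; it makes the subgroup of relations lie in the
  free group on \<open>carrier M \<times> carrier N\<close>.\<close>

locale tensor_factors =
  fixes R :: "('r, 'k) ring_scheme" and M :: "('r, 'm) module" and N :: "('r, 'n) module"
  assumes M_add: "\<lbrakk>m \<in> carrier M; m' \<in> carrier M\<rbrakk> \<Longrightarrow> m \<oplus>\<^bsub>M\<^esub> m' \<in> carrier M"
    and M_smult: "\<lbrakk>r \<in> carrier R; m \<in> carrier M\<rbrakk> \<Longrightarrow> r \<odot>\<^bsub>M\<^esub> m \<in> carrier M"
    and N_add: "\<lbrakk>n \<in> carrier N; n' \<in> carrier N\<rbrakk> \<Longrightarrow> n \<oplus>\<^bsub>N\<^esub> n' \<in> carrier N"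
    and N_smult: "\<lbrakk>r \<in> carrier R; n \<in> carrier N\<rbrakk> \<Longrightarrow> r \<odot>\<^bsub>N\<^esub> n \<in> carrier N"
begin

definition "K = generate (tensor_free M N) (tensor_relations R M N)"

abbreviation "S \<equiv> carrier M \<times> carrier N"

lemma keys_minus2:
  "a \<in> S \<Longrightarrow> b \<in> S \<Longrightarrow> c \<in> S \<Longrightarrow> Poly_Mapping.keys (frag_of a - frag_of b - frag_of c) \<subseteq> S"
  "a \<in> S \<Longrightarrow> b \<in> S \<Longrightarrow> Poly_Mapping.keys (frag_of a - frag_of b) \<subseteq> S"
  using keys_diff[of "frag_of a" "frag_of b"] keys_diff[of "frag_of a - frag_of b" "frag_of c"] by auto

lemma relations_carrier: "tensor_relations R M N \<subseteq> carrier (tensor_free M N)"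
  unfolding tensor_relations_def tensor_free_def
  using keys_minus2 M_add M_smult N_add N_smult by fastforce

lemma K_carrier: assumes "u \<in> K" shows "Poly_Mapping.keys u \<subseteq> S"
proof -
  have "u \<in> carrier (free_Abelian_group S)"
    using assms group.generate_incl[OF group_free_Abelian_group relations_carrier[unfolded tensor_free_def]]
    unfolding K_def tensor_free_def by (rule rev_subsetD)
  then show ?thesis by (simp only: carrier_free_Abelian_group_iff)
qed

lemma K_0: "0 \<in> K"
  unfolding K_def tensor_free_def using generate.one[of "free_Abelian_group S"] by simp

lemma K_add: "u \<in> K \<Longrightarrow> w \<in> K \<Longrightarrow> u + w \<in> K"
  unfolding K_def tensor_free_def using generate.eng[of u "free_Abelian_group S"] by simp

lemma K_minus: "u \<in> K \<Longrightarrow> - u \<in> K"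
  using group.generate_m_inv_closed[OF group_free_Abelian_group relations_carrier[unfolded tensor_free_def], of u]
    K_carrier[of u]
  unfolding K_def tensor_free_def by simp

lemma K_diff: "u \<in> K \<Longrightarrow> w \<in> K \<Longrightarrow> u - w \<in> K"
  using K_add[OF _ K_minus] by fastforce

lemma K_induct [consumes 1, case_names add_left add_right balanced zero add minus]:
  assumes "u \<in> K"
    and "\<And>m m' n. m \<in> carrier M \<Longrightarrow> m' \<in> carrier M \<Longrightarrow> n \<in> carrier N \<Longrightarrow>
      P (frag_of (m \<oplus>\<^bsub>M\<^esub> m', n) - frag_of (m, n) - frag_of (m', n))"
    and "\<And>m n n'. m \<in> carrier M \<Longrightarrow> n \<in> carrier N \<Longrightarrow> n' \<in> carrier N \<Longrightarrow>
      P (frag_of (m, n \<oplus>\<^bsub>N\<^esub> n') - frag_of (m, n) - frag_of (m, n'))"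
    and "\<And>r m n. r \<in> carrier R \<Longrightarrow> m \<in> carrier M \<Longrightarrow> n \<in> carrier N \<Longrightarrow>
      P (frag_of (r \<odot>\<^bsub>M\<^esub> m, n) - frag_of (m, r \<odot>\<^bsub>N\<^esub> n))"
    and "P 0" and "\<And>u w. P u \<Longrightarrow> P w \<Longrightarrow> P (u + w)" and "\<And>u. P u \<Longrightarrow> P (- u)"
  shows "P u"
proof -
  have rel: "P h" if "h \<in> tensor_relations R M N" for h
    using that assms(2-4) unfolding tensor_relations_def by blast
  from assms(1) show ?thesis unfolding K_def
  proof (induction rule: generate.induct)
    case (inv h)
    then have "h \<in> carrier (free_Abelian_group S)"
      using relations_carrier unfolding tensor_free_def by (rule subsetD[rotated])
    then have "Poly_Mapping.keys h \<subseteq> S" by (simp only: carrier_free_Abelian_group_iff)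
    then show ?case using assms(7)[OF rel[OF inv]] by (simp add: tensor_free_def)
  qed (use rel assms(5,6) in \<open>auto simp: tensor_free_def\<close>)
qed

lemma relations_in_K:
  "\<lbrakk>m \<in> carrier M; m' \<in> carrier M; n \<in> carrier N\<rbrakk> \<Longrightarrow> frag_of (m \<oplus>\<^bsub>M\<^esub> m', n) - frag_of (m, n) - frag_of (m', n) \<in> K"
  "\<lbrakk>m \<in> carrier M; n \<in> carrier N; n' \<in> carrier N\<rbrakk> \<Longrightarrow> frag_of (m, n \<oplus>\<^bsub>N\<^esub> n') - frag_of (m, n) - frag_of (m, n') \<in> K"
  "\<lbrakk>r \<in> carrier R; m \<in> carrier M; n \<in> carrier N\<rbrakk> \<Longrightarrow> frag_of (r \<odot>\<^bsub>M\<^esub> m, n) - frag_of (m, r \<odot>\<^bsub>N\<^esub> n) \<in> K"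
  unfolding K_def by (rule generate.incl; unfold tensor_relations_def; blast)+

lemma mem_coset: "w \<in> tensor_coset R M N u \<longleftrightarrow> w - u \<in> K"
proof -
  have "w \<in> tensor_coset R M N u \<longleftrightarrow> (\<exists>k\<in>K. w = k + u)"
    by (auto simp: tensor_coset_def r_coset_def K_def tensor_free_def)
  also have "\<dots> \<longleftrightarrow> w - u \<in> K" by (metis add_diff_cancel_right' diff_add_cancel)
  finally show ?thesis .
qed

lemma coset_eq_iff: "tensor_coset R M N u = tensor_coset R M N w \<longleftrightarrow> u - w \<in> K"
proof
  assume "tensor_coset R M N u = tensor_coset R M N w"
  moreover have "u \<in> tensor_coset R M N u" by (simp add: mem_coset K_0)
  ultimately show "u - w \<in> K" by (simp add: mem_coset)
next
  assume *: "u - w \<in> K"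
  have "x - u \<in> K \<longleftrightarrow> x - w \<in> K" for x
    using K_add[OF _ *, of "x - u"] K_diff[OF _ *, of "x - w"] by auto
  then show "tensor_coset R M N u = tensor_coset R M N w" by (simp add: set_eq_iff mem_coset)
qed

lemma coset_add: "tensor_coset R M N u <#>\<^bsub>tensor_free M N\<^esub> tensor_coset R M N w = tensor_coset R M N (u + w)"
proof (intro equalityI subsetI)
  fix x assume "x \<in> tensor_coset R M N u <#>\<^bsub>tensor_free M N\<^esub> tensor_coset R M N w"
  then obtain a b where "x = a + b" "a - u \<in> K" "b - w \<in> K"
    by (auto simp: set_mult_def tensor_free_def mem_coset)
  then show "x \<in> tensor_coset R M N (u + w)" using K_add[of "a - u" "b - w"] by (simp add: mem_coset algebra_simps)
next
  fix x assume "x \<in> tensor_coset R M N (u + w)"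
  then have "x - (u + w) \<in> K" by (simp add: mem_coset)
  then have "x - w \<in> tensor_coset R M N u" "w \<in> tensor_coset R M N w" by (simp_all add: mem_coset K_0 diff_diff_eq add.commute)
  then show "x \<in> tensor_coset R M N u <#>\<^bsub>tensor_free M N\<^esub> tensor_coset R M N w"
    unfolding set_mult_def tensor_free_def by (simp, intro bexI[of _ "x - w"] bexI[of _ w]) simp_all
qed

end

text \<open>The union over a coset in the definition of scalar multiplication and of restriction is a single coset,
  provided that the map respects the relations.\<close>

lemma image_coset:
  assumes "tensor_factors R M N" "tensor_factors R' M' N'"
    and "\<And>u. u \<in> tensor_factors.K R M N \<Longrightarrow> frag_extend f u \<in> tensor_factors.K R' M' N'"
  shows "(\<Union>u\<in>tensor_coset R M N w. tensor_coset R' M' N' (frag_extend f u)) = tensor_coset R' M' N' (frag_extend f w)"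
proof -
  interpret A: tensor_factors R M N by fact
  interpret B: tensor_factors R' M' N' by fact
  have "tensor_coset R' M' N' (frag_extend f u) = tensor_coset R' M' N' (frag_extend f w)"
    if "u \<in> tensor_coset R M N w" for u
    using assms(3)[of "u - w"] that by (simp add: A.mem_coset B.coset_eq_iff frag_extend_diff)
  moreover have "w \<in> tensor_coset R M N w" by (simp add: A.mem_coset A.K_0)
  ultimately show ?thesis by blast
qed

text \<open>The homomorphism from the free abelian group to the complex numbers that extends \<open>f\<close>.\<close>

definition frag_eval :: "('a \<Rightarrow> complex) \<Rightarrow> ('a \<Rightarrow>\<^sub>0 int) \<Rightarrow> complex"
  where "frag_eval f u = (\<Sum>k\<in>Poly_Mapping.keys u. of_int (Poly_Mapping.lookup u k) * f k)"

lemma frag_eval_superset: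
  "finite A \<Longrightarrow> Poly_Mapping.keys u \<subseteq> A \<Longrightarrow> frag_eval f u = (\<Sum>k\<in>A. of_int (Poly_Mapping.lookup u k) * f k)"
  unfolding frag_eval_def by (intro sum.mono_neutral_left) (auto simp: in_keys_iff)

lemma frag_eval_0 [simp]: "frag_eval f 0 = 0"
  by (simp add: frag_eval_def)

lemma frag_eval_of [simp]: "frag_eval f (frag_of a) = f a"
  by (simp add: frag_eval_def)

lemma frag_eval_add: "frag_eval f (u + w) = frag_eval f u + frag_eval f w"
proof -
  let ?A = "Poly_Mapping.keys u \<union> Poly_Mapping.keys w"
  have "frag_eval f (u + w) = (\<Sum>k\<in>?A. of_int (Poly_Mapping.lookup (u + w) k) * f k)"
    by (rule frag_eval_superset) (use keys_add[of u w] in auto)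
  then show ?thesis
    by (simp add: lookup_add algebra_simps sum.distrib frag_eval_superset[of ?A u] frag_eval_superset[of ?A w])
qed

lemma frag_eval_minus: "frag_eval f (- u) = - frag_eval f u"
  using frag_eval_add[of f u "- u"] by (simp add: eq_neg_iff_add_eq_0 add.commute)

lemma frag_eval_diff: "frag_eval f (u - w) = frag_eval f u - frag_eval f w"
  using frag_eval_add[of f u "- w"] by (simp add: frag_eval_minus)

lemma keys_frag_extend_pair:
  assumes "Poly_Mapping.keys u \<subseteq> A \<times> B" "\<And>m. m \<in> A \<Longrightarrow> f m \<in> A'" "\<And>n. n \<in> B \<Longrightarrow> g n \<in> B'"
  shows "Poly_Mapping.keys (frag_extend (\<lambda>(m, n). frag_of (f m, g n)) u) \<subseteq> A' \<times> B'"
proof -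
  have "(\<Union>x\<in>Poly_Mapping.keys u. Poly_Mapping.keys (case x of (m, n) \<Rightarrow> frag_of (f m, g n))) \<subseteq> A' \<times> B'"
  proof (rule UN_least)
    fix x assume "x \<in> Poly_Mapping.keys u"
    then have "fst x \<in> A" "snd x \<in> B" using assms(1) by auto
    then show "Poly_Mapping.keys (case x of (m, n) \<Rightarrow> frag_of (f m, g n)) \<subseteq> A' \<times> B'"
      using assms(2,3) by (cases x) simp
  qed
  then show ?thesis using keys_frag_extend by (rule order_trans[rotated])
qed

text \<open>The two module laws are exactly what makes scalar multiplication on the first factor respect the relations of
  the tensor product.\<close>

locale tensor_presheaves = F: presheaf_module Ox F + G: presheaf_module Ox G
  for Ox :: "('x::topological_space, 'r, 'r) module_presheaf" and F :: "('x, 'r, 'm) module_presheaf"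
    and G :: "('x, 'r, 'n) module_presheaf" +
  assumes smult_add: "\<lbrakk>open U; r \<in> carrier (sections Ox U); s \<in> carrier (sections F U); t \<in> carrier (sections F U)\<rbrakk> \<Longrightarrow>
      r \<odot>\<^bsub>sections F U\<^esub> (s \<oplus>\<^bsub>sections F U\<^esub> t) = r \<odot>\<^bsub>sections F U\<^esub> s \<oplus>\<^bsub>sections F U\<^esub> r \<odot>\<^bsub>sections F U\<^esub> t"
    and smult_left_commute: "\<lbrakk>open U; r \<in> carrier (sections Ox U); r' \<in> carrier (sections Ox U); s \<in> carrier (sections F U)\<rbrakk> \<Longrightarrow>
      r \<odot>\<^bsub>sections F U\<^esub> (r' \<odot>\<^bsub>sections F U\<^esub> s) = r' \<odot>\<^bsub>sections F U\<^esub> (r \<odot>\<^bsub>sections F U\<^esub> s)"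
begin

abbreviation "P \<equiv> tensor_presheaf Ox F G"
abbreviation "coset U \<equiv> tensor_coset (sections Ox U) (sections F U) (sections G U)"
abbreviation "KK U \<equiv> tensor_factors.K (sections Ox U) (sections F U) (sections G U)"
abbreviation "SS U \<equiv> carrier (sections F U) \<times> carrier (sections G U)"
abbreviation "rmap U V \<equiv> frag_extend (\<lambda>(m, n). frag_of (restr F U V m, restr G U V n))"
abbreviation "smap U r \<equiv> frag_extend (\<lambda>(m, n). frag_of (r \<odot>\<^bsub>sections F U\<^esub> m, n))"

lemma tf: "open U \<Longrightarrow> tensor_factors (sections Ox U) (sections F U) (sections G U)"
  by unfold_locales (simp_all add: F.add_closed G.add_closed F.smult_closed G.smult_closed)

lemma tensor_carrier: "A \<in> carrier (sections P U) \<longleftrightarrow> (\<exists>u. Poly_Mapping.keys u \<subseteq> SS U \<and> A = coset U u)"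
  unfolding tensor_presheaf_def tensor_module_def tensor_free_def
  by (simp add: image_iff Bex_def)

lemma tensor_carrierI: "Poly_Mapping.keys u \<subseteq> SS U \<Longrightarrow> coset U u \<in> carrier (sections P U)"
  using tensor_carrier by blast

lemma tensor_add: "open U \<Longrightarrow> coset U u \<oplus>\<^bsub>sections P U\<^esub> coset U w = coset U (u + w)"
  by (simp add: tensor_presheaf_def tensor_module_def tensor_factors.coset_add[OF tf])

lemma rmap_K:
  assumes "open U" "open V" "V \<subseteq> U" "u \<in> KK U"
  shows "rmap U V u \<in> KK V"
proof -
  interpret A: tensor_factors "sections Ox U" "sections F U" "sections G U" by (rule tf[OF assms(1)])
  interpret B: tensor_factors "sections Ox V" "sections F V" "sections G V" by (rule tf[OF assms(2)])
  note cl = F.restr_closed[OF assms(1-3)] G.restr_closed[OF assms(1-3)] F.Ox.restr_closed[OF assms(1-3)]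
  from assms(4) show ?thesis
  proof (induction rule: A.K_induct)
    case (add_left m m' n)
    then show ?case using B.relations_in_K(1)[OF cl(1) cl(1) cl(2)]
      by (simp add: frag_extend_diff F.restr_add[OF assms(1-3)])
  next
    case (add_right m n n')
    then show ?case using B.relations_in_K(2)[OF cl(1) cl(2) cl(2)]
      by (simp add: frag_extend_diff G.restr_add[OF assms(1-3)])
  next
    case (balanced r m n)
    then show ?case using B.relations_in_K(3)[OF cl(3) cl(1) cl(2)]
      by (simp add: frag_extend_diff F.restr_smult[OF assms(1-3)] G.restr_smult[OF assms(1-3)])
  qed (simp_all add: B.K_0 B.K_add B.K_minus frag_extend_add frag_extend_minus)
qed

lemma smap_K:
  assumes "open U" "r \<in> carrier (sections Ox U)" "u \<in> KK U"
  shows "smap U r u \<in> KK U"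
proof -
  interpret A: tensor_factors "sections Ox U" "sections F U" "sections G U" by (rule tf[OF assms(1)])
  note cl = F.smult_closed[OF assms(1,2)]
  from assms(3) show ?thesis
  proof (induction rule: A.K_induct)
    case (add_left m m' n)
    then show ?case using A.relations_in_K(1)[OF cl cl, of m m' n]
      by (simp add: frag_extend_diff smult_add[OF assms(1,2)])
  next
    case (add_right m n n')
    then show ?case using A.relations_in_K(2)[OF cl, of m n n'] by (simp add: frag_extend_diff)
  next
    case (balanced r' m n)
    then show ?case using A.relations_in_K(3)[OF _ cl, of r' m n]
      by (simp add: frag_extend_diff smult_left_commute[OF assms(1,2), of r' m])
  qed (simp_all add: A.K_0 A.K_add A.K_minus frag_extend_add frag_extend_minus)
qed

lemma tensor_restr: "open U \<Longrightarrow> open V \<Longrightarrow> V \<subseteq> U \<Longrightarrow> restr P U V (coset U u) = coset V (rmap U V u)"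
  by (simp add: tensor_presheaf_def image_coset[OF tf tf rmap_K])

lemma tensor_smult: "open U \<Longrightarrow> r \<in> carrier (sections Ox U) \<Longrightarrow> r \<odot>\<^bsub>sections P U\<^esub> coset U u = coset U (smap U r u)"
  by (simp add: tensor_presheaf_def tensor_module_def image_coset[OF tf tf smap_K])

lemma keys_rmap: "open U \<Longrightarrow> open V \<Longrightarrow> V \<subseteq> U \<Longrightarrow> Poly_Mapping.keys u \<subseteq> SS U \<Longrightarrow> Poly_Mapping.keys (rmap U V u) \<subseteq> SS V"
  by (rule keys_frag_extend_pair) (assumption, (rule F.restr_closed G.restr_closed; assumption)+)

lemma keys_smap: "open U \<Longrightarrow> r \<in> carrier (sections Ox U) \<Longrightarrow> Poly_Mapping.keys u \<subseteq> SS U \<Longrightarrow> Poly_Mapping.keys (smap U r u) \<subseteq> SS U"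
  by (rule keys_frag_extend_pair) (assumption, (rule F.smult_closed; assumption)+)

lemma rmap_rmap:
  assumes "open U" "open V" "open W" "W \<subseteq> V" "V \<subseteq> U" "Poly_Mapping.keys u \<subseteq> SS U"
  shows "rmap V W (rmap U V u) = rmap U W u"
  using assms(6)
proof (induction rule: frag_induction)
  case (one a)
  then show ?case using F.restr_restr[OF assms(1-5)] G.restr_restr[OF assms(1-5)] by (cases a) simp
qed (simp_all add: frag_extend_diff)

lemma rmap_smap:
  assumes "open U" "open V" "V \<subseteq> U" "r \<in> carrier (sections Ox U)" "Poly_Mapping.keys u \<subseteq> SS U"
  shows "rmap U V (smap U r u) = smap V (restr Ox U V r) (rmap U V u)"
  using assms(5)
proof (induction rule: frag_induction)
  case (one a)
  then show ?case using F.restr_smult[OF assms(1-4)] by (cases a) simp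
qed (simp_all add: frag_extend_diff)

lemma presheaf_module_tensor: "presheaf_module Ox P"
proof unfold_locales
  fix U V s
  assume 1: "open U" "open V" "V \<subseteq> U" "s \<in> carrier (sections P U)"
  then obtain u where u: "Poly_Mapping.keys u \<subseteq> SS U" "s = coset U u" using tensor_carrier by blast
  show "restr P U V s \<in> carrier (sections P V)"
    using tensor_carrierI keys_rmap[OF 1(1-3) u(1)] by (simp add: u(2) tensor_restr[OF 1(1-3)])
next
  fix U V W s
  assume 1: "open U" "open V" "open W" "W \<subseteq> V" "V \<subseteq> U" "s \<in> carrier (sections P U)"
  then obtain u where u: "Poly_Mapping.keys u \<subseteq> SS U" "s = coset U u" using tensor_carrier by blast
  have "W \<subseteq> U" using 1 by blast
  then show "restr P V W (restr P U V s) = restr P U W s"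
    using 1 u rmap_rmap[OF 1(1-5) u(1)] by (simp add: tensor_restr)
next
  fix U s t
  assume 1: "open U" "s \<in> carrier (sections P U)" "t \<in> carrier (sections P U)"
  obtain u where u: "Poly_Mapping.keys u \<subseteq> SS U" "s = coset U u" using tensor_carrier 1 by blast
  obtain w where w: "Poly_Mapping.keys w \<subseteq> SS U" "t = coset U w" using tensor_carrier 1 by blast
  have "Poly_Mapping.keys (u + w) \<subseteq> SS U" using keys_add[of u w] u w by blast
  then show "s \<oplus>\<^bsub>sections P U\<^esub> t \<in> carrier (sections P U)"
    using tensor_carrierI u w tensor_add[OF 1(1)] by simp
  fix V assume V: "open V" "V \<subseteq> U"
  show "restr P U V (s \<oplus>\<^bsub>sections P U\<^esub> t) = restr P U V s \<oplus>\<^bsub>sections P V\<^esub> restr P U V t"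
    by (simp add: u w tensor_add 1 V tensor_restr frag_extend_add)
next
  fix U r s
  assume 1: "open U" "r \<in> carrier (sections Ox U)" "s \<in> carrier (sections P U)"
  obtain u where u: "Poly_Mapping.keys u \<subseteq> SS U" "s = coset U u" using tensor_carrier 1 by blast
  show "r \<odot>\<^bsub>sections P U\<^esub> s \<in> carrier (sections P U)"
    using tensor_carrierI[OF keys_smap[OF 1(1,2) u(1)]] by (simp add: u tensor_smult 1)
  fix V assume V: "open V" "V \<subseteq> U"
  have "restr Ox U V r \<in> carrier (sections Ox V)" using F.Ox.restr_closed 1 V by simp
  then show "restr P U V (r \<odot>\<^bsub>sections P U\<^esub> s) = restr Ox U V r \<odot>\<^bsub>sections P V\<^esub> restr P U V s"
    using rmap_smap[OF 1(1) V 1(2) u(1)] by (simp add: u tensor_smult 1 V tensor_restr)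
qed

end

section \<open>Factoring through a locally surjective morphism\<close>

text \<open>The universal property of a quotient sheaf: preimages under \<open>\<Psi>\<close> exist locally, and their
  images under \<open>\<rho>\<close> agree and can be glued.\<close>

lemma sheaf_hom_factor:
  fixes E :: "('x::topological_space, 'r, 'e) module_presheaf" and T :: "('x, 'r, 't) module_presheaf"
    and G :: "('x, 'r, 'g) module_presheaf"
  assumes "presheaf_module Ox E" "presheaf_module Ox T" "sheaf_of_modules Ox G"
    and \<Psi>: "sheaf_hom Ox E T \<Psi>" and \<rho>: "sheaf_hom Ox E G \<rho>"
    and surj: "\<And>U t. open U \<Longrightarrow> t \<in> carrier (sections T U) \<Longrightarrow> locally_in_image E T \<Psi> U t"
    and ker: "\<And>U y y'. \<lbrakk>open U; y \<in> carrier (sections E U); y' \<in> carrier (sections E U); \<Psi> U y = \<Psi> U y'\<rbrakk> \<Longrightarrow> \<rho> U y = \<rho> U y'"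
  obtains \<Theta> where "sheaf_hom Ox T G \<Theta>"
    "\<And>U y. open U \<Longrightarrow> y \<in> carrier (sections E U) \<Longrightarrow> \<Theta> U (\<Psi> U y) = \<rho> U y"
proof -
  interpret E: presheaf_module Ox E by fact
  interpret T: presheaf_module Ox T by fact
  interpret G: sheaf_of_modules Ox G by fact
  note \<psi> = sheaf_homD[OF \<Psi>] and r = sheaf_homD[OF \<rho>]
  define R where "R U t g \<longleftrightarrow> (\<forall>x\<in>U. \<exists>V y. open V \<and> x \<in> V \<and> V \<subseteq> U \<and> y \<in> carrier (sections E V) \<and>
     \<Psi> V y = restr T U V t \<and> \<rho> V y = restr G U V g)" for U t g
  have RE: "\<exists>V y. open V \<and> x \<in> V \<and> V \<subseteq> U \<and> y \<in> carrier (sections E V) \<and>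
     \<Psi> V y = restr T U V t \<and> \<rho> V y = restr G U V g" if "R U t g" "x \<in> U" for U t g x
    using that unfolding R_def by blast
  have shr: "restr E V W y \<in> carrier (sections E W) \<and> \<Psi> W (restr E V W y) = restr T U W t"
    if "open U" "open V" "open W" "W \<subseteq> V" "V \<subseteq> U" "y \<in> carrier (sections E V)"
      "\<Psi> V y = restr T U V t" "t \<in> carrier (sections T U)" for U V W y t
    using that E.restr_closed[of V W y] \<psi>(4)[of V W y] T.restr_restr[of U V W t] by simp
  have shr': "\<rho> W (restr E V W y) = restr G U W g"
    if "open U" "open V" "open W" "W \<subseteq> V" "V \<subseteq> U" "y \<in> carrier (sections E V)"
      "\<rho> V y = restr G U V g" "g \<in> carrier (sections G U)" for U V W y g
    using that r(4)[of V W y] G.restr_restr[of U V W g] by simp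
  have exR: "\<exists>g\<in>carrier (sections G U). R U t g" if U: "open U" and t: "t \<in> carrier (sections T U)" for U t
  proof -
    have "\<forall>x\<in>U. \<exists>V y. open V \<and> x \<in> V \<and> V \<subseteq> U \<and> y \<in> carrier (sections E V) \<and> \<Psi> V y = restr T U V t"
      using surj[OF U t] unfolding locally_in_image_def by blast
    then obtain V y where V: "\<And>x. x \<in> U \<Longrightarrow> open (V x) \<and> x \<in> V x \<and> V x \<subseteq> U \<and> y x \<in> carrier (sections E (V x)) \<and>
        \<Psi> (V x) (y x) = restr T U (V x) t"
      by (rule bchoice2E) (rule that)
    have "\<exists>g\<in>carrier (sections G U). \<forall>x\<in>U. restr G U (V x) g = \<rho> (V x) (y x)"
    proof (rule G.glue[OF U])
      show "open (V x) \<and> x \<in> V x \<and> V x \<subseteq> U \<and> \<rho> (V x) (y x) \<in> carrier (sections G (V x))" if "x \<in> U" for x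
        using V[OF that] r(1)[of "V x" "y x"] by simp
      fix x x' z assume x: "x \<in> U" "x' \<in> U" "z \<in> V x" "z \<in> V x'"
      let ?W = "V x \<inter> V x'"
      have a: "open (V x)" "V x \<subseteq> U" "y x \<in> carrier (sections E (V x))" "\<Psi> (V x) (y x) = restr T U (V x) t"
        and b: "open (V x')" "V x' \<subseteq> U" "y x' \<in> carrier (sections E (V x'))" "\<Psi> (V x') (y x') = restr T U (V x') t"
        using V[OF x(1)] V[OF x(2)] by auto
      have W: "open ?W" "?W \<subseteq> V x" "?W \<subseteq> V x'" using a b by auto
      note 1 = shr[OF U a(1) W(1,2) a(2-4) t] and 2 = shr[OF U b(1) W(1,3) b(2-4) t]
      have "\<rho> ?W (restr E (V x) ?W (y x)) = \<rho> ?W (restr E (V x') ?W (y x'))"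
        by (rule ker[OF W(1)]) (use 1 2 in simp_all)
      then have "restr G (V x) ?W (\<rho> (V x) (y x)) = restr G (V x') ?W (\<rho> (V x') (y x'))"
        using r(4)[OF a(1) W(1,2) a(3)] r(4)[OF b(1) W(1,3) b(3)] by simp
      then show "\<exists>W. open W \<and> z \<in> W \<and> W \<subseteq> V x \<and> W \<subseteq> V x' \<and>
          restr G (V x) W (\<rho> (V x) (y x)) = restr G (V x') W (\<rho> (V x') (y x'))"
        using W x by (intro exI[of _ ?W]) simp
    qed
    then obtain g where g: "g \<in> carrier (sections G U)" "\<And>x. x \<in> U \<Longrightarrow> restr G U (V x) g = \<rho> (V x) (y x)" by blast
    have "R U t g" unfolding R_def
    proof
      fix x assume "x \<in> U"
      then show "\<exists>V y. open V \<and> x \<in> V \<and> V \<subseteq> U \<and> y \<in> carrier (sections E V) \<and> \<Psi> V y = restr T U V t \<and> \<rho> V y = restr G U V g"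
        using V[of x] g(2)[of x] by (intro exI[of _ "V x"] exI[of _ "y x"]) simp
    qed
    then show ?thesis using g(1) by blast
  qed
  have uniq: "g = h" if U: "open U" and t: "t \<in> carrier (sections T U)" and g: "g \<in> carrier (sections G U)" "h \<in> carrier (sections G U)"
    and R: "R U t g" "R U t h" for U t g h
  proof (rule G.separated[OF U g])
    fix x assume x: "x \<in> U"
    obtain V y where V: "open V" "x \<in> V" "V \<subseteq> U" "y \<in> carrier (sections E V)" "\<Psi> V y = restr T U V t" "\<rho> V y = restr G U V g"
      using RE[OF R(1) x] by blast
    obtain V' y' where V': "open V'" "x \<in> V'" "V' \<subseteq> U" "y' \<in> carrier (sections E V')" "\<Psi> V' y' = restr T U V' t" "\<rho> V' y' = restr G U V' h"
      using RE[OF R(2) x] by blast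
    let ?W = "V \<inter> V'"
    have W: "open ?W" "x \<in> ?W" "?W \<subseteq> V" "?W \<subseteq> V'" "?W \<subseteq> U" using V V' by auto
    have "\<rho> ?W (restr E V ?W y) = \<rho> ?W (restr E V' ?W y')"
      by (rule ker[OF W(1)])
        (use shr[OF U V(1) W(1,3) V(3-5) t] shr[OF U V'(1) W(1,4) V'(3-5) t] in simp_all)
    then have "restr G U ?W g = restr G U ?W h"
      using shr'[OF U V(1) W(1,3) V(3,4,6) g(1)] shr'[OF U V'(1) W(1,4) V'(3,4,6) g(2)] by simp
    with W show "\<exists>V. open V \<and> x \<in> V \<and> V \<subseteq> U \<and> restr G U V g = restr G U V h" by (intro exI[of _ ?W]) simp
  qed
  define \<Theta> where "\<Theta> U t = (THE g. g \<in> carrier (sections G U) \<and> R U t g)" for U t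
  have \<Theta>_eq: "\<Theta> U t = g" if "open U" "t \<in> carrier (sections T U)" "g \<in> carrier (sections G U)" "R U t g" for U t g
    unfolding \<Theta>_def using that(3,4) uniq[OF that(1,2) _ that(3) _ that(4)] by (intro the_equality conjI) blast+
  have \<Theta>: "\<Theta> U t \<in> carrier (sections G U)" "R U t (\<Theta> U t)"
    if Ut: "open U" "t \<in> carrier (sections T U)" for U t
  proof -
    obtain g where "g \<in> carrier (sections G U)" "R U t g" using exR[OF Ut] by blast
    then show "\<Theta> U t \<in> carrier (sections G U)" "R U t (\<Theta> U t)" using \<Theta>_eq[OF Ut] by simp_all
  qed
  have R_add: "R U (t \<oplus>\<^bsub>sections T U\<^esub> t') (g \<oplus>\<^bsub>sections G U\<^esub> h)"
    if U: "open U" and t: "t \<in> carrier (sections T U)" "t' \<in> carrier (sections T U)"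
      and g: "g \<in> carrier (sections G U)" "h \<in> carrier (sections G U)" and R: "R U t g" "R U t' h" for U t t' g h
    unfolding R_def
  proof
    fix x assume x: "x \<in> U"
    obtain V y where V: "open V" "x \<in> V" "V \<subseteq> U" "y \<in> carrier (sections E V)" "\<Psi> V y = restr T U V t" "\<rho> V y = restr G U V g"
      using RE[OF R(1) x] by blast
    obtain V' y' where V': "open V'" "x \<in> V'" "V' \<subseteq> U" "y' \<in> carrier (sections E V')" "\<Psi> V' y' = restr T U V' t'" "\<rho> V' y' = restr G U V' h"
      using RE[OF R(2) x] by blast
    let ?W = "V \<inter> V'"
    have W: "open ?W" "x \<in> ?W" "?W \<subseteq> V" "?W \<subseteq> V'" "?W \<subseteq> U" using V V' by auto
    note 1 = shr[OF U V(1) W(1,3) V(3-5) t(1)] and 2 = shr[OF U V'(1) W(1,4) V'(3-5) t(2)]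
    note 3 = shr'[OF U V(1) W(1,3) V(3,4,6) g(1)] and 4 = shr'[OF U V'(1) W(1,4) V'(3,4,6) g(2)]
    let ?y = "restr E V ?W y" and ?y' = "restr E V' ?W y'"
    have "?y \<oplus>\<^bsub>sections E ?W\<^esub> ?y' \<in> carrier (sections E ?W)" using E.add_closed[OF W(1)] 1 2 by simp
    moreover have "\<Psi> ?W (?y \<oplus>\<^bsub>sections E ?W\<^esub> ?y') = restr T U ?W (t \<oplus>\<^bsub>sections T U\<^esub> t')"
      using 1 2 \<psi>(2)[OF W(1)] T.restr_add[OF U W(1,5) t] by simp
    moreover have "\<rho> ?W (?y \<oplus>\<^bsub>sections E ?W\<^esub> ?y') = restr G U ?W (g \<oplus>\<^bsub>sections G U\<^esub> h)"
      using 1 2 3 4 r(2)[OF W(1)] G.restr_add[OF U W(1,5) g] by simp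
    ultimately show "\<exists>V y. open V \<and> x \<in> V \<and> V \<subseteq> U \<and> y \<in> carrier (sections E V) \<and>
        \<Psi> V y = restr T U V (t \<oplus>\<^bsub>sections T U\<^esub> t') \<and> \<rho> V y = restr G U V (g \<oplus>\<^bsub>sections G U\<^esub> h)"
      using W by (intro exI[of _ ?W] exI[of _ "?y \<oplus>\<^bsub>sections E ?W\<^esub> ?y'"]) simp
  qed
  have R_smult: "R U (k \<odot>\<^bsub>sections T U\<^esub> t) (k \<odot>\<^bsub>sections G U\<^esub> g)"
    if U: "open U" and k: "k \<in> carrier (sections Ox U)" and t: "t \<in> carrier (sections T U)"
      and g: "g \<in> carrier (sections G U)" and R: "R U t g" for U t k g
    unfolding R_def
  proof
    fix x assume x: "x \<in> U"
    obtain V y where V: "open V" "x \<in> V" "V \<subseteq> U" "y \<in> carrier (sections E V)" "\<Psi> V y = restr T U V t" "\<rho> V y = restr G U V g"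
      using RE[OF R x] by blast
    let ?k = "restr Ox U V k"
    have kV: "?k \<in> carrier (sections Ox V)" using E.Ox.restr_closed[OF U V(1,3) k] .
    have "\<Psi> V (?k \<odot>\<^bsub>sections E V\<^esub> y) = restr T U V (k \<odot>\<^bsub>sections T U\<^esub> t)"
      using \<psi>(3)[OF V(1) kV V(4)] V(5) T.restr_smult[OF U V(1,3) k t] by simp
    moreover have "\<rho> V (?k \<odot>\<^bsub>sections E V\<^esub> y) = restr G U V (k \<odot>\<^bsub>sections G U\<^esub> g)"
      using r(3)[OF V(1) kV V(4)] V(6) G.restr_smult[OF U V(1,3) k g] by simp
    ultimately show "\<exists>V y. open V \<and> x \<in> V \<and> V \<subseteq> U \<and> y \<in> carrier (sections E V) \<and>
        \<Psi> V y = restr T U V (k \<odot>\<^bsub>sections T U\<^esub> t) \<and> \<rho> V y = restr G U V (k \<odot>\<^bsub>sections G U\<^esub> g)"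
      using V(1-3) E.smult_closed[OF V(1) kV V(4)] by (intro exI[of _ V] exI[of _ "?k \<odot>\<^bsub>sections E V\<^esub> y"]) simp
  qed
  have R_restr: "R V (restr T U V t) (restr G U V g)"
    if U: "open U" and V: "open V" "V \<subseteq> U" and t: "t \<in> carrier (sections T U)"
      and g: "g \<in> carrier (sections G U)" and R: "R U t g" for U V t g
    unfolding R_def
  proof
    fix x assume x: "x \<in> V"
    have xU: "x \<in> U" using x V(2) by blast
    obtain V' y where V': "open V'" "x \<in> V'" "V' \<subseteq> U" "y \<in> carrier (sections E V')" "\<Psi> V' y = restr T U V' t" "\<rho> V' y = restr G U V' g"
      using RE[OF R xU] by blast
    let ?W = "V \<inter> V'"
    have W: "open ?W" "x \<in> ?W" "?W \<subseteq> V" "?W \<subseteq> V'" using V V' x by auto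
    have "restr G V ?W (restr G U V g) = restr G U ?W g" "restr T V ?W (restr T U V t) = restr T U ?W t"
      using G.restr_restr[OF U V(1) W(1,3) V(2) g] T.restr_restr[OF U V(1) W(1,3) V(2) t] by simp_all
    then show "\<exists>V' y. open V' \<and> x \<in> V' \<and> V' \<subseteq> V \<and> y \<in> carrier (sections E V') \<and>
        \<Psi> V' y = restr T V V' (restr T U V t) \<and> \<rho> V' y = restr G V V' (restr G U V g)"
      using shr[OF U V'(1) W(1,4) V'(3-5) t] shr'[OF U V'(1) W(1,4) V'(3,4,6) g] W
      by (intro exI[of _ ?W] exI[of _ "restr E V' ?W y"]) simp
  qed
  have "sheaf_hom Ox T G \<Theta>"
    unfolding sheaf_hom_def
  proof (intro allI impI conjI ballI funcsetI)
    fix U :: "'x set" assume U: "open U"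
    fix t assume t: "t \<in> carrier (sections T U)"
    show "\<Theta> U t \<in> carrier (sections G U)" using \<Theta>[OF U t] by blast
    {
      fix t' assume t': "t' \<in> carrier (sections T U)"
      show "\<Theta> U (t \<oplus>\<^bsub>sections T U\<^esub> t') = \<Theta> U t \<oplus>\<^bsub>sections G U\<^esub> \<Theta> U t'"
        by (rule \<Theta>_eq[OF U T.add_closed[OF U t t'] G.add_closed[OF U] R_add[OF U t t']])
          (rule \<Theta>[OF U t] \<Theta>[OF U t'])+
    next
      fix V assume V: "open V" "V \<subseteq> U"
      show "\<Theta> V (restr T U V t) = restr G U V (\<Theta> U t)"
        by (rule \<Theta>_eq[OF V(1) T.restr_closed[OF U V t] G.restr_closed[OF U V] R_restr[OF U V t]])
          (rule \<Theta>[OF U t])+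
    }
    fix k assume k: "k \<in> carrier (sections Ox U)"
    show "\<Theta> U (k \<odot>\<^bsub>sections T U\<^esub> t) = k \<odot>\<^bsub>sections G U\<^esub> \<Theta> U t"
      by (rule \<Theta>_eq[OF U T.smult_closed[OF U k t] G.smult_closed[OF U k] R_smult[OF U k t]])
        (rule \<Theta>[OF U t])+
  qed
  moreover have "\<Theta> U (\<Psi> U y) = \<rho> U y" if U: "open U" and y: "y \<in> carrier (sections E U)" for U y
  proof (rule \<Theta>_eq[OF U \<psi>(1)[OF U y] r(1)[OF U y]])
    show "R U (\<Psi> U y) (\<rho> U y)" unfolding R_def
    proof
      fix x assume x: "x \<in> U"
      show "\<exists>V y'. open V \<and> x \<in> V \<and> V \<subseteq> U \<and> y' \<in> carrier (sections E V) \<and>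
          \<Psi> V y' = restr T U V (\<Psi> U y) \<and> \<rho> V y' = restr G U V (\<rho> U y)"
        using U x E.restr_closed[OF U U subset_refl y] \<psi>(4)[OF U U subset_refl y] r(4)[OF U U subset_refl y]
        by (intro exI[of _ U] exI[of _ "restr E U U y"]) simp
    qed
  qed
  ultimately show thesis by (rule that)
qed

section \<open>Restriction to a line\<close>

lemma tensor_presheaves_bundle: "tensor_presheaves O_plane (arrangement_bundle \<alpha> \<A>) (twist l 0)"
proof -
  interpret F: presheaf_module O_plane "arrangement_bundle \<alpha> \<A>" by (rule presheaf_module_arrangement_bundle)
  interpret G: presheaf_module O_plane "twist l 0" by (rule presheaf_module_twist)
  show ?thesis by unfold_locales (simp_all add: algebra_simps)
qed

text \<open>A morphism from the bundle to a sum of two twists on the line that is surjective and whose kernel is locally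
  generated by multiples of functions vanishing on the line. Under these assumptions the target is the tensor
  product with the structure sheaf of the line.\<close>

locale line_restriction =
  fixes p :: poly3 and l :: "proj_plane set" and \<alpha> :: "proj_plane set \<Rightarrow> poly3" and \<A> :: "proj_plane set set"
    and i j :: int and \<Theta>
  assumes line: "defines_line p l"
    and hom: "sheaf_hom O_plane (arrangement_bundle \<alpha> \<A>) (direct_sum (twist l i) (twist l j)) \<Theta>"
    and surj: "\<And>U g. \<lbrakk>open U; g \<in> carrier (sections (direct_sum (twist l i) (twist l j)) U)\<rbrakk> \<Longrightarrow>
      locally_in_image (arrangement_bundle \<alpha> \<A>) (direct_sum (twist l i) (twist l j)) \<Theta> U g"
    and ker: "\<And>U t t' x. \<lbrakk>open U; t \<in> carrier (sections (arrangement_bundle \<alpha> \<A>) U);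
        t' \<in> carrier (sections (arrangement_bundle \<alpha> \<A>) U); \<Theta> U t = \<Theta> U t'; x \<in> U; x \<in> l\<rbrakk> \<Longrightarrow>
      \<exists>V c t''. open V \<and> x \<in> V \<and> V \<subseteq> U \<and> c \<in> twist_sections UNIV 0 V \<and> (\<forall>v\<in>affine_cone (V \<inter> l). c v = 0) \<and>
        t'' \<in> carrier (sections (arrangement_bundle \<alpha> \<A>) V) \<and>
        restr (arrangement_bundle \<alpha> \<A>) U V t = restr (arrangement_bundle \<alpha> \<A>) U V t'
          \<oplus>\<^bsub>sections (arrangement_bundle \<alpha> \<A>) V\<^esub> c \<odot>\<^bsub>sections (arrangement_bundle \<alpha> \<A>) V\<^esub> t''"
begin

abbreviation "T \<equiv> arrangement_bundle \<alpha> \<A>"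
abbreviation "GG \<equiv> direct_sum (twist l i) (twist l j)"
abbreviation "un W \<equiv> (\<lambda>v. if v \<in> affine_cone (W \<inter> l) then 1 else 0 :: complex)"

sublocale tensor_presheaves O_plane T "twist l 0" by (rule tensor_presheaves_bundle)

lemmas \<Theta> = sheaf_homD[OF hom]

lemma open_off_line: "open (- l)"
  using open_nonzero_locus[OF defines_lineD(1)[OF line]] defines_lineD(3)[OF line]
  by (simp add: nonzero_locus_def)

lemma un_closed: "open W \<Longrightarrow> un W \<in> carrier (sections (twist l 0) W)"
  using tw_form[of 0 1 W l] by (simp add: homog_one cong: if_cong)

lemma T_zero: "open W \<Longrightarrow> \<zero>\<^bsub>sections T W\<^esub> \<in> carrier (sections T W)"
  by (simp add: arrangement_bundle_simps tw_zero)

lemma zero_tensor: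
  assumes W: "open W" and n: "n \<in> carrier (sections (twist l 0) W)"
  shows "frag_of (\<zero>\<^bsub>sections T W\<^esub>, n) \<in> KK W"
proof -
  interpret A: tensor_factors "sections O_plane W" "sections T W" "sections (twist l 0) W" by (rule tf[OF W])
  have "frag_of (\<zero>\<^bsub>sections T W\<^esub> \<oplus>\<^bsub>sections T W\<^esub> \<zero>\<^bsub>sections T W\<^esub>, n)
    - frag_of (\<zero>\<^bsub>sections T W\<^esub>, n) - frag_of (\<zero>\<^bsub>sections T W\<^esub>, n) \<in> KK W"
    by (rule A.relations_in_K(1)[OF T_zero[OF W] T_zero[OF W] n])
  then have "- frag_of (\<zero>\<^bsub>sections T W\<^esub>, n) \<in> KK W" by simp
  from A.K_minus[OF this] show ?thesis by simp
qed

lemma tensor_zero: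
  assumes W: "open W" and m: "m \<in> carrier (sections T W)"
  shows "frag_of (m, (\<lambda>v. 0)) \<in> KK W"
proof -
  interpret A: tensor_factors "sections O_plane W" "sections T W" "sections (twist l 0) W" by (rule tf[OF W])
  have z: "(\<lambda>v. 0) \<in> carrier (sections (twist l 0) W)" by (simp add: tw_zero W)
  have "frag_of (m, (\<lambda>v. 0) \<oplus>\<^bsub>sections (twist l 0) W\<^esub> (\<lambda>v. 0)) - frag_of (m, (\<lambda>v. 0)) - frag_of (m, (\<lambda>v. 0)) \<in> KK W"
    by (rule A.relations_in_K(2)[OF m z z])
  then have "- frag_of (m, (\<lambda>v. 0)) \<in> KK W" by simp
  from A.K_minus[OF this] show ?thesis by simp
qed

text \<open>Off the line the second factor is zero.\<close>

lemma tensor_off_line: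
  assumes W: "open W" "W \<inter> l = {}" and u: "Poly_Mapping.keys u \<subseteq> SS W"
  shows "u \<in> KK W"
proof -
  interpret A: tensor_factors "sections O_plane W" "sections T W" "sections (twist l 0) W" by (rule tf[OF W(1)])
  from u show ?thesis
  proof (induction rule: frag_induction)
    case (one a)
    then obtain m n where a: "a = (m, n)" "m \<in> carrier (sections T W)" "n \<in> twist_sections l 0 W" by auto
    have "n = (\<lambda>v. 0)" using tw_outside[OF a(3)] W(2) by (auto simp: mem_affine_cone)
    then show ?case using tensor_zero[OF W(1) a(2)] a(1) by simp
  qed (simp_all add: A.K_0 A.K_diff)
qed

lemma minus_one_in_O: "open W \<Longrightarrow> (\<lambda>v. if v \<in> affine_cone W then - 1 else 0) \<in> carrier (sections O_plane W)"
  using tw_form[OF homog_uminus[OF homog_one], of W UNIV] by (simp add: peval_uminus cong: if_cong)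

lemma tensor_diff:
  assumes W: "open W" and t: "t \<in> carrier (sections T W)" "t' \<in> carrier (sections T W)" and n: "n \<in> carrier (sections (twist l 0) W)"
  shows "\<exists>t''\<in>carrier (sections T W). frag_of (t, n) - frag_of (t', n) - frag_of (t'', n) \<in> KK W"
proof -
  interpret A: tensor_factors "sections O_plane W" "sections T W" "sections (twist l 0) W" by (rule tf[OF W])
  let ?m = "(\<lambda>v. if v \<in> affine_cone W then - 1 else 0) \<odot>\<^bsub>sections T W\<^esub> t'"
  have m: "?m \<in> carrier (sections T W)" by (rule F.smult_closed[OF W minus_one_in_O[OF W] t(2)])
  have "t' \<oplus>\<^bsub>sections T W\<^esub> ?m = \<zero>\<^bsub>sections T W\<^esub>"
    using t(2) tw_outside[of _ UNIV 0 W] by (auto simp: arrangement_bundle_simps)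
  then have 1: "frag_of (\<zero>\<^bsub>sections T W\<^esub>, n) - frag_of (t', n) - frag_of (?m, n) \<in> KK W"
    using A.relations_in_K(1)[OF t(2) m n] by simp
  have 2: "frag_of (t \<oplus>\<^bsub>sections T W\<^esub> ?m, n) - frag_of (t, n) - frag_of (?m, n) \<in> KK W"
    by (rule A.relations_in_K(1)[OF t(1) m n])
  have "frag_of (t, n) - frag_of (t', n) - frag_of (t \<oplus>\<^bsub>sections T W\<^esub> ?m, n) =
      (frag_of (\<zero>\<^bsub>sections T W\<^esub>, n) - frag_of (t', n) - frag_of (?m, n)) - frag_of (\<zero>\<^bsub>sections T W\<^esub>, n)
      - (frag_of (t \<oplus>\<^bsub>sections T W\<^esub> ?m, n) - frag_of (t, n) - frag_of (?m, n))" by (simp add: algebra_simps)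
  also have "\<dots> \<in> KK W" by (intro A.K_diff 1 2 zero_tensor[OF W n])
  finally show ?thesis using F.add_closed[OF W t(1) m] by blast
qed

lemma normal_form_restrict:
  assumes U: "open U" "open W" "open Y" "W \<subseteq> U" "Y \<subseteq> W" and u: "Poly_Mapping.keys u \<subseteq> SS U"
    and nf: "rmap U W u - frag_of (t, un W) \<in> KK W"
  shows "rmap U Y u - frag_of (restr T W Y t, un Y) \<in> KK Y"
proof -
  have "restr (twist l 0) W Y (un W) = un Y"
  proof
    fix v show "restr (twist l 0) W Y (un W) v = un Y v" using U(5) by (auto simp: mem_affine_cone)
  qed
  then have "rmap W Y (rmap U W u - frag_of (t, un W)) = rmap U Y u - frag_of (restr T W Y t, un Y)"
    unfolding frag_extend_diff rmap_rmap[OF U(1-3,5,4) u] by simp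
  then show ?thesis using rmap_K[OF U(2,3,5) nf] by simp
qed

text \<open>Locally every tensor is pure with second factor \<open>1\<close>: the second factor of \<open>m \<otimes>
  n\<close> lifts to a function on the plane, which moves to the first factor.\<close>

lemma tensor_normal_form:
  assumes U: "open U" and x: "x \<in> U" and u: "Poly_Mapping.keys u \<subseteq> SS U"
  shows "\<exists>W t. open W \<and> x \<in> W \<and> W \<subseteq> U \<and> t \<in> carrier (sections T W) \<and> rmap U W u - frag_of (t, un W) \<in> KK W"
  using u
proof (induction u rule: free_Abelian_group_induct[consumes 1, case_names zero diff one])
  case zero
  interpret A: tensor_factors "sections O_plane U" "sections T U" "sections (twist l 0) U" by (rule tf[OF U])
  have "rmap U U 0 - frag_of (\<zero>\<^bsub>sections T U\<^esub>, un U) \<in> KK U"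
    using A.K_minus[OF zero_tensor[OF U un_closed[OF U]]] by simp
  then show ?case using U x T_zero[OF U] by blast
next
  case (one a)
  then obtain m n where a: "a = (m, n)" "m \<in> carrier (sections T U)" "n \<in> twist_sections l 0 U" by auto
  show ?case
  proof (cases "x \<in> l")
    case True
    obtain W r where W: "open W" "x \<in> W" "W \<subseteq> U" "r \<in> twist_sections UNIV 0 W"
      "\<And>v. v \<in> affine_cone (W \<inter> l) \<Longrightarrow> r v = n v"
      using tw_lift[OF a(3) x True] by metis
    interpret A: tensor_factors "sections O_plane W" "sections T W" "sections (twist l 0) W" by (rule tf[OF W(1)])
    let ?m = "restr T U W m"
    have m: "?m \<in> carrier (sections T W)" by (rule F.restr_closed[OF U W(1,3) a(2)])
    have r: "r \<in> carrier (sections O_plane W)" using W(4) by simp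
    have n: "restr (twist l 0) U W n = r \<odot>\<^bsub>sections (twist l 0) W\<^esub> un W"
    proof
      fix v show "restr (twist l 0) U W n v = (r \<odot>\<^bsub>sections (twist l 0) W\<^esub> un W) v"
        using W(5)[of v] W(3) tw_outside[OF a(3), of v] by (auto simp: mem_affine_cone)
    qed
    have "rmap U W (frag_of a) - frag_of (r \<odot>\<^bsub>sections T W\<^esub> ?m, un W) =
      - (frag_of (r \<odot>\<^bsub>sections T W\<^esub> ?m, un W) - frag_of (?m, r \<odot>\<^bsub>sections (twist l 0) W\<^esub> un W))"
      unfolding a(1) n[symmetric] by simp
    also have "\<dots> \<in> KK W" by (intro A.K_minus A.relations_in_K(3)[OF r m un_closed[OF W(1)]])
    finally show ?thesis using W(1-3) F.smult_closed[OF W(1) r m] by blast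
  next
    case False
    let ?W = "U \<inter> - l"
    have W: "open ?W" "x \<in> ?W" "?W \<subseteq> U" "?W \<inter> l = {}" using U x False open_off_line by auto
    interpret A: tensor_factors "sections O_plane ?W" "sections T ?W" "sections (twist l 0) ?W" by (rule tf[OF W(1)])
    have "rmap U ?W (frag_of a) \<in> KK ?W"
      by (rule tensor_off_line[OF W(1,4)]) (rule keys_rmap[OF U W(1,3)], use one in simp)
    then have "rmap U ?W (frag_of a) - frag_of (\<zero>\<^bsub>sections T ?W\<^esub>, un ?W) \<in> KK ?W"
      by (rule A.K_diff) (rule zero_tensor[OF W(1) un_closed[OF W(1)]])
    then show ?thesis using W(1-3) T_zero[OF W(1)] by blast
  qed
next
  case (diff u w)
  obtain W t where W: "open W" "x \<in> W" "W \<subseteq> U" "t \<in> carrier (sections T W)" "rmap U W u - frag_of (t, un W) \<in> KK W"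
    using diff.IH(1) by blast
  obtain W' t' where W': "open W'" "x \<in> W'" "W' \<subseteq> U" "t' \<in> carrier (sections T W')" "rmap U W' w - frag_of (t', un W') \<in> KK W'"
    using diff.IH(2) by blast
  let ?Y = "W \<inter> W'"
  have Y: "open ?Y" "x \<in> ?Y" "?Y \<subseteq> W" "?Y \<subseteq> W'" "?Y \<subseteq> U" using W W' by auto
  interpret A: tensor_factors "sections O_plane ?Y" "sections T ?Y" "sections (twist l 0) ?Y" by (rule tf[OF Y(1)])
  let ?t = "restr T W ?Y t" and ?t' = "restr T W' ?Y t'"
  note 1 = normal_form_restrict[OF U W(1) Y(1) W(3) Y(3) diff.hyps(1) W(5)]
    and 2 = normal_form_restrict[OF U W'(1) Y(1) W'(3) Y(4) diff.hyps(2) W'(5)]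
  obtain t'' where t'': "t'' \<in> carrier (sections T ?Y)" "frag_of (?t, un ?Y) - frag_of (?t', un ?Y) - frag_of (t'', un ?Y) \<in> KK ?Y"
    using tensor_diff[OF Y(1) F.restr_closed[OF W(1) Y(1,3) W(4)] F.restr_closed[OF W'(1) Y(1,4) W'(4)] un_closed[OF Y(1)]] by blast
  have "rmap U ?Y (u - w) - frag_of (t'', un ?Y) = ((rmap U ?Y u - frag_of (?t, un ?Y)) - (rmap U ?Y w - frag_of (?t', un ?Y)))
     + (frag_of (?t, un ?Y) - frag_of (?t', un ?Y) - frag_of (t'', un ?Y))"
    unfolding frag_extend_diff by (simp only: algebra_simps)
  also have "\<dots> \<in> KK ?Y" by (intro A.K_add A.K_diff 1 2 t''(2))
  finally show ?case using Y t''(1) by blast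
qed

text \<open>The additive extension of \<open>(t, s) \<mapsto> s \<Theta>(t)\<close> to the free abelian group on pairs.\<close>

definition ev :: "proj_plane set \<Rightarrow> _ \<Rightarrow> (complex^3 \<Rightarrow> complex) \<times> (complex^3 \<Rightarrow> complex)"
  where "ev U u = (\<lambda>v. frag_eval (\<lambda>(t, s). s v * fst (\<Theta> U t) v) u, \<lambda>v. frag_eval (\<lambda>(t, s). s v * snd (\<Theta> U t) v) u)"

lemma frag_eval_K:
  assumes U: "open U" and u: "u \<in> KK U"
    and add: "\<And>t t'. t \<in> carrier (sections T U) \<Longrightarrow> t' \<in> carrier (sections T U) \<Longrightarrow> L (t \<oplus>\<^bsub>sections T U\<^esub> t') = L t + L t'"
    and smult: "\<And>r t. r \<in> carrier (sections O_plane U) \<Longrightarrow> t \<in> carrier (sections T U) \<Longrightarrow> L (r \<odot>\<^bsub>sections T U\<^esub> t) = r v * L t"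
  shows "frag_eval (\<lambda>(t, s). s v * L t) u = 0"
proof -
  interpret A: tensor_factors "sections O_plane U" "sections T U" "sections (twist l 0) U" by (rule tf[OF U])
  from u show ?thesis
    by (induction rule: A.K_induct)
      (simp_all add: frag_eval_diff frag_eval_add frag_eval_minus add smult algebra_simps
        del: arrangement_bundle_ops)
qed

lemma ev_K:
  assumes U: "open U" and u: "u \<in> KK U"
  shows "ev U u = (\<lambda>v. 0, \<lambda>v. 0)"
proof -
  have "frag_eval (\<lambda>(t, s). s v * fst (\<Theta> U t) v) u = 0" for v
    by (rule frag_eval_K[OF U u]) (simp_all add: \<Theta>(2,3)[OF U] del: arrangement_bundle_ops twist_simps(1))
  moreover have "frag_eval (\<lambda>(t, s). s v * snd (\<Theta> U t) v) u = 0" for v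
    by (rule frag_eval_K[OF U u]) (simp_all add: \<Theta>(2,3)[OF U] del: arrangement_bundle_ops twist_simps(1))
  ultimately show ?thesis by (simp add: ev_def)
qed

lemma ev_add: "ev U (u + w) = ev U u \<oplus>\<^bsub>sections GG U\<^esub> ev U w"
  by (simp add: ev_def frag_eval_add)

lemma ev_cong: "open U \<Longrightarrow> u - w \<in> KK U \<Longrightarrow> ev U u = ev U w"
  using ev_K[of U "u - w"] by (simp add: ev_def frag_eval_diff fun_eq_iff)

lemma ev_closed:
  assumes U: "open U" and u: "Poly_Mapping.keys u \<subseteq> SS U"
  shows "ev U u \<in> carrier (sections GG U)"
proof -
  have *: "(\<lambda>v. frag_eval (\<lambda>(t, s). s v * L t v) u) \<in> twist_sections l k U"
    if L: "\<And>t. t \<in> carrier (sections T U) \<Longrightarrow> L t \<in> twist_sections l k U" for L k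
    using u
  proof (induction rule: frag_induction)
    case (one a)
    then show ?case using tw_mult'[OF L[of "fst a"], of "snd a" l 0 U k] U by (cases a) auto
  qed (simp_all add: tw_zero tw_diff frag_eval_diff U)
  have "fst (\<Theta> U t) \<in> twist_sections l i U" "snd (\<Theta> U t) \<in> twist_sections l j U"
    if "t \<in> carrier (sections T U)" for t
    using \<Theta>(1)[OF U that] by auto
  then show ?thesis by (simp add: ev_def *)
qed

lemma ev_smap:
  assumes U: "open U" and r: "r \<in> carrier (sections O_plane U)" and u: "Poly_Mapping.keys u \<subseteq> SS U"
  shows "ev U (smap U r u) = r \<odot>\<^bsub>sections GG U\<^esub> ev U u"
  using u
proof (induction rule: frag_induction)
  case (one a)
  then show ?case using \<Theta>(3)[OF U r, of "fst a"]
    by (cases a) (simp add: ev_def mult_ac del: arrangement_bundle_ops)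
qed (simp_all add: ev_def frag_extend_diff frag_eval_diff fun_eq_iff algebra_simps)

lemma ev_rmap:
  assumes U: "open U" "open V" "V \<subseteq> U" and u: "Poly_Mapping.keys u \<subseteq> SS U"
  shows "ev V (rmap U V u) = restr GG U V (ev U u)"
  using u
proof (induction rule: frag_induction)
  case (one a)
  then show ?case using \<Theta>(4)[OF U, of "fst a"]
    by (cases a) (simp add: ev_def fun_eq_iff del: arrangement_bundle_ops)
qed (simp_all add: ev_def frag_extend_diff frag_eval_diff fun_eq_iff)

text \<open>The map induced by \<open>ev\<close> on cosets.\<close>

definition \<theta> where "\<theta> U A = ev U (SOME u. Poly_Mapping.keys u \<subseteq> SS U \<and> A = coset U u)"

lemma \<theta>_coset:
  assumes U: "open U" and u: "Poly_Mapping.keys u \<subseteq> SS U"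
  shows "\<theta> U (coset U u) = ev U u"
proof -
  interpret A: tensor_factors "sections O_plane U" "sections T U" "sections (twist l 0) U" by (rule tf[OF U])
  define w where "w = (SOME w. Poly_Mapping.keys w \<subseteq> SS U \<and> coset U u = coset U w)"
  have "Poly_Mapping.keys w \<subseteq> SS U \<and> coset U u = coset U w"
    unfolding w_def by (rule someI[of _ u]) (use u in simp)
  then have "u - w \<in> KK U" using A.coset_eq_iff by blast
  from ev_cong[OF U this] show ?thesis by (simp add: \<theta>_def w_def)
qed

lemma hom_\<theta>: "sheaf_hom O_plane P GG \<theta>"
  unfolding sheaf_hom_def
proof (intro allI impI conjI ballI funcsetI)
  fix U :: "proj_plane set" assume U: "open U"
  fix A assume "A \<in> carrier (sections P U)"
  then obtain u where u: "Poly_Mapping.keys u \<subseteq> SS U" "A = coset U u" using tensor_carrier by blast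
  show "\<theta> U A \<in> carrier (sections GG U)" unfolding u(2) \<theta>_coset[OF U u(1)] by (rule ev_closed[OF U u(1)])
  {
    fix B assume "B \<in> carrier (sections P U)"
    then obtain w where w: "Poly_Mapping.keys w \<subseteq> SS U" "B = coset U w" using tensor_carrier by blast
    have "Poly_Mapping.keys (u + w) \<subseteq> SS U" using keys_add[of u w] u w by blast
    then show "\<theta> U (A \<oplus>\<^bsub>sections P U\<^esub> B) = \<theta> U A \<oplus>\<^bsub>sections GG U\<^esub> \<theta> U B"
      unfolding u(2) w(2) tensor_add[OF U] by (simp only: \<theta>_coset[OF U] u(1) w(1) ev_add)
  next
    fix V assume V: "open V" "V \<subseteq> U"
    show "\<theta> V (restr P U V A) = restr GG U V (\<theta> U A)"
      unfolding u(2) tensor_restr[OF U V] \<theta>_coset[OF U u(1)] \<theta>_coset[OF V(1) keys_rmap[OF U V u(1)]]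
      by (rule ev_rmap[OF U V u(1)])
  }
  fix r assume r: "r \<in> carrier (sections O_plane U)"
  show "\<theta> U (r \<odot>\<^bsub>sections P U\<^esub> A) = r \<odot>\<^bsub>sections GG U\<^esub> \<theta> U A"
    unfolding u(2) tensor_smult[OF U r] \<theta>_coset[OF U u(1)] \<theta>_coset[OF U keys_smap[OF U r u(1)]]
    by (rule ev_smap[OF U r u(1)])
qed

lemma ev_pure:
  assumes W: "open W" and t: "t \<in> carrier (sections T W)"
  shows "ev W (frag_of (t, un W)) = \<Theta> W t"
proof -
  have "fst (\<Theta> W t) \<in> twist_sections l i W" "snd (\<Theta> W t) \<in> twist_sections l j W"
    using \<Theta>(1)[OF W t] by auto
  then show ?thesis
    by (auto simp: ev_def fun_eq_iff prod_eq_iff tw_outside)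
qed

text \<open>Two tensors are locally \<open>t \<otimes> 1\<close> and \<open>t' \<otimes> 1\<close>. If they have the same
  image, then \<open>t = t' + c t''\<close> with \<open>c\<close> vanishing on the line, and \<open>c t''
  \<otimes> 1 = t'' \<otimes> c = 0\<close>.\<close>

lemma locally_injective_\<theta>:
  assumes U: "open U" "x \<in> U" and A: "A \<in> carrier (sections P U)" "B \<in> carrier (sections P U)" and eq: "\<theta> U A = \<theta> U B"
  shows "\<exists>V. open V \<and> x \<in> V \<and> V \<subseteq> U \<and> restr P U V A = restr P U V B"
proof -
  obtain u where u: "Poly_Mapping.keys u \<subseteq> SS U" "A = coset U u" using A tensor_carrier by blast
  obtain w where w: "Poly_Mapping.keys w \<subseteq> SS U" "B = coset U w" using A tensor_carrier by blast
  have "\<exists>V. open V \<and> x \<in> V \<and> V \<subseteq> U \<and> rmap U V u - rmap U V w \<in> KK V"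
  proof (cases "x \<in> l")
    case False
    let ?W = "U \<inter> - l"
    have W: "open ?W" "x \<in> ?W" "?W \<subseteq> U" "?W \<inter> l = {}" using U False open_off_line by auto
    interpret C: tensor_factors "sections O_plane ?W" "sections T ?W" "sections (twist l 0) ?W" by (rule tf[OF W(1)])
    have "rmap U ?W u - rmap U ?W w \<in> KK ?W"
      by (intro C.K_diff tensor_off_line[OF W(1,4)] keys_rmap[OF U(1) W(1,3)] u w)
    then show ?thesis using W by blast
  next
    case True
    obtain W t where W: "open W" "x \<in> W" "W \<subseteq> U" "t \<in> carrier (sections T W)" "rmap U W u - frag_of (t, un W) \<in> KK W"
      using tensor_normal_form[OF U u(1)] by blast
    obtain W' t' where W': "open W'" "x \<in> W'" "W' \<subseteq> U" "t' \<in> carrier (sections T W')" "rmap U W' w - frag_of (t', un W') \<in> KK W'"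
      using tensor_normal_form[OF U w(1)] by blast
    let ?Y = "W \<inter> W'"
    have Y: "open ?Y" "x \<in> ?Y" "?Y \<subseteq> W" "?Y \<subseteq> W'" "?Y \<subseteq> U" using W W' by auto
    let ?t = "restr T W ?Y t" and ?t' = "restr T W' ?Y t'"
    note 1 = normal_form_restrict[OF U(1) W(1) Y(1) W(3) Y(3) u(1) W(5)]
      and 2 = normal_form_restrict[OF U(1) W'(1) Y(1) W'(3) Y(4) w(1) W'(5)]
    have t: "?t \<in> carrier (sections T ?Y)" "?t' \<in> carrier (sections T ?Y)"
      by (rule F.restr_closed[OF W(1) Y(1,3) W(4)], rule F.restr_closed[OF W'(1) Y(1,4) W'(4)])
    have "ev U u = ev U w" using eq by (simp only: u(2) w(2) \<theta>_coset[OF U(1)] u(1) w(1))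
    then have "ev ?Y (rmap U ?Y u) = ev ?Y (rmap U ?Y w)"
      by (simp only: ev_rmap[OF U(1) Y(1,5)] u(1) w(1))
    then have "\<Theta> ?Y ?t = \<Theta> ?Y ?t'"
      using ev_cong[OF Y(1) 1] ev_cong[OF Y(1) 2] ev_pure[OF Y(1) t(1)] ev_pure[OF Y(1) t(2)] by (simp only:)
    from ker[OF Y(1) t this Y(2) True]
    obtain V c t'' where V: "open V" "x \<in> V" "V \<subseteq> ?Y" and c: "c \<in> twist_sections UNIV 0 V" "\<forall>v\<in>affine_cone (V \<inter> l). c v = 0"
      and t'': "t'' \<in> carrier (sections T V)"
      and tt: "restr T ?Y V ?t = restr T ?Y V ?t' \<oplus>\<^bsub>sections T V\<^esub> c \<odot>\<^bsub>sections T V\<^esub> t''" by blast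
    interpret C: tensor_factors "sections O_plane V" "sections T V" "sections (twist l 0) V" by (rule tf[OF V(1)])
    note 3 = normal_form_restrict[OF U(1) Y(1) V(1) Y(5) V(3) u(1) 1]
      and 4 = normal_form_restrict[OF U(1) Y(1) V(1) Y(5) V(3) w(1) 2]
    have c': "c \<in> carrier (sections O_plane V)" using c(1) by simp
    have "c \<odot>\<^bsub>sections (twist l 0) V\<^esub> un V = (\<lambda>v. 0)" using c(2) by auto
    with C.relations_in_K(3)[OF c' t'' un_closed[OF V(1)]]
    have "frag_of (c \<odot>\<^bsub>sections T V\<^esub> t'', un V) - frag_of (t'', (\<lambda>v. 0)) \<in> KK V" by (simp only:)
    from C.K_add[OF this tensor_zero[OF V(1) t'']]
    have 5: "frag_of (c \<odot>\<^bsub>sections T V\<^esub> t'', un V) \<in> KK V" by (simp only: diff_add_cancel)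
    have 6: "frag_of (restr T ?Y V ?t, un V) - frag_of (restr T ?Y V ?t', un V) - frag_of (c \<odot>\<^bsub>sections T V\<^esub> t'', un V) \<in> KK V"
      unfolding tt by (rule C.relations_in_K(1)[OF F.restr_closed[OF Y(1) V(1,3) t(2)] F.smult_closed[OF V(1) c' t''] un_closed[OF V(1)]])
    have "rmap U V u - rmap U V w = (rmap U V u - frag_of (restr T ?Y V ?t, un V)) - (rmap U V w - frag_of (restr T ?Y V ?t', un V))
      + ((frag_of (restr T ?Y V ?t, un V) - frag_of (restr T ?Y V ?t', un V) - frag_of (c \<odot>\<^bsub>sections T V\<^esub> t'', un V))
      + frag_of (c \<odot>\<^bsub>sections T V\<^esub> t'', un V))" by (simp only: algebra_simps)
    also have "\<dots> \<in> KK V" by (intro C.K_add C.K_diff 3 4 5 6)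
    finally show ?thesis using V Y by blast
  qed
  then obtain V where V: "open V" "x \<in> V" "V \<subseteq> U" "rmap U V u - rmap U V w \<in> KK V" by blast
  interpret C: tensor_factors "sections O_plane V" "sections T V" "sections (twist l 0) V" by (rule tf[OF V(1)])
  have "restr P U V A = restr P U V B"
    unfolding u(2) w(2) tensor_restr[OF U(1) V(1,3)] C.coset_eq_iff by (rule V(4))
  then show ?thesis using V by blast
qed

lemma locally_surjective_\<theta>:
  assumes U: "open U" and g: "g \<in> carrier (sections GG U)"
  shows "locally_in_image P GG \<theta> U g"
  unfolding locally_in_image_def
proof
  fix x assume "x \<in> U"
  then obtain V t where V: "open V" "x \<in> V" "V \<subseteq> U" "t \<in> carrier (sections T V)" "\<Theta> V t = restr GG U V g"
    using surj[OF U g] unfolding locally_in_image_def by blast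
  have k: "Poly_Mapping.keys (frag_of (t, un V)) \<subseteq> SS V" using V(4) un_closed[OF V(1)] by simp
  have "\<theta> V (coset V (frag_of (t, un V))) = restr GG U V g"
    using \<theta>_coset[OF V(1) k] ev_pure[OF V(1,4)] V(5) by (simp only:)
  then show "\<exists>V. open V \<and> x \<in> V \<and> V \<subseteq> U \<and> (\<exists>s\<in>carrier (sections P V). \<theta> V s = restr GG U V g)"
    using V(1-3) tensor_carrierI[OF k] by blast
qed

theorem tensor_sheaf_isomorphic: "sheaf_isomorphic O_plane (tensor_sheaf O_plane T (twist l 0)) GG"
  unfolding tensor_sheaf_def
  by (rule sheafify_isomorphic[OF presheaf_module_tensor sheaf_direct_sum[OF sheaf_twist sheaf_twist] hom_\<theta>
        locally_injective_\<theta> locally_surjective_\<theta>])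

end

section \<open>Presented bundles\<close>

text \<open>An exact sequence \<open>0 \<rightarrow> \<O>(n0) \<rightarrow> \<O>(n1) \<oplus> \<O>(n2) \<oplus> \<O>(n3)
  \<rightarrow> T \<rightarrow> 0\<close> with first map \<open>c \<mapsto> (a1 c, a2 c, a3 c)\<close>. The
  second map takes three arguments rather than a nested pair, so that the summands can be permuted freely.\<close>

locale presentation =
  fixes \<alpha> :: "proj_plane set \<Rightarrow> poly3" and \<A> :: "proj_plane set set"
    and n0 n1 n2 n3 :: int and a1 a2 a3 :: "complex^3 \<Rightarrow> complex" and \<Psi>
  assumes a: "a1 \<in> twist_sections UNIV (n1 - n0) UNIV" "a2 \<in> twist_sections UNIV (n2 - n0) UNIV"
      "a3 \<in> twist_sections UNIV (n3 - n0) UNIV"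
    and a_inj: "\<lbrakk>open U; c \<in> twist_sections UNIV n0 U; \<And>v. a1 v * c v = 0; \<And>v. a2 v * c v = 0; \<And>v. a3 v * c v = 0\<rbrakk> \<Longrightarrow> c v = 0"
    and \<Psi>_closed: "\<lbrakk>open U; y1 \<in> twist_sections UNIV n1 U; y2 \<in> twist_sections UNIV n2 U; y3 \<in> twist_sections UNIV n3 U\<rbrakk> \<Longrightarrow>
      \<Psi> U y1 y2 y3 \<in> carrier (sections (arrangement_bundle \<alpha> \<A>) U)"
    and \<Psi>_add: "\<lbrakk>open U; y1 \<in> twist_sections UNIV n1 U; y2 \<in> twist_sections UNIV n2 U; y3 \<in> twist_sections UNIV n3 U;
        z1 \<in> twist_sections UNIV n1 U; z2 \<in> twist_sections UNIV n2 U; z3 \<in> twist_sections UNIV n3 U\<rbrakk> \<Longrightarrow>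
      \<Psi> U (\<lambda>v. y1 v + z1 v) (\<lambda>v. y2 v + z2 v) (\<lambda>v. y3 v + z3 v) =
        \<Psi> U y1 y2 y3 \<oplus>\<^bsub>sections (arrangement_bundle \<alpha> \<A>) U\<^esub> \<Psi> U z1 z2 z3"
    and \<Psi>_smult: "\<lbrakk>open U; r \<in> twist_sections UNIV 0 U; y1 \<in> twist_sections UNIV n1 U; y2 \<in> twist_sections UNIV n2 U;
        y3 \<in> twist_sections UNIV n3 U\<rbrakk> \<Longrightarrow>
      \<Psi> U (\<lambda>v. r v * y1 v) (\<lambda>v. r v * y2 v) (\<lambda>v. r v * y3 v) = r \<odot>\<^bsub>sections (arrangement_bundle \<alpha> \<A>) U\<^esub> \<Psi> U y1 y2 y3"
    and \<Psi>_restr: "\<lbrakk>open U; open V; V \<subseteq> U; y1 \<in> twist_sections UNIV n1 U; y2 \<in> twist_sections UNIV n2 U;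
        y3 \<in> twist_sections UNIV n3 U\<rbrakk> \<Longrightarrow>
      \<Psi> V (\<lambda>v. if v \<in> affine_cone V then y1 v else 0) (\<lambda>v. if v \<in> affine_cone V then y2 v else 0)
        (\<lambda>v. if v \<in> affine_cone V then y3 v else 0) = restr (arrangement_bundle \<alpha> \<A>) U V (\<Psi> U y1 y2 y3)"
    and \<Psi>_zero: "\<lbrakk>open U; c \<in> twist_sections UNIV n0 U\<rbrakk> \<Longrightarrow>
      \<Psi> U (\<lambda>v. a1 v * c v) (\<lambda>v. a2 v * c v) (\<lambda>v. a3 v * c v) = \<zero>\<^bsub>sections (arrangement_bundle \<alpha> \<A>) U\<^esub>"
    and \<Psi>_ker: "\<lbrakk>open U; y1 \<in> twist_sections UNIV n1 U; y2 \<in> twist_sections UNIV n2 U; y3 \<in> twist_sections UNIV n3 U;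
        \<Psi> U y1 y2 y3 = \<zero>\<^bsub>sections (arrangement_bundle \<alpha> \<A>) U\<^esub>; x \<in> U\<rbrakk> \<Longrightarrow>
      \<exists>V c. open V \<and> x \<in> V \<and> V \<subseteq> U \<and> c \<in> twist_sections UNIV n0 V \<and>
        (\<forall>v\<in>affine_cone V. y1 v = a1 v * c v \<and> y2 v = a2 v * c v \<and> y3 v = a3 v * c v)"
    and \<Psi>_surj: "\<lbrakk>open U; t \<in> carrier (sections (arrangement_bundle \<alpha> \<A>) U); x \<in> U\<rbrakk> \<Longrightarrow>
      \<exists>V y1 y2 y3. open V \<and> x \<in> V \<and> V \<subseteq> U \<and> y1 \<in> twist_sections UNIV n1 V \<and> y2 \<in> twist_sections UNIV n2 V \<and>
        y3 \<in> twist_sections UNIV n3 V \<and> \<Psi> V y1 y2 y3 = restr (arrangement_bundle \<alpha> \<A>) U V t"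
begin

abbreviation "T \<equiv> arrangement_bundle \<alpha> \<A>"

lemma minus_one: "open U \<Longrightarrow> (\<lambda>v. if v \<in> affine_cone U then - 1 else 0) \<in> twist_sections UNIV 0 U"
  using tw_form[OF homog_uminus[OF homog_one], of U UNIV] by (simp add: peval_uminus cong: if_cong)

lemma diff_eq_add:
  assumes "y \<in> twist_sections UNIV n U"
  shows "(\<lambda>v. z v - y v) = (\<lambda>v. z v + (if v \<in> affine_cone U then - 1 else 0) * y v)"
proof
  fix v show "z v - y v = z v + (if v \<in> affine_cone U then - 1 else 0) * y v"
    using tw_outside[OF assms, of v] by simp
qed

lemma \<Psi>_eq_imp_diff:
  assumes U: "open U" and y: "y1 \<in> twist_sections UNIV n1 U" "y2 \<in> twist_sections UNIV n2 U" "y3 \<in> twist_sections UNIV n3 U"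
    and z: "z1 \<in> twist_sections UNIV n1 U" "z2 \<in> twist_sections UNIV n2 U" "z3 \<in> twist_sections UNIV n3 U"
    and eq: "\<Psi> U y1 y2 y3 = \<Psi> U z1 z2 z3"
  shows "\<Psi> U (\<lambda>v. y1 v - z1 v) (\<lambda>v. y2 v - z2 v) (\<lambda>v. y3 v - z3 v) = \<zero>\<^bsub>sections T U\<^esub>"
proof -
  let ?m = "\<lambda>v. if v \<in> affine_cone U then - 1 else 0 :: complex"
  have mz: "(\<lambda>v. ?m v * z1 v) \<in> twist_sections UNIV n1 U" "(\<lambda>v. ?m v * z2 v) \<in> twist_sections UNIV n2 U"
    "(\<lambda>v. ?m v * z3 v) \<in> twist_sections UNIV n3 U"
    using tw_O_mult[OF minus_one[OF U] z(1) U] tw_O_mult[OF minus_one[OF U] z(2) U] tw_O_mult[OF minus_one[OF U] z(3) U] by simp_all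
  have c: "\<Psi> U z1 z2 z3 \<in> carrier (sections T U)" by (rule \<Psi>_closed[OF U z])
  have "\<Psi> U (\<lambda>v. y1 v - z1 v) (\<lambda>v. y2 v - z2 v) (\<lambda>v. y3 v - z3 v) =
      \<Psi> U y1 y2 y3 \<oplus>\<^bsub>sections T U\<^esub> ?m \<odot>\<^bsub>sections T U\<^esub> \<Psi> U z1 z2 z3"
    unfolding diff_eq_add[OF z(1)] diff_eq_add[OF z(2)] diff_eq_add[OF z(3)]
    by (simp only: \<Psi>_add[OF U y mz] \<Psi>_smult[OF U minus_one[OF U] z])
  also have "\<dots> = \<zero>\<^bsub>sections T U\<^esub>"
    using c tw_outside[of _ UNIV 0 U] unfolding eq by (auto simp: arrangement_bundle_simps)
  finally show ?thesis .
qed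

end

lemma tw_restrict_line:
  assumes "y \<in> twist_sections UNIV n U" "open U"
  shows "(\<lambda>v. if v \<in> affine_cone l then y v else 0) \<in> twist_sections l n U"
proof -
  have "(\<lambda>v. if v \<in> affine_cone l then y v else 0) = (\<lambda>v. if v \<in> affine_cone (U \<inter> l) then y v else 0)"
    using tw_outside[OF assms(1)] by (auto simp: mem_affine_cone)
  then show ?thesis using tw_restrict[OF assms(1) subset_refl _ assms(2), of l] by simp
qed

text \<open>Division on the line by a section without zeros; the quotient is lifted to the plane.\<close>

lemma ex_section_on_line:
  assumes g: "g \<in> twist_sections l k V" and a: "a \<in> twist_sections UNIV m UNIV" and V: "open V" "x \<in> V" "x \<in> l"
    and nz: "\<And>v. v \<in> affine_cone (V \<inter> l) \<Longrightarrow> a v \<noteq> 0"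
  obtains W c where "open W" "x \<in> W" "W \<subseteq> V" "c \<in> twist_sections UNIV (k - m) W"
    "\<And>v. v \<in> affine_cone (W \<inter> l) \<Longrightarrow> g v = a v * c v"
proof -
  have "(\<lambda>v. if v \<in> affine_cone (V \<inter> l) then a v else 0) \<in> twist_sections l m V"
    by (rule tw_restrict[OF a]) (use V in auto)
  then have "(\<lambda>v. inverse (if v \<in> affine_cone (V \<inter> l) then a v else 0)) \<in> twist_sections l (- m) V"
    by (rule tw_inverse) (use nz in auto)
  from tw_mult[OF g this subset_refl subset_refl V(1)]
  have "(\<lambda>v. g v * inverse (if v \<in> affine_cone (V \<inter> l) then a v else 0)) \<in> twist_sections l (k - m) V" by simp
  from tw_lift[OF this V(2,3)] obtain W c where W: "open W" "x \<in> W" "W \<subseteq> V" "c \<in> twist_sections UNIV (k - m) W"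
    "\<And>v. v \<in> affine_cone (W \<inter> l) \<Longrightarrow> c v = g v * inverse (if v \<in> affine_cone (V \<inter> l) then a v else 0)" by metis
  show thesis
  proof (rule that[OF W(1-4)])
    fix v assume v: "v \<in> affine_cone (W \<inter> l)"
    then have v': "v \<in> affine_cone (V \<inter> l)" using W(3) by (auto simp: mem_affine_cone)
    show "g v = a v * c v" using W(5)[OF v] nz[OF v'] v' by simp
  qed
qed

context presentation begin

text \<open>The map \<open>r\<close> in the proof kills \<open>(a1, a2, a3)\<close> on the line, hence factors through the
  bundle. Near a point of the line at which \<open>a1\<close> or \<open>a2\<close> is invertible one can divide
  by it: this shows that \<open>r\<close> is surjective, and that a triple in its kernel agrees on the line with
  a multiple of \<open>(a1, a2, a3)\<close>. What remains of the triple is divisible by the equation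
  \<open>p\<close> of the line.\<close>

theorem restriction_splits:
  assumes line: "defines_line p l" and nz: "\<And>v. v \<in> affine_cone l \<Longrightarrow> a1 v \<noteq> 0 \<or> a2 v \<noteq> 0"
    and A: "A \<in> twist_sections l (n3 - n1) UNIV" and B: "B \<in> twist_sections l (n3 - n2) UNIV"
    and a3: "\<And>v. v \<in> affine_cone l \<Longrightarrow> a3 v = A v * a1 v + B v * a2 v"
  shows "sheaf_isomorphic O_plane (tensor_sheaf O_plane T (twist l 0)) (direct_sum (twist l n3) (twist l (n1 + n2 - n0)))"
proof -
  let ?E = "direct_sum (twist UNIV n1) (direct_sum (twist UNIV n2) (twist UNIV n3))"
  let ?G = "direct_sum (twist l n3) (twist l (n1 + n2 - n0))"
  define r where "r = (\<lambda>(U :: proj_plane set) (y :: (complex^3 \<Rightarrow> complex) \<times> (complex^3 \<Rightarrow> complex) \<times> (complex^3 \<Rightarrow> complex)).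
    (\<lambda>v. if v \<in> affine_cone l then snd (snd y) v - A v * fst y v - B v * fst (snd y) v else 0,
     \<lambda>v. if v \<in> affine_cone l then a2 v * fst y v - a1 v * fst (snd y) v else 0))"
  define \<Psi>' where "\<Psi>' = (\<lambda>U (y :: (complex^3 \<Rightarrow> complex) \<times> (complex^3 \<Rightarrow> complex) \<times> (complex^3 \<Rightarrow> complex)).
     \<Psi> U (fst y) (fst (snd y)) (snd (snd y)))"
  interpret E: presheaf_module O_plane ?E
    by (intro presheaf_module_direct_sum presheaf_module_twist)
  interpret T: presheaf_module O_plane T by (rule presheaf_module_arrangement_bundle)
  interpret G: sheaf_of_modules O_plane ?G by (intro sheaf_direct_sum sheaf_twist)
  have off: "v \<notin> affine_cone U \<Longrightarrow> y \<in> twist_sections UNIV n U \<Longrightarrow> y v = 0" for v U y n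
    using tw_outside[of y UNIV n U v] by simp
  have r_closed: "r U y \<in> carrier (sections ?G U)" if U: "open U" and y: "y \<in> carrier (sections ?E U)" for U y
  proof -
    have y': "fst y \<in> twist_sections UNIV n1 U" "fst (snd y) \<in> twist_sections UNIV n2 U" "snd (snd y) \<in> twist_sections UNIV n3 U"
      using y by auto
    let ?c = "\<lambda>y v. if v \<in> affine_cone l then y v else 0 :: complex"
    note c = tw_restrict_line[OF y'(1) U, of l] tw_restrict_line[OF y'(2) U, of l] tw_restrict_line[OF y'(3) U, of l]
    have "(\<lambda>v. ?c (snd (snd y)) v - A v * ?c (fst y) v - B v * ?c (fst (snd y)) v) \<in> twist_sections l n3 U"
      by (intro tw_diff c(3) tw_mult'[OF c(1) A] tw_mult'[OF c(2) B] U) simp_all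
    also have "(\<lambda>v. ?c (snd (snd y)) v - A v * ?c (fst y) v - B v * ?c (fst (snd y)) v) = fst (r U y)"
      by (auto simp: r_def)
    finally have 1: "fst (r U y) \<in> twist_sections l n3 U" .
    have "(\<lambda>v. a2 v * ?c (fst y) v - a1 v * ?c (fst (snd y)) v) \<in> twist_sections l (n1 + n2 - n0) U"
      by (intro tw_diff tw_mult'[OF c(1) a(2)] tw_mult'[OF c(2) a(1)] U) simp_all
    also have "(\<lambda>v. a2 v * ?c (fst y) v - a1 v * ?c (fst (snd y)) v) = snd (r U y)"
      by (auto simp: r_def)
    finally show ?thesis using 1 by (simp add: mem_Times_iff)
  qed
  have hom_r: "sheaf_hom O_plane ?E ?G r"
    unfolding sheaf_hom_def
  proof (intro allI impI conjI ballI funcsetI)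
    fix U and y :: "(complex^3 \<Rightarrow> complex) \<times> (complex^3 \<Rightarrow> complex) \<times> (complex^3 \<Rightarrow> complex)"
    assume "open U" "y \<in> carrier (sections ?E U)"
    then show "r U y \<in> carrier (sections ?G U)" by (rule r_closed)
  qed (simp_all add: r_def fun_eq_iff algebra_simps)
  have hom_\<Psi>: "sheaf_hom O_plane ?E T \<Psi>'"
    unfolding sheaf_hom_def
    by (auto simp: \<Psi>'_def \<Psi>_closed \<Psi>_add \<Psi>_smult \<Psi>_restr simp del: arrangement_bundle_ops)
  have surj_\<Psi>: "locally_in_image ?E T \<Psi>' U t" if U: "open U" and t: "t \<in> carrier (sections T U)" for U t
    unfolding locally_in_image_def
  proof
    fix x assume "x \<in> U"
    from \<Psi>_surj[OF U t this] obtain V y1 y2 y3 where V: "open V" "x \<in> V" "V \<subseteq> U" "y1 \<in> twist_sections UNIV n1 V"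
      "y2 \<in> twist_sections UNIV n2 V" "y3 \<in> twist_sections UNIV n3 V" "\<Psi> V y1 y2 y3 = restr T U V t" by blast
    show "\<exists>V. open V \<and> x \<in> V \<and> V \<subseteq> U \<and> (\<exists>s\<in>carrier (sections ?E V). \<Psi>' V s = restr T U V t)"
      by (rule exI[of _ V], intro conjI V bexI[of _ "(y1, y2, y3)"]) (use V in \<open>simp_all add: \<Psi>'_def del: arrangement_bundle_ops\<close>)
  qed
  have ker_r: "r U y = r U z" if U: "open U" and y: "y \<in> carrier (sections ?E U)" "z \<in> carrier (sections ?E U)" and eq: "\<Psi>' U y = \<Psi>' U z" for U y z
  proof -
    have y': "fst y \<in> twist_sections UNIV n1 U" "fst (snd y) \<in> twist_sections UNIV n2 U" "snd (snd y) \<in> twist_sections UNIV n3 U"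
      and z': "fst z \<in> twist_sections UNIV n1 U" "fst (snd z) \<in> twist_sections UNIV n2 U" "snd (snd z) \<in> twist_sections UNIV n3 U"
      using y by auto
    note d = \<Psi>_eq_imp_diff[OF U y' z' eq[unfolded \<Psi>'_def]]
    have *: "snd (snd y) v - A v * fst y v - B v * fst (snd y) v = snd (snd z) v - A v * fst z v - B v * fst (snd z) v \<and>
      a2 v * fst y v - a1 v * fst (snd y) v = a2 v * fst z v - a1 v * fst (snd z) v" if v: "v \<in> affine_cone l" for v
    proof (cases "v \<in> affine_cone U")
      case True
      then have "pt v \<in> U" by (simp add: mem_affine_cone)
      from \<Psi>_ker[OF U tw_diff[OF y'(1) z'(1) U] tw_diff[OF y'(2) z'(2) U] tw_diff[OF y'(3) z'(3) U] d this]
      obtain V c where V: "pt v \<in> V" "\<forall>v\<in>affine_cone V. fst y v - fst z v = a1 v * c v \<and>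
         fst (snd y) v - fst (snd z) v = a2 v * c v \<and> snd (snd y) v - snd (snd z) v = a3 v * c v" by blast
      have "v \<in> affine_cone V" using V(1) v by (simp add: mem_affine_cone)
      with V(2) have e: "fst y v = fst z v + a1 v * c v" "fst (snd y) v = fst (snd z) v + a2 v * c v"
        "snd (snd y) v = snd (snd z) v + a3 v * c v" by (simp_all add: algebra_simps)
      show ?thesis unfolding e a3[OF v] by (simp add: algebra_simps)
    next
      case False
      then show ?thesis
        using off[OF False y'(1)] off[OF False y'(2)] off[OF False y'(3)] off[OF False z'(1)] off[OF False z'(2)] off[OF False z'(3)]
        by simp
    qed
    show ?thesis unfolding r_def prod.inject by (intro conjI ext) (use * in auto)
  qed
  obtain \<Theta> where \<Theta>: "sheaf_hom O_plane T ?G \<Theta>"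
    and \<Theta>\<Psi>: "\<And>U y. open U \<Longrightarrow> y \<in> carrier (sections ?E U) \<Longrightarrow> \<Theta> U (\<Psi>' U y) = r U y"
    using sheaf_hom_factor[OF E.presheaf_module_axioms T.presheaf_module_axioms G.sheaf_of_modules_axioms hom_\<Psi> hom_r surj_\<Psi> ker_r]
    by blast
  have "line_restriction p l \<alpha> \<A> n3 (n1 + n2 - n0) \<Theta>"
  proof
    show "defines_line p l" by fact
    show "sheaf_hom O_plane T ?G \<Theta>" by fact
  next
    fix U g assume U: "open U" and g: "g \<in> carrier (sections ?G U)"
    show "locally_in_image T ?G \<Theta> U g"
      unfolding locally_in_image_def
    proof
      fix x assume x: "x \<in> U"
      have g': "fst g \<in> twist_sections l n3 U" "snd g \<in> twist_sections l (n1 + n2 - n0) U" using g by auto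
      have lifted: "\<exists>V y. open V \<and> x \<in> V \<and> V \<subseteq> U \<and> y \<in> carrier (sections ?E V) \<and> r V y = restr ?G U V g"
        if W: "open W" "x \<in> W" "W \<subseteq> U" "x \<in> l" and y: "y1 \<in> twist_sections UNIV n1 W" "y2 \<in> twist_sections UNIV n2 W"
          and e: "\<And>v. v \<in> affine_cone (W \<inter> l) \<Longrightarrow> snd g v = a2 v * y1 v - a1 v * y2 v" for W y1 y2
      proof -
        note c = tw_restrict_line[OF y(1) W(1), of l] tw_restrict_line[OF y(2) W(1), of l]
        have "(\<lambda>v. (if v \<in> affine_cone W then fst g v else 0) + (A v * (if v \<in> affine_cone l then y1 v else 0)
            + B v * (if v \<in> affine_cone l then y2 v else 0))) \<in> twist_sections l n3 W"
          by (intro tw_add tw_restr[OF g'(1) W(1,3)] tw_mult'[OF c(1) A] tw_mult'[OF c(2) B] W(1)) simp_all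
        from tw_lift[OF this W(2,4)] obtain V y3 where V: "open V" "x \<in> V" "V \<subseteq> W" "y3 \<in> twist_sections UNIV n3 V"
          and y3: "\<And>v. v \<in> affine_cone (V \<inter> l) \<Longrightarrow> y3 v = (if v \<in> affine_cone W then fst g v else 0) +
            (A v * (if v \<in> affine_cone l then y1 v else 0) + B v * (if v \<in> affine_cone l then y2 v else 0))" by metis
        let ?y = "(\<lambda>v. if v \<in> affine_cone V then y1 v else 0, \<lambda>v. if v \<in> affine_cone V then y2 v else 0, y3)"
        have "?y \<in> carrier (sections ?E V)" using tw_restr[OF y(1) V(1,3)] tw_restr[OF y(2) V(1,3)] V(4) by simp
        moreover have "r V ?y = restr ?G U V g"
        proof -
          have "fst (r V ?y) v = (if v \<in> affine_cone V then fst g v else 0) \<and> snd (r V ?y) v = (if v \<in> affine_cone V then snd g v else 0)" for v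
          proof (cases "v \<in> affine_cone l")
            case True
            show ?thesis
            proof (cases "v \<in> affine_cone V")
              case vV: True
              then have vW: "v \<in> affine_cone W" "v \<in> affine_cone (V \<inter> l)" "v \<in> affine_cone (W \<inter> l)"
                using True V(3) by (auto simp: mem_affine_cone)
              show ?thesis using y3[OF vW(2)] e[OF vW(3)] True vV vW(1) by (simp add: r_def)
            next
              case False
              then show ?thesis using off[OF False V(4)] by (simp add: r_def)
            qed
          next
            case False
            then have "fst g v = 0" "snd g v = 0"
              using tw_outside[OF g'(1), of v] tw_outside[OF g'(2), of v] by (auto simp: mem_affine_cone)
            then show ?thesis using False by (simp add: r_def)
          qed
          then show ?thesis by (auto simp: prod_eq_iff fun_eq_iff)
        qed
        ultimately show ?thesis using V W(3) by blast
      qed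
      have "\<exists>V y. open V \<and> x \<in> V \<and> V \<subseteq> U \<and> y \<in> carrier (sections ?E V) \<and> r V y = restr ?G U V g"
      proof (cases "x \<in> l")
        case False
        let ?V = "U \<inter> - l"
        have "open (- l)"
          using open_nonzero_locus[OF defines_lineD(1)[OF line]] defines_lineD(3)[OF line] by (simp add: nonzero_locus_def)
        then have V: "open ?V" "x \<in> ?V" "?V \<subseteq> U" using U x False by auto
        have "(if v \<in> affine_cone ?V then fst g v else 0) = 0 \<and> (if v \<in> affine_cone ?V then snd g v else 0) = 0" for v
          using tw_outside[OF g'(1), of v] tw_outside[OF g'(2), of v] by (auto simp: mem_affine_cone)
        then have "r ?V (\<lambda>v. 0, \<lambda>v. 0, \<lambda>v. 0) = restr ?G U ?V g" by (auto simp: r_def fun_eq_iff)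
        moreover have "(\<lambda>v. 0, \<lambda>v. 0, \<lambda>v. 0) \<in> carrier (sections ?E ?V)" by (simp add: tw_zero V(1))
        ultimately show ?thesis using V by blast
      next
        case True
        obtain v0 where v0: "v0 \<noteq> 0" "x = pt v0" by (rule pt_cases)
        have v0l: "v0 \<in> affine_cone l" using True v0 by (simp add: mem_affine_cone)
        have gr: "(\<lambda>v. if v \<in> affine_cone V then snd g v else 0) \<in> twist_sections l (n1 + n2 - n0) V" if "open V" "V \<subseteq> U" for V
          by (rule tw_restr[OF g'(2) that])
        show ?thesis
        proof (cases "a1 v0 = 0")
          case False
          from tw_open_nonvanishing[OF a(1) v0(1) UNIV_I UNIV_I False] obtain V where
            V: "open V" "pt v0 \<in> V" "\<And>v. v \<in> affine_cone (V \<inter> UNIV) \<Longrightarrow> a1 v \<noteq> 0" by metis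
          have V': "open (U \<inter> V)" "x \<in> U \<inter> V" "U \<inter> V \<subseteq> U" using V U x v0 by auto
          from ex_section_on_line[OF gr[OF V'(1,3)] a(1) V'(1,2) True]
          obtain W c where W: "open W" "x \<in> W" "W \<subseteq> U \<inter> V" "c \<in> twist_sections UNIV (n1 + n2 - n0 - (n1 - n0)) W"
            "\<And>v. v \<in> affine_cone (W \<inter> l) \<Longrightarrow> (if v \<in> affine_cone (U \<inter> V) then snd g v else 0) = a1 v * c v"
            using V(3) by (metis affine_cone_Int Int_UNIV_right)
          have c: "(\<lambda>v. - 1 * c v) \<in> twist_sections UNIV n2 W" using tw_cmult[OF W(4,1), of "- 1"] by simp
          show ?thesis
          proof (rule lifted[OF W(1,2) _ True tw_zero[OF W(1)] c])
            show "W \<subseteq> U" using W(3) by blast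
            fix v assume v: "v \<in> affine_cone (W \<inter> l)"
            have "v \<in> affine_cone (U \<inter> V)" using v W(3) by (auto simp: mem_affine_cone)
            then show "snd g v = a2 v * 0 - a1 v * (- 1 * c v)" using W(5)[OF v] by simp
          qed
        next
          case a0: True
          then have "a2 v0 \<noteq> 0" using nz[OF v0l] by simp
          from tw_open_nonvanishing[OF a(2) v0(1) UNIV_I UNIV_I this] obtain V where
            V: "open V" "pt v0 \<in> V" "\<And>v. v \<in> affine_cone (V \<inter> UNIV) \<Longrightarrow> a2 v \<noteq> 0" by metis
          have V': "open (U \<inter> V)" "x \<in> U \<inter> V" "U \<inter> V \<subseteq> U" using V U x v0 by auto
          from ex_section_on_line[OF gr[OF V'(1,3)] a(2) V'(1,2) True]
          obtain W c where W: "open W" "x \<in> W" "W \<subseteq> U \<inter> V" "c \<in> twist_sections UNIV (n1 + n2 - n0 - (n2 - n0)) W"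
            "\<And>v. v \<in> affine_cone (W \<inter> l) \<Longrightarrow> (if v \<in> affine_cone (U \<inter> V) then snd g v else 0) = a2 v * c v"
            using V(3) by (metis affine_cone_Int Int_UNIV_right)
          have c: "c \<in> twist_sections UNIV n1 W" using W(4) by simp
          show ?thesis
          proof (rule lifted[OF W(1,2) _ True c tw_zero[OF W(1)]])
            show "W \<subseteq> U" using W(3) by blast
            fix v assume v: "v \<in> affine_cone (W \<inter> l)"
            have "v \<in> affine_cone (U \<inter> V)" using v W(3) by (auto simp: mem_affine_cone)
            then show "snd g v = a2 v * c v - a1 v * 0" using W(5)[OF v] by simp
          qed
        qed
      qed
      then obtain V y where V: "open V" "x \<in> V" "V \<subseteq> U" "y \<in> carrier (sections ?E V)" "r V y = restr ?G U V g" by blast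
      then show "\<exists>V. open V \<and> x \<in> V \<and> V \<subseteq> U \<and> (\<exists>s\<in>carrier (sections T V). \<Theta> V s = restr ?G U V g)"
        using \<Theta>\<Psi>[OF V(1,4)] sheaf_homD(1)[OF hom_\<Psi> V(1,4)] by auto
    qed
  next
    fix U t t' x
    assume U: "open U" and t: "t \<in> carrier (sections T U)" "t' \<in> carrier (sections T U)" and eq: "\<Theta> U t = \<Theta> U t'"
      and x: "x \<in> U" "x \<in> l"
    show "\<exists>V c t''. open V \<and> x \<in> V \<and> V \<subseteq> U \<and> c \<in> twist_sections UNIV 0 V \<and> (\<forall>v\<in>affine_cone (V \<inter> l). c v = 0) \<and>
        t'' \<in> carrier (sections T V) \<and>
        restr T U V t = restr T U V t' \<oplus>\<^bsub>sections T V\<^esub> c \<odot>\<^bsub>sections T V\<^esub> t''"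
    proof -
      obtain V1 y1 y2 y3 where V1: "open V1" "x \<in> V1" "V1 \<subseteq> U" and y: "y1 \<in> twist_sections UNIV n1 V1"
        "y2 \<in> twist_sections UNIV n2 V1" "y3 \<in> twist_sections UNIV n3 V1" "\<Psi> V1 y1 y2 y3 = restr T U V1 t"
        using \<Psi>_surj[OF U t(1) x(1)] by blast
      obtain V2 z1 z2 z3 where V2: "open V2" "x \<in> V2" "V2 \<subseteq> U" and z: "z1 \<in> twist_sections UNIV n1 V2"
        "z2 \<in> twist_sections UNIV n2 V2" "z3 \<in> twist_sections UNIV n3 V2" "\<Psi> V2 z1 z2 z3 = restr T U V2 t'"
        using \<Psi>_surj[OF U t(2) x(1)] by blast
      let ?cut = "\<lambda>V y v. if v \<in> affine_cone V then y v else 0 :: complex"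
      have \<Psi>y: "\<Psi> W (?cut W y1) (?cut W y2) (?cut W y3) = restr T U W t" if "open W" "W \<subseteq> V1" for W
        using \<Psi>_restr[OF V1(1) that y(1-3)] T.restr_restr[OF U V1(1) that V1(3) t(1)] y(4) by (simp del: arrangement_bundle_ops)
      have \<Psi>z: "\<Psi> W (?cut W z1) (?cut W z2) (?cut W z3) = restr T U W t'" if "open W" "W \<subseteq> V2" for W
        using \<Psi>_restr[OF V2(1) that z(1-3)] T.restr_restr[OF U V2(1) that V2(3) t(2)] z(4) by (simp del: arrangement_bundle_ops)
      let ?V = "V1 \<inter> V2"
      have V: "open ?V" "x \<in> ?V" "?V \<subseteq> V1" "?V \<subseteq> V2" "?V \<subseteq> U" using V1 V2 by auto
      note ycut = tw_restr[OF y(1) V(1,3)] tw_restr[OF y(2) V(1,3)] tw_restr[OF y(3) V(1,3)]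
        and zcut = tw_restr[OF z(1) V(1,4)] tw_restr[OF z(2) V(1,4)] tw_restr[OF z(3) V(1,4)]
      have rr: "r ?V (?cut ?V y1, ?cut ?V y2, ?cut ?V y3) = r ?V (?cut ?V z1, ?cut ?V z2, ?cut ?V z3)"
      proof -
        have "r ?V (?cut ?V y1, ?cut ?V y2, ?cut ?V y3) = \<Theta> ?V (restr T U ?V t)"
          using \<Theta>\<Psi>[OF V(1), of "(?cut ?V y1, ?cut ?V y2, ?cut ?V y3)"] ycut \<Psi>y[OF V(1,3)]
          by (simp add: \<Psi>'_def del: arrangement_bundle_ops)
        also have "\<dots> = \<Theta> ?V (restr T U ?V t')"
          using sheaf_homD(4)[OF \<Theta> U V(1,5) t(1)] sheaf_homD(4)[OF \<Theta> U V(1,5) t(2)] eq by (simp only:)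
        also have "\<dots> = r ?V (?cut ?V z1, ?cut ?V z2, ?cut ?V z3)"
          using \<Theta>\<Psi>[OF V(1), of "(?cut ?V z1, ?cut ?V z2, ?cut ?V z3)"] zcut \<Psi>z[OF V(1,4)]
          by (simp add: \<Psi>'_def del: arrangement_bundle_ops)
        finally show ?thesis .
      qed
      define d1 d2 d3 where d: "d1 = (\<lambda>v. ?cut ?V y1 v - ?cut ?V z1 v)" "d2 = (\<lambda>v. ?cut ?V y2 v - ?cut ?V z2 v)"
        "d3 = (\<lambda>v. ?cut ?V y3 v - ?cut ?V z3 v)"
      have dS: "d1 \<in> twist_sections UNIV n1 ?V" "d2 \<in> twist_sections UNIV n2 ?V" "d3 \<in> twist_sections UNIV n3 ?V"
        unfolding d by (intro tw_diff ycut zcut V(1))+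
      have rel: "d3 v = A v * d1 v + B v * d2 v" "a2 v * d1 v = a1 v * d2 v" if "v \<in> affine_cone l" for v
        using fun_cong[OF arg_cong[OF rr, of fst], of v] fun_cong[OF arg_cong[OF rr, of snd], of v] that
        by (simp_all add: r_def d algebra_simps)
      obtain v0 where v0: "v0 \<noteq> 0" "x = pt v0" by (rule pt_cases)
      have v0l: "v0 \<in> affine_cone l" using x(2) v0 by (simp add: mem_affine_cone)
      have "\<exists>W c. open W \<and> x \<in> W \<and> W \<subseteq> ?V \<and> c \<in> twist_sections UNIV n0 W \<and>
        (\<forall>v\<in>affine_cone (W \<inter> l). d1 v = a1 v * c v \<and> d2 v = a2 v * c v)"
      proof (cases "a1 v0 = 0")
        case False
        from tw_open_nonvanishing[OF a(1) v0(1) UNIV_I UNIV_I False] obtain Y where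
          Y: "open Y" "pt v0 \<in> Y" "\<And>v. v \<in> affine_cone (Y \<inter> UNIV) \<Longrightarrow> a1 v \<noteq> 0" by metis
        have Y': "open (?V \<inter> Y)" "x \<in> ?V \<inter> Y" "?V \<inter> Y \<subseteq> ?V" using Y V v0 by auto
        note g = tw_restrict_line[OF tw_restr[OF dS(1) Y'(1,3)] Y'(1), of l]
        from ex_section_on_line[OF g a(1) Y'(1,2) x(2)]
        obtain W c where W: "open W" "x \<in> W" "W \<subseteq> ?V \<inter> Y" "c \<in> twist_sections UNIV (n1 - (n1 - n0)) W"
          "\<And>v. v \<in> affine_cone (W \<inter> l) \<Longrightarrow> (if v \<in> affine_cone l then if v \<in> affine_cone (?V \<inter> Y) then d1 v else 0 else 0) = a1 v * c v"
          using Y(3) by (metis affine_cone_Int Int_UNIV_right)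
        have "d1 v = a1 v * c v \<and> d2 v = a2 v * c v" if v: "v \<in> affine_cone (W \<inter> l)" for v
        proof -
          have v': "v \<in> affine_cone l" "v \<in> affine_cone (?V \<inter> Y)" "a1 v \<noteq> 0"
            using v W(3) Y(3)[of v] by (auto simp: mem_affine_cone)
          have "d1 v = a1 v * c v" using W(5)[OF v] v' by simp
          then show ?thesis using rel(2)[OF v'(1)] v'(3) by simp
        qed
        then show ?thesis using W by (intro exI[of _ W] exI[of _ c]) auto
      next
        case True
        then have "a2 v0 \<noteq> 0" using nz[OF v0l] by simp
        from tw_open_nonvanishing[OF a(2) v0(1) UNIV_I UNIV_I this] obtain Y where
          Y: "open Y" "pt v0 \<in> Y" "\<And>v. v \<in> affine_cone (Y \<inter> UNIV) \<Longrightarrow> a2 v \<noteq> 0" by metis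
        have Y': "open (?V \<inter> Y)" "x \<in> ?V \<inter> Y" "?V \<inter> Y \<subseteq> ?V" using Y V v0 by auto
        note g = tw_restrict_line[OF tw_restr[OF dS(2) Y'(1,3)] Y'(1), of l]
        from ex_section_on_line[OF g a(2) Y'(1,2) x(2)]
        obtain W c where W: "open W" "x \<in> W" "W \<subseteq> ?V \<inter> Y" "c \<in> twist_sections UNIV (n2 - (n2 - n0)) W"
          "\<And>v. v \<in> affine_cone (W \<inter> l) \<Longrightarrow> (if v \<in> affine_cone l then if v \<in> affine_cone (?V \<inter> Y) then d2 v else 0 else 0) = a2 v * c v"
          using Y(3) by (metis affine_cone_Int Int_UNIV_right)
        have "d1 v = a1 v * c v \<and> d2 v = a2 v * c v" if v: "v \<in> affine_cone (W \<inter> l)" for v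
        proof -
          have v': "v \<in> affine_cone l" "v \<in> affine_cone (?V \<inter> Y)" "a2 v \<noteq> 0"
            using v W(3) Y(3)[of v] by (auto simp: mem_affine_cone)
          have "d2 v = a2 v * c v" using W(5)[OF v] v' by simp
          then show ?thesis using rel(2)[OF v'(1)] v'(3) by simp
        qed
        then show ?thesis using W by (intro exI[of _ W] exI[of _ c]) auto
      qed
      then obtain W c where W: "open W" "x \<in> W" "W \<subseteq> ?V" and c: "c \<in> twist_sections UNIV n0 W"
        and dc: "\<And>v. v \<in> affine_cone (W \<inter> l) \<Longrightarrow> d1 v = a1 v * c v \<and> d2 v = a2 v * c v" by blast
      note ac = tw_mult'[OF c a(1) _ _ W(1), of n1] tw_mult'[OF c a(2) _ _ W(1), of n2] tw_mult'[OF c a(3) _ _ W(1), of n3]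
      have e: "(\<lambda>v. ?cut W d1 v - a1 v * c v) \<in> twist_sections UNIV n1 W" "(\<lambda>v. ?cut W d2 v - a2 v * c v) \<in> twist_sections UNIV n2 W"
        "(\<lambda>v. ?cut W d3 v - a3 v * c v) \<in> twist_sections UNIV n3 W"
        by (intro tw_diff tw_restr[OF dS(1) W(1,3)] tw_restr[OF dS(2) W(1,3)] tw_restr[OF dS(3) W(1,3)] ac W(1); simp)+
      have e0: "?cut W d1 v - a1 v * c v = 0" "?cut W d2 v - a2 v * c v = 0" "?cut W d3 v - a3 v * c v = 0"
        if v: "v \<in> affine_cone (W \<inter> l)" for v
        using dc[OF v] v rel(1)[of v] a3[of v] by (simp_all add: affine_cone_Int algebra_simps)
      note line' = defines_lineD[OF line]
      obtain W1 w1 where W1: "open W1" "x \<in> W1" "W1 \<subseteq> W" "w1 \<in> twist_sections UNIV (n1 - 1) W1"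
        "\<And>v. v \<in> affine_cone W1 \<Longrightarrow> ?cut W d1 v - a1 v * c v = peval p v * w1 v"
        using tw_vanish_divide[OF line' e(1) W(2) x(2) e0(1)] by blast
      obtain W2 w2 where W2: "open W2" "x \<in> W2" "W2 \<subseteq> W" "w2 \<in> twist_sections UNIV (n2 - 1) W2"
        "\<And>v. v \<in> affine_cone W2 \<Longrightarrow> ?cut W d2 v - a2 v * c v = peval p v * w2 v"
        using tw_vanish_divide[OF line' e(2) W(2) x(2) e0(2)] by blast
      obtain W3 w3 where W3: "open W3" "x \<in> W3" "W3 \<subseteq> W" "w3 \<in> twist_sections UNIV (n3 - 1) W3"
        "\<And>v. v \<in> affine_cone W3 \<Longrightarrow> ?cut W d3 v - a3 v * c v = peval p v * w3 v"
        using tw_vanish_divide[OF line' e(3) W(2) x(2) e0(3)] by blast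
      obtain W0 h where W0: "open W0" "x \<in> W0" "h \<in> twist_sections UNIV 1 W0" "\<And>v. v \<in> affine_cone W0 \<Longrightarrow> h v \<noteq> 0"
        using tw_local_generator[OF v0(1), of 1] v0(2) by metis
      let ?Y = "W0 \<inter> W1 \<inter> W2 \<inter> W3"
      have Y: "open ?Y" "x \<in> ?Y" "?Y \<subseteq> W0" "?Y \<subseteq> W1" "?Y \<subseteq> W2" "?Y \<subseteq> W3" "?Y \<subseteq> W" "?Y \<subseteq> ?V" "?Y \<subseteq> V1" "?Y \<subseteq> V2" "?Y \<subseteq> U"
        using W0 W1 W2 W3 W V1(3) by auto
      have in_cones: "v \<in> affine_cone ?Y \<Longrightarrow> v \<in> affine_cone W0 \<and> v \<in> affine_cone W1 \<and> v \<in> affine_cone W2 \<and> v \<in> affine_cone W3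
        \<and> v \<in> affine_cone W \<and> v \<in> affine_cone ?V \<and> v \<in> affine_cone V1 \<and> v \<in> affine_cone V2" for v
        using affine_cone_mono[OF Y(3), of v] affine_cone_mono[OF Y(4), of v] affine_cone_mono[OF Y(5), of v] affine_cone_mono[OF Y(6), of v]
          affine_cone_mono[OF Y(7), of v] affine_cone_mono[OF Y(8), of v] affine_cone_mono[OF Y(9), of v] affine_cone_mono[OF Y(10), of v] by blast
      note hY = tw_restr[OF W0(3) Y(1,3)]
      have hi: "(\<lambda>v. inverse (?cut ?Y h v)) \<in> twist_sections UNIV (- 1) ?Y"
        by (rule tw_inverse[OF hY]) (use in_cones W0(4) in auto)
      have lam: "(\<lambda>v. peval p v * inverse (?cut ?Y h v)) \<in> twist_sections UNIV 0 ?Y"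
        using tw_form_mult[OF line'(1) hi Y(1)] by simp
      have w: "(\<lambda>v. h v * ?cut ?Y w1 v) \<in> twist_sections UNIV n1 ?Y" "(\<lambda>v. h v * ?cut ?Y w2 v) \<in> twist_sections UNIV n2 ?Y"
        "(\<lambda>v. h v * ?cut ?Y w3 v) \<in> twist_sections UNIV n3 ?Y"
        by (rule tw_mult'[OF tw_restr[OF W1(4) Y(1,4)] W0(3) Y(3) subset_refl Y(1)], simp,
            rule tw_mult'[OF tw_restr[OF W2(4) Y(1,5)] W0(3) Y(3) subset_refl Y(1)], simp,
            rule tw_mult'[OF tw_restr[OF W3(4) Y(1,6)] W0(3) Y(3) subset_refl Y(1)], simp)
      let ?t = "\<Psi> ?Y (\<lambda>v. h v * ?cut ?Y w1 v) (\<lambda>v. h v * ?cut ?Y w2 v) (\<lambda>v. h v * ?cut ?Y w3 v)"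
      let ?lam = "\<lambda>v. peval p v * inverse (?cut ?Y h v)"
      have tc: "?t \<in> carrier (sections T ?Y)" by (rule \<Psi>_closed[OF Y(1) w])
      note cY = tw_restr[OF c Y(1,7)]
      note acY = tw_mult'[OF cY a(1) _ _ Y(1), of n1] tw_mult'[OF cY a(2) _ _ Y(1), of n2] tw_mult'[OF cY a(3) _ _ Y(1), of n3]
      note lw = tw_O_mult[OF lam w(1) Y(1)] tw_O_mult[OF lam w(2) Y(1)] tw_O_mult[OF lam w(3) Y(1)]
      note zY = tw_restr[OF z(1) Y(1,10)] tw_restr[OF z(2) Y(1,10)] tw_restr[OF z(3) Y(1,10)]
      have dec: "?cut ?Y y1 = (\<lambda>v. ?cut ?Y z1 v + (a1 v * ?cut ?Y c v + ?lam v * (h v * ?cut ?Y w1 v)))"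
          "?cut ?Y y2 = (\<lambda>v. ?cut ?Y z2 v + (a2 v * ?cut ?Y c v + ?lam v * (h v * ?cut ?Y w2 v)))"
          "?cut ?Y y3 = (\<lambda>v. ?cut ?Y z3 v + (a3 v * ?cut ?Y c v + ?lam v * (h v * ?cut ?Y w3 v)))"
      proof -
        have *: "?cut ?Y y1 v = ?cut ?Y z1 v + (a1 v * ?cut ?Y c v + ?lam v * (h v * ?cut ?Y w1 v)) \<and>
          ?cut ?Y y2 v = ?cut ?Y z2 v + (a2 v * ?cut ?Y c v + ?lam v * (h v * ?cut ?Y w2 v)) \<and>
          ?cut ?Y y3 v = ?cut ?Y z3 v + (a3 v * ?cut ?Y c v + ?lam v * (h v * ?cut ?Y w3 v))" for v
        proof (cases "v \<in> affine_cone ?Y")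
          case True
          note ic = in_cones[OF True]
          have h: "h v \<noteq> 0" using W0(4) ic by blast
          have q: "peval p v * inverse (h v) * (h v * w) = peval p v * w" for w using h by simp
          have "y1 v - z1 v - a1 v * c v = peval p v * w1 v" "y2 v - z2 v - a2 v * c v = peval p v * w2 v"
            "y3 v - z3 v - a3 v * c v = peval p v * w3 v"
            using W1(5)[of v] W2(5)[of v] W3(5)[of v] ic by (simp_all add: d)
          then show ?thesis using True by (simp only: if_True q) (simp add: algebra_simps)
        qed simp
        show "?cut ?Y y1 = (\<lambda>v. ?cut ?Y z1 v + (a1 v * ?cut ?Y c v + ?lam v * (h v * ?cut ?Y w1 v)))"
          "?cut ?Y y2 = (\<lambda>v. ?cut ?Y z2 v + (a2 v * ?cut ?Y c v + ?lam v * (h v * ?cut ?Y w2 v)))"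
          "?cut ?Y y3 = (\<lambda>v. ?cut ?Y z3 v + (a3 v * ?cut ?Y c v + ?lam v * (h v * ?cut ?Y w3 v)))"
          by (intro ext, use * in blast)+
      qed
      have acl: "(\<lambda>v. a1 v * ?cut ?Y c v) \<in> twist_sections UNIV n1 ?Y" "(\<lambda>v. a2 v * ?cut ?Y c v) \<in> twist_sections UNIV n2 ?Y"
        "(\<lambda>v. a3 v * ?cut ?Y c v) \<in> twist_sections UNIV n3 ?Y"
        by (rule acY; simp)+
      have "restr T U ?Y t = restr T U ?Y t' \<oplus>\<^bsub>sections T ?Y\<^esub> (\<zero>\<^bsub>sections T ?Y\<^esub> \<oplus>\<^bsub>sections T ?Y\<^esub> ?lam \<odot>\<^bsub>sections T ?Y\<^esub> ?t)"
        unfolding \<Psi>y[OF Y(1,9), symmetric] dec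
          \<Psi>_add[OF Y(1) zY tw_add[OF acl(1) lw(1)] tw_add[OF acl(2) lw(2)] tw_add[OF acl(3) lw(3)]]
          \<Psi>_add[OF Y(1) acl lw] \<Psi>_smult[OF Y(1) lam w] \<Psi>_zero[OF Y(1) cY] \<Psi>z[OF Y(1,10)] ..
      also have "\<dots> = restr T U ?Y t' \<oplus>\<^bsub>sections T ?Y\<^esub> ?lam \<odot>\<^bsub>sections T ?Y\<^esub> ?t" by simp
      finally have res: "restr T U ?Y t = restr T U ?Y t' \<oplus>\<^bsub>sections T ?Y\<^esub> ?lam \<odot>\<^bsub>sections T ?Y\<^esub> ?t" .
      show ?thesis
      proof (rule exI[of _ ?Y], rule exI[of _ ?lam], rule exI[of _ ?t], intro conjI Y lam tc res ballI)
        fix v assume "v \<in> affine_cone (?Y \<inter> l)"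
        then have "peval p v = 0" using mem_cone_line[OF line] by (simp add: affine_cone_Int)
        then show "?lam v = 0" by simp
      qed
    qed
  qed
  then show ?thesis by (rule line_restriction.tensor_sheaf_isomorphic)
qed

end

section \<open>Local freeness\<close>

text \<open>The kernel of the gradient is saturated: the target is torsion free.\<close>

lemma syzygy_saturated:
  assumes q: "peval q B \<noteq> 0" and U: "open U"
    and s: "s1 \<in> twist_sections UNIV k U" "s2 \<in> twist_sections UNIV k U" "s3 \<in> twist_sections UNIV k U"
    and z: "\<And>v. v \<in> affine_cone U \<Longrightarrow> peval q v * (peval f1 v * s1 v + peval f2 v * s2 v + peval f3 v * s3 v) = 0"
    and v: "v \<in> affine_cone U"
  shows "peval f1 v * s1 v + peval f2 v * s2 v + peval f3 v * s3 v = 0"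
proof -
  have vU: "pt v \<in> U" and v0: "v \<noteq> 0" using v by (auto simp: mem_affine_cone)
  obtain V1 where V1: "open V1" "pt v \<in> V1" "V1 \<subseteq> U" "is_fraction (V1 \<inter> UNIV) k s1" by (rule tw_local[OF s(1) vU UNIV_I])
  obtain V2 where V2: "open V2" "pt v \<in> V2" "V2 \<subseteq> U" "is_fraction (V2 \<inter> UNIV) k s2" by (rule tw_local[OF s(2) vU UNIV_I])
  obtain V3 where V3: "open V3" "pt v \<in> V3" "V3 \<subseteq> U" "is_fraction (V3 \<inter> UNIV) k s3" by (rule tw_local[OF s(3) vU UNIV_I])
  obtain P1 Q1 where 1: "\<And>v. v \<in> affine_cone V1 \<Longrightarrow> peval Q1 v \<noteq> 0" "\<And>v. v \<in> affine_cone V1 \<Longrightarrow> s1 v = peval P1 v / peval Q1 v"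
    using is_fractionE[OF V1(4)] by (metis Int_UNIV_right)
  obtain P2 Q2 where 2: "\<And>v. v \<in> affine_cone V2 \<Longrightarrow> peval Q2 v \<noteq> 0" "\<And>v. v \<in> affine_cone V2 \<Longrightarrow> s2 v = peval P2 v / peval Q2 v"
    using is_fractionE[OF V2(4)] by (metis Int_UNIV_right)
  obtain P3 Q3 where 3: "\<And>v. v \<in> affine_cone V3 \<Longrightarrow> peval Q3 v \<noteq> 0" "\<And>v. v \<in> affine_cone V3 \<Longrightarrow> s3 v = peval P3 v / peval Q3 v"
    using is_fractionE[OF V3(4)] by (metis Int_UNIV_right)
  let ?W = "V1 \<inter> V2 \<inter> V3"
  have W: "open ?W" "pt v \<in> ?W" using V1 V2 V3 by auto
  let ?G = "f1 * P1 * Q2 * Q3 + f2 * P2 * Q1 * Q3 + f3 * P3 * Q1 * Q2"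
  have G: "peval ?G u = (peval f1 u * s1 u + peval f2 u * s2 u + peval f3 u * s3 u) * (peval Q1 u * peval Q2 u * peval Q3 u)"
    if "u \<in> affine_cone ?W" for u
  proof -
    have "peval P1 u = s1 u * peval Q1 u" "peval P2 u = s2 u * peval Q2 u" "peval P3 u = s3 u * peval Q3 u"
      using that 1[of u] 2[of u] 3[of u] by (simp_all add: affine_cone_Int)
    then show ?thesis by (simp add: peval_simps algebra_simps)
  qed
  have qG: "peval (q * ?G) u = 0" for u
  proof (rule peval_eq_0_dense_UNIV[OF W])
    fix u assume u: "u \<in> affine_cone ?W"
    then have "u \<in> affine_cone U" using V1(3) by (auto simp: mem_affine_cone)
    then show "peval (q * ?G) u = 0" using z[of u] unfolding peval_mult[of q] G[OF u] by auto
  qed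
  have "peval ?G v = 0"
    by (rule peval_mult_eq_0_on_lines[where S = UNIV and p = q and ?v0.0 = B]) (use qG q in \<open>simp_all only: peval_mult[symmetric] UNIV_I simp_thms\<close>)
  moreover have vW: "v \<in> affine_cone ?W" using W(2) v0 by (simp add: mem_affine_cone)
  ultimately show ?thesis
    using G[OF vW] 1(1)[of v] 2(1)[of v] 3(1)[of v] vW by (simp add: affine_cone_Int)
qed

context presentation begin

text \<open>The argument is explained at the top of the theory. The linear form \<open>r\<close>, which does not vanish at
  \<open>C\<close>, only serves to turn the local parameters into functions \<open>p'\<close> and
  \<open>q'\<close> of degree \<open>0\<close>; the generator \<open>h\<close> of \<open>\<O>(n0)\<close> near
  \<open>C\<close> is the section whose image is decomposed.\<close>

lemma no_common_zero:
  assumes C: "C \<noteq> 0" and z: "a1 C = 0" "a2 C = 0" "a3 C = 0"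
  shows False
proof -
  let ?cut = "\<lambda>V y v. if v \<in> affine_cone V then y v else 0 :: complex"
  interpret T: presheaf_module O_plane T by (rule presheaf_module_arrangement_bundle)
  obtain p q r A B where f: "frame p q r A B C" using ex_frame_at[OF C] by metis
  note hp = frame_homog(1)[OF f] and hq = frame_homog(2)[OF f] and hr = frame_homog(3)[OF f] and fb = frame_basis[OF f]
  obtain V1 b1 c1 where V1: "open V1" "pt C \<in> V1" "b1 \<in> twist_sections UNIV (n1 - n0 - 1) V1" "c1 \<in> twist_sections UNIV (n1 - n0 - 1) V1"
    "\<And>v. v \<in> affine_cone V1 \<Longrightarrow> a1 v = peval p v * b1 v + peval q v * c1 v"
    using tw_point_divide[OF f C a(1) UNIV_I z(1)] by metis
  obtain V2 b2 c2 where V2: "open V2" "pt C \<in> V2" "b2 \<in> twist_sections UNIV (n2 - n0 - 1) V2" "c2 \<in> twist_sections UNIV (n2 - n0 - 1) V2"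
    "\<And>v. v \<in> affine_cone V2 \<Longrightarrow> a2 v = peval p v * b2 v + peval q v * c2 v"
    using tw_point_divide[OF f C a(2) UNIV_I z(2)] by metis
  obtain V3 b3 c3 where V3: "open V3" "pt C \<in> V3" "b3 \<in> twist_sections UNIV (n3 - n0 - 1) V3" "c3 \<in> twist_sections UNIV (n3 - n0 - 1) V3"
    "\<And>v. v \<in> affine_cone V3 \<Longrightarrow> a3 v = peval p v * b3 v + peval q v * c3 v"
    using tw_point_divide[OF f C a(3) UNIV_I z(3)] by metis
  obtain V0 h where V0: "open V0" "pt C \<in> V0" "h \<in> twist_sections UNIV n0 V0" "\<And>v. v \<in> affine_cone V0 \<Longrightarrow> h v \<noteq> 0"
    using tw_local_generator[OF C, of n0] by metis
  let ?Y = "V0 \<inter> V1 \<inter> V2 \<inter> V3 \<inter> nonzero_locus r"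
  have Y: "open ?Y" "pt C \<in> ?Y" "?Y \<subseteq> V0" "?Y \<subseteq> V1" "?Y \<subseteq> V2" "?Y \<subseteq> V3"
    using V0 V1 V2 V3 open_nonzero_locus[OF hr] pt_nonzero_locus[OF hr C] fb by auto
  have inY: "v \<in> affine_cone ?Y \<Longrightarrow> v \<in> affine_cone V0 \<and> v \<in> affine_cone V1 \<and> v \<in> affine_cone V2 \<and> v \<in> affine_cone V3 \<and> peval r v \<noteq> 0" for v
    using pt_nonzero_locus[OF hr, of v] by (auto simp: affine_cone_Int mem_affine_cone)
  define ri where "ri = (\<lambda>v. inverse (?cut ?Y (peval r) v))"
  have ri: "ri \<in> twist_sections UNIV (- 1) ?Y"
    unfolding ri_def using tw_form[OF hr Y(1), of UNIV] by (intro tw_inverse) (use inY in auto)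
  have r_ri: "peval r v * ri v = 1" if "v \<in> affine_cone ?Y" for v using inY[OF that] that by (simp add: ri_def)
  define p' where "p' = (\<lambda>v. peval p v * ri v)"
  define q' where "q' = (\<lambda>v. peval q v * ri v)"
  have p': "p' \<in> twist_sections UNIV 0 ?Y" and q': "q' \<in> twist_sections UNIV 0 ?Y"
    using tw_form_mult[OF hp ri Y(1)] tw_form_mult[OF hq ri Y(1)] by (simp_all add: p'_def q'_def)
  have mk: "(\<lambda>v. peval r v * (h v * ?cut ?Y b v)) \<in> twist_sections UNIV n ?Y"
    if "b \<in> twist_sections UNIV (n - n0 - 1) V" "?Y \<subseteq> V" for b n V
    using tw_form_mult[OF hr tw_mult'[OF tw_restr[OF that(1) Y(1) that(2)] V0(3) Y(3) subset_refl Y(1) refl] Y(1)] by simp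
  define \<beta>1 where "\<beta>1 = (\<lambda>v. peval r v * (h v * ?cut ?Y b1 v))"
  define \<beta>2 where "\<beta>2 = (\<lambda>v. peval r v * (h v * ?cut ?Y b2 v))"
  define \<beta>3 where "\<beta>3 = (\<lambda>v. peval r v * (h v * ?cut ?Y b3 v))"
  define \<gamma>1 where "\<gamma>1 = (\<lambda>v. peval r v * (h v * ?cut ?Y c1 v))"
  define \<gamma>2 where "\<gamma>2 = (\<lambda>v. peval r v * (h v * ?cut ?Y c2 v))"
  define \<gamma>3 where "\<gamma>3 = (\<lambda>v. peval r v * (h v * ?cut ?Y c3 v))"
  note \<beta>\<gamma>_def = \<beta>1_def \<beta>2_def \<beta>3_def \<gamma>1_def \<gamma>2_def \<gamma>3_def
  have \<beta>: "\<beta>1 \<in> twist_sections UNIV n1 ?Y" "\<beta>2 \<in> twist_sections UNIV n2 ?Y" "\<beta>3 \<in> twist_sections UNIV n3 ?Y"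
    unfolding \<beta>\<gamma>_def by (rule mk[OF V1(3) Y(4)], rule mk[OF V2(3) Y(5)], rule mk[OF V3(3) Y(6)])
  have \<gamma>: "\<gamma>1 \<in> twist_sections UNIV n1 ?Y" "\<gamma>2 \<in> twist_sections UNIV n2 ?Y" "\<gamma>3 \<in> twist_sections UNIV n3 ?Y"
    unfolding \<beta>\<gamma>_def by (rule mk[OF V1(4) Y(4)], rule mk[OF V2(4) Y(5)], rule mk[OF V3(4) Y(6)])
  have dec: "a1 v * ?cut ?Y h v = p' v * \<beta>1 v + q' v * \<gamma>1 v" "a2 v * ?cut ?Y h v = p' v * \<beta>2 v + q' v * \<gamma>2 v"
    "a3 v * ?cut ?Y h v = p' v * \<beta>3 v + q' v * \<gamma>3 v" for v
  proof -
    have "a1 v * ?cut ?Y h v = p' v * \<beta>1 v + q' v * \<gamma>1 v \<and> a2 v * ?cut ?Y h v = p' v * \<beta>2 v + q' v * \<gamma>2 v \<and>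
      a3 v * ?cut ?Y h v = p' v * \<beta>3 v + q' v * \<gamma>3 v"
    proof (cases "v \<in> affine_cone ?Y")
      case True
      have "peval p v * ri v * (peval r v * (h v * b)) + peval q v * ri v * (peval r v * (h v * c)) = (peval r v * ri v) * ((peval p v * b + peval q v * c) * h v)" for b c
        by (simp add: algebra_simps)
      then show ?thesis using True V1(5) V2(5) V3(5) inY[OF True] r_ri[OF True]
        by (simp only: p'_def q'_def \<beta>\<gamma>_def if_True mult_1)
    next
      case False
      then show ?thesis by (simp add: \<beta>\<gamma>_def)
    qed
    then show "a1 v * ?cut ?Y h v = p' v * \<beta>1 v + q' v * \<gamma>1 v" "a2 v * ?cut ?Y h v = p' v * \<beta>2 v + q' v * \<gamma>2 v"
      "a3 v * ?cut ?Y h v = p' v * \<beta>3 v + q' v * \<gamma>3 v" by blast+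
  qed
  note hY = tw_restr[OF V0(3) Y(1,3)]
  define tb where "tb = \<Psi> ?Y \<beta>1 \<beta>2 \<beta>3"
  define tc where "tc = \<Psi> ?Y \<gamma>1 \<gamma>2 \<gamma>3"
  have tb: "tb \<in> carrier (sections T ?Y)" and tc: "tc \<in> carrier (sections T ?Y)"
    unfolding tb_def tc_def by (rule \<Psi>_closed[OF Y(1) \<beta>], rule \<Psi>_closed[OF Y(1) \<gamma>])
  have sum0: "p' \<odot>\<^bsub>sections T ?Y\<^esub> tb \<oplus>\<^bsub>sections T ?Y\<^esub> q' \<odot>\<^bsub>sections T ?Y\<^esub> tc = \<zero>\<^bsub>sections T ?Y\<^esub>"
  proof -
    have "\<zero>\<^bsub>sections T ?Y\<^esub> = \<Psi> ?Y (\<lambda>v. p' v * \<beta>1 v + q' v * \<gamma>1 v) (\<lambda>v. p' v * \<beta>2 v + q' v * \<gamma>2 v) (\<lambda>v. p' v * \<beta>3 v + q' v * \<gamma>3 v)"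
      using \<Psi>_zero[OF Y(1) hY] unfolding dec by (rule sym)
    also have "\<dots> = p' \<odot>\<^bsub>sections T ?Y\<^esub> tb \<oplus>\<^bsub>sections T ?Y\<^esub> q' \<odot>\<^bsub>sections T ?Y\<^esub> tc"
      unfolding tb_def tc_def \<Psi>_smult[OF Y(1) p' \<beta>, symmetric] \<Psi>_smult[OF Y(1) q' \<gamma>, symmetric]
      by (rule \<Psi>_add[OF Y(1)]) (intro tw_O_mult p' q' \<beta> \<gamma> Y(1))+
    finally show ?thesis by (rule sym)
  qed
  have rel: "peval p v * fst tb v = - peval q v * fst tc v" "peval p v * fst (snd tb) v = - peval q v * fst (snd tc) v"
    "peval p v * snd (snd tb) v = - peval q v * snd (snd tc) v" if v: "v \<in> affine_cone ?Y" for v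
  proof -
    have canc: "peval p v * x = - peval q v * y" if "peval p v * ri v * x + peval q v * ri v * y = 0" for x y
    proof -
      have "peval p v * x + peval q v * y = peval r v * (peval p v * ri v * x + peval q v * ri v * y)"
        using r_ri[OF v] by (simp add: algebra_simps) (simp add: mult.assoc[symmetric] mult.commute)
      then show ?thesis using that by (simp add: eq_neg_iff_add_eq_0)
    qed
    have x: "p' v * fst tb v + q' v * fst tc v = 0" "p' v * fst (snd tb) v + q' v * fst (snd tc) v = 0"
      "p' v * snd (snd tb) v + q' v * snd (snd tc) v = 0"
      using sum0 by (simp_all add: fun_eq_iff)
    show "peval p v * fst tb v = - peval q v * fst tc v" using x(1) unfolding p'_def q'_def by (rule canc)
    show "peval p v * fst (snd tb) v = - peval q v * fst (snd tc) v" using x(2) unfolding p'_def q'_def by (rule canc)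
    show "peval p v * snd (snd tb) v = - peval q v * snd (snd tc) v" using x(3) unfolding p'_def q'_def by (rule canc)
  qed
  have tb': "fst tb \<in> twist_sections UNIV 0 ?Y" "fst (snd tb) \<in> twist_sections UNIV 0 ?Y" "snd (snd tb) \<in> twist_sections UNIV 0 ?Y"
    and tc': "fst tc \<in> twist_sections UNIV 0 ?Y" "fst (snd tc) \<in> twist_sections UNIV 0 ?Y" "snd (snd tc) \<in> twist_sections UNIV 0 ?Y"
    using tb tc by (auto simp: arrangement_bundle_simps)
  obtain Z1 s1 where Z1: "open Z1" "pt C \<in> Z1" "Z1 \<subseteq> ?Y" "s1 \<in> twist_sections UNIV (0 - 1) Z1"
    "\<And>v. v \<in> affine_cone Z1 \<Longrightarrow> fst tb v = peval q v * s1 v" "\<And>v. v \<in> affine_cone Z1 \<Longrightarrow> fst tc v = - peval p v * s1 v"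
    using tw_coprime[OF f C tb'(1) tc'(1) Y(2) rel(1)] by blast
  obtain Z2 s2 where Z2: "open Z2" "pt C \<in> Z2" "Z2 \<subseteq> ?Y" "s2 \<in> twist_sections UNIV (0 - 1) Z2"
    "\<And>v. v \<in> affine_cone Z2 \<Longrightarrow> fst (snd tb) v = peval q v * s2 v" "\<And>v. v \<in> affine_cone Z2 \<Longrightarrow> fst (snd tc) v = - peval p v * s2 v"
    using tw_coprime[OF f C tb'(2) tc'(2) Y(2) rel(2)] by blast
  obtain Z3 s3 where Z3: "open Z3" "pt C \<in> Z3" "Z3 \<subseteq> ?Y" "s3 \<in> twist_sections UNIV (0 - 1) Z3"
    "\<And>v. v \<in> affine_cone Z3 \<Longrightarrow> snd (snd tb) v = peval q v * s3 v" "\<And>v. v \<in> affine_cone Z3 \<Longrightarrow> snd (snd tc) v = - peval p v * s3 v"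
    using tw_coprime[OF f C tb'(3) tc'(3) Y(2) rel(3)] by blast
  let ?Z = "Z1 \<inter> Z2 \<inter> Z3"
  have Z: "open ?Z" "pt C \<in> ?Z" "?Z \<subseteq> Z1" "?Z \<subseteq> Z2" "?Z \<subseteq> Z3" "?Z \<subseteq> ?Y" using Z1 Z2 Z3 by auto
  let ?f1 = "partial 1 (defining_poly \<alpha> \<A>)" and ?f2 = "partial 2 (defining_poly \<alpha> \<A>)" and ?f3 = "partial 3 (defining_poly \<alpha> \<A>)"
  have inZ: "v \<in> affine_cone ?Z \<Longrightarrow> v \<in> affine_cone Z1 \<and> v \<in> affine_cone Z2 \<and> v \<in> affine_cone Z3 \<and> v \<in> affine_cone ?Y" for v
    using affine_cone_mono[OF Z(3), of v] affine_cone_mono[OF Z(4), of v] affine_cone_mono[OF Z(5), of v] affine_cone_mono[OF Z(6), of v] by blast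
  note sZ = tw_restr[OF Z1(4) Z(1,3)] tw_restr[OF Z2(4) Z(1,4)] tw_restr[OF Z3(4) Z(1,5)]
  have syz: "peval ?f1 v * ?cut ?Z s1 v + peval ?f2 v * ?cut ?Z s2 v + peval ?f3 v * ?cut ?Z s3 v = 0" if v: "v \<in> affine_cone ?Z" for v
  proof (rule syzygy_saturated[OF _ Z(1) sZ _ v])
    show "peval q B \<noteq> 0" using fb by simp
    fix v assume v: "v \<in> affine_cone ?Z"
    have "peval ?f1 v * fst tb v + peval ?f2 v * fst (snd tb) v + peval ?f3 v * snd (snd tb) v = 0"
      using tb by (simp add: arrangement_bundle_simps)
    then show "peval q v * (peval ?f1 v * ?cut ?Z s1 v + peval ?f2 v * ?cut ?Z s2 v + peval ?f3 v * ?cut ?Z s3 v) = 0"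
      using Z1(5)[of v] Z2(5)[of v] Z3(5)[of v] inZ[OF v] v by (simp add: algebra_simps)
  qed
  define t where "t = (\<lambda>v. peval r v * ?cut ?Z s1 v, \<lambda>v. peval r v * ?cut ?Z s2 v, \<lambda>v. peval r v * ?cut ?Z s3 v)"
  have t: "t \<in> carrier (sections T ?Z)"
  proof -
    have "peval ?f1 v * (peval r v * ?cut ?Z s1 v) + peval ?f2 v * (peval r v * ?cut ?Z s2 v) + peval ?f3 v * (peval r v * ?cut ?Z s3 v) = 0" for v
    proof (cases "v \<in> affine_cone ?Z")
      case True
      have "peval ?f1 v * (peval r v * ?cut ?Z s1 v) + peval ?f2 v * (peval r v * ?cut ?Z s2 v) + peval ?f3 v * (peval r v * ?cut ?Z s3 v)
        = peval r v * (peval ?f1 v * ?cut ?Z s1 v + peval ?f2 v * ?cut ?Z s2 v + peval ?f3 v * ?cut ?Z s3 v)" by (simp only: algebra_simps)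
      then show ?thesis by (simp only: syz[OF True] mult_zero_right)
    qed simp
    moreover note tw_form_mult[OF hr sZ(1) Z(1)] tw_form_mult[OF hr sZ(2) Z(1)] tw_form_mult[OF hr sZ(3) Z(1)]
    ultimately show ?thesis by (simp add: arrangement_bundle_simps t_def)
  qed
  obtain W w1 w2 w3 where W: "open W" "pt C \<in> W" "W \<subseteq> ?Z" and w: "w1 \<in> twist_sections UNIV n1 W" "w2 \<in> twist_sections UNIV n2 W"
    "w3 \<in> twist_sections UNIV n3 W" "\<Psi> W w1 w2 w3 = restr T ?Z W t"
    using \<Psi>_surj[OF Z(1) t Z(2)] by blast
  have WY: "W \<subseteq> ?Y" using W(3) Z(6) by blast
  have inW: "v \<in> affine_cone W \<Longrightarrow> v \<in> affine_cone Z1 \<and> v \<in> affine_cone Z2 \<and> v \<in> affine_cone Z3 \<and> v \<in> affine_cone ?Y \<and> v \<in> affine_cone ?Z" for v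
    using inZ[of v] affine_cone_mono[OF W(3), of v] by blast
  note pW = tw_restr[OF p' W(1) WY] and qW = tw_restr[OF q' W(1) WY]
  have npW: "(\<lambda>v. - 1 * ?cut W p' v) \<in> twist_sections UNIV 0 W" by (rule tw_cmult[OF pW W(1)])
  note \<beta>W = tw_restr[OF \<beta>(1) W(1) WY] tw_restr[OF \<beta>(2) W(1) WY] tw_restr[OF \<beta>(3) W(1) WY]
    and \<gamma>W = tw_restr[OF \<gamma>(1) W(1) WY] tw_restr[OF \<gamma>(2) W(1) WY] tw_restr[OF \<gamma>(3) W(1) WY]
  have rs: "peval q v * s = q' v * (peval r v * s)" "- peval p v * s = - 1 * p' v * (peval r v * s)" if "v \<in> affine_cone ?Y" for v s
  proof -
    have "q' v * (peval r v * s) = (peval r v * ri v) * (peval q v * s)" "p' v * (peval r v * s) = (peval r v * ri v) * (peval p v * s)"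
      by (simp_all only: q'_def p'_def mult_ac)
    then have *: "q' v * (peval r v * s) = peval q v * s" "p' v * (peval r v * s) = peval p v * s"
      by (simp_all only: r_ri[OF that] mult_1)
    show "peval q v * s = q' v * (peval r v * s)" by (rule *(1)[symmetric])
    show "- peval p v * s = - 1 * p' v * (peval r v * s)"
      by (simp only: mult.assoc *(2)) simp
  qed
  have "\<Psi> W (?cut W \<beta>1) (?cut W \<beta>2) (?cut W \<beta>3) = ?cut W q' \<odot>\<^bsub>sections T W\<^esub> \<Psi> W w1 w2 w3"
  proof -
    have "(if v \<in> affine_cone W then fst tb v else 0) = ?cut W q' v * (if v \<in> affine_cone W then fst t v else 0) \<and>
      (if v \<in> affine_cone W then fst (snd tb) v else 0) = ?cut W q' v * (if v \<in> affine_cone W then fst (snd t) v else 0) \<and>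
      (if v \<in> affine_cone W then snd (snd tb) v else 0) = ?cut W q' v * (if v \<in> affine_cone W then snd (snd t) v else 0)" for v
    proof (cases "v \<in> affine_cone W")
      case True
      note i = inW[OF True]
      show ?thesis using Z1(5)[of v] Z2(5)[of v] Z3(5)[of v] i True rs(1)[of v] by (simp add: t_def)
    qed simp
    then show ?thesis unfolding \<Psi>_restr[OF Y(1) W(1) WY \<beta>] w(4) tb_def[symmetric] by (simp add: prod_eq_iff fun_eq_iff)
  qed
  then have "\<Psi> W (?cut W \<beta>1) (?cut W \<beta>2) (?cut W \<beta>3) = \<Psi> W (\<lambda>v. ?cut W q' v * w1 v) (\<lambda>v. ?cut W q' v * w2 v) (\<lambda>v. ?cut W q' v * w3 v)"
    unfolding \<Psi>_smult[OF W(1) qW w(1-3)] .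
  from \<Psi>_ker[OF W(1) _ _ _ \<Psi>_eq_imp_diff[OF W(1) \<beta>W tw_O_mult[OF qW w(1) W(1)] tw_O_mult[OF qW w(2) W(1)] tw_O_mult[OF qW w(3) W(1)] this] W(2)]
  obtain N1 k1 where N1: "open N1" "pt C \<in> N1" "N1 \<subseteq> W" "k1 \<in> twist_sections UNIV n0 N1"
    "\<And>v. v \<in> affine_cone N1 \<Longrightarrow> ?cut W \<beta>1 v - ?cut W q' v * w1 v = a1 v * k1 v \<and> ?cut W \<beta>2 v - ?cut W q' v * w2 v = a2 v * k1 v \<and>
       ?cut W \<beta>3 v - ?cut W q' v * w3 v = a3 v * k1 v"
    using tw_diff[OF \<beta>W(1) tw_O_mult[OF qW w(1) W(1)] W(1)] tw_diff[OF \<beta>W(2) tw_O_mult[OF qW w(2) W(1)] W(1)]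
      tw_diff[OF \<beta>W(3) tw_O_mult[OF qW w(3) W(1)] W(1)] by blast
  have "\<Psi> W (?cut W \<gamma>1) (?cut W \<gamma>2) (?cut W \<gamma>3) = (\<lambda>v. - 1 * ?cut W p' v) \<odot>\<^bsub>sections T W\<^esub> \<Psi> W w1 w2 w3"
  proof -
    have "(if v \<in> affine_cone W then fst tc v else 0) = - 1 * ?cut W p' v * (if v \<in> affine_cone W then fst t v else 0) \<and>
      (if v \<in> affine_cone W then fst (snd tc) v else 0) = - 1 * ?cut W p' v * (if v \<in> affine_cone W then fst (snd t) v else 0) \<and>
      (if v \<in> affine_cone W then snd (snd tc) v else 0) = - 1 * ?cut W p' v * (if v \<in> affine_cone W then snd (snd t) v else 0)" for v
    proof (cases "v \<in> affine_cone W")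
      case True
      note i = inW[OF True]
      show ?thesis using Z1(6)[of v] Z2(6)[of v] Z3(6)[of v] i True rs(2)[of v] by (simp add: t_def)
    qed simp
    then show ?thesis unfolding \<Psi>_restr[OF Y(1) W(1) WY \<gamma>] w(4) tc_def[symmetric] by (simp add: prod_eq_iff fun_eq_iff)
  qed
  then have "\<Psi> W (?cut W \<gamma>1) (?cut W \<gamma>2) (?cut W \<gamma>3) =
      \<Psi> W (\<lambda>v. - 1 * ?cut W p' v * w1 v) (\<lambda>v. - 1 * ?cut W p' v * w2 v) (\<lambda>v. - 1 * ?cut W p' v * w3 v)"
    unfolding \<Psi>_smult[OF W(1) npW w(1-3)] .
  from \<Psi>_ker[OF W(1) _ _ _ \<Psi>_eq_imp_diff[OF W(1) \<gamma>W tw_O_mult[OF npW w(1) W(1)] tw_O_mult[OF npW w(2) W(1)] tw_O_mult[OF npW w(3) W(1)] this] W(2)]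
  obtain N2 k2 where N2: "open N2" "pt C \<in> N2" "N2 \<subseteq> W" "k2 \<in> twist_sections UNIV n0 N2"
    "\<And>v. v \<in> affine_cone N2 \<Longrightarrow> ?cut W \<gamma>1 v - - 1 * ?cut W p' v * w1 v = a1 v * k2 v \<and> ?cut W \<gamma>2 v - - 1 * ?cut W p' v * w2 v = a2 v * k2 v \<and>
       ?cut W \<gamma>3 v - - 1 * ?cut W p' v * w3 v = a3 v * k2 v"
    using tw_diff[OF \<gamma>W(1) tw_O_mult[OF npW w(1) W(1)] W(1)] tw_diff[OF \<gamma>W(2) tw_O_mult[OF npW w(2) W(1)] W(1)]
      tw_diff[OF \<gamma>W(3) tw_O_mult[OF npW w(3) W(1)] W(1)] by blast
  let ?N = "N1 \<inter> N2"
  have N: "open ?N" "pt C \<in> ?N" "?N \<subseteq> N1" "?N \<subseteq> N2" "?N \<subseteq> W" "?N \<subseteq> ?Y" "?N \<subseteq> V0" using N1 N2 WY Y(3) by auto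
  define k where "k = (\<lambda>v. ?cut ?N h v - (p' v * ?cut ?N k1 v + q' v * ?cut ?N k2 v))"
  have kS: "k \<in> twist_sections UNIV n0 ?N" unfolding k_def
    by (intro tw_diff tw_add tw_restr[OF V0(3) N(1,7)] tw_mult'[OF tw_restr[OF N1(4) N(1,3)] p' N(6) subset_refl N(1)]
        tw_mult'[OF tw_restr[OF N2(4) N(1,4)] q' N(6) subset_refl N(1)] N(1)) simp_all
  have k0: "a1 v * k v = 0 \<and> a2 v * k v = 0 \<and> a3 v * k v = 0" for v
  proof (cases "v \<in> affine_cone ?N")
    case True
    have i: "v \<in> affine_cone N1" "v \<in> affine_cone N2" "v \<in> affine_cone W" "v \<in> affine_cone ?Y"
      using affine_cone_mono[OF N(3) True] affine_cone_mono[OF N(4) True] affine_cone_mono[OF N(5) True] affine_cone_mono[OF N(6) True] .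
    have e: "a * (h v - (p' v * k1 v + q' v * k2 v)) = 0"
      if "a * ?cut ?Y h v = p' v * \<beta> + q' v * \<gamma>" "\<beta> - q' v * w = a * k1 v" "\<gamma> - - 1 * p' v * w = a * k2 v" for a \<beta> \<gamma> w
    proof -
      have "a * (h v - (p' v * k1 v + q' v * k2 v)) = a * h v - (p' v * (a * k1 v) + q' v * (a * k2 v))" by (simp add: algebra_simps)
      also have "\<dots> = 0" unfolding that(2,3)[symmetric] using that(1) i(4) by (simp add: algebra_simps)
      finally show ?thesis .
    qed
    have kv: "k v = h v - (p' v * k1 v + q' v * k2 v)" using True by (simp add: k_def)
    have "\<beta>1 v - q' v * w1 v = a1 v * k1 v" "\<beta>2 v - q' v * w2 v = a2 v * k1 v" "\<beta>3 v - q' v * w3 v = a3 v * k1 v"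
      "\<gamma>1 v - - 1 * p' v * w1 v = a1 v * k2 v" "\<gamma>2 v - - 1 * p' v * w2 v = a2 v * k2 v" "\<gamma>3 v - - 1 * p' v * w3 v = a3 v * k2 v"
      using N1(5)[OF i(1)] N2(5)[OF i(2)] i(3) by (simp_all only: if_True simp_thms)
    then show ?thesis
      using e[OF dec(1)[of v]] e[OF dec(2)[of v]] e[OF dec(3)[of v]] unfolding kv by blast
  next
    case False
    then show ?thesis by (simp add: k_def)
  qed
  have CN: "C \<in> affine_cone ?N" using N(2) C by (simp add: mem_affine_cone)
  have "k C = 0" by (rule a_inj[OF N(1) kS]) (use k0 in blast)+
  moreover have "k C = h C" using CN fb by (simp add: k_def p'_def q'_def)
  moreover have "C \<in> affine_cone V0" using V0(2) C by (simp add: mem_affine_cone)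
  ultimately show False using V0(4) by simp
qed

lemma swap_23: "presentation \<alpha> \<A> n0 n1 n3 n2 a1 a3 a2 (\<lambda>U y1 y3 y2. \<Psi> U y1 y2 y3)"
proof
  fix U y1 y3 y2 x assume *: "open U" "y1 \<in> twist_sections UNIV n1 U" "y3 \<in> twist_sections UNIV n3 U" "y2 \<in> twist_sections UNIV n2 U"
    "\<Psi> U y1 y2 y3 = \<zero>\<^bsub>sections T U\<^esub>" "x \<in> U"
  from \<Psi>_ker[OF *(1,2,4,3,5,6)]
  show "\<exists>V c. open V \<and> x \<in> V \<and> V \<subseteq> U \<and> c \<in> twist_sections UNIV n0 V \<and>
        (\<forall>v\<in>affine_cone V. y1 v = a1 v * c v \<and> y3 v = a3 v * c v \<and> y2 v = a2 v * c v)" by blast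
next
  fix U t x assume *: "open U" "t \<in> carrier (sections T U)" "x \<in> U"
  from \<Psi>_surj[OF *] show "\<exists>V y1 y3 y2. open V \<and> x \<in> V \<and> V \<subseteq> U \<and> y1 \<in> twist_sections UNIV n1 V \<and> y3 \<in> twist_sections UNIV n3 V \<and>
        y2 \<in> twist_sections UNIV n2 V \<and> \<Psi> V y1 y2 y3 = restr T U V t" by blast
qed (rule a \<Psi>_closed \<Psi>_add \<Psi>_smult \<Psi>_restr \<Psi>_zero a_inj; assumption)+

lemma rotate: "presentation \<alpha> \<A> n0 n2 n3 n1 a2 a3 a1 (\<lambda>U y2 y3 y1. \<Psi> U y1 y2 y3)"
proof
  fix U y2 y3 y1 x assume *: "open U" "y2 \<in> twist_sections UNIV n2 U" "y3 \<in> twist_sections UNIV n3 U" "y1 \<in> twist_sections UNIV n1 U"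
    "\<Psi> U y1 y2 y3 = \<zero>\<^bsub>sections T U\<^esub>" "x \<in> U"
  from \<Psi>_ker[OF *(1,4,2,3,5,6)]
  show "\<exists>V c. open V \<and> x \<in> V \<and> V \<subseteq> U \<and> c \<in> twist_sections UNIV n0 V \<and>
        (\<forall>v\<in>affine_cone V. y2 v = a2 v * c v \<and> y3 v = a3 v * c v \<and> y1 v = a1 v * c v)" by blast
next
  fix U t x assume *: "open U" "t \<in> carrier (sections T U)" "x \<in> U"
  from \<Psi>_surj[OF *] show "\<exists>V y2 y3 y1. open V \<and> x \<in> V \<and> V \<subseteq> U \<and> y2 \<in> twist_sections UNIV n2 V \<and> y3 \<in> twist_sections UNIV n3 V \<and>
        y1 \<in> twist_sections UNIV n1 V \<and> \<Psi> V y1 y2 y3 = restr T U V t" by blast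
qed (rule a \<Psi>_closed \<Psi>_add \<Psi>_smult \<Psi>_restr \<Psi>_zero a_inj; assumption)+

end

section \<open>The presentation given by a plus-one generated resolution\<close>

text \<open>Local generators of \<open>\<O>(n)\<close> determine a morphism, so the quotient of the image of a generator
  by the generator depends neither on the generator nor on the open set.\<close>

lemma hom_between_twists:
  assumes hom: "sheaf_hom O_plane (twist UNIV n) (twist UNIV m) \<kappa>"
  obtains H where "H \<in> twist_sections UNIV (m - n) UNIV"
    "\<And>U s. open U \<Longrightarrow> s \<in> twist_sections UNIV n U \<Longrightarrow> \<kappa> U s = (\<lambda>v. H v * s v)"
proof -
  let ?cut = "\<lambda>V y v. if v \<in> affine_cone V then y v else 0 :: complex"
  note \<kappa> = sheaf_homD[OF hom, simplified]
  have "\<forall>x\<in>UNIV. \<exists>W \<rho>. open W \<and> x \<in> W \<and> \<rho> \<in> twist_sections UNIV n W \<and> (\<forall>v\<in>affine_cone W. \<rho> v \<noteq> 0)"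
  proof
    fix x :: proj_plane
    obtain v where v: "v \<noteq> 0" "x = pt v" by (rule pt_cases)
    show "\<exists>W \<rho>. open W \<and> x \<in> W \<and> \<rho> \<in> twist_sections UNIV n W \<and> (\<forall>v\<in>affine_cone W. \<rho> v \<noteq> 0)"
      using tw_local_generator[OF v(1), of n] v(2) by metis
  qed
  then obtain W \<rho> where W0: "\<And>x. x \<in> UNIV \<Longrightarrow> open (W x) \<and> x \<in> W x \<and> \<rho> x \<in> twist_sections UNIV n (W x) \<and>
      (\<forall>v\<in>affine_cone (W x). \<rho> x v \<noteq> 0)"
    by (rule bchoice2E) (rule that)
  then have W: "open (W x)" "x \<in> W x" "\<rho> x \<in> twist_sections UNIV n (W x)" "v \<in> affine_cone (W x) \<Longrightarrow> \<rho> x v \<noteq> 0" for x v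
    by blast+
  have key: "\<kappa> U s v = \<kappa> (W x) (\<rho> x) v / \<rho> x v * s v"
    if U: "open U" and s: "s \<in> twist_sections UNIV n U" and v: "v \<in> affine_cone U" "v \<in> affine_cone (W x)" for U s v x
  proof -
    let ?Y = "U \<inter> W x"
    have Y: "open ?Y" "?Y \<subseteq> U" "?Y \<subseteq> W x" using U W by auto
    have vY: "v \<in> affine_cone ?Y" using v by (simp add: affine_cone_Int)
    note sY = tw_restr[OF s Y(1,2)] and \<rho>Y = tw_restr[OF W(3) Y(1,3)]
    have inv: "(\<lambda>v. inverse (?cut ?Y (\<rho> x) v)) \<in> twist_sections UNIV (- n) ?Y"
      by (rule tw_inverse[OF \<rho>Y]) (use W(4)[of _ x] in \<open>auto simp: affine_cone_Int\<close>)
    have r: "(\<lambda>v. ?cut ?Y s v * inverse (?cut ?Y (\<rho> x) v)) \<in> twist_sections UNIV 0 ?Y"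
      using tw_mult[OF sY inv subset_refl subset_refl Y(1)] by simp
    have *: "?cut ?Y s = (\<lambda>v. ?cut ?Y s v * inverse (?cut ?Y (\<rho> x) v) * ?cut ?Y (\<rho> x) v)"
      using W(4)[of _ x] by (auto simp: affine_cone_Int)
    have "\<kappa> U s v = \<kappa> ?Y (?cut ?Y s) v" using \<kappa>(4)[OF U Y(1,2) s] vY by simp
    also have "\<dots> = ?cut ?Y s v * inverse (?cut ?Y (\<rho> x) v) * \<kappa> ?Y (?cut ?Y (\<rho> x)) v"
      using \<kappa>(3)[OF Y(1) r \<rho>Y] by (subst *) simp
    also have "\<kappa> ?Y (?cut ?Y (\<rho> x)) v = \<kappa> (W x) (\<rho> x) v"
      using \<kappa>(4)[OF W(1) Y(1,3) W(3)] vY by simp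
    finally show ?thesis using vY by (simp add: field_simps)
  qed
  define H where "H = (\<lambda>v. if v = 0 then 0 else \<kappa> (W (pt v)) (\<rho> (pt v)) v / \<rho> (pt v) v)"
  have \<kappa>H: "\<kappa> U s v = H v * s v" if U: "open U" and s: "s \<in> twist_sections UNIV n U" for U s v
  proof (cases "v \<in> affine_cone U")
    case True
    then have "v \<noteq> 0" by (simp add: mem_affine_cone)
    then show ?thesis using key[OF U s True, of "pt v"] W(2) by (simp add: H_def mem_affine_cone)
  next
    case False
    then show ?thesis using tw_outside[OF s, of v] tw_outside[OF \<kappa>(1)[OF U s], of v] by simp
  qed
  have "H \<in> twist_sections UNIV (m - n) UNIV"
  proof (rule twI)
    fix v assume "v \<notin> affine_cone (UNIV \<inter> UNIV)"
    then show "H v = 0" by (simp add: mem_affine_cone H_def)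
  next
    fix x :: proj_plane
    have "(\<lambda>v. inverse (\<rho> x v)) \<in> twist_sections UNIV (- n) (W x)"
      by (rule tw_inverse[OF W(3)]) (use W(4) in simp)
    from tw_mult[OF \<kappa>(1)[OF W(1,3)] this subset_refl subset_refl W(1)]
    have "(\<lambda>v. \<kappa> (W x) (\<rho> x) v * inverse (\<rho> x v)) \<in> twist_sections UNIV (m - n) (W x)" by simp
    then obtain V where V: "open V" "x \<in> V" "V \<subseteq> W x" "is_fraction (V \<inter> UNIV) (m - n) (\<lambda>v. \<kappa> (W x) (\<rho> x) v * inverse (\<rho> x v))"
      by (rule tw_local[OF _ W(2) UNIV_I])
    have "is_fraction (V \<inter> UNIV) (m - n) H"
      using V(4)
    proof (subst is_fraction_cong[of _ H])
      fix v assume "v \<in> affine_cone (V \<inter> UNIV)"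
      then have "v \<in> affine_cone (W x)" using V(3) by (auto simp: mem_affine_cone)
      then show "H v = \<kappa> (W x) (\<rho> x) v * inverse (\<rho> x v)" using \<kappa>H[OF W(1,3), of x v] W(4) by simp
    qed
    then show "\<exists>V. open V \<and> x \<in> V \<and> V \<subseteq> UNIV \<and> is_fraction (V \<inter> UNIV) (m - n) H" using V by blast
  qed
  then show thesis using \<kappa>H by (intro that) auto
qed

text \<open>A form as a global section of a twist: sections are zero at the origin, while a form of degree
  \<open>0\<close> need not be.\<close>

definition punctured :: "poly3 \<Rightarrow> complex^3 \<Rightarrow> complex"
  where "punctured p v = (if v = 0 then 0 else peval p v)"

lemma punctured_section: "homog k p \<Longrightarrow> punctured p \<in> twist_sections UNIV k UNIV"
proof -
  assume "homog k p"
  from tw_form[OF this, of UNIV UNIV]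
  have "(\<lambda>v. if v \<in> affine_cone (UNIV \<inter> UNIV) then peval p v else 0) \<in> twist_sections UNIV k UNIV" by simp
  also have "(\<lambda>v. if v \<in> affine_cone (UNIV \<inter> UNIV) then peval p v else 0) = punctured p"
    by (auto simp: punctured_def mem_affine_cone)
  finally show ?thesis .
qed

lemma punctured_mult:
  "s \<in> twist_sections UNIV k U \<Longrightarrow> (\<lambda>v. punctured p v * s v) = (\<lambda>v. peval p v * s v)"
  using tw_outside[of s UNIV k U 0] by (auto simp: punctured_def mem_affine_cone)

theorem presentation_of_resolution:
  assumes res: "plus_one_resolution (arrangement_bundle \<alpha> \<A>) a b d \<phi> \<psi>" and eqs: "resolution_equations b d \<phi> e g"
  obtains H where "presentation \<alpha> \<A> (- 1 - d) (- d) (- b) (- a) (punctured e) (punctured g) H (\<lambda>U y1 y2 y3. \<psi> U (y1, y2, y3))"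
proof -
  let ?T = "arrangement_bundle \<alpha> \<A>" and ?E = "direct_sum (twist UNIV (- d)) (direct_sum (twist UNIV (- b)) (twist UNIV (- a)))"
  have ex: "short_exact O_plane (twist UNIV (- 1 - d)) ?E ?T \<phi> \<psi>" using res by (simp add: plus_one_resolution_def)
  have hom\<phi>: "sheaf_hom O_plane (twist UNIV (- 1 - d)) ?E \<phi>" and hom\<psi>: "sheaf_hom O_plane ?E ?T \<psi>"
    using ex by (simp_all add: short_exact_def)
  have inj: "\<And>U. open U \<Longrightarrow> inj_on (\<phi> U) (twist_sections UNIV (- 1 - d) U)"
    and ker: "\<And>U t. open U \<Longrightarrow> t \<in> carrier (sections ?E U) \<Longrightarrow> \<psi> U t = \<zero>\<^bsub>sections ?T U\<^esub> \<longleftrightarrow> locally_in_image (twist UNIV (- 1 - d)) ?E \<phi> U t"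
    and surj: "\<And>U u. open U \<Longrightarrow> u \<in> carrier (sections ?T U) \<Longrightarrow> locally_in_image ?E ?T \<psi> U u"
    using ex unfolding short_exact_def by (metis twist_simps(1))+
  have h: "homog 1 e" "homog (d + 1 - b) g"
    and \<phi>12: "\<And>U s. open U \<Longrightarrow> s \<in> twist_sections UNIV (- 1 - d) U \<Longrightarrow> fst (\<phi> U s) = (\<lambda>v. peval e v * s v)"
      "\<And>U s. open U \<Longrightarrow> s \<in> twist_sections UNIV (- 1 - d) U \<Longrightarrow> fst (snd (\<phi> U s)) = (\<lambda>v. peval g v * s v)"
    using eqs by (simp_all add: resolution_equations_def)
  note \<phi>h = sheaf_homD[OF hom\<phi>] and \<psi>h = sheaf_homD[OF hom\<psi>]
  have "sheaf_hom O_plane (twist UNIV (- 1 - d)) (twist UNIV (- a)) (\<lambda>U s. snd (snd (\<phi> U s)))"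
    unfolding sheaf_hom_def
  proof (intro allI impI conjI ballI funcsetI)
    fix U and s assume U: "open U" and s: "s \<in> carrier (sections (twist UNIV (- 1 - d)) U)"
    show "snd (snd (\<phi> U s)) \<in> carrier (sections (twist UNIV (- a)) U)" using \<phi>h(1)[OF U s] by auto
    {
      fix t assume t: "t \<in> carrier (sections (twist UNIV (- 1 - d)) U)"
      show "snd (snd (\<phi> U (s \<oplus>\<^bsub>sections (twist UNIV (- 1 - d)) U\<^esub> t))) = snd (snd (\<phi> U s)) \<oplus>\<^bsub>sections (twist UNIV (- a)) U\<^esub> snd (snd (\<phi> U t))"
        by (subst \<phi>h(2)[OF U s t]) simp
    next
      fix V assume V: "open V" "V \<subseteq> U"
      show "snd (snd (\<phi> V (restr (twist UNIV (- 1 - d)) U V s))) = restr (twist UNIV (- a)) U V (snd (snd (\<phi> U s)))"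
        by (subst \<phi>h(4)[OF U V s]) simp
    }
    fix r assume r: "r \<in> carrier (sections O_plane U)"
    show "snd (snd (\<phi> U (r \<odot>\<^bsub>sections (twist UNIV (- 1 - d)) U\<^esub> s))) = r \<odot>\<^bsub>sections (twist UNIV (- a)) U\<^esub> snd (snd (\<phi> U s))"
      by (subst \<phi>h(3)[OF U r s]) simp
  qed
  then obtain H where H: "H \<in> twist_sections UNIV (- a - (- 1 - d)) UNIV"
    "\<And>U s. open U \<Longrightarrow> s \<in> twist_sections UNIV (- 1 - d) U \<Longrightarrow> snd (snd (\<phi> U s)) = (\<lambda>v. H v * s v)"
    by (rule hom_between_twists) blast
  have \<phi>: "\<phi> U s = (\<lambda>v. punctured e v * s v, \<lambda>v. punctured g v * s v, \<lambda>v. H v * s v)"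
    if "open U" "s \<in> twist_sections UNIV (- 1 - d) U" for U s
    using \<phi>12(1)[OF that] \<phi>12(2)[OF that] H(2)[OF that] by (simp add: prod_eq_iff punctured_mult[OF that(2)])
  have "presentation \<alpha> \<A> (- 1 - d) (- d) (- b) (- a) (punctured e) (punctured g) H (\<lambda>U y1 y2 y3. \<psi> U (y1, y2, y3))"
  proof
    show "punctured e \<in> twist_sections UNIV (- d - (- 1 - d)) UNIV" using punctured_section[OF h(1)] by simp
    show "punctured g \<in> twist_sections UNIV (- b - (- 1 - d)) UNIV" using punctured_section[OF h(2)] by (simp add: algebra_simps)
    show "H \<in> twist_sections UNIV (- a - (- 1 - d)) UNIV" by (rule H(1))
  next
    fix U c v assume U: "open U" and c: "c \<in> twist_sections UNIV (- 1 - d) U" and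
      z: "\<And>v. punctured e v * c v = 0" "\<And>v. punctured g v * c v = 0" "\<And>v. H v * c v = 0"
    have z0: "(\<lambda>v. 0) \<in> twist_sections UNIV (- 1 - d) U" by (rule tw_zero[OF U])
    have "\<phi> U c = \<phi> U (\<lambda>v. 0)" unfolding \<phi>[OF U c] \<phi>[OF U z0] by (simp add: z)
    then have "c = (\<lambda>v. 0)" using inj_onD[OF inj[OF U] _ c z0] by blast
    then show "c v = 0" by simp
  next
    fix U y1 y2 y3 assume U: "open U" and y: "y1 \<in> twist_sections UNIV (- d) U" "y2 \<in> twist_sections UNIV (- b) U" "y3 \<in> twist_sections UNIV (- a) U"
    then have yc: "(y1, y2, y3) \<in> carrier (sections ?E U)" by simp
    show "\<psi> U (y1, y2, y3) \<in> carrier (sections ?T U)" by (rule \<psi>h(1)[OF U yc])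
    {
      fix z1 z2 z3 assume z: "z1 \<in> twist_sections UNIV (- d) U" "z2 \<in> twist_sections UNIV (- b) U" "z3 \<in> twist_sections UNIV (- a) U"
      then have zc: "(z1, z2, z3) \<in> carrier (sections ?E U)" by simp
      show "\<psi> U (\<lambda>v. y1 v + z1 v, \<lambda>v. y2 v + z2 v, \<lambda>v. y3 v + z3 v) = \<psi> U (y1, y2, y3) \<oplus>\<^bsub>sections ?T U\<^esub> \<psi> U (z1, z2, z3)"
        using \<psi>h(2)[OF U yc zc] by (simp del: arrangement_bundle_ops)
    next
      fix r assume "r \<in> twist_sections UNIV 0 U"
      then have r: "r \<in> carrier (sections O_plane U)" by simp
      show "\<psi> U (\<lambda>v. r v * y1 v, \<lambda>v. r v * y2 v, \<lambda>v. r v * y3 v) = r \<odot>\<^bsub>sections ?T U\<^esub> \<psi> U (y1, y2, y3)"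
        using \<psi>h(3)[OF U r yc] by (simp del: arrangement_bundle_ops)
    next
      fix V assume V: "open V" "V \<subseteq> U"
      show "\<psi> V (\<lambda>v. if v \<in> affine_cone V then y1 v else 0, \<lambda>v. if v \<in> affine_cone V then y2 v else 0, \<lambda>v. if v \<in> affine_cone V then y3 v else 0)
        = restr ?T U V (\<psi> U (y1, y2, y3))"
        using \<psi>h(4)[OF U V yc] by (simp del: arrangement_bundle_ops)
    next
      fix x assume z: "\<psi> U (y1, y2, y3) = \<zero>\<^bsub>sections ?T U\<^esub>" and x: "x \<in> U"
      then obtain V s where V: "open V" "x \<in> V" "V \<subseteq> U" and s: "s \<in> twist_sections UNIV (- 1 - d) V" "\<phi> V s = restr ?E U V (y1, y2, y3)"
        using ker[OF U yc] unfolding locally_in_image_def by (metis twist_simps(1))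
      have "y1 v = punctured e v * s v \<and> y2 v = punctured g v * s v \<and> y3 v = H v * s v" if "v \<in> affine_cone V" for v
        using s(2) that unfolding \<phi>[OF V(1) s(1)] by (auto simp: fun_eq_iff)
      then show "\<exists>V c. open V \<and> x \<in> V \<and> V \<subseteq> U \<and> c \<in> twist_sections UNIV (- 1 - d) V \<and>
          (\<forall>v\<in>affine_cone V. y1 v = punctured e v * c v \<and> y2 v = punctured g v * c v \<and> y3 v = H v * c v)"
        using V s(1) by blast
    }
  next
    fix U c assume U: "open U" and c: "c \<in> twist_sections UNIV (- 1 - d) U"
    have cc: "c \<in> carrier (sections (twist UNIV (- 1 - d)) U)" using c by simp
    have "locally_in_image (twist UNIV (- 1 - d)) ?E \<phi> U (\<phi> U c)"
      unfolding locally_in_image_def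
    proof
      fix x assume x: "x \<in> U"
      have "restr (twist UNIV (- 1 - d)) U U c \<in> carrier (sections (twist UNIV (- 1 - d)) U)"
        using tw_restr[OF c U subset_refl] by simp
      then show "\<exists>V. open V \<and> x \<in> V \<and> V \<subseteq> U \<and> (\<exists>s\<in>carrier (sections (twist UNIV (- 1 - d)) V). \<phi> V s = restr ?E U V (\<phi> U c))"
        using U x \<phi>h(4)[OF U U subset_refl cc] by blast
    qed
    then have "\<psi> U (\<phi> U c) = \<zero>\<^bsub>sections ?T U\<^esub>" using ker[OF U \<phi>h(1)[OF U cc]] by blast
    then show "\<psi> U (\<lambda>v. punctured e v * c v, \<lambda>v. punctured g v * c v, \<lambda>v. H v * c v) = \<zero>\<^bsub>sections ?T U\<^esub>"
      unfolding \<phi>[OF U c] .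
  next
    fix U t x assume U: "open U" and t: "t \<in> carrier (sections ?T U)" and x: "x \<in> U"
    from surj[OF U t] x obtain V y where V: "open V" "x \<in> V" "V \<subseteq> U" "y \<in> carrier (sections ?E V)" "\<psi> V y = restr ?T U V t"
      unfolding locally_in_image_def by blast
    then show "\<exists>V y1 y2 y3. open V \<and> x \<in> V \<and> V \<subseteq> U \<and> y1 \<in> twist_sections UNIV (- d) V \<and> y2 \<in> twist_sections UNIV (- b) V \<and>
        y3 \<in> twist_sections UNIV (- a) V \<and> \<psi> V (y1, y2, y3) = restr ?T U V t"
      by (intro exI[of _ V] exI[of _ "fst y"] exI[of _ "fst (snd y)"] exI[of _ "snd (snd y)"]) (auto simp del: arrangement_bundle_ops)
  qed
  then show thesis by (rule that)
qed

section \<open>Splitting types\<close>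

lemma tw_to_line:
  assumes "H \<in> twist_sections UNIV k UNIV"
  shows "(\<lambda>v. if v \<in> affine_cone l then H v else 0) \<in> twist_sections l k UNIV"
  by (rule tw_restrict_line[OF assms open_UNIV])

lemma linear_power_section:
  assumes m: "homog 1 m" and k: "k \<ge> 0"
  shows "(\<lambda>v. if v \<in> affine_cone l then c * peval m v ^ nat k else 0) \<in> twist_sections l k UNIV"
proof -
  have "homog k (Poly_Mapping.single 0 c * m ^ nat k)"
    using homog_mult[OF homog_const homog_power[OF m, of "nat k"], of c] k by simp
  from tw_form[OF this open_UNIV, of l] show ?thesis by (simp add: peval_simps cong: if_cong)
qed

text \<open>Sections of \<open>\<O>(k)\<close> are homogeneous functions of degree \<open>k\<close>.\<close>

lemma tw_scale:
  assumes s: "s \<in> twist_sections X k UNIV" and k: "k \<ge> 0" and v: "v \<in> affine_cone X" and c: "c \<noteq> 0"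
  shows "s (c *s v) = c ^ nat k * s v"
proof -
  have v': "v \<noteq> 0" "pt v \<in> X" using v by (auto simp: mem_affine_cone)
  obtain V where V: "open V" "pt v \<in> V" "is_fraction (V \<inter> X) k s" using tw_local[OF s UNIV_I v'(2)] by metis
  obtain P Q m n where 1: "homog m P" "homog n Q" "m - n = k"
    "\<And>v. v \<in> affine_cone (V \<inter> X) \<Longrightarrow> peval Q v \<noteq> 0" "\<And>v. v \<in> affine_cone (V \<inter> X) \<Longrightarrow> s v = peval P v / peval Q v"
    using is_fractionE[OF V(3)] by metis
  have vV: "v \<in> affine_cone (V \<inter> X)" "c *s v \<in> affine_cone (V \<inter> X)"
    using V(2) v' pt_scale[OF c v'(1)] c by (simp_all add: mem_affine_cone)
  have e: "s (c *s v) = (c ^ nat m * peval P v) / (c ^ nat n * peval Q v)"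
    by (simp add: 1(5)[OF vV(2)] peval_scale[OF 1(1)] peval_scale[OF 1(2)])
  show ?thesis
  proof (cases "peval P v = 0")
    case True
    then show ?thesis by (simp add: e 1(5)[OF vV(1)])
  next
    case False
    then have "\<not> n < 0" using 1(4)[OF vV(1)] homog_neg[OF 1(2)] by fastforce
    then have "nat m = nat n + nat k" using 1(3) k by simp
    then show ?thesis using c by (simp add: e 1(5)[OF vV(1)] power_add)
  qed
qed

text \<open>The section \<open>B\<close> is a power of a linear form with \<open>r = 1\<close> at the zero
  \<open>C\<close> of \<open>e\<close>, scaled so that \<open>H - g B\<close> vanishes at \<open>C\<close>. By
  homogeneity it then vanishes at all multiples of \<open>C\<close>, and \<open>e\<close> divides it.\<close>

theorem splitting_disjoint:
  assumes pres: "presentation \<alpha> \<A> (- 1 - d) (- d) (- b) (- a) (punctured e) (punctured g) H \<Psi>"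
    and l: "defines_line p l" and e: "homog 1 e" and g: "homog (d + 1 - b) g" and ab: "a \<le> b" "b \<le> d"
    and disj: "\<And>v. v \<in> affine_cone l \<Longrightarrow> peval e v \<noteq> 0 \<or> peval g v \<noteq> 0"
  shows "sheaf_isomorphic O_plane (tensor_sheaf O_plane (arrangement_bundle \<alpha> \<A>) (twist l 0))
    (direct_sum (twist l (- a)) (twist l (1 - b)))"
proof -
  interpret presentation \<alpha> \<A> "- 1 - d" "- d" "- b" "- a" "punctured e" "punctured g" H \<Psi> by (rule pres)
  note p = defines_lineD[OF l]
  obtain C where C: "C \<noteq> 0" "peval p C = 0" "peval e C = 0" by (rule two_lines_meet[OF p(1,2) e])
  have Cl: "C \<in> affine_cone l" using C mem_cone_line[OF l] by simp
  have gC: "peval g C \<noteq> 0" using disj[OF Cl] C by simp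
  obtain v1 where v1: "v1 \<in> affine_cone l" "peval g v1 = 0"
    by (rule form_has_zero_on_line[OF l g]) (use ab in auto)
  have ev1: "peval e v1 \<noteq> 0" using disj[OF v1(1)] v1 by simp
  obtain q r A0 B0 where f: "frame p q r A0 B0 C" by (rule frame_exists[OF p(1,2) C(2,1)])
  note m = frame_homog(3)[OF f]
  define B where "B = (\<lambda>v. if v \<in> affine_cone l then (H C / peval g C) * peval r v ^ nat (b - a) else 0)"
  have B: "B \<in> twist_sections l (- a - - b) UNIV"
    using linear_power_section[OF m, of "b - a" l "H C / peval g C"] ab by (simp add: B_def)
  define t where "t = (\<lambda>v. (if v \<in> affine_cone l then H v else 0) - peval g v * B v)"
  have t: "t \<in> twist_sections l (- a - (- 1 - d)) UNIV"
    unfolding t_def using tw_form_mult[OF g B open_UNIV] by (intro tw_diff tw_to_line a(3) open_UNIV) (simp add: algebra_simps)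
  have homH: "H (c *s C) = c ^ nat (d + 1 - a) * H C" if "c \<noteq> 0" for c
    using tw_scale[OF a(3) _ _ that, of C] C(1) ab by (simp add: affine_cone_UNIV algebra_simps)
  have t0: "t v = 0" if v: "v \<in> affine_cone l" "peval e v = 0" for v
  proof -
    have v': "v \<noteq> 0" "peval p v = 0" using v(1) mem_cone_line[OF l] by auto
    have eB: "peval e w = peval q w * peval e B0" if "peval p w = 0" for w
      by (subst (1) frame_expand[OF f, of w]) (simp add: peval_linear[OF e] C that)
    have "peval e B0 \<noteq> 0" using eB[of v1] ev1 v1(1) mem_cone_line[OF l] by auto
    then have "peval q v = 0" using eB[OF v'(2)] v(2) by simp
    then have vC: "v = peval r v *s C" by (subst (1) frame_expand[OF f, of v]) (simp add: v')
    then have r0: "peval r v \<noteq> 0" using v'(1) by (metis vector_smult_lzero)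
    have "H v = peval r v ^ nat (d + 1 - a) * H C" using homH[OF r0] vC by simp
    moreover have "peval g v = peval r v ^ nat (d + 1 - b) * peval g C" using peval_scale[OF g, of "peval r v" C] vC by simp
    moreover have "nat (d + 1 - a) = nat (d + 1 - b) + nat (b - a)" using ab by simp
    ultimately show ?thesis using v(1) gC by (simp add: t_def B_def power_add)
  qed
  obtain A where A: "A \<in> twist_sections l (- a - (- 1 - d) - 1) UNIV" "\<And>v. v \<in> affine_cone l \<Longrightarrow> t v = peval e v * A v"
    by (rule tw_line_divide[OF l e v1(1) ev1 t t0]) blast+
  have A': "A \<in> twist_sections l (- a - - d) UNIV" using A(1) by (simp add: algebra_simps)
  have "sheaf_isomorphic O_plane (tensor_sheaf O_plane T (twist l 0))
      (direct_sum (twist l (- a)) (twist l (- d + - b - (- 1 - d))))"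
  proof (rule restriction_splits[OF l _ A' B])
    fix v assume v: "v \<in> affine_cone l"
    then have "v \<noteq> 0" by (simp add: mem_affine_cone)
    then show "punctured e v \<noteq> 0 \<or> punctured g v \<noteq> 0" using disj[OF v] by (simp add: punctured_def)
    show "H v = A v * punctured e v + B v * punctured g v"
      using A(2)[OF v] v \<open>v \<noteq> 0\<close> by (simp add: t_def punctured_def algebra_simps)
  qed
  then show ?thesis by (simp add: algebra_simps)
qed

text \<open>At the zero of \<open>e\<close> on the line \<open>g\<close> vanishes, so \<open>H\<close> does not.\<close>

theorem splitting_transversal:
  assumes pres: "presentation \<alpha> \<A> (- 1 - d) (- d) (- b) (- a) (punctured e) (punctured g) H \<Psi>"
    and l: "defines_line p l" and e: "homog 1 e" and g: "homog (d + 1 - b) g"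
    and e1: "v1 \<in> affine_cone l" "peval e v1 \<noteq> 0" and v0: "v0 \<in> affine_cone l" "peval e v0 = 0" "peval g v0 = 0"
  shows "sheaf_isomorphic O_plane (tensor_sheaf O_plane (arrangement_bundle \<alpha> \<A>) (twist l 0))
    (direct_sum (twist l (1 - a)) (twist l (- b)))"
proof -
  interpret orig: presentation \<alpha> \<A> "- 1 - d" "- d" "- b" "- a" "punctured e" "punctured g" H \<Psi> by (rule pres)
  interpret presentation \<alpha> \<A> "- 1 - d" "- d" "- a" "- b" "punctured e" H "punctured g" "\<lambda>U y1 y3 y2. \<Psi> U y1 y2 y3"
    by (rule orig.swap_23)
  note p = defines_lineD[OF l]
  have v0': "v0 \<noteq> 0" "peval p v0 = 0" using v0(1) mem_cone_line[OF l] by auto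
  obtain q r A0 B0 where f: "frame p q r A0 B0 v0" by (rule frame_exists[OF p(1,2) v0'(2,1)])
  have eB: "peval e w = peval q w * peval e B0" if "peval p w = 0" for w
    by (subst (1) frame_expand[OF f, of w]) (simp add: peval_linear[OF e] v0 that)
  have eB0: "peval e B0 \<noteq> 0" using eB[of v1] e1 mem_cone_line[OF l] by auto
  have multiple: "\<exists>c. c \<noteq> 0 \<and> v = c *s v0" if v: "v \<in> affine_cone l" "peval e v = 0" for v
  proof -
    have v': "v \<noteq> 0" "peval p v = 0" using v(1) mem_cone_line[OF l] by auto
    have "peval q v = 0" using eB[OF v'(2)] v(2) eB0 by simp
    then have vC: "v = peval r v *s v0" by (subst (1) frame_expand[OF f, of v]) (simp add: v')
    then have r0: "peval r v \<noteq> 0" using v'(1) by (metis vector_smult_lzero)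
    then show ?thesis using vC by blast
  qed
  have Hnz: "H v \<noteq> 0" if vl: "v \<in> affine_cone l" "peval e v = 0" for v
  proof
    assume H: "H v = 0"
    obtain c where c: "v = c *s v0" using multiple[OF vl] by blast
    have "peval g v = 0" unfolding c by (simp add: peval_scale[OF g] v0)
    moreover have "v \<noteq> 0" using vl by (simp add: mem_affine_cone)
    ultimately show False using orig.no_common_zero[of v] H vl(2) by (simp add: punctured_def)
  qed
  have g': "(\<lambda>v. if v \<in> affine_cone l then punctured g v else 0) \<in> twist_sections l (d + 1 - b) UNIV"
    by (rule tw_to_line[OF punctured_section[OF g]])
  have g0: "(if v \<in> affine_cone l then punctured g v else 0) = 0" if v: "v \<in> affine_cone l" "peval e v = 0" for v
  proof -
    obtain c where c: "v = c *s v0" using multiple[OF v] by blast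
    show ?thesis unfolding c by (simp add: punctured_def peval_scale[OF g] v0)
  qed
  obtain A where A: "A \<in> twist_sections l (d + 1 - b - 1) UNIV"
    "\<And>v. v \<in> affine_cone l \<Longrightarrow> (if v \<in> affine_cone l then punctured g v else 0) = peval e v * A v"
    using tw_line_divide[OF l e e1 g' g0] by blast
  have A': "A \<in> twist_sections l (- b - - d) UNIV" using A(1) by (simp add: algebra_simps)
  have "sheaf_isomorphic O_plane (tensor_sheaf O_plane T (twist l 0))
      (direct_sum (twist l (- b)) (twist l (- d + - a - (- 1 - d))))"
  proof (rule restriction_splits[OF l _ A' tw_zero[OF open_UNIV]])
    fix v assume v: "v \<in> affine_cone l"
    then have "v \<noteq> 0" by (simp add: mem_affine_cone)
    then show "punctured e v \<noteq> 0 \<or> H v \<noteq> 0" using Hnz[OF v] by (auto simp: punctured_def)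
    show "punctured g v = A v * punctured e v + 0 * H v"
      using A(2)[OF v] v \<open>v \<noteq> 0\<close> by (simp add: punctured_def)
  qed
  from sheaf_isomorphic_swap[OF this] show ?thesis by (simp add: algebra_simps)
qed

theorem splitting_on_e:
  assumes pres: "presentation \<alpha> \<A> (- 1 - d) (- d) (- b) (- a) (punctured e) (punctured g) H \<Psi>"
    and l: "defines_line p l" and e0: "\<And>v. v \<in> affine_cone l \<Longrightarrow> peval e v = 0"
  shows "sheaf_isomorphic O_plane (tensor_sheaf O_plane (arrangement_bundle \<alpha> \<A>) (twist l 0))
    (direct_sum (twist l (- d)) (twist l (d + 1 - a - b)))"
proof -
  interpret orig: presentation \<alpha> \<A> "- 1 - d" "- d" "- b" "- a" "punctured e" "punctured g" H \<Psi> by (rule pres)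
  interpret presentation \<alpha> \<A> "- 1 - d" "- b" "- a" "- d" "punctured g" H "punctured e" "\<lambda>U y2 y3 y1. \<Psi> U y1 y2 y3"
    by (rule orig.rotate)
  have "sheaf_isomorphic O_plane (tensor_sheaf O_plane T (twist l 0))
      (direct_sum (twist l (- d)) (twist l (- b + - a - (- 1 - d))))"
  proof (rule restriction_splits[OF l _ tw_zero[OF open_UNIV] tw_zero[OF open_UNIV]])
    fix v assume v: "v \<in> affine_cone l"
    then have "v \<noteq> 0" by (simp add: mem_affine_cone)
    then show "punctured g v \<noteq> 0 \<or> H v \<noteq> 0"
      using orig.no_common_zero[of v] e0[OF v] by (auto simp: punctured_def)
    show "punctured e v = 0 * punctured g v + 0 * H v" using e0[OF v] by (simp add: punctured_def)
  qed
  then show ?thesis by (simp add: algebra_simps)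
qed

text \<open>If \<open>e\<close> and \<open>g\<close> both vanished on the line, \<open>H\<close> would have no zero there,
  but it is a section of positive degree \<open>d + 1 - a\<close>.\<close>

lemma g_nonzero_on_e:
  assumes pres: "presentation \<alpha> \<A> (- 1 - d) (- d) (- b) (- a) (punctured e) (punctured g) H \<Psi>"
    and l: "defines_line p l" and e0: "\<And>v. v \<in> affine_cone l \<Longrightarrow> peval e v = 0" and ab: "a \<le> b" "b \<le> d"
  obtains v where "v \<in> affine_cone l" "peval g v \<noteq> 0"
proof -
  interpret presentation \<alpha> \<A> "- 1 - d" "- d" "- b" "- a" "punctured e" "punctured g" H \<Psi> by (rule pres)
  obtain v where v: "v \<in> affine_cone l" "(if v \<in> affine_cone l then H v else 0) = 0"
    by (rule section_has_zero_on_line[OF l tw_to_line[OF a(3)]]) (use ab in auto)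
  have "v \<noteq> 0" using v(1) by (simp add: mem_affine_cone)
  then have "peval g v \<noteq> 0" using no_common_zero[of v] v e0[OF v(1)] by (auto simp: punctured_def)
  then show thesis using that v(1) by blast
qed

section \<open>The local ring at a point of the line\<close>

lemma cring_O: assumes U: "open U" shows "cring (sections O_plane U)"
proof (rule cringI)
  show "abelian_group (sections O_plane U)"
  proof (rule abelian_groupI)
    fix s assume s: "s \<in> carrier (sections O_plane U)"
    then show "\<exists>t\<in>carrier (sections O_plane U). t \<oplus>\<^bsub>sections O_plane U\<^esub> s = \<zero>\<^bsub>sections O_plane U\<^esub>"
      using tw_cmult[of s UNIV 0 U "- 1"] U by (intro bexI[of _ "\<lambda>v. - 1 * s v"]) auto
  qed (simp_all add: tw_add tw_zero U algebra_simps)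
  have one: "(\<lambda>v. if v \<in> affine_cone (U \<inter> UNIV) then 1 else 0) \<in> twist_sections UNIV 0 U"
    using tw_form[OF homog_one U, of UNIV] by (simp cong: if_cong)
  show "Group.comm_monoid (sections O_plane U)"
  proof (rule comm_monoidI)
    fix s assume s: "s \<in> carrier (sections O_plane U)"
    then show "\<one>\<^bsub>sections O_plane U\<^esub> \<otimes>\<^bsub>sections O_plane U\<^esub> s = s"
      using tw_outside[of s UNIV 0 U] by (auto simp: fun_eq_iff)
  qed (use one in \<open>simp_all add: tw_O_mult U mult_ac\<close>)
qed (simp add: algebra_simps)

lemma ring_O: "open U \<Longrightarrow> ring (sections O_plane U)"
  using cring_O cring.axioms(1) by blast

definition fraction_section :: "proj_plane set \<Rightarrow> poly3 \<Rightarrow> poly3 \<Rightarrow> complex^3 \<Rightarrow> complex"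
  where "fraction_section U P Q v = (if v \<in> affine_cone U then peval P v / peval Q v else 0)"

lemma fraction_section_closed:
  assumes "open U" "homog n P" "homog n Q" "\<And>v. v \<in> affine_cone U \<Longrightarrow> peval Q v \<noteq> 0"
  shows "fraction_section U P Q \<in> twist_sections UNIV 0 U"
proof -
  have "is_fraction (U \<inter> UNIV) 0 (\<lambda>v. peval P v / peval Q v)"
    by (rule is_fractionI[OF assms(2,3)]) (use assms(4) in auto)
  from tw_fraction[OF assms(1) this] show ?thesis by (simp add: fraction_section_def[abs_def])
qed

abbreviation "stalk_ring x \<equiv> stalk O_plane O_plane x"

interpretation O: presheaf_module O_plane O_plane by (rule presheaf_module_twist)

lemma stalk_mult_eq_smult: "A \<otimes>\<^bsub>stalk_ring x\<^esub> B = A \<odot>\<^bsub>stalk_ring x\<^esub> B"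
  by (simp add: stalk_def)

lemma stalk_mult:
  assumes "open U" "x \<in> U" "s \<in> twist_sections UNIV 0 U" "t \<in> twist_sections UNIV 0 U"
  shows "germ O_plane x U s \<otimes>\<^bsub>stalk_ring x\<^esub> germ O_plane x U t = germ O_plane x U (\<lambda>v. s v * t v)"
  unfolding stalk_mult_eq_smult using O.stalk_smult[of U x s t] assms by simp

text \<open>The stalk at the point spanned by \<open>u\<close>. Each germ is represented by a fraction of forms, and
  computations in the stalk become identities between polynomial functions.\<close>

locale local_point =
  fixes u :: "complex^3"
  assumes u: "u \<noteq> 0"
begin

definition "is_rep P Q \<longleftrightarrow> (\<exists>n. homog n P \<and> homog n Q) \<and> peval Q u \<noteq> 0"

abbreviation "x \<equiv> pt u"
abbreviation "R \<equiv> stalk_ring x"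

definition "fr P Q = germ O_plane x (nonzero_locus Q) (fraction_section (nonzero_locus Q) P Q)"

lemma nonzero_locus_rep:
  assumes "is_rep P Q"
  shows "open (nonzero_locus Q)" "x \<in> nonzero_locus Q" "v \<in> affine_cone (nonzero_locus Q) \<Longrightarrow> peval Q v \<noteq> 0"
    "fraction_section (nonzero_locus Q) P Q \<in> twist_sections UNIV 0 (nonzero_locus Q)"
proof -
  obtain n where n: "homog n P" "homog n Q" and Q: "peval Q u \<noteq> 0" using assms by (auto simp: is_rep_def)
  show o: "open (nonzero_locus Q)" by (rule open_nonzero_locus[OF n(2)])
  show "x \<in> nonzero_locus Q" using pt_nonzero_locus[OF n(2) u] Q by simp
  show nz: "peval Q v \<noteq> 0" if "v \<in> affine_cone (nonzero_locus Q)" for v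
    using that pt_nonzero_locus[OF n(2)] by (auto simp: mem_affine_cone)
  show "fraction_section (nonzero_locus Q) P Q \<in> twist_sections UNIV 0 (nonzero_locus Q)"
    by (rule fraction_section_closed[OF o n nz])
qed

lemma germ_eq_fr:
  assumes U: "open U" "x \<in> U" "s \<in> twist_sections UNIV 0 U" and rep: "is_rep P Q"
    and W: "open W" "x \<in> W" "W \<subseteq> U" "\<And>v. v \<in> affine_cone W \<Longrightarrow> peval Q v \<noteq> 0 \<Longrightarrow> s v = peval P v / peval Q v"
  shows "germ O_plane x U s = fr P Q"
proof -
  note r = nonzero_locus_rep[OF rep]
  let ?Y = "W \<inter> nonzero_locus Q"
  show ?thesis unfolding fr_def
  proof (rule O.germ_eqI[of U x s "nonzero_locus Q" _ ?Y])
    show "restr O_plane U ?Y s = restr O_plane (nonzero_locus Q) ?Y (fraction_section (nonzero_locus Q) P Q)"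
      using W(4) r(3) by (auto simp: fraction_section_def affine_cone_Int)
  qed (use U W r in auto)
qed

lemma fr_eq_iff:
  assumes "is_rep P Q" "is_rep P' Q'"
  shows "fr P Q = fr P' Q' \<longleftrightarrow> (\<forall>v. peval P v * peval Q' v = peval P' v * peval Q v)"
proof
  note r = nonzero_locus_rep[OF assms(1)] and r' = nonzero_locus_rep[OF assms(2)]
  assume "fr P Q = fr P' Q'"
  then obtain W where W: "open W" "x \<in> W" "W \<subseteq> nonzero_locus Q" "W \<subseteq> nonzero_locus Q'"
    "restr O_plane (nonzero_locus Q) W (fraction_section (nonzero_locus Q) P Q) =
      restr O_plane (nonzero_locus Q') W (fraction_section (nonzero_locus Q') P' Q')"
    unfolding fr_def using O.germ_eqE[of x "nonzero_locus Q" _ "nonzero_locus Q'"] r r' by (metis twist_simps(1))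
  have "peval (P * Q' - P' * Q) v = 0" for v
  proof (rule peval_eq_0_dense_UNIV[OF W(1,2)])
    fix v assume v: "v \<in> affine_cone W"
    then have v': "v \<in> affine_cone (nonzero_locus Q)" "v \<in> affine_cone (nonzero_locus Q')"
      using affine_cone_mono W(3,4) by blast+
    have "peval P v / peval Q v = peval P' v / peval Q' v"
      using fun_cong[OF W(5), of v] v v' by (simp add: fraction_section_def)
    then show "peval (P * Q' - P' * Q) v = 0" using r(3)[OF v'(1)] r'(3)[OF v'(2)] by (simp add: peval_simps field_simps)
  qed
  then show "\<forall>v. peval P v * peval Q' v = peval P' v * peval Q v" by (simp add: peval_simps)
next
  note r = nonzero_locus_rep[OF assms(1)] and r' = nonzero_locus_rep[OF assms(2)]
  assume *: "\<forall>v. peval P v * peval Q' v = peval P' v * peval Q v"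
  show "fr P Q = fr P' Q'" unfolding fr_def[of P Q]
  proof (rule germ_eq_fr[OF r(1,2,4) assms(2) r(1,2) subset_refl])
    fix v assume v: "v \<in> affine_cone (nonzero_locus Q)" "peval Q' v \<noteq> 0"
    then show "fraction_section (nonzero_locus Q) P Q v = peval P' v / peval Q' v"
      using *[rule_format, of v] r(3)[OF v(1)] by (simp add: fraction_section_def field_simps)
  qed
qed

lemma fr_carrier: "is_rep P Q \<Longrightarrow> fr P Q \<in> carrier R"
  unfolding stalk_def fr_def using nonzero_locus_rep[of P Q] by auto

lemma fr_cases:
  assumes "\<xi> \<in> carrier R"
  obtains P Q where "is_rep P Q" "\<xi> = fr P Q"
proof -
  obtain U s where U: "\<xi> = germ O_plane x U s" "open U" "x \<in> U" "s \<in> twist_sections UNIV 0 U"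
    using assms unfolding stalk_def by auto
  obtain V where V: "open V" "x \<in> V" "V \<subseteq> U" "is_fraction (V \<inter> UNIV) 0 s" by (rule tw_local[OF U(4,3) UNIV_I])
  obtain P Q m n where 1: "homog m P" "homog n Q" "m - n = 0"
    "\<And>v. v \<in> affine_cone (V \<inter> UNIV) \<Longrightarrow> peval Q v \<noteq> 0" "\<And>v. v \<in> affine_cone (V \<inter> UNIV) \<Longrightarrow> s v = peval P v / peval Q v"
    using is_fractionE[OF V(4)] by metis
  have "peval Q u \<noteq> 0" using 1(4)[of u] V(2) u by (simp add: mem_affine_cone)
  then have rep: "is_rep P Q" using 1(1-3) by (auto simp: is_rep_def)
  show thesis
    by (rule that[OF rep]) (unfold U(1), rule germ_eq_fr[OF U(2-4) rep V(1-3)], use 1(5) in simp)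
qed

lemma rep_add: "is_rep P Q \<Longrightarrow> is_rep P' Q' \<Longrightarrow> is_rep (P * Q' + P' * Q) (Q * Q')"
  unfolding is_rep_def peval_mult by (metis add.commute homog_add homog_mult mult_eq_0_iff)

lemma rep_mult: "is_rep P Q \<Longrightarrow> is_rep P' Q' \<Longrightarrow> is_rep (P * P') (Q * Q')"
  unfolding is_rep_def peval_mult by (metis homog_mult mult_eq_0_iff)

lemma rep_uminus: "is_rep P Q \<Longrightarrow> is_rep (- P) Q"
  unfolding is_rep_def by (metis homog_uminus)

lemma rep_0: "is_rep 0 1" and rep_1: "is_rep 1 1"
  unfolding is_rep_def using homog_one by auto

lemma fr_op:
  assumes rep: "is_rep P Q" "is_rep P' Q'"
  shows fr_add: "fr P Q \<oplus>\<^bsub>R\<^esub> fr P' Q' = fr (P * Q' + P' * Q) (Q * Q')"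
    and fr_mult: "fr P Q \<otimes>\<^bsub>R\<^esub> fr P' Q' = fr (P * P') (Q * Q')"
proof -
  note r = nonzero_locus_rep[OF rep(1)] and r' = nonzero_locus_rep[OF rep(2)]
  let ?Y = "nonzero_locus Q \<inter> nonzero_locus Q'"
  have Y: "open ?Y" "x \<in> ?Y" "?Y \<subseteq> nonzero_locus Q" "?Y \<subseteq> nonzero_locus Q'" using r r' by auto
  note s = tw_restr[OF r(4) Y(1,3)] and t = tw_restr[OF r'(4) Y(1,4)]
  have e: "fr P Q = germ O_plane x ?Y (\<lambda>v. if v \<in> affine_cone ?Y then fraction_section (nonzero_locus Q) P Q v else 0)"
    "fr P' Q' = germ O_plane x ?Y (\<lambda>v. if v \<in> affine_cone ?Y then fraction_section (nonzero_locus Q') P' Q' v else 0)"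
    using O.germ_restr[OF r(1) Y(1,3,2), of "fraction_section (nonzero_locus Q) P Q"] r(4)
      O.germ_restr[OF r'(1) Y(1,4,2), of "fraction_section (nonzero_locus Q') P' Q'"] r'(4)
    by (simp_all add: fr_def)
  have nz: "v \<in> affine_cone ?Y \<Longrightarrow> peval Q v \<noteq> 0 \<and> peval Q' v \<noteq> 0" for v
    using r(3)[of v] r'(3)[of v] by (simp add: affine_cone_Int)
  show "fr P Q \<oplus>\<^bsub>R\<^esub> fr P' Q' = fr (P * Q' + P' * Q) (Q * Q')"
    unfolding e using O.stalk_add[OF Y(1,2), of "\<lambda>v. if v \<in> affine_cone ?Y then fraction_section (nonzero_locus Q) P Q v else 0"
        "\<lambda>v. if v \<in> affine_cone ?Y then fraction_section (nonzero_locus Q') P' Q' v else 0"] s t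
    by simp (rule germ_eq_fr[OF Y(1,2) tw_add[OF s t] rep_add[OF rep] Y(1,2) subset_refl],
        use nz in \<open>auto simp: fraction_section_def affine_cone_Int peval_simps field_simps\<close>)
  show "fr P Q \<otimes>\<^bsub>R\<^esub> fr P' Q' = fr (P * P') (Q * Q')"
    unfolding e stalk_mult[OF Y(1,2) s t]
    by (rule germ_eq_fr[OF Y(1,2) tw_O_mult[OF s t Y(1)] rep_mult[OF rep] Y(1,2) subset_refl])
      (use nz in \<open>auto simp: fraction_section_def affine_cone_Int peval_simps\<close>)
qed

lemma stalk_zero: "\<zero>\<^bsub>R\<^esub> = fr 0 1"
  unfolding stalk_def by simp (rule germ_eq_fr[OF open_UNIV UNIV_I tw_zero rep_0 open_UNIV], simp_all)

lemma stalk_one: "\<one>\<^bsub>R\<^esub> = fr 1 1"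
proof -
  have "(\<lambda>v. if v \<in> affine_cone (UNIV \<inter> UNIV) then 1 else 0) \<in> twist_sections UNIV 0 UNIV"
    using tw_form[OF homog_one open_UNIV, of UNIV] by (simp cong: if_cong)
  then show ?thesis
    unfolding stalk_def by simp (rule germ_eq_fr[OF open_UNIV UNIV_I _ rep_1 open_UNIV], simp_all)
qed

lemma cring_stalk: "cring R"
proof (rule cringI)
  show "abelian_group R"
  proof (rule abelian_groupI)
    fix a b c assume a: "a \<in> carrier R" and b: "b \<in> carrier R" and c: "c \<in> carrier R"
    obtain P Q where P: "is_rep P Q" "a = fr P Q" by (rule fr_cases[OF a])
    obtain P' Q' where P': "is_rep P' Q'" "b = fr P' Q'" by (rule fr_cases[OF b])
    obtain P'' Q'' where P'': "is_rep P'' Q''" "c = fr P'' Q''" by (rule fr_cases[OF c])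
    show "a \<oplus>\<^bsub>R\<^esub> b \<oplus>\<^bsub>R\<^esub> c = a \<oplus>\<^bsub>R\<^esub> (b \<oplus>\<^bsub>R\<^esub> c)"
      by (simp add: P P' P'' fr_add rep_add fr_eq_iff) (simp add: peval_simps algebra_simps)
  next
    fix a b assume a: "a \<in> carrier R" and b: "b \<in> carrier R"
    obtain P Q where P: "is_rep P Q" "a = fr P Q" by (rule fr_cases[OF a])
    obtain P' Q' where P': "is_rep P' Q'" "b = fr P' Q'" by (rule fr_cases[OF b])
    show "a \<oplus>\<^bsub>R\<^esub> b \<in> carrier R" by (simp add: P P' fr_add rep_add fr_carrier)
    show "a \<oplus>\<^bsub>R\<^esub> b = b \<oplus>\<^bsub>R\<^esub> a"
      by (simp add: P P' fr_add rep_add fr_eq_iff) (simp add: peval_simps algebra_simps)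
  next
    show "\<zero>\<^bsub>R\<^esub> \<in> carrier R" by (simp add: stalk_zero fr_carrier rep_0)
  next
    fix a assume a: "a \<in> carrier R"
    obtain P Q where P: "is_rep P Q" "a = fr P Q" by (rule fr_cases[OF a])
    show "\<zero>\<^bsub>R\<^esub> \<oplus>\<^bsub>R\<^esub> a = a"
      by (simp only: P stalk_zero fr_add rep_0 rep_add fr_eq_iff) (simp add: peval_simps algebra_simps)
    show "\<exists>b\<in>carrier R. b \<oplus>\<^bsub>R\<^esub> a = \<zero>\<^bsub>R\<^esub>"
      by (rule bexI[of _ "fr (- P) Q"])
        (simp only: P stalk_zero fr_add rep_0 rep_add rep_uminus fr_eq_iff, simp add: peval_simps algebra_simps,
         simp add: fr_carrier rep_uminus P)
  qed
  show "Group.comm_monoid R"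
  proof (rule comm_monoidI)
    fix a b c assume a: "a \<in> carrier R" and b: "b \<in> carrier R" and c: "c \<in> carrier R"
    obtain P Q where P: "is_rep P Q" "a = fr P Q" by (rule fr_cases[OF a])
    obtain P' Q' where P': "is_rep P' Q'" "b = fr P' Q'" by (rule fr_cases[OF b])
    obtain P'' Q'' where P'': "is_rep P'' Q''" "c = fr P'' Q''" by (rule fr_cases[OF c])
    show "a \<otimes>\<^bsub>R\<^esub> b \<otimes>\<^bsub>R\<^esub> c = a \<otimes>\<^bsub>R\<^esub> (b \<otimes>\<^bsub>R\<^esub> c)"
      by (simp add: P P' P'' fr_mult rep_mult fr_eq_iff mult.assoc)
  next
    fix a b assume a: "a \<in> carrier R" and b: "b \<in> carrier R"
    obtain P Q where P: "is_rep P Q" "a = fr P Q" by (rule fr_cases[OF a])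
    obtain P' Q' where P': "is_rep P' Q'" "b = fr P' Q'" by (rule fr_cases[OF b])
    show "a \<otimes>\<^bsub>R\<^esub> b \<in> carrier R" by (simp add: P P' fr_mult rep_mult fr_carrier)
    show "a \<otimes>\<^bsub>R\<^esub> b = b \<otimes>\<^bsub>R\<^esub> a" by (simp add: P P' fr_mult mult.commute)
  next
    show "\<one>\<^bsub>R\<^esub> \<in> carrier R" by (simp add: stalk_one fr_carrier rep_1)
  next
    fix a assume a: "a \<in> carrier R"
    obtain P Q where P: "is_rep P Q" "a = fr P Q" by (rule fr_cases[OF a])
    show "\<one>\<^bsub>R\<^esub> \<otimes>\<^bsub>R\<^esub> a = a" by (simp add: P stalk_one fr_mult rep_1)
  qed
  fix a b c assume a: "a \<in> carrier R" and b: "b \<in> carrier R" and c: "c \<in> carrier R"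
  obtain P Q where P: "is_rep P Q" "a = fr P Q" by (rule fr_cases[OF a])
  obtain P' Q' where P': "is_rep P' Q'" "b = fr P' Q'" by (rule fr_cases[OF b])
  obtain P'' Q'' where P'': "is_rep P'' Q''" "c = fr P'' Q''" by (rule fr_cases[OF c])
  show "(a \<oplus>\<^bsub>R\<^esub> b) \<otimes>\<^bsub>R\<^esub> c = a \<otimes>\<^bsub>R\<^esub> c \<oplus>\<^bsub>R\<^esub> b \<otimes>\<^bsub>R\<^esub> c"
    by (simp add: P P' P'' fr_mult fr_add rep_add rep_mult fr_eq_iff) (simp add: peval_simps algebra_simps)
qed

lemma ring_stalk: "ring R"
  using cring_stalk cring.axioms(1) by blast

end

section \<open>Order of vanishing along the line\<close>

lemma power_dvd_cancel:
  fixes a b :: "complex poly"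
  assumes "[:- s, 1:] ^ i dvd a * b" "poly b s \<noteq> 0"
  shows "[:- s, 1:] ^ i dvd a"
proof (cases "a = 0")
  case False
  have "b \<noteq> 0" using assms(2) by auto
  then have "order s (a * b) = order s a" using False assms(2) by (simp add: order_mult order_0I)
  then show ?thesis using assms(1) False \<open>b \<noteq> 0\<close> by (simp add: order_divides)
qed simp

text \<open>A point \<open>s0 B + C\<close> of the line \<open>p = 0\<close>. It lies in the affine part of the
  parametrisation.\<close>

locale line_point =
  fixes p q r :: poly3 and A B C :: "complex^3" and s0 :: complex
  assumes frame: "frame p q r A B C"
begin

sublocale local_point "s0 *s B + C"
  by unfold_locales (rule frame_vector_nonzero(1)[OF frame])

abbreviation "u \<equiv> s0 *s B + C"
abbreviation "X \<equiv> [:- s0, 1:]"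

lemmas hp = frame_homog(1)[OF frame] and hq = frame_homog(2)[OF frame] and hr = frame_homog(3)[OF frame]
lemmas on_line = frame_vector_nonzero(2,5,6)[OF frame]

text \<open>The restriction of a form to the parametrised line.\<close>

definition "rs P = (THE c. \<forall>s. poly c s = peval P (s *s B + C))"

lemma poly_rs: "poly (rs P) s = peval P (s *s B + C)"
proof -
  have "\<exists>!c. \<forall>s. poly c s = peval P (s *s B + C)"
  proof (rule ex_ex1I)
    show "\<exists>c. \<forall>s. poly c s = peval P (s *s B + C)" using peval_restrict_line[of P C B] by (simp add: add.commute)
    show "c = c'" if "\<forall>s. poly c s = peval P (s *s B + C)" "\<forall>s. poly c' s = peval P (s *s B + C)" for c c'
      using that by (simp add: poly_eq_poly_eq_iff[symmetric] fun_eq_iff)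
  qed
  from theI'[OF this] show ?thesis unfolding rs_def by blast
qed

lemma rs_eqI: "(\<And>s. poly c s = peval P (s *s B + C)) \<Longrightarrow> rs P = c"
  by (simp add: poly_eq_poly_eq_iff[symmetric] fun_eq_iff poly_rs)

lemma rs_mult: "rs (P * Q) = rs P * rs Q" and rs_add: "rs (P + Q) = rs P + rs Q" and rs_uminus: "rs (- P) = - rs P"
  and rs_diff: "rs (P - Q) = rs P - rs Q"
  and rs_0: "rs 0 = 0" and rs_1: "rs 1 = 1"
  by (rule rs_eqI; simp add: poly_rs peval_simps)+

lemma rs_cross: "\<forall>v. peval P v * peval Q' v = peval P' v * peval Q v \<Longrightarrow> rs P * rs Q' = rs P' * rs Q"
  by (simp add: poly_eq_poly_eq_iff[symmetric] fun_eq_iff poly_rs)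

text \<open>The germs whose restriction to the line vanishes to order at least \<open>i\<close> at the point.\<close>

definition "J i = {fr P Q | P Q. is_rep P Q \<and> X ^ i dvd rs P}"

lemma fr_in_J: assumes "is_rep P Q" shows "fr P Q \<in> J i \<longleftrightarrow> X ^ i dvd rs P"
proof
  assume "fr P Q \<in> J i"
  then obtain P' Q' where P': "is_rep P' Q'" "X ^ i dvd rs P'" "fr P Q = fr P' Q'" by (auto simp: J_def)
  have "rs P * rs Q' = rs P' * rs Q" by (rule rs_cross) (use fr_eq_iff[OF assms P'(1)] P'(3) in blast)
  then have "X ^ i dvd rs P * rs Q'" using P'(2) by simp
  then show "X ^ i dvd rs P" by (rule power_dvd_cancel) (use P'(1) in \<open>simp add: poly_rs is_rep_def\<close>)
qed (use assms in \<open>auto simp: J_def\<close>)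

lemma J_carrier: "J i \<subseteq> carrier R"
  by (auto simp: J_def fr_carrier)

lemma J_cases:
  assumes "\<xi> \<in> J i" obtains P Q where "is_rep P Q" "\<xi> = fr P Q" "X ^ i dvd rs P"
  using assms by (auto simp: J_def)

lemma ideal_J: "ideal (J i) R"
proof -
  interpret R: cring R by (rule cring_stalk)
  have mult: "a \<otimes>\<^bsub>R\<^esub> b \<in> J i" if a: "a \<in> J i" and b: "b \<in> carrier R" for a b
  proof -
    obtain P Q where P: "is_rep P Q" "a = fr P Q" "X ^ i dvd rs P" by (rule J_cases[OF a])
    obtain P' Q' where P': "is_rep P' Q'" "b = fr P' Q'" by (rule fr_cases[OF b])
    show ?thesis using P(3) by (simp add: P(1,2) P' fr_mult fr_in_J rep_mult rs_mult)
  qed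
  show ?thesis
  proof (rule idealI[OF ring_stalk])
    show "subgroup (J i) (add_monoid R)"
    proof
      fix a b assume a: "a \<in> J i" and b: "b \<in> J i"
      obtain P Q where P: "is_rep P Q" "a = fr P Q" "X ^ i dvd rs P" by (rule J_cases[OF a])
      obtain P' Q' where P': "is_rep P' Q'" "b = fr P' Q'" "X ^ i dvd rs P'" by (rule J_cases[OF b])
      have "a \<oplus>\<^bsub>R\<^esub> b \<in> J i" using P(3) P'(3) by (simp add: P(1,2) P'(1,2) fr_add fr_in_J rep_add rs_mult rs_add)
      then show "a \<otimes>\<^bsub>add_monoid R\<^esub> b \<in> J i" by simp
    next
      show "\<one>\<^bsub>add_monoid R\<^esub> \<in> J i" by (simp add: stalk_zero fr_in_J rep_0 rs_0)
    next
      fix a assume a: "a \<in> J i"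
      obtain P Q where P: "is_rep P Q" "a = fr P Q" "X ^ i dvd rs P" by (rule J_cases[OF a])
      have "fr (- P) Q \<oplus>\<^bsub>R\<^esub> a = \<zero>\<^bsub>R\<^esub>"
        by (simp only: P(1,2) stalk_zero fr_add rep_0 rep_add rep_uminus fr_eq_iff) (simp add: peval_simps algebra_simps)
      then have "\<ominus>\<^bsub>R\<^esub> a = fr (- P) Q"
        using R.minus_equality[of "fr (- P) Q" a] P(1,2) fr_carrier rep_uminus by simp
      then have "\<ominus>\<^bsub>R\<^esub> a \<in> J i" using P(3) by (simp add: fr_in_J rep_uminus P(1) rs_uminus)
      then show "inv\<^bsub>add_monoid R\<^esub> a \<in> J i" by (simp add: a_inv_def)
    qed (use J_carrier in auto)
    show "a \<otimes>\<^bsub>R\<^esub> b \<in> J i" if "a \<in> J i" "b \<in> carrier R" for a b using mult[OF that] .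
    show "b \<otimes>\<^bsub>R\<^esub> a \<in> J i" if "a \<in> J i" "b \<in> carrier R" for a b
      using mult[OF that] R.m_comm[OF that(2) subsetD[OF J_carrier that(1)]] by simp
  qed
qed

lemma J_0: "J 0 = carrier R"
  using J_carrier[of 0] fr_in_J[of _ _ 0] by (auto elim: fr_cases)

lemma J_mono: "i \<le> j \<Longrightarrow> J j \<subseteq> J i"
proof
  fix a assume "i \<le> j" "a \<in> J j"
  from this(2) obtain P Q where P: "is_rep P Q" "a = fr P Q" "X ^ j dvd rs P" by (rule J_cases)
  have "X ^ i dvd rs P" by (rule dvd_trans[OF le_imp_power_dvd[OF \<open>i \<le> j\<close>] P(3)])
  then show "a \<in> J i" by (simp add: P(1,2) fr_in_J)
qed

text \<open>The numerator of the \<open>i\<close>-th power of a uniformizer of the line at the point; the denominator is a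
  power of \<open>r\<close>.\<close>

definition uniformizer where "uniformizer i = (q - Poly_Mapping.single 0 s0 * r) ^ i"

lemma rep_uniformizer: "is_rep (uniformizer i) (r ^ i)"
proof -
  have "homog 1 (q - Poly_Mapping.single 0 s0 * r)"
    using homog_diff[OF hq] homog_mult[OF homog_const hr] by simp
  then show ?thesis
    unfolding is_rep_def uniformizer_def using homog_power[of 1 _ i] hr on_line by (simp add: peval_power) blast
qed

lemma rs_uniformizer: "rs (uniformizer i) = X ^ i"
  by (rule rs_eqI) (simp add: uniformizer_def peval_simps on_line)

lemma uniformizer_in_J: "fr (uniformizer i) (r ^ i) \<in> J j \<longleftrightarrow> j \<le> i"
  by (simp add: fr_in_J[OF rep_uniformizer] rs_uniformizer order_divides order_power_n_n)

lemma J_strict: "i < j \<Longrightarrow> J j \<subset> J i"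
  using J_mono[of i j] uniformizer_in_J[of i i] uniformizer_in_J[of i j] by auto

text \<open>Division in the local ring of the line, lifted to the plane: \<open>U\<close> and \<open>W\<close> are
  homogenisations of the cofactors of \<open>X ^ i\<close> in \<open>rs P\<close> and \<open>rs P'\<close>, of
  degrees chosen large enough to match.\<close>

lemma divide_modulo_line:
  assumes P: "homog m P" and P': "homog n P'" and i: "rs P = X ^ i * w" "poly w s0 \<noteq> 0" and i': "X ^ i dvd rs P'"
  obtains U W N k j where "homog k U" "homog j W" "k + n = j + m" "homog (k + n - 1) N" "peval U u \<noteq> 0"
    "\<And>v. peval P' v * peval U v = peval P v * peval W v + peval p v * peval N v"
proof -
  obtain w' where w': "rs P' = X ^ i * w'" using i' by (auto elim: dvdE)
  have "rs P \<noteq> 0" using i by auto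
  then have "P \<noteq> 0" using rs_0 by auto
  then have m: "m \<ge> 0" using homog_neg[OF P] by force
  let ?n = "max n 0"
  have P'n: "homog ?n P'" using P' homog_neg[OF P'] by (cases "n < 0") (auto simp: max_def)
  define K where "K = degree w + nat m + degree w'"
  define L where "L = degree w + nat ?n + degree w'"
  let ?U = "bin K w q r" and ?W = "bin L w' q r"
  have U: "homog (int K) ?U" "homog (int L) ?W" by (rule homog_bin[OF hq hr])+
  have rsU: "rs ?U = w" "rs ?W = w'"
    by (rule rs_eqI, subst poly_bin, simp_all add: K_def L_def on_line)+
  have hD: "homog (int K + ?n) (P' * ?U - P * ?W)"
  proof (rule homog_diff)
    show "homog (int K + ?n) (P' * ?U)" using homog_mult[OF P'n U(1)] by (simp add: add.commute)
    have "m + int L = int K + ?n" using m by (simp add: K_def L_def)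
    then show "homog (int K + ?n) (P * ?W)" using homog_mult[OF P U(2)] by simp
  qed
  have "peval (P' * ?U - P * ?W) (s *s B + C) = 0" for s
    unfolding poly_rs[symmetric] by (simp add: rs_diff rs_mult w' i(1) rsU)
  then obtain N where N: "homog (int K + ?n - 1) N" "\<And>v. peval (P' * ?U - P * ?W) v = peval p v * peval N v"
    using vanish_on_affine_line_imp_dvd[OF frame hD] by metis
  show thesis
  proof (cases "n < 0")
    case False
    then have "?n = n" by simp
    show thesis
    proof (rule that[OF U])
      show "int K + n = int L + m" using m False by (simp add: K_def L_def)
      show "homog (int K + n - 1) N" using N(1) \<open>?n = n\<close> by simp
      show "peval ?U u \<noteq> 0" using i(2) poly_rs[of ?U s0] rsU by simp
      show "peval P' v * peval ?U v = peval P v * peval ?W v + peval p v * peval N v" for v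
        using N(2)[of v] by (simp add: peval_simps algebra_simps)
    qed
  next
    case True
    then have "P' = 0" using homog_neg[OF P'] by simp
    then show thesis
      by (intro that[of "m" "r ^ nat m" n 0 0]) (use homog_power[OF hr, of "nat m"] m on_line in \<open>simp_all add: peval_power\<close>)
  qed
qed

text \<open>Modulo the equation of the line the stalk is a discrete valuation ring. The equation itself lies in \<open>J
  m\<close>, so an ideal above \<open>J m\<close> is determined by the least order of its elements.\<close>

lemma ideal_containing_J:
  assumes K: "ideal K R" and JK: "J m \<subseteq> K"
  obtains k where "k \<le> m" "K = J k"
proof -
  interpret K: ideal K R by (rule K)
  let ?Q = "\<lambda>k. \<exists>P Q. is_rep P Q \<and> fr P Q \<in> K \<and> \<not> X ^ Suc k dvd rs P"
  have ex: "?Q m"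
    using rep_uniformizer[of m] uniformizer_in_J[of m m] uniformizer_in_J[of m "Suc m"] JK fr_in_J[OF rep_uniformizer]
    by (intro exI[of _ "uniformizer m"] exI[of _ "r ^ m"]) auto
  define k where "k = (LEAST k. ?Q k)"
  have k: "?Q k" "k \<le> m" unfolding k_def by (rule LeastI[of ?Q, OF ex], rule Least_le[of ?Q, OF ex])
  have least: "X ^ k dvd rs P" if "is_rep P Q" "fr P Q \<in> K" for P Q
  proof (cases k)
    case (Suc k')
    then have "\<not> ?Q k'" using not_less_Least[of k' ?Q] by (simp add: k_def)
    then show ?thesis using that Suc by blast
  qed simp
  have "K = J k"
  proof (intro equalityI subsetI)
    fix a assume a: "a \<in> K"
    obtain P Q where P: "is_rep P Q" "a = fr P Q" by (rule fr_cases[OF K.a_subset[THEN subsetD, OF a]])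
    show "a \<in> J k" using least[OF P(1)] a by (simp add: P fr_in_J)
  next
    fix a assume "a \<in> J k"
    then obtain P' Q' where P': "is_rep P' Q'" "a = fr P' Q'" "X ^ k dvd rs P'" by (rule J_cases)
    obtain P Q where P: "is_rep P Q" "fr P Q \<in> K" "\<not> X ^ Suc k dvd rs P" using k(1) by blast
    obtain w where w: "rs P = X ^ k * w" using least[OF P(1,2)] by (auto elim: dvdE)
    have w0: "poly w s0 \<noteq> 0"
    proof
      assume "poly w s0 = 0"
      then have "X dvd w" by (simp add: poly_eq_0_iff_dvd)
      then have "X ^ Suc k dvd X ^ k * w" by (simp only: power_Suc2 mult_dvd_mono dvd_refl)
      then show False using P(3) w by simp
    qed
    obtain n where n: "homog n P'" "homog n Q'" and Q': "peval Q' u \<noteq> 0" using P'(1) by (auto simp: is_rep_def)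
    obtain m' where m': "homog m' P" "homog m' Q" and Q: "peval Q u \<noteq> 0" using P(1) by (auto simp: is_rep_def)
    obtain U W N i j where D: "homog i U" "homog j W" "i + n = j + m'" "homog (i + n - 1) N" "peval U u \<noteq> 0"
      "\<And>v. peval P' v * peval U v = peval P v * peval W v + peval p v * peval N v"
      by (rule divide_modulo_line[OF m'(1) n(1) w w0 P'(3)]) metis
    have r1: "is_rep (W * Q) (U * Q')"
      using homog_mult[OF D(2) m'(2)] homog_mult[OF D(1) n(2)] D(3,5) Q' by (auto simp: is_rep_def peval_simps)
    have r2: "is_rep (p * N) (U * Q')"
      using homog_mult[OF hp D(4)] homog_mult[OF D(1) n(2)] D(3,5) Q' by (auto simp: is_rep_def peval_simps)
    have "rs (p * N) = 0" by (rule rs_eqI) (simp add: peval_simps on_line)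
    then have "fr (p * N) (U * Q') \<in> K" using JK r2 by (auto simp: fr_in_J)
    moreover have "fr P Q \<otimes>\<^bsub>R\<^esub> fr (W * Q) (U * Q') \<in> K" by (rule K.I_r_closed[OF P(2) fr_carrier[OF r1]])
    ultimately have "fr P Q \<otimes>\<^bsub>R\<^esub> fr (W * Q) (U * Q') \<oplus>\<^bsub>R\<^esub> fr (p * N) (U * Q') \<in> K"
      using K.a_closed by blast
    moreover have "a = fr P Q \<otimes>\<^bsub>R\<^esub> fr (W * Q) (U * Q') \<oplus>\<^bsub>R\<^esub> fr (p * N) (U * Q')"
    proof -
      have e: "P'v * (qv * (uv * q'v) * (uv * q'v)) = (pv * (wv * qv) * (uv * q'v) + ppv * (qv * (uv * q'v))) * q'v"
        if "P'v * uv = pv * wv + ppv" for P'v uv pv wv ppv qv q'v :: complex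
      proof -
        have "P'v * (qv * (uv * q'v) * (uv * q'v)) = (P'v * uv) * (qv * q'v * uv * q'v)" by (simp only: mult_ac)
        also have "\<dots> = ((pv * (wv * qv)) * (uv * q'v) + ppv * (qv * (uv * q'v))) * q'v" unfolding that by (simp only: algebra_simps)
        finally show ?thesis .
      qed
      show ?thesis
        unfolding P'(2) fr_mult[OF P(1) r1] fr_add[OF rep_mult[OF P(1) r1] r2] fr_eq_iff[OF P'(1) rep_add[OF rep_mult[OF P(1) r1] r2]]
          peval_add peval_mult
        by (intro allI e D(6))
    qed
    ultimately show "a \<in> K" by simp
  qed
  then show thesis using that k(2) by blast
qed

lemma quotient_length_J: "quotient_length R (J m) = enat m"
  unfolding quotient_length_def
proof (rule antisym)
  show "Sup {enat n |n. \<exists>K. K 0 = J m \<and> K n = carrier R \<and> (\<forall>i\<le>n. ideal (K i) R) \<and> (\<forall>i<n. K i \<subset> K (Suc i))} \<le> enat m"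
  proof (rule Sup_least)
    fix y assume "y \<in> {enat n |n. \<exists>K. K 0 = J m \<and> K n = carrier R \<and> (\<forall>i\<le>n. ideal (K i) R) \<and> (\<forall>i<n. K i \<subset> K (Suc i))}"
    then obtain n K where y: "y = enat n" and K: "K 0 = J m" "K n = carrier R" "\<forall>i\<le>n. ideal (K i) R" "\<forall>i<n. K i \<subset> K (Suc i)"
      unfolding mem_Collect_eq by (elim exE conjE)
    have "\<exists>k. k + i \<le> m \<and> K i = J k" if "i \<le> n" for i
      using that
    proof (induction i)
      case 0
      then show ?case using K(1) by auto
    next
      case (Suc i)
      then obtain k where k: "k + i \<le> m" "K i = J k" by auto
      have "i < n" using Suc.prems by simp
      then have s: "J k \<subset> K (Suc i)" using K(4) k(2) by metis
      then obtain k' where k': "k' \<le> k" "K (Suc i) = J k'" using ideal_containing_J[of "K (Suc i)" k] K(3) Suc.prems by blast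
      then have "k' < k" using s by (metis le_neq_implies_less less_irrefl)
      then show ?case using k k' by (intro exI[of _ k']) auto
    qed
    from this[of n] show "y \<le> enat m" unfolding y by auto
  qed
  show "enat m \<le> Sup {enat n |n. \<exists>K. K 0 = J m \<and> K n = carrier R \<and> (\<forall>i\<le>n. ideal (K i) R) \<and> (\<forall>i<n. K i \<subset> K (Suc i))}"
    by (rule Sup_upper, rule CollectI, rule exI[of _ m], rule conjI[OF refl], rule exI[of _ "\<lambda>i. J (m - i)"])
      (simp add: J_0 ideal_J J_strict)
qed

end

section \<open>The scheme-theoretic intersection with a line\<close>

text \<open>The generators in the definition of the ideal sheaf of a subscheme given by forms.\<close>

definition form_fractions :: "poly3 set \<Rightarrow> proj_plane set \<Rightarrow> (complex^3 \<Rightarrow> complex) set"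
  where "form_fractions S V = {t \<in> carrier (sections O_plane V). \<exists>p\<in>S. \<exists>q k. homog k p \<and> homog k q \<and>
    (\<forall>v\<in>affine_cone V. peval q v \<noteq> 0 \<and> t v = peval p v / peval q v)}"

lemma forms_ideal_eq: "forms_ideal S U =
    {s \<in> carrier (sections O_plane U). \<forall>x\<in>U. \<exists>V. open V \<and> x \<in> V \<and> V \<subseteq> U \<and>
      restr O_plane U V s \<in> Idl\<^bsub>sections O_plane V\<^esub> form_fractions S V}"
  by (simp add: forms_ideal_def form_fractions_def)

lemma restr_self: "s \<in> twist_sections UNIV 0 V \<Longrightarrow> restr O_plane V V s = s"
  using tw_outside[of s UNIV 0 V] by (auto simp: fun_eq_iff)

lemma forms_idealI:
  assumes V: "open V" and s: "s \<in> twist_sections UNIV 0 V" and f: "f \<in> S"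
    and h: "homog k f" "homog k h" "\<And>v. v \<in> affine_cone V \<Longrightarrow> peval h v \<noteq> 0"
    and c: "c \<in> twist_sections UNIV 0 V" "\<And>v. v \<in> affine_cone V \<Longrightarrow> s v = peval f v / peval h v * c v"
  shows "s \<in> forms_ideal S V"
proof -
  interpret ring "sections O_plane V" by (rule ring_O[OF V])
  let ?t = "fraction_section V f h"
  have sub: "form_fractions S V \<subseteq> carrier (sections O_plane V)" by (auto simp: form_fractions_def)
  interpret I: ideal "Idl\<^bsub>sections O_plane V\<^esub> form_fractions S V" "sections O_plane V" by (rule genideal_ideal[OF sub])
  have "?t \<in> form_fractions S V"
    using fraction_section_closed[OF V h] f h unfolding form_fractions_def by (auto simp: fraction_section_def)
  then have "?t \<in> Idl\<^bsub>sections O_plane V\<^esub> form_fractions S V" using genideal_self[OF sub] by blast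
  then have "?t \<otimes>\<^bsub>sections O_plane V\<^esub> c \<in> Idl\<^bsub>sections O_plane V\<^esub> form_fractions S V"
    by (rule I.I_r_closed) (use c in simp)
  also have "?t \<otimes>\<^bsub>sections O_plane V\<^esub> c = s"
    using c(2) tw_outside[OF s] by (auto simp: fun_eq_iff fraction_section_def)
  finally have "restr O_plane V V s \<in> Idl\<^bsub>sections O_plane V\<^esub> form_fractions S V"
    by (simp only: restr_self[OF s])
  then show ?thesis unfolding forms_ideal_eq using V s by auto
qed

lemma zero_in_forms_ideal: "open V \<Longrightarrow> (\<lambda>v. 0) \<in> forms_ideal S V"
proof -
  assume V: "open V"
  interpret ring "sections O_plane V" by (rule ring_O[OF V])
  have sub: "form_fractions S V \<subseteq> carrier (sections O_plane V)" by (auto simp: form_fractions_def)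
  interpret I: ideal "Idl\<^bsub>sections O_plane V\<^esub> form_fractions S V" "sections O_plane V" by (rule genideal_ideal[OF sub])
  have "restr O_plane V V (\<lambda>v. 0) \<in> Idl\<^bsub>sections O_plane V\<^esub> form_fractions S V"
    using I.zero_closed by (simp add: cong: if_cong)
  then show ?thesis unfolding forms_ideal_eq using V tw_zero[OF V] by auto
qed

lemma intersection_idealI:
  assumes V: "open V" and s: "s \<in> twist_sections UNIV 0 V" and ab: "a \<in> vanishing_ideal l V" "b \<in> forms_ideal {e, g} V"
    and eq: "\<And>v. s v = a v + b v"
  shows "s \<in> intersection_ideal l e g V"
proof -
  have "restr O_plane V V s = a \<oplus>\<^bsub>sections O_plane V\<^esub> b" unfolding restr_self[OF s] using eq by auto
  then have "restr O_plane V V s \<in> vanishing_ideal l V <+>\<^bsub>sections O_plane V\<^esub> forms_ideal {e, g} V"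
    unfolding set_add_def' using ab by blast
  then show ?thesis unfolding intersection_ideal_def ideal_sum_def using V s by auto
qed

lemma ideal_stalk_I: "open U \<Longrightarrow> x \<in> U \<Longrightarrow> s \<in> I U \<Longrightarrow> germ O_plane x U s \<in> ideal_stalk O_plane I x"
  by (auto simp: ideal_stalk_def)

lemma intersection_ideal_closed: "intersection_ideal l e g U \<subseteq> carrier (sections O_plane U)"
  by (auto simp: intersection_ideal_def ideal_sum_def)

lemma ideal_stalk_subset: "ideal_stalk O_plane (intersection_ideal l e g) x \<subseteq> carrier (stalk_ring x)"
  using intersection_ideal_closed by (fastforce simp: ideal_stalk_def stalk_def)

lemma ideal_stalk_trivial:
  assumes W: "open W" "x \<in> W" and all: "\<And>V. open V \<Longrightarrow> V \<subseteq> W \<Longrightarrow> twist_sections UNIV 0 V \<subseteq> intersection_ideal l e g V"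
  shows "ideal_stalk O_plane (intersection_ideal l e g) x = carrier (stalk_ring x)"
proof (rule antisym[OF ideal_stalk_subset], rule subsetI)
  fix \<xi> assume "\<xi> \<in> carrier (stalk_ring x)"
  then obtain U s where U: "\<xi> = germ O_plane x U s" "open U" "x \<in> U" "s \<in> twist_sections UNIV 0 U"
    unfolding stalk_def by auto
  have V: "open (U \<inter> W)" "U \<inter> W \<subseteq> U" "x \<in> U \<inter> W" "U \<inter> W \<subseteq> W" using U W by auto
  have "\<xi> = germ O_plane x (U \<inter> W) (restr O_plane U (U \<inter> W) s)"
    using O.germ_restr[OF U(2) V(1-3), of s] U by simp
  moreover have "restr O_plane U (U \<inter> W) s \<in> twist_sections UNIV 0 (U \<inter> W)" using tw_restr[OF U(4) V(1,2)] by simp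
  ultimately show "\<xi> \<in> ideal_stalk O_plane (intersection_ideal l e g) x"
    using ideal_stalk_I[where I = "intersection_ideal l e g", OF V(1,3)] all[OF V(1,4)] by blast
qed

lemma sum_ideal_elements:
  assumes x: "x \<in> U" and s: "s \<in> intersection_ideal l e g U"
  obtains V a b where "open V" "x \<in> V" "V \<subseteq> U" "a \<in> twist_sections UNIV 0 V" "\<And>v. v \<in> affine_cone (V \<inter> l) \<Longrightarrow> a v = 0"
    "b \<in> Idl\<^bsub>sections O_plane V\<^esub> form_fractions {e, g} V" "\<And>v. v \<in> affine_cone V \<Longrightarrow> s v = a v + b v"
proof -
  obtain V where V: "open V" "x \<in> V" "V \<subseteq> U"
    "restr O_plane U V s \<in> vanishing_ideal l V <+>\<^bsub>sections O_plane V\<^esub> forms_ideal {e, g} V"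
    using s x unfolding intersection_ideal_def ideal_sum_def by blast
  obtain a b where ab: "a \<in> vanishing_ideal l V" "b \<in> forms_ideal {e, g} V" "restr O_plane U V s = a \<oplus>\<^bsub>sections O_plane V\<^esub> b"
    using V(4) unfolding set_add_def' by blast
  obtain W where W: "open W" "x \<in> W" "W \<subseteq> V" "restr O_plane V W b \<in> Idl\<^bsub>sections O_plane W\<^esub> form_fractions {e, g} W"
    using ab(2) V(2) unfolding forms_ideal_eq by blast
  have a: "a \<in> twist_sections UNIV 0 V" "\<And>v. v \<in> affine_cone (V \<inter> l) \<Longrightarrow> a v = 0" using ab(1) by (auto simp: vanishing_ideal_def)
  show thesis
  proof (rule that[OF W(1,2) _ _ _ W(4)])
    show "W \<subseteq> U" using W(3) V(3) by blast
    show "restr O_plane V W a \<in> twist_sections UNIV 0 W" using tw_restr[OF a(1) W(1,3)] by simp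
    show "restr O_plane V W a v = 0" if "v \<in> affine_cone (W \<inter> l)" for v
      using a(2)[of v] that W(3) by (auto simp: mem_affine_cone)
    show "s v = restr O_plane V W a v + restr O_plane V W b v" if "v \<in> affine_cone W" for v
      using fun_cong[OF ab(3), of v] that affine_cone_mono[OF W(3) that] by simp
  qed
qed

text \<open>Where one of the equations is nonzero it is a unit, and the ideal is everything. Where all of them vanish, so
  do all elements of the ideal.\<close>

theorem mem_subscheme_points:
  assumes l: "defines_line p l" and e: "homog i e" and g: "homog j g" and w: "w \<noteq> 0"
  shows "pt w \<in> subscheme_points O_plane (intersection_ideal l e g) \<longleftrightarrow> peval p w = 0 \<and> peval e w = 0 \<and> peval g w = 0"
proof
  let ?I = "intersection_ideal l e g"
  assume *: "pt w \<in> subscheme_points O_plane ?I"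
  show "peval p w = 0 \<and> peval e w = 0 \<and> peval g w = 0"
  proof (rule ccontr)
    assume nz: "\<not> ?thesis"
    have "ideal_stalk O_plane ?I (pt w) = carrier (stalk_ring (pt w))"
    proof (cases "peval p w = 0")
      case False
      have o: "open (- l)" using open_nonzero_locus[OF defines_lineD(1)[OF l]] defines_lineD(3)[OF l] by (simp add: nonzero_locus_def)
      show ?thesis
      proof (rule ideal_stalk_trivial[OF o])
        show "pt w \<in> - l" using False pt_mem_line[OF l w] by simp
        fix V assume V: "open V" "V \<subseteq> - l"
        show "twist_sections UNIV 0 V \<subseteq> ?I V"
        proof
          fix s assume s: "s \<in> twist_sections UNIV 0 V"
          have "s \<in> vanishing_ideal l V" using s V(2) by (auto simp: vanishing_ideal_def mem_affine_cone)
          then show "s \<in> ?I V" by (rule intersection_idealI[OF V(1) s _ zero_in_forms_ideal[OF V(1)]]) simp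
        qed
      qed
    next
      case True
      then obtain f k where f: "f \<in> {e, g}" "homog k f" "peval f w \<noteq> 0" using nz e g by blast
      show ?thesis
      proof (rule ideal_stalk_trivial[OF open_nonzero_locus[OF f(2)]])
        show "pt w \<in> nonzero_locus f" using f pt_nonzero_locus[OF f(2) w] by simp
        fix V assume V: "open V" "V \<subseteq> nonzero_locus f"
        have fnz: "peval f v \<noteq> 0" if "v \<in> affine_cone V" for v
          using that V(2) pt_nonzero_locus[OF f(2)] by (auto simp: mem_affine_cone)
        show "twist_sections UNIV 0 V \<subseteq> ?I V"
        proof
          fix s assume s: "s \<in> twist_sections UNIV 0 V"
          have "s \<in> forms_ideal {e, g} V"
            by (rule forms_idealI[OF V(1) s f(1) f(2) f(2) fnz s]) (use fnz in simp_all)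
          moreover have "(\<lambda>v. 0) \<in> vanishing_ideal l V" using tw_zero[OF V(1)] by (simp add: vanishing_ideal_def)
          ultimately show "s \<in> ?I V" by (intro intersection_idealI[OF V(1) s, of "\<lambda>v. 0" l s]) simp_all
        qed
      qed
    qed
    then show False using * by (simp add: subscheme_points_def)
  qed
next
  let ?I = "intersection_ideal l e g"
  assume z: "peval p w = 0 \<and> peval e w = 0 \<and> peval g w = 0"
  interpret local_point w by unfold_locales (rule w)
  have "fr 1 1 \<notin> ideal_stalk O_plane ?I (pt w)"
  proof
    assume "fr 1 1 \<in> ideal_stalk O_plane ?I (pt w)"
    then obtain U s where U: "fr 1 1 = germ O_plane (pt w) U s" "open U" "pt w \<in> U" "s \<in> ?I U"
      by (auto simp: ideal_stalk_def)
    have s: "s \<in> twist_sections UNIV 0 U" using intersection_ideal_closed U(4) by fastforce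
    obtain V a b where V: "open V" "pt w \<in> V" "V \<subseteq> U" "a \<in> twist_sections UNIV 0 V" "\<And>v. v \<in> affine_cone (V \<inter> l) \<Longrightarrow> a v = 0"
      "b \<in> Idl\<^bsub>sections O_plane V\<^esub> form_fractions {e, g} V" "\<And>v. v \<in> affine_cone V \<Longrightarrow> s v = a v + b v"
      by (rule sum_ideal_elements[OF U(3,4)]) blast
    interpret OV: cring "sections O_plane V" by (rule cring_O[OF V(1)])
    let ?M = "{t \<in> twist_sections UNIV 0 V. t w = 0}"
    have neg: "\<ominus>\<^bsub>sections O_plane V\<^esub> t = (\<lambda>v. - 1 * t v)" if "t \<in> twist_sections UNIV 0 V" for t
      by (rule OV.minus_equality) (use that tw_cmult[OF that V(1), of "- 1"] in auto)
    have "ideal ?M (sections O_plane V)"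
    proof (rule idealI[OF ring_O[OF V(1)]])
      show "subgroup ?M (add_monoid (sections O_plane V))"
      proof
        fix t assume t: "t \<in> ?M"
        have "inv\<^bsub>add_monoid (sections O_plane V)\<^esub> t = (\<lambda>v. - 1 * t v)" using neg[of t] t by (simp add: a_inv_def)
        then show "inv\<^bsub>add_monoid (sections O_plane V)\<^esub> t \<in> ?M" using t tw_cmult[of t UNIV 0 V "- 1"] V(1) by simp
      qed (use V(1) in \<open>auto simp: tw_add tw_zero\<close>)
    qed (use V(1) in \<open>auto simp: tw_O_mult\<close>)
    moreover have "form_fractions {e, g} V \<subseteq> ?M"
      using z V(2) w by (auto simp: form_fractions_def mem_affine_cone)
    ultimately have "b \<in> ?M" using OV.genideal_minimal V(6) by blast
    moreover have wV: "w \<in> affine_cone V" "w \<in> affine_cone (V \<inter> l)"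
      using V(2) w z pt_mem_line[OF l w] by (auto simp: mem_affine_cone)
    ultimately have "s w = 0" using V(5)[OF wV(2)] V(7)[OF wV(1)] by simp
    obtain W where W: "open W" "pt w \<in> W" "W \<subseteq> nonzero_locus 1" "W \<subseteq> U"
      "restr O_plane (nonzero_locus 1) W (fraction_section (nonzero_locus 1) 1 1) = restr O_plane U W s"
      using O.germ_eqE[OF U(1)[unfolded fr_def] nonzero_locus_rep(1,2)[OF rep_1] _ U(2,3)] nonzero_locus_rep(4)[OF rep_1] s by (metis twist_simps(1))
    have "w \<in> affine_cone W" "w \<in> affine_cone (nonzero_locus 1)" using W w by (auto simp: mem_affine_cone)
    then show False using fun_cong[OF W(5), of w] \<open>s w = 0\<close> by (simp add: fraction_section_def)
  qed
  moreover have "fr 1 1 \<in> carrier (stalk_ring (pt w))" by (rule fr_carrier[OF rep_1])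
  ultimately show "pt w \<in> subscheme_points O_plane ?I" by (auto simp: subscheme_points_def)
qed

context line_point begin

text \<open>One inclusion holds since the equation of the line, \<open>e\<close> and \<open>g\<close> vanish on the line
  to order at least \<open>m\<close>, and \<open>J m\<close> is an ideal. For the other one divide by
  \<open>g\<close> in the local ring of the line.\<close>

lemma ideal_stalk_eq_J:
  assumes l: "defines_line p l" and e: "\<And>v. v \<in> affine_cone l \<Longrightarrow> peval e v = 0"
    and g: "homog n g" and w: "rs g = X ^ m * w" "poly w s0 \<noteq> 0"
  shows "ideal_stalk O_plane (intersection_ideal l e g) (pt u) = J m"
proof (intro equalityI subsetI)
  let ?I = "intersection_ideal l e g"
  fix \<xi> assume "\<xi> \<in> ideal_stalk O_plane ?I (pt u)"
  then obtain U s where U: "\<xi> = germ O_plane x U s" "open U" "x \<in> U" "s \<in> ?I U"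
    by (auto simp: ideal_stalk_def)
  have s: "s \<in> twist_sections UNIV 0 U" using intersection_ideal_closed U(4) by fastforce
  obtain V a b where V: "open V" "x \<in> V" "V \<subseteq> U" "a \<in> twist_sections UNIV 0 V" "\<And>v. v \<in> affine_cone (V \<inter> l) \<Longrightarrow> a v = 0"
    "b \<in> Idl\<^bsub>sections O_plane V\<^esub> form_fractions {e, g} V" "\<And>v. v \<in> affine_cone V \<Longrightarrow> s v = a v + b v"
    by (rule sum_ideal_elements[OF U(3,4)]) blast
  interpret Jm: ideal "J m" R by (rule ideal_J)
  interpret R: cring R by (rule cring_stalk)
  interpret OV: cring "sections O_plane V" by (rule cring_O[OF V(1)])
  let ?g = "germ O_plane x V"
  have g_closed: "?g t \<in> carrier R" if "t \<in> twist_sections UNIV 0 V" for t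
    using that V(1,2) by (auto simp: stalk_def)
  have g_add: "?g (\<lambda>v. t v + t' v) = ?g t \<oplus>\<^bsub>R\<^esub> ?g t'" if "t \<in> twist_sections UNIV 0 V" "t' \<in> twist_sections UNIV 0 V" for t t'
    using O.stalk_add[OF V(1,2), of t t'] that by simp
  have g_mult: "?g (\<lambda>v. t v * t' v) = ?g t \<otimes>\<^bsub>R\<^esub> ?g t'" if "t \<in> twist_sections UNIV 0 V" "t' \<in> twist_sections UNIV 0 V" for t t'
    using stalk_mult[OF V(1,2) that] by simp
  have g_0: "?g (\<lambda>v. 0) = \<zero>\<^bsub>R\<^esub>"
    unfolding stalk_zero by (rule germ_eq_fr[OF V(1,2) tw_zero[OF V(1)] rep_0 V(1,2)]) simp_all
  have neg: "\<ominus>\<^bsub>sections O_plane V\<^esub> t = (\<lambda>v. - 1 * t v)" if "t \<in> twist_sections UNIV 0 V" for t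
    by (rule OV.minus_equality) (use that tw_cmult[OF that V(1), of "- 1"] in auto)
  have g_neg: "?g (\<lambda>v. - 1 * t v) = \<ominus>\<^bsub>R\<^esub> ?g t" if t: "t \<in> twist_sections UNIV 0 V" for t
  proof (rule Jm.minus_equality[symmetric])
    show "?g (\<lambda>v. - 1 * t v) \<oplus>\<^bsub>R\<^esub> ?g t = \<zero>\<^bsub>R\<^esub>"
      using g_add[OF tw_cmult[OF t V(1), of "- 1"] t] g_0 by simp
  qed (use g_closed t tw_cmult[OF t V(1), of "- 1"] in auto)
  let ?M = "{t \<in> twist_sections UNIV 0 V. ?g t \<in> J m}"
  have "ideal ?M (sections O_plane V)"
  proof (rule idealI[OF ring_O[OF V(1)]])
    show "subgroup ?M (add_monoid (sections O_plane V))"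
    proof
      fix t assume t: "t \<in> ?M"
      have "inv\<^bsub>add_monoid (sections O_plane V)\<^esub> t = (\<lambda>v. - 1 * t v)" using neg[of t] t by (simp add: a_inv_def)
      then show "inv\<^bsub>add_monoid (sections O_plane V)\<^esub> t \<in> ?M"
        using t tw_cmult[of t UNIV 0 V "- 1"] V(1) g_neg[of t] Jm.a_inv_closed[of "?g t"] by simp
    qed (use V(1) g_0 Jm.zero_closed in \<open>auto simp: tw_add tw_zero g_add Jm.a_closed\<close>)
  qed (use V(1) g_closed in \<open>auto simp: tw_O_mult g_mult Jm.I_l_closed Jm.I_r_closed\<close>)
  moreover have "form_fractions {e, g} V \<subseteq> ?M"
  proof
    fix t assume "t \<in> form_fractions {e, g} V"
    then obtain f h k where t: "t \<in> twist_sections UNIV 0 V" and f: "f \<in> {e, g}" and hk: "homog k f" "homog k h"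
      and th: "\<And>v. v \<in> affine_cone V \<Longrightarrow> peval h v \<noteq> 0 \<and> t v = peval f v / peval h v" by (auto simp: form_fractions_def)
    have "u \<in> affine_cone V" using V(2) local_point.u[OF local_point_axioms] by (simp add: mem_affine_cone)
    then have rep: "is_rep f h" using hk th by (auto simp: is_rep_def)
    have "?g t = fr f h" by (rule germ_eq_fr[OF V(1,2) t rep V(1,2)]) (use th in auto)
    moreover have "X ^ m dvd rs f"
    proof (cases "f = g")
      case False
      then have "f = e" using f by simp
      moreover have "rs e = 0"
        by (rule rs_eqI) (use e mem_cone_line[OF l] frame_vector_nonzero[OF frame] in simp)
      ultimately show ?thesis by simp
    qed (simp add: w)
    ultimately show "t \<in> ?M" using t rep by (simp add: fr_in_J)
  qed
  ultimately have b: "b \<in> ?M" using OV.genideal_minimal V(6) by blast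
  have "?g a \<in> J m"
  proof -
    obtain P Q where P: "is_rep P Q" "?g a = fr P Q" by (rule fr_cases[OF g_closed[OF V(4)]])
    note r = nonzero_locus_rep[OF P(1)]
    obtain W where W: "open W" "x \<in> W" "W \<subseteq> V" "W \<subseteq> nonzero_locus Q"
      "restr O_plane V W a = restr O_plane (nonzero_locus Q) W (fraction_section (nonzero_locus Q) P Q)"
      using O.germ_eqE[OF P(2)[unfolded fr_def] V(1,2) _ r(1,2)] V(4) r(4) by (metis twist_simps(1))
    have "peval P v = 0" if pv: "peval p v = 0" for v
    proof (rule peval_eq_0_dense_line[OF hp W(1) local_point.u[OF local_point_axioms] on_line(1) W(2) _ pv])
      fix v assume v: "v \<noteq> 0" "peval p v = 0" "pt v \<in> W"
      then have vc: "v \<in> affine_cone W" "v \<in> affine_cone (nonzero_locus Q)" "v \<in> affine_cone (V \<inter> l)"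
        using W(3,4) pt_mem_line[OF l] by (auto simp: mem_affine_cone)
      then show "peval P v = 0" using fun_cong[OF W(5), of v] V(5)[OF vc(3)] r(3)[OF vc(2)] by (simp add: fraction_section_def)
    qed
    then have "rs P = 0" by (intro rs_eqI) (simp add: on_line)
    then show ?thesis by (simp add: P fr_in_J)
  qed
  moreover have "\<xi> = ?g a \<oplus>\<^bsub>R\<^esub> ?g b"
  proof -
    have "restr O_plane U V s = (\<lambda>v. a v + b v)"
      using V(7) tw_outside[OF V(4)] tw_outside[of b UNIV 0 V] b by (auto simp: fun_eq_iff)
    then have "\<xi> = ?g (\<lambda>v. a v + b v)" using O.germ_restr[OF U(2) V(1,3,2), of s] U(1) s by simp
    then show ?thesis using g_add[OF V(4)] b by simp
  qed
  ultimately show "\<xi> \<in> J m" using Jm.a_closed b by simp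
next
  let ?I = "intersection_ideal l e g"
  fix \<xi> assume "\<xi> \<in> J m"
  then obtain P' Q' where P': "is_rep P' Q'" "\<xi> = fr P' Q'" "X ^ m dvd rs P'" by (rule J_cases)
  obtain n' where n': "homog n' P'" "homog n' Q'" and Q': "peval Q' u \<noteq> 0" using P'(1) by (auto simp: is_rep_def)
  obtain U W N i j where D: "homog i U" "homog j W" "i + n' = j + n" "homog (i + n' - 1) N" "peval U u \<noteq> 0"
    "\<And>v. peval P' v * peval U v = peval g v * peval W v + peval p v * peval N v"
    by (rule divide_modulo_line[OF g n'(1) w P'(3)]) metis
  have "rs g \<noteq> 0" using w by auto
  then have "g \<noteq> 0" using rs_0 by auto
  then have n0: "n \<ge> 0" using homog_neg[OF g] by force
  have rn: "homog n (r ^ nat n)" using homog_power[OF hr, of "nat n"] n0 by simp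
  let ?Y = "nonzero_locus U \<inter> nonzero_locus Q' \<inter> nonzero_locus r"
  have u0: "u \<noteq> 0" by (rule local_point.u[OF local_point_axioms])
  have Y: "open ?Y" "x \<in> ?Y"
    using open_nonzero_locus[OF D(1)] open_nonzero_locus[OF n'(2)] open_nonzero_locus[OF hr]
      pt_nonzero_locus[OF D(1) u0] pt_nonzero_locus[OF n'(2) u0] pt_nonzero_locus[OF hr u0] D(5) Q' on_line by auto
  have nz: "peval U v \<noteq> 0 \<and> peval Q' v \<noteq> 0 \<and> peval r v \<noteq> 0" if "v \<in> affine_cone ?Y" for v
    using that pt_nonzero_locus[OF D(1), of v] pt_nonzero_locus[OF n'(2), of v] pt_nonzero_locus[OF hr, of v]
    by (auto simp: mem_affine_cone)
  let ?a = "fraction_section ?Y (p * N) (U * Q')" and ?b = "fraction_section ?Y (g * W) (U * Q')" and ?s = "fraction_section ?Y P' Q'"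
    and ?c = "fraction_section ?Y (W * r ^ nat n) (U * Q')"
  have hUQ: "homog (i + n') (U * Q')" by (rule homog_mult[OF D(1) n'(2)])
  have hs: "homog (i + n') (p * N)" "homog (i + n') (g * W)" "homog (i + n') (W * r ^ nat n)"
    using homog_mult[OF hp D(4)] homog_mult[OF g D(2)] homog_mult[OF D(2) rn] D(3) by (simp_all add: add.commute)
  have nzUQ: "peval (U * Q') v \<noteq> 0" if "v \<in> affine_cone ?Y" for v using nz[OF that] by (simp add: peval_mult)
  have closed: "?a \<in> twist_sections UNIV 0 ?Y" "?b \<in> twist_sections UNIV 0 ?Y" "?c \<in> twist_sections UNIV 0 ?Y" "?s \<in> twist_sections UNIV 0 ?Y"
    by (intro fraction_section_closed[OF Y(1) _ hUQ nzUQ] hs; assumption)+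
      (intro fraction_section_closed[OF Y(1) n'], use nz in blast)
  have "?s \<in> ?I ?Y"
  proof (rule intersection_idealI[OF Y(1) closed(4)])
    show "?a \<in> vanishing_ideal l ?Y"
      using closed(1) mem_cone_line[OF l] by (auto simp: vanishing_ideal_def fraction_section_def affine_cone_Int peval_mult)
    show "?b \<in> forms_ideal {e, g} ?Y"
      by (rule forms_idealI[OF Y(1) closed(2) _ g rn _ closed(3)])
        (use nz in \<open>auto simp: fraction_section_def peval_simps\<close>)
    show "?s v = ?a v + ?b v" for v
    proof (cases "v \<in> affine_cone ?Y")
      case True
      have "peval P' v / peval Q' v = (peval P' v * peval U v) / (peval U v * peval Q' v)" using nz[OF True] by simp
      then show ?thesis using True unfolding D(6) by (simp add: fraction_section_def peval_mult add_divide_distrib)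
    qed (simp add: fraction_section_def)
  qed
  moreover have "\<xi> = germ O_plane x ?Y ?s"
    unfolding P'(2) by (rule germ_eq_fr[OF Y closed(4) P'(1) Y subset_refl, symmetric]) (simp add: fraction_section_def)
  ultimately show "\<xi> \<in> ideal_stalk O_plane ?I (pt u)"
    using ideal_stalk_I[where I = ?I, OF Y(1,2)] by simp
qed

end

text \<open>Put a point \<open>v1\<close> of the line with \<open>g \<noteq> 0\<close> at infinity. Then the restriction
  of \<open>g\<close> to the affine part has degree exactly \<open>k\<close>, its roots are the points of the
  scheme, and the length at a root is its multiplicity.\<close>

theorem subscheme_length_on_e:
  assumes l: "defines_line p l" and e: "homog i e" "\<And>v. v \<in> affine_cone l \<Longrightarrow> peval e v = 0"
    and g: "homog (int k) g" and nz: "v1 \<in> affine_cone l" "peval g v1 \<noteq> 0"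
  shows "subscheme_length O_plane (intersection_ideal l e g) = enat k"
proof -
  let ?I = "intersection_ideal l e g"
  note p = defines_lineD[OF l]
  have v1: "v1 \<noteq> 0" "peval p v1 = 0" using nz(1) mem_cone_line[OF l] by auto
  obtain q r A C where f': "frame p q r A C v1" by (rule frame_exists[OF p(1,2) v1(2,1)])
  note f = frame_swap[OF f']
  note b = frame_basis[OF f]
  obtain c where c: "degree c \<le> k" "\<And>s. poly c s = peval g (s *s v1 + C)" "coeff c k = peval g v1"
    using line_poly[OF f g] by metis
  have dc: "degree c = k" "c \<noteq> 0" using c(1,3) nz(2) le_degree[of c k] by auto
  let ?P = "\<lambda>s. pt (s *s v1 + C)"
  have points: "subscheme_points O_plane ?I = ?P ` {s. poly c s = 0}"
  proof (intro equalityI subsetI)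
    fix x assume x: "x \<in> subscheme_points O_plane ?I"
    obtain w where w: "w \<noteq> 0" "x = pt w" by (rule pt_cases)
    have z: "peval p w = 0" "peval g w = 0" using x mem_subscheme_points[OF l e(1) g w(1)] w(2) by auto
    have wd: "w = peval r w *s v1 + peval q w *s C" by (subst (1) frame_expand[OF f, of w]) (simp add: z)
    have q0: "peval q w \<noteq> 0"
    proof
      assume "peval q w = 0"
      then have wr: "w = peval r w *s v1" using wd by simp
      then have "peval r w \<noteq> 0" using w(1) by (metis vector_smult_lzero)
      then show False using z(2) nz(2) peval_scale[OF g, of "peval r w" v1] wr by simp
    qed
    let ?s = "peval r w / peval q w"
    have "w = peval q w *s (?s *s v1 + C)" using q0 by (subst wd) (simp add: vector_add_ldistrib)
    from trans[OF arg_cong[OF this, of pt] pt_scale[OF q0 frame_vector_nonzero(1)[OF f]]]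
      trans[OF arg_cong[OF this, of "peval g"] peval_scale[OF g]]
    have "x = ?P ?s" "peval g (?s *s v1 + C) = 0" using w(2) z(2) q0 by simp_all
    then show "x \<in> ?P ` {s. poly c s = 0}" using c(2) by auto
  next
    fix x assume "x \<in> ?P ` {s. poly c s = 0}"
    then obtain s where s: "x = ?P s" "peval g (s *s v1 + C) = 0" using c(2) by auto
    have "peval e (s *s v1 + C) = 0" using e(2)[of "s *s v1 + C"] mem_cone_line[OF l] frame_vector_nonzero(1,2)[OF f] by simp
    then show "x \<in> subscheme_points O_plane ?I"
      using mem_subscheme_points[OF l e(1) g frame_vector_nonzero(1)[OF f]] s frame_vector_nonzero(2)[OF f] by simp
  qed
  have inj: "inj_on ?P {s. poly c s = 0}"
  proof (rule inj_onI)
    fix s t assume "?P s = ?P t"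
    then obtain a where a: "s *s v1 + C = a *s (t *s v1 + C)"
      using pt_eqD[OF frame_vector_nonzero(1)[OF f] frame_vector_nonzero(1)[OF f]] by blast
    have "peval r (a *s (t *s v1 + C)) = a * t" "peval q (a *s (t *s v1 + C)) = a"
      using frame_vector_nonzero(5,6)[OF f, of t] by (simp_all only: peval_linear(2)[OF frame_homog(2)[OF f]] peval_linear(2)[OF frame_homog(3)[OF f]] mult_1_right)
    then show "s = t" using frame_vector_nonzero(5,6)[OF f, of s] a by simp
  qed
  have fin: "finite {s. poly c s = 0}" using dc(2) by (rule poly_roots_finite)
  have len: "quotient_length (stalk_ring (?P s)) (ideal_stalk O_plane ?I (?P s)) = enat (order s c)" for s
  proof -
    interpret line_point p r q A v1 C s by unfold_locales (rule f)
    have rs: "rs g = c" by (rule rs_eqI) (rule c(2))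
    obtain w where w: "c = [:- s, 1:] ^ order s c * w" "\<not> [:- s, 1:] dvd w" using order_decomp[OF dc(2)] by metis
    have w0: "poly w s \<noteq> 0" using w(2) by (simp add: poly_eq_0_iff_dvd)
    have "ideal_stalk O_plane ?I (?P s) = J (order s c)"
      by (rule ideal_stalk_eq_J[OF l e(2) g _ w0]) (use rs w(1) in simp_all)
    then show ?thesis using quotient_length_J by simp
  qed
  have "subscheme_length O_plane ?I = (\<Sum>s | poly c s = 0. enat (order s c))"
    unfolding subscheme_length_def points using fin by (simp add: sum.reindex[OF inj] len)
  also have "\<dots> = enat (\<Sum>s | poly c s = 0. order s c)"
    using fin by (induction rule: finite_induct) (simp_all add: zero_enat_def)
  also have "(\<Sum>s | poly c s = 0. order s c) = size (proots c)"
    using dc(2) by (simp add: size_multiset_overloaded_eq)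
  also have "\<dots> = k" using size_proots_complex[of c] dc(1) by simp
  finally show ?thesis .
qed

section \<open>Restrictions of the bundle to lines\<close>

theorem theorem2p1:
  fixes \<A> :: "proj_plane set set" and \<alpha> :: "proj_plane set \<Rightarrow> poly3"
    and a b d :: int and \<phi> and \<psi> and e g :: poly3 and l :: "proj_plane set"
  assumes "line_arrangement \<A>"
    and "\<forall>H\<in>\<A>. defines_line (\<alpha> H) H"
    and "plus_one_resolution (arrangement_bundle \<alpha> \<A>) a b d \<phi> \<psi>"
    and "resolution_equations b d \<phi> e g"
    and "is_line l"
  shows
    "(subscheme_points O_plane (intersection_ideal l e g) = {} \<longrightarrow>
        sheaf_isomorphic O_plane (tensor_sheaf O_plane (arrangement_bundle \<alpha> \<A>) (twist l 0))
          (direct_sum (twist l (- a)) (twist l (1 - b)))) \<and>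
     (subscheme_length O_plane (intersection_ideal l e g) = 1 \<longrightarrow>
        sheaf_isomorphic O_plane (tensor_sheaf O_plane (arrangement_bundle \<alpha> \<A>) (twist l 0))
          (direct_sum (twist l (1 - a)) (twist l (- b)))) \<and>
     (l = zero_locus e \<longrightarrow>
        subscheme_length O_plane (intersection_ideal l e g) = enat (nat (d + 1 - b)) \<and>
        sheaf_isomorphic O_plane (tensor_sheaf O_plane (arrangement_bundle \<alpha> \<A>) (twist l 0))
          (direct_sum (twist l (- d)) (twist l (d + 1 - a - b))))"
proof -
  let ?T = "arrangement_bundle \<alpha> \<A>" and ?I = "intersection_ideal l e g"
  let ?TL = "tensor_sheaf O_plane ?T (twist l 0)"
  obtain p where l: "defines_line p l" using assms(5) unfolding is_line_def by blast
  have e: "homog 1 e" and g: "homog (d + 1 - b) g" using assms(4) by (simp_all add: resolution_equations_def)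
  have ab: "a \<le> b" "b \<le> d" using assms(3) by (simp_all add: plus_one_resolution_def)
  obtain H where pres: "presentation \<alpha> \<A> (- 1 - d) (- d) (- b) (- a) (punctured e) (punctured g) H (\<lambda>U y1 y2 y3. \<psi> U (y1, y2, y3))"
    by (rule presentation_of_resolution[OF assms(3,4)])
  have points: "pt v \<in> subscheme_points O_plane ?I \<longleftrightarrow> v \<in> affine_cone l \<and> peval e v = 0 \<and> peval g v = 0" if "v \<noteq> 0" for v
    using mem_subscheme_points[OF l e g that] mem_cone_line[OF l] that by simp
  have on_e: "subscheme_length O_plane ?I = enat (nat (d + 1 - b)) \<and>
      sheaf_isomorphic O_plane ?TL (direct_sum (twist l (- d)) (twist l (d + 1 - a - b)))"
    if e0: "\<And>v. v \<in> affine_cone l \<Longrightarrow> peval e v = 0"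
  proof
    obtain v where v: "v \<in> affine_cone l" "peval g v \<noteq> 0" by (rule g_nonzero_on_e[OF pres l e0 ab])
    have g': "homog (int (nat (d + 1 - b))) g" using g ab by simp
    show "subscheme_length O_plane ?I = enat (nat (d + 1 - b))" by (rule subscheme_length_on_e[OF l e e0 g' v])
    show "sheaf_isomorphic O_plane ?TL (direct_sum (twist l (- d)) (twist l (d + 1 - a - b)))"
      by (rule splitting_on_e[OF pres l e0])
  qed
  have 1: "sheaf_isomorphic O_plane ?TL (direct_sum (twist l (- a)) (twist l (1 - b)))"
    if "subscheme_points O_plane ?I = {}"
    by (rule splitting_disjoint[OF pres l e g ab]) (use that points in \<open>auto simp: mem_affine_cone\<close>)
  have 2: "sheaf_isomorphic O_plane ?TL (direct_sum (twist l (1 - a)) (twist l (- b)))"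
    if len: "subscheme_length O_plane ?I = 1"
  proof (cases "\<exists>v\<in>affine_cone l. peval e v \<noteq> 0")
    case True
    then obtain v1 where v1: "v1 \<in> affine_cone l" "peval e v1 \<noteq> 0" by blast
    have "subscheme_points O_plane ?I \<noteq> {}" using len by (auto simp: subscheme_length_def)
    then obtain x where "x \<in> subscheme_points O_plane ?I" by blast
    moreover obtain v0 where "v0 \<noteq> 0" "x = pt v0" by (rule pt_cases)
    ultimately have "v0 \<in> affine_cone l" "peval e v0 = 0" "peval g v0 = 0" using points by auto
    then show ?thesis by (rule splitting_transversal[OF pres l e g v1])
  next
    case False
    then have e0: "peval e v = 0" if "v \<in> affine_cone l" for v using that by blast
    have "nat (d + 1 - b) = 1" using conjunct1[OF on_e[OF e0]] len by (simp add: one_enat_def)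
    then have "d = b" using ab by arith
    then have "sheaf_isomorphic O_plane ?TL (direct_sum (twist l (- b)) (twist l (1 - a)))" using on_e[OF e0] by simp
    then show ?thesis by (rule sheaf_isomorphic_swap)
  qed
  have 3: "subscheme_length O_plane ?I = enat (nat (d + 1 - b)) \<and>
      sheaf_isomorphic O_plane ?TL (direct_sum (twist l (- d)) (twist l (d + 1 - a - b)))" if "l = zero_locus e"
  proof (rule on_e)
    show "peval e v = 0" if "v \<in> affine_cone l" for v
      using that \<open>l = zero_locus e\<close> pt_zero_locus[OF e] by (auto simp: mem_affine_cone)
  qed
  show ?thesis using 1 2 3 by blast
qed

end
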